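(* Let $R$ be a complete discrete valuation ring of characteristic $p$ with fraction field $K$, let $A$ be the ring of integers of a finite extension of $\mathbb{Q}_p$ with uniformizer $\pi$, and let $G$ be a $1$-dimensional $p$-divisible group over $R$ (with its $A$-module structure coming from the associated one-dimensional formal $A$-module) whose special fiber has height $s$ and whose generic fiber has height $g$, with $1\le g<s$. Let $T(G)=\varprojlim_n G[\pi^n](K^{sep})$, a free $A$-module of rank $d=s-g$, and let $\rho^{0/1}:\mathfrak{G}_K=\mathrm{Gal}(K^{sep}/K)\to \mathrm{GL}_d(A)$ be the representation given by the Galois action on $T(G)$. Then every non-zero orbit of the action of the monodromy group $\rho^{0/1}(\mathfrak{G}_K)$ on $T(G)$ is open in $T(G)$. In particular, $\rho^{0/1}$ is irreducible.
   Context: Heights are formal $A$-module heights. $T(G)$ is given its natural ($\pi$-adic) topology.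
   Formalization: T(G) is formed from points of G[π^n] over an algebraic closure of K (equivalently, K^sep-points of the étale quotient), with Galois acting by unique extension, because the K^sep-points of G[π^n] need not give a module of rank s−g; irreducibility is over Frac(A). *)

theory Defs
  imports
    "HOL-Algebra.Algebraic_Closure_Type"
    "HOL-Algebra.Bij"
    "Jordan_Normal_Form.VS_Connect"
    "Berlekamp_Zassenhaus.Finite_Field"
begin

no_notation vec_index (infixl \<open>$\<close> 100)

section \<open>The \<open>p\<close>-adic numbers, \<open>p = CARD('p)\<close>\<close>

text \<open>\<open>\<int>\<^sub>p\<close> is the inverse limit of the rings \<open>\<int>/p\<^sup>n\<close>, residues being represented in
  \<open>{0..<p\<^sup>n}\<close>.\<close>

typedef (overloaded) ('p :: prime_card) padic_int =
  "{x :: nat \<Rightarrow> int. \<forall>n. x (Suc n) mod int CARD('p) ^ n = x n}"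
  by (rule exI[of _ "\<lambda>_. 0"]) simp

setup_lifting type_definition_padic_int

lemma padic_mod_Suc: "(a :: int) mod q ^ Suc n mod q ^ n = a mod q ^ n"
  by (rule mod_mod_cancel) simp

instantiation padic_int :: (prime_card) comm_ring_1
begin

lift_definition zero_padic_int :: "'a padic_int" is "\<lambda>_. 0" by simp
lift_definition one_padic_int :: "'a padic_int" is "\<lambda>n. 1 mod int CARD('a) ^ n"
  by (simp only: padic_mod_Suc)
lift_definition plus_padic_int :: "'a padic_int \<Rightarrow> 'a padic_int \<Rightarrow> 'a padic_int"
  is "\<lambda>x y n. (x n + y n) mod int CARD('a) ^ n"
  by (simp only: padic_mod_Suc) (metis mod_add_eq)
lift_definition minus_padic_int :: "'a padic_int \<Rightarrow> 'a padic_int \<Rightarrow> 'a padic_int"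
  is "\<lambda>x y n. (x n - y n) mod int CARD('a) ^ n"
  by (simp only: padic_mod_Suc) (metis mod_diff_eq)
lift_definition uminus_padic_int :: "'a padic_int \<Rightarrow> 'a padic_int"
  is "\<lambda>x n. (- x n) mod int CARD('a) ^ n"
  by (simp only: padic_mod_Suc) (metis mod_minus_eq)
lift_definition times_padic_int :: "'a padic_int \<Rightarrow> 'a padic_int \<Rightarrow> 'a padic_int"
  is "\<lambda>x y n. (x n * y n) mod int CARD('a) ^ n"
  by (simp only: padic_mod_Suc) (metis mod_mult_eq)

instance
proof
  have reduced: "x n mod int CARD('a) ^ n = x n"
    if "\<forall>n. x (Suc n) mod int CARD('a) ^ n = x n" for x and n :: nat
    using that by (metis mod_mod_trivial)
  fix a b c :: "'a padic_int"
  show "a * b * c = a * (b * c)"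
    by transfer (simp add: fun_eq_iff mod_simps mult.assoc)
  show "a * b = b * a"
    by transfer (simp add: mult.commute)
  show "1 * a = a"
    by transfer (simp add: fun_eq_iff mod_simps reduced)
  show "a + b + c = a + (b + c)"
    by transfer (simp add: fun_eq_iff mod_simps add.assoc)
  show "a + b = b + a"
    by transfer (simp add: add.commute)
  show "0 + a = a"
    by transfer (simp add: fun_eq_iff reduced)
  show "- a + a = 0"
    by transfer (simp add: fun_eq_iff mod_simps)
  show "a - b = a + - b"
    by transfer (simp add: fun_eq_iff mod_simps)
  show "(a + b) * c = a * c + b * c"
    by transfer (simp add: fun_eq_iff mod_simps distrib_right)
  show "(0 :: 'a padic_int) \<noteq> 1"
  proof transfer
    have "(1 :: int) < int CARD('a)"
      using prime_gt_1_nat[OF prime_card[where 'a = 'a]] by simp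
    then have "1 mod int CARD('a) ^ 1 \<noteq> 0" by simp
    then show "(\<lambda>_. 0) \<noteq> (\<lambda>n. 1 mod int CARD('a) ^ n)" by metis
  qed
qed

end

instance padic_int :: (prime_card) idom
proof
  fix a b :: "'a padic_int"
  assume "a \<noteq> 0" "b \<noteq> 0"
  then show "a * b \<noteq> 0"
  proof transfer
    let ?p = "int CARD('a)"
    fix x y :: "nat \<Rightarrow> int"
    assume x: "\<forall>n. x (Suc n) mod ?p ^ n = x n" and y: "\<forall>n. y (Suc n) mod ?p ^ n = y n"
    assume "x \<noteq> (\<lambda>_. 0)" "y \<noteq> (\<lambda>_. 0)"
    then obtain i j where ij: "x i \<noteq> 0" "y j \<noteq> 0" by (auto simp: fun_eq_iff)
    have proj: "z (n + k) mod ?p ^ n = z n" if z: "\<forall>n. z (Suc n) mod ?p ^ n = z n" for z n k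
    proof (induction k)
      case 0
      then show ?case using z by (metis add_0_right mod_mod_trivial)
    next
      case (Suc k)
      have "z (n + k) mod ?p ^ n = z (Suc (n + k)) mod ?p ^ (n + k) mod ?p ^ n"
        using z by simp
      also have "\<dots> = z (Suc (n + k)) mod ?p ^ n"
        by (rule mod_mod_cancel) (simp add: le_imp_power_dvd)
      finally show ?case using Suc by simp
    qed
    have "\<not> ?p ^ i dvd x (i + j)"
      using proj[OF x, of i j] ij by (auto simp: dvd_eq_mod_eq_0)
    moreover have "\<not> ?p ^ j dvd y (i + j)"
      using proj[OF y, of j i] ij by (auto simp: dvd_eq_mod_eq_0 add.commute)
    moreover have "prime_elem ?p"
      using prime_card[where 'a = 'a] by simp
    ultimately have "\<not> ?p ^ (i + j) dvd x (i + j) * y (i + j)"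
    proof -
      assume nd: "\<not> ?p ^ i dvd x (i + j)" "\<not> ?p ^ j dvd y (i + j)" and pr: "prime_elem ?p"
      show ?thesis
      proof
        assume "?p ^ (i + j) dvd x (i + j) * y (i + j)"
        then obtain r s where rs: "r + s = i + j" "?p ^ r dvd x (i + j)" "?p ^ s dvd y (i + j)"
          using pr by (metis prime_elem_power_dvd_prod)
        then have "i \<le> r \<or> j \<le> s" by arith
        then show False using rs nd by (meson dvd_trans le_imp_power_dvd)
      qed
    qed
    then show "(\<lambda>n. (x n * y n) mod ?p ^ n) \<noteq> (\<lambda>_. 0)"
      by (metis dvd_eq_mod_eq_0)
  qed
qed

type_synonym 'p padic = "'p padic_int fract"

text \<open>The type \<open>'a\<close> is the ring of integers (the integral closure of \<open>\<int>\<^sub>p\<close>) of its fraction field,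
  which is a finite extension of \<open>\<rat>\<^sub>p\<close>.\<close>

definition padic_integer_ring :: "'p :: prime_card itself \<Rightarrow> 'a :: idom itself \<Rightarrow> bool" where
  "padic_integer_ring _ _ \<longleftrightarrow>
     (\<exists>\<iota> :: 'p padic \<Rightarrow> 'a fract. comm_ring_hom \<iota> \<and>
        (\<exists>S. finite S \<and> (\<forall>x. \<exists>c. x = (\<Sum>v\<in>S. \<iota> (c v) * v))) \<and>
        range (to_fract :: 'a \<Rightarrow> 'a fract) =
          {x. \<exists>f :: 'p padic_int poly. lead_coeff f = 1 \<and> poly (map_poly (\<iota> \<circ> to_fract) f) x = 0})"


section \<open>Discrete valuation rings\<close>

definition uniformizer :: "'a :: idom \<Rightarrow> bool" where
  "uniformizer t \<longleftrightarrow> t \<noteq> 0 \<and> \<not> t dvd 1 \<and> (\<forall>x. x \<noteq> 0 \<longrightarrow> (\<exists>u n. u dvd 1 \<and> x = u * t ^ n))"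

definition complete_dvr :: "'r :: idom itself \<Rightarrow> bool" where
  "complete_dvr _ \<longleftrightarrow>
     (\<exists>t :: 'r. uniformizer t \<and>
        (\<forall>x. (\<forall>n. t ^ n dvd x (Suc n) - x n) \<longrightarrow> (\<exists>y. \<forall>n. t ^ n dvd y - x n)))"

definition max_ideal :: "'r :: idom set" where
  "max_ideal = {x. \<not> x dvd 1}"

definition residue_card :: "'a :: idom \<Rightarrow> nat" where
  "residue_card \<pi> = card (range (\<lambda>a. {b. \<pi> dvd b - a}))"


section \<open>One-dimensional formal modules\<close>

text \<open>The coefficient of \<open>X\<^sup>iY\<^sup>j\<close> in \<open>F :: 'r fps fps\<close> is \<open>F $ i $ j\<close>, and that of \<open>X\<^sup>iY\<^sup>jZ\<^sup>k\<close> in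
  \<open>F :: 'r fps fps fps\<close> is \<open>F $ i $ j $ k\<close>. The following substitutions are meant for series without
  constant term, for which the omitted terms do not contribute to the coefficient in question.\<close>

definition subst_1_2 :: "'r :: comm_ring_1 fps \<Rightarrow> 'r fps fps \<Rightarrow> 'r fps fps" where
  "subst_1_2 f g = Abs_fps (\<lambda>a. Abs_fps (\<lambda>b. \<Sum>i\<le>a + b. f $ i * (g ^ i) $ a $ b))"

definition subst_2_1 :: "'r :: comm_ring_1 fps fps \<Rightarrow> 'r fps \<Rightarrow> 'r fps \<Rightarrow> 'r fps" where
  "subst_2_1 F g h = Abs_fps (\<lambda>a. \<Sum>i\<le>a. \<Sum>j\<le>a. F $ i $ j * (g ^ i * h ^ j) $ a)"

definition subst_2_2 :: "'r :: comm_ring_1 fps fps \<Rightarrow> 'r fps fps \<Rightarrow> 'r fps fps \<Rightarrow> 'r fps fps" where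
  "subst_2_2 F g h = Abs_fps (\<lambda>a. Abs_fps (\<lambda>b.
     \<Sum>i\<le>a + b. \<Sum>j\<le>a + b. F $ i $ j * (g ^ i * h ^ j) $ a $ b))"

definition subst_2_3 ::
  "'r :: comm_ring_1 fps fps \<Rightarrow> 'r fps fps fps \<Rightarrow> 'r fps fps fps \<Rightarrow> 'r fps fps fps" where
  "subst_2_3 F g h = Abs_fps (\<lambda>a. Abs_fps (\<lambda>b. Abs_fps (\<lambda>c.
     \<Sum>i\<le>a + b + c. \<Sum>j\<le>a + b + c. F $ i $ j * (g ^ i * h ^ j) $ a $ b $ c)))"

text \<open>\<open>f(X)\<close> and \<open>f(Y)\<close> as elements of \<open>R[[X,Y]]\<close>.\<close>

definition in_X :: "'r :: comm_ring_1 fps \<Rightarrow> 'r fps fps" where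
  "in_X f = Abs_fps (\<lambda>i. fps_const (f $ i))"

definition in_Y :: "'r :: comm_ring_1 fps \<Rightarrow> 'r fps fps" where
  "in_Y f = fps_const f"

definition formal_group_law :: "'r :: comm_ring_1 fps fps \<Rightarrow> bool" where
  "formal_group_law F \<longleftrightarrow>
     subst_2_1 F fps_X 0 = fps_X \<and> subst_2_1 F 0 fps_X = fps_X \<and>
     subst_2_2 F (in_Y fps_X) (in_X fps_X) = F \<and>
     (let x = fps_X; y = fps_const fps_X; z = fps_const (fps_const fps_X)
      in subst_2_3 F (subst_2_3 F x y) z = subst_2_3 F x (subst_2_3 F y z))"

text \<open>\<open>\<gamma>\<close> is the structure map of the \<open>A\<close>-algebra \<open>R\<close>, and \<open>act a\<close> is the series \<open>[a]\<^sub>F\<close>.\<close>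

definition formal_module ::
  "('a :: comm_ring_1 \<Rightarrow> 'r :: comm_ring_1) \<Rightarrow> 'r fps fps \<Rightarrow> ('a \<Rightarrow> 'r fps) \<Rightarrow> bool" where
  "formal_module \<gamma> F act \<longleftrightarrow>
     comm_ring_hom \<gamma> \<and> formal_group_law F \<and>
     (\<forall>a. act a $ 0 = 0 \<and> act a $ 1 = \<gamma> a) \<and>
     (\<forall>a. subst_1_2 (act a) F = subst_2_2 F (in_X (act a)) (in_Y (act a))) \<and>
     (\<forall>a b. act (a + b) = subst_2_1 F (act a) (act b)) \<and>
     (\<forall>a b. act (a * b) = act a oo act b) \<and>
     act 1 = fps_X"

text \<open>For a prime ideal \<open>P\<close> of \<open>R\<close>, the fibre over the residue field of \<open>P\<close> has height \<open>h\<close> if over that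
  field \<open>[\<pi>]\<^sub>F\<close> is \<open>f(X\<^bsup>q^h\<^esup>)\<close> with \<open>f'(0) \<noteq> 0\<close>, where \<open>q\<close> is the cardinality of \<open>A/\<pi>A\<close>.
  The special fibre belongs to \<open>P = max_ideal\<close>, the generic fibre to \<open>P = {0}\<close>.\<close>

definition fibre_height ::
  "'r :: idom set \<Rightarrow> 'a :: idom \<Rightarrow> ('a \<Rightarrow> 'r fps) \<Rightarrow> nat \<Rightarrow> bool" where
  "fibre_height P \<pi> act h \<longleftrightarrow>
     (\<forall>i. act \<pi> $ i \<notin> P \<longrightarrow> residue_card \<pi> ^ h dvd i) \<and> act \<pi> $ (residue_card \<pi> ^ h) \<notin> P"


section \<open>Finite flat commutative group schemes\<close>

text \<open>Over a local ring a finite flat group scheme is the spectrum of a Hopf algebra that is free of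
  finite rank \<open>N\<close>. It is given by structure constants with respect to a basis \<open>e\<^sub>0, \<dots>, e\<^sub>N\<^sub>-\<^sub>1\<close>:
  \<open>e\<^sub>i e\<^sub>j = \<Sum>\<^sub>k mlt i j k e\<^sub>k\<close>, \<open>1 = \<Sum>\<^sub>k unt k e\<^sub>k\<close>, \<open>\<Delta>(e\<^sub>k) = \<Sum>\<^sub>i\<^sub>j cml k i j e\<^sub>i \<otimes> e\<^sub>j\<close>,
  \<open>\<epsilon>(e\<^sub>k) = cnt k\<close>, \<open>S(e\<^sub>k) = \<Sum>\<^sub>i ant k i e\<^sub>i\<close>. Likewise a linear map \<open>f\<close> between two such algebras is
  given by \<open>f(e\<^sub>k) = \<Sum>\<^sub>j f k j e'\<^sub>j\<close>. Only the values at indices below the ranks are relevant.\<close>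

record 'r hopf =
  rk :: nat
  mlt :: "nat \<Rightarrow> nat \<Rightarrow> nat \<Rightarrow> 'r"
  unt :: "nat \<Rightarrow> 'r"
  cml :: "nat \<Rightarrow> nat \<Rightarrow> nat \<Rightarrow> 'r"
  cnt :: "nat \<Rightarrow> 'r"
  ant :: "nat \<Rightarrow> nat \<Rightarrow> 'r"

definition hopf_algebra :: "'r :: comm_ring_1 hopf \<Rightarrow> bool" where
  "hopf_algebra H \<longleftrightarrow> (let N = rk H; m = mlt H; u = unt H; c = cml H; e = cnt H; s = ant H in
     (\<forall>i<N. \<forall>j<N. \<forall>k<N. m i j k = m j i k) \<and>
     (\<forall>i<N. \<forall>j<N. \<forall>k<N. \<forall>t<N. (\<Sum>l<N. m i j l * m l k t) = (\<Sum>l<N. m j k l * m i l t)) \<and>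
     (\<forall>j<N. \<forall>k<N. (\<Sum>i<N. u i * m i j k) = (if j = k then 1 else 0)) \<and>
     (\<forall>k<N. \<forall>i<N. \<forall>j<N. c k i j = c k j i) \<and>
     (\<forall>k<N. \<forall>i<N. \<forall>j<N. \<forall>t<N. (\<Sum>l<N. c k l t * c l i j) = (\<Sum>l<N. c k i l * c l j t)) \<and>
     (\<forall>k<N. \<forall>j<N. (\<Sum>i<N. e i * c k i j) = (if k = j then 1 else 0)) \<and>
     (\<forall>a<N. \<forall>b<N. \<forall>i<N. \<forall>j<N. (\<Sum>l<N. m a b l * c l i j) =
        (\<Sum>i1<N. \<Sum>j1<N. \<Sum>i2<N. \<Sum>j2<N. c a i1 j1 * c b i2 j2 * m i1 i2 i * m j1 j2 j)) \<and>
     (\<forall>i<N. \<forall>j<N. (\<Sum>k<N. u k * c k i j) = u i * u j) \<and>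
     (\<forall>i<N. \<forall>j<N. (\<Sum>k<N. m i j k * e k) = e i * e j) \<and>
     (\<Sum>k<N. u k * e k) = 1 \<and>
     (\<forall>k<N. \<forall>t<N. (\<Sum>i<N. \<Sum>j<N. \<Sum>l<N. c k i j * s i l * m l j t) = e k * u t))"

text \<open>Elements of the algebra are coordinate functions vanishing outside \<open>{..<rk H}\<close>, elements of its
  tensor square are coordinate functions in two indices.\<close>

definition elems :: "'r :: comm_ring_1 hopf \<Rightarrow> (nat \<Rightarrow> 'r) set" where
  "elems H = {v. \<forall>k\<ge>rk H. v k = 0}"

definition elt_one :: "'r :: comm_ring_1 hopf \<Rightarrow> nat \<Rightarrow> 'r" where
  "elt_one H = (\<lambda>k. if k < rk H then unt H k else 0)"

definition elt_mult :: "'r :: comm_ring_1 hopf \<Rightarrow> (nat \<Rightarrow> 'r) \<Rightarrow> (nat \<Rightarrow> 'r) \<Rightarrow> nat \<Rightarrow> 'r" where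
  "elt_mult H v w = (\<lambda>k. if k < rk H then \<Sum>i<rk H. \<Sum>j<rk H. v i * w j * mlt H i j k else 0)"

definition tensor_mult ::
  "'r :: comm_ring_1 hopf \<Rightarrow> (nat \<Rightarrow> nat \<Rightarrow> 'r) \<Rightarrow> (nat \<Rightarrow> nat \<Rightarrow> 'r) \<Rightarrow> nat \<Rightarrow> nat \<Rightarrow> 'r" where
  "tensor_mult H v w = (\<lambda>k l. if k < rk H \<and> l < rk H
     then \<Sum>i<rk H. \<Sum>j<rk H. \<Sum>i'<rk H. \<Sum>j'<rk H. v i j * w i' j' * mlt H i i' k * mlt H j j' l
     else 0)"

definition elt_comult :: "'r :: comm_ring_1 hopf \<Rightarrow> (nat \<Rightarrow> 'r) \<Rightarrow> nat \<Rightarrow> nat \<Rightarrow> 'r" where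
  "elt_comult H v = (\<lambda>i j. if i < rk H \<and> j < rk H then \<Sum>k<rk H. v k * cml H k i j else 0)"

definition lin_app ::
  "'r :: comm_ring_1 hopf \<Rightarrow> 'r hopf \<Rightarrow> (nat \<Rightarrow> nat \<Rightarrow> 'r) \<Rightarrow> (nat \<Rightarrow> 'r) \<Rightarrow> nat \<Rightarrow> 'r" where
  "lin_app H H' f v = (\<lambda>j. if j < rk H' then \<Sum>k<rk H. v k * f k j else 0)"

definition hopf_hom :: "'r :: comm_ring_1 hopf \<Rightarrow> 'r hopf \<Rightarrow> (nat \<Rightarrow> nat \<Rightarrow> 'r) \<Rightarrow> bool" where
  "hopf_hom H H' f \<longleftrightarrow>
     lin_app H H' f (elt_one H) = elt_one H' \<and>
     (\<forall>v\<in>elems H. \<forall>w\<in>elems H.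
        lin_app H H' f (elt_mult H v w) = elt_mult H' (lin_app H H' f v) (lin_app H H' f w)) \<and>
     (\<forall>v\<in>elems H. \<forall>i<rk H'. \<forall>j<rk H'. elt_comult H' (lin_app H H' f v) i j =
        (\<Sum>k<rk H. \<Sum>l<rk H. elt_comult H v k l * f k i * f l j))"

definition aug_ideal :: "'r :: comm_ring_1 hopf \<Rightarrow> (nat \<Rightarrow> 'r) set" where
  "aug_ideal H = {v \<in> elems H. (\<Sum>k<rk H. v k * cnt H k) = 0}"

definition ideal_generated :: "'r :: comm_ring_1 hopf \<Rightarrow> (nat \<Rightarrow> 'r) set \<Rightarrow> (nat \<Rightarrow> 'r) set" where
  "ideal_generated H S = \<Inter>{I. S \<subseteq> I \<and> I \<subseteq> elems H \<and> (\<lambda>_. 0) \<in> I \<and>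
     (\<forall>v\<in>I. \<forall>w\<in>I. (\<lambda>k. v k + w k) \<in> I) \<and> (\<forall>v\<in>elems H. \<forall>w\<in>I. elt_mult H v w \<in> I)}"

text \<open>The algebra map belonging to multiplication by \<open>m\<close> on the group scheme.\<close>

primrec mult_by :: "'r :: comm_ring_1 hopf \<Rightarrow> nat \<Rightarrow> nat \<Rightarrow> nat \<Rightarrow> 'r" where
  "mult_by H 0 = (\<lambda>k j. cnt H k * unt H j)"
| "mult_by H (Suc m) =
     (\<lambda>k j. \<Sum>a<rk H. \<Sum>b<rk H. \<Sum>l<rk H. cml H k a b * mult_by H m a l * mlt H l b j)"


section \<open>\<open>p\<close>-divisible groups\<close>

text \<open>\<open>lev G n\<close> is the Hopf algebra of \<open>G\<^sub>n = G[p\<^sup>n]\<close>, and \<open>trn G n\<close> is the algebra map belonging to the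
  closed immersion \<open>i\<^sub>n : G\<^sub>n \<rightarrow> G\<^sub>n\<^sub>+\<^sub>1\<close>, which has to be the kernel of \<open>p\<^sup>n\<close> on \<open>G\<^sub>n\<^sub>+\<^sub>1\<close>.\<close>

record 'r pdiv =
  lev :: "nat \<Rightarrow> 'r hopf"
  trn :: "nat \<Rightarrow> nat \<Rightarrow> nat \<Rightarrow> 'r"

definition p_divisible_group :: "nat \<Rightarrow> 'r :: comm_ring_1 pdiv \<Rightarrow> bool" where
  "p_divisible_group p G \<longleftrightarrow>
     (\<exists>h. \<forall>n. rk (lev G n) = p ^ (n * h)) \<and>
     (\<forall>n. hopf_algebra (lev G n)) \<and>
     (\<forall>n. let H = lev G (Suc n); H' = lev G n; i = lin_app H H' (trn G n) in
        hopf_hom H H' (trn G n) \<and> i ` elems H = elems H' \<and>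
        {v \<in> elems H. i v = (\<lambda>_. 0)} =
          ideal_generated H (lin_app H H (mult_by H (p ^ n)) ` aug_ideal H))"

text \<open>\<open>F\<close> is the one-dimensional formal \<open>A\<close>-module associated with \<open>G\<close>: there are compatible isomorphisms
  \<open>\<theta>\<^sub>n\<close> from \<open>R[[X]]/([p\<^sup>n]\<^sub>F)\<close> to the algebra of \<open>G\<^sub>n\<close> under which \<open>f \<mapsto> f(F(X,Y))\<close> becomes the
  comultiplication. \<open>\<Theta>\<close> is the map \<open>\<theta>\<^sub>n \<otimes> \<theta>\<^sub>n\<close> on \<open>R[[X,Y]]\<close>. The algebra maps \<open>\<alpha> n a\<close> describe the
  action of \<open>a\<close> on \<open>G\<^sub>n\<close>; they are induced by \<open>[a]\<^sub>F\<close>. As \<open>\<theta>\<^sub>n\<close> is surjective, this determines \<open>\<alpha>\<close>.\<close>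

definition associated_formal_module ::
  "nat \<Rightarrow> 'r :: comm_ring_1 pdiv \<Rightarrow> (nat \<Rightarrow> 'a :: comm_ring_1 \<Rightarrow> nat \<Rightarrow> nat \<Rightarrow> 'r) \<Rightarrow>
     'r fps fps \<Rightarrow> ('a \<Rightarrow> 'r fps) \<Rightarrow> bool" where
  "associated_formal_module p G \<alpha> F act \<longleftrightarrow>
     (\<exists>\<theta> :: nat \<Rightarrow> 'r fps \<Rightarrow> nat \<Rightarrow> 'r. \<forall>n. let H = lev G n in
        range (\<theta> n) = elems H \<and>
        (\<forall>f g. \<theta> n (f + g) = (\<lambda>k. \<theta> n f k + \<theta> n g k)) \<and>
        (\<forall>f g. \<theta> n (f * g) = elt_mult H (\<theta> n f) (\<theta> n g)) \<and>
        (\<forall>r. \<theta> n (fps_const r) = (\<lambda>k. r * elt_one H k)) \<and>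
        {f. \<theta> n f = (\<lambda>_. 0)} = {f. act (of_nat p ^ n) dvd f} \<and>
        (\<forall>f. lin_app (lev G (Suc n)) H (trn G n) (\<theta> (Suc n) f) = \<theta> n f) \<and>
        (\<forall>a f. lin_app H H (\<alpha> n a) (\<theta> n f) = \<theta> n (f oo act a)) \<and>
        (\<exists>\<Theta> :: 'r fps fps \<Rightarrow> nat \<Rightarrow> nat \<Rightarrow> 'r.
           (\<forall>f g. \<Theta> (f + g) = (\<lambda>k l. \<Theta> f k l + \<Theta> g k l)) \<and>
           (\<forall>f g. \<Theta> (f * g) = tensor_mult H (\<Theta> f) (\<Theta> g)) \<and>
           (\<forall>f. \<Theta> (in_X f) = (\<lambda>k l. \<theta> n f k * elt_one H l)) \<and>
           (\<forall>f. \<Theta> (in_Y f) = (\<lambda>k l. elt_one H k * \<theta> n f l)) \<and>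
           (\<forall>f. elt_comult H (\<theta> n f) = \<Theta> (subst_1_2 f F))))"


section \<open>The Galois group\<close>

definition sep_closure :: "'k :: field alg_closure set" where
  "sep_closure = {x. \<exists>f :: 'k poly. coprime f (pderiv f) \<and> poly (map_poly to_ac f) x = 0}"

definition Gal_sep :: "('k :: field alg_closure \<Rightarrow> 'k alg_closure) monoid" where
  "Gal_sep = (BijGroup sep_closure)
     \<lparr>carrier := {\<sigma> \<in> Bij sep_closure. (\<forall>c. \<sigma> (to_ac c) = to_ac c) \<and>
        (\<forall>x\<in>sep_closure. \<forall>y\<in>sep_closure. \<sigma> (x + y) = \<sigma> x + \<sigma> y \<and> \<sigma> (x * y) = \<sigma> x * \<sigma> y)}\<rparr>"

text \<open>The algebraic closure is purely inseparable over the separable closure, so every \<open>\<sigma>\<close> in the Galois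
  group has a unique extension to the algebraic closure.\<close>

definition gal_ext ::
  "('k :: field alg_closure \<Rightarrow> 'k alg_closure) \<Rightarrow> 'k alg_closure \<Rightarrow> 'k alg_closure" where
  "gal_ext \<sigma> = (THE \<tau>. bij \<tau> \<and> comm_ring_hom \<tau> \<and> (\<forall>x\<in>sep_closure. \<tau> x = \<sigma> x))"


section \<open>The Tate module\<close>

abbreviation emb :: "'r :: idom \<Rightarrow> 'r fract alg_closure" where
  "emb r \<equiv> to_ac (to_fract r)"

text \<open>An \<open>R\<close>-algebra homomorphism from the Hopf algebra to the algebraic closure of \<open>K\<close> is given by its
  values at the basis.\<close>

definition points :: "'r :: idom hopf \<Rightarrow> (nat \<Rightarrow> 'r fract alg_closure) set" where
  "points H = {\<phi>. (\<forall>k\<ge>rk H. \<phi> k = 0) \<and> (\<Sum>k<rk H. emb (unt H k) * \<phi> k) = 1 \<and>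
     (\<forall>i<rk H. \<forall>j<rk H. \<phi> i * \<phi> j = (\<Sum>k<rk H. emb (mlt H i j k) * \<phi> k))}"

definition point_zero :: "'r :: idom hopf \<Rightarrow> nat \<Rightarrow> 'r fract alg_closure" where
  "point_zero H = (\<lambda>k. if k < rk H then emb (cnt H k) else 0)"

definition point_add :: "'r :: idom hopf \<Rightarrow> (nat \<Rightarrow> 'r fract alg_closure) \<Rightarrow>
    (nat \<Rightarrow> 'r fract alg_closure) \<Rightarrow> nat \<Rightarrow> 'r fract alg_closure" where
  "point_add H \<phi> \<psi> =
     (\<lambda>k. if k < rk H then \<Sum>i<rk H. \<Sum>j<rk H. emb (cml H k i j) * \<phi> i * \<psi> j else 0)"

text \<open>The image of a point of \<open>H'\<close> under the morphism of group schemes belonging to \<open>f : H \<rightarrow> H'\<close>.\<close>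

definition point_map :: "'r :: idom hopf \<Rightarrow> 'r hopf \<Rightarrow> (nat \<Rightarrow> nat \<Rightarrow> 'r) \<Rightarrow>
    (nat \<Rightarrow> 'r fract alg_closure) \<Rightarrow> nat \<Rightarrow> 'r fract alg_closure" where
  "point_map H H' f \<phi> = (\<lambda>k. if k < rk H then \<Sum>j<rk H'. emb (f k j) * \<phi> j else 0)"

text \<open>Since \<open>\<pi>\<^sup>n\<close> divides \<open>p\<^sup>n\<close>, the group \<open>G[\<pi>\<^sup>n]\<close> is the kernel of \<open>\<pi>\<^sup>n\<close> on \<open>G\<^sub>n\<close>.\<close>

definition pi_torsion ::
  "'r :: idom pdiv \<Rightarrow> (nat \<Rightarrow> 'a :: idom \<Rightarrow> nat \<Rightarrow> nat \<Rightarrow> 'r) \<Rightarrow> 'a \<Rightarrow> nat \<Rightarrow>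
     (nat \<Rightarrow> 'r fract alg_closure) set" where
  "pi_torsion G \<alpha> \<pi> n =
     {\<phi> \<in> points (lev G n). point_map (lev G n) (lev G n) (\<alpha> n (\<pi> ^ n)) \<phi> = point_zero (lev G n)}"

text \<open>The inverse limit of the groups \<open>G[\<pi>\<^sup>n]\<close> along \<open>\<pi> : G[\<pi>\<^sup>n\<^sup>+\<^sup>1] \<rightarrow> G[\<pi>\<^sup>n]\<close>. The points are taken in the
  algebraic closure: they correspond to the points of the etale quotient of \<open>G[\<pi>\<^sup>n]\<close> in the separable
  closure. As \<open>K\<close> is not perfect, \<open>G[\<pi>\<^sup>n]\<close> itself has in general fewer points in the separable closure,
  and these do not yield a module of rank \<open>s - g\<close>.\<close>

definition tate_module ::
  "'r :: idom pdiv \<Rightarrow> (nat \<Rightarrow> 'a :: idom \<Rightarrow> nat \<Rightarrow> nat \<Rightarrow> 'r) \<Rightarrow> 'a \<Rightarrow>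
     ('a, nat \<Rightarrow> nat \<Rightarrow> 'r fract alg_closure) module" where
  "tate_module G \<alpha> \<pi> =
     \<lparr>carrier = {t. \<forall>n. t n \<in> pi_torsion G \<alpha> \<pi> n \<and>
        point_map (lev G (Suc n)) (lev G (Suc n)) (\<alpha> (Suc n) \<pi>) (t (Suc n)) =
          point_map (lev G (Suc n)) (lev G n) (trn G n) (t n)},
      monoid.mult = undefined, one = undefined,
      zero = (\<lambda>n. point_zero (lev G n)),
      add = (\<lambda>t u n. point_add (lev G n) (t n) (u n)),
      module.smult = (\<lambda>a t n. point_map (lev G n) (lev G n) (\<alpha> n a) (t n))\<rparr>"

definition pi_adic_open :: "('a :: idom, 't) module \<Rightarrow> 'a \<Rightarrow> 't set \<Rightarrow> bool" where
  "pi_adic_open T \<pi> U \<longleftrightarrow> U \<subseteq> carrier T \<and>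
     (\<forall>t\<in>U. \<exists>n. \<forall>u\<in>carrier T. t \<oplus>\<^bsub>T\<^esub> (\<pi> ^ n) \<odot>\<^bsub>T\<^esub> u \<in> U)"

definition free_module_basis :: "('a :: idom, 't) module \<Rightarrow> nat \<Rightarrow> (nat \<Rightarrow> 't) \<Rightarrow> bool" where
  "free_module_basis T d b \<longleftrightarrow> Module.module class_ring T \<and> b \<in> {..<d} \<rightarrow> carrier T \<and>
     (\<forall>t\<in>carrier T. \<exists>!c. c \<in> carrier_vec d \<and> t = (\<Oplus>\<^bsub>T\<^esub>i\<in>{..<d}. vec_index c i \<odot>\<^bsub>T\<^esub> b i))"

definition coords :: "('a :: idom, 't) module \<Rightarrow> nat \<Rightarrow> (nat \<Rightarrow> 't) \<Rightarrow> 't \<Rightarrow> 'a vec" where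
  "coords T d b t = (THE c. c \<in> carrier_vec d \<and> t = (\<Oplus>\<^bsub>T\<^esub>i\<in>{..<d}. vec_index c i \<odot>\<^bsub>T\<^esub> b i))"


section \<open>The Galois representation\<close>

definition galois_action :: "('k :: field alg_closure \<Rightarrow> 'k alg_closure) \<Rightarrow>
    (nat \<Rightarrow> nat \<Rightarrow> 'k alg_closure) \<Rightarrow> nat \<Rightarrow> nat \<Rightarrow> 'k alg_closure" where
  "galois_action \<sigma> t = (\<lambda>n k. gal_ext \<sigma> (t n k))"

definition monodromy_group ::
  "('a, nat \<Rightarrow> nat \<Rightarrow> 'k :: field alg_closure) module \<Rightarrow>
     ((nat \<Rightarrow> nat \<Rightarrow> 'k alg_closure) \<Rightarrow> nat \<Rightarrow> nat \<Rightarrow> 'k alg_closure) set" where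
  "monodromy_group T = (\<lambda>\<sigma>. restrict (galois_action \<sigma>) (carrier T)) ` carrier Gal_sep"

definition galois_rep ::
  "('a :: idom, nat \<Rightarrow> nat \<Rightarrow> 'k :: field alg_closure) module \<Rightarrow> nat \<Rightarrow>
     (nat \<Rightarrow> nat \<Rightarrow> nat \<Rightarrow> 'k alg_closure) \<Rightarrow> ('k alg_closure \<Rightarrow> 'k alg_closure) \<Rightarrow> 'a mat" where
  "galois_rep T d b \<sigma> = mat d d (\<lambda>(i, j). vec_index (coords T d b (galois_action \<sigma> (b j))) i)"

definition GL :: "nat \<Rightarrow> 'a :: idom mat monoid" where
  "GL d = units_of (ring_mat TYPE('a) d ())"

text \<open>Irreducibility of a representation over \<open>A\<close> refers to the fraction field of \<open>A\<close>.\<close>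

definition irreducible_rep :: "nat \<Rightarrow> 'g set \<Rightarrow> ('g \<Rightarrow> 'a :: idom mat) \<Rightarrow> bool" where
  "irreducible_rep d \<Gamma> \<rho> \<longleftrightarrow> d > 0 \<and>
     (\<forall>W. VectorSpace.subspace class_ring W (module_vec TYPE('a fract) d) \<and>
          (\<forall>\<sigma>\<in>\<Gamma>. \<forall>w\<in>W. map_mat to_fract (\<rho> \<sigma>) *\<^sub>v w \<in> W) \<longrightarrow>
          W = {0\<^sub>v d} \<or> W = carrier_vec d)"

end

theory Submission
  imports Defs "HOL-Algebra.Sylow"
begin

text \<open>The points of the connected group \<open>G[\<pi>\<^sup>n]\<close> are the zeros of \<open>[\<pi>\<^sup>n]\<close> in the maximal ideal of the integral closure
  of \<open>R\<close>. By Weierstrass preparation \<open>[\<pi>\<^sup>n]\<close> is, up to a unit, a separable polynomial of degree \<open>q\<^sup>d\<^sup>n\<close>, where \<open>d = s - g\<close>,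
  in the \<open>q\<^sup>g\<^sup>n\<close>-th power of the variable, so there are \<open>q\<^sup>d\<^sup>n\<close> of them, and \<open>T(G)\<close> is free of rank \<open>d\<close>.

  Let \<open>(x\<^sub>n)\<close> be a nonzero element of \<open>T(G)\<close>. As \<open>[\<pi>](X) \<equiv> unit \<cdot> X^(q\<^sup>s)\<close> modulo the maximal ideal of \<open>R\<close>, the valuation of
  \<open>x\<^sub>n\<close> is divided by \<open>q\<^sup>s\<close> in each step from some step on. The power of \<open>x\<^sub>n\<close> with exponent \<open>q\<^sup>g\<^sup>n\<close> is separable over \<open>K\<close>, and the
  product of its conjugates has a valuation in \<open>\<int>\<close>. Hence \<open>x\<^sub>n\<close> has at least \<open>c q\<^sup>d\<^sup>n\<close> conjugates for a constant \<open>c > 0\<close>.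
  As the fibres of \<open>[\<pi>]\<close> have \<open>q\<^sup>d\<close> elements, for large \<open>n\<close> the conjugates of \<open>x\<^sub>n\<^sub>+\<^sub>1\<close> are all the
  preimages of the conjugates of \<open>x\<^sub>n\<close>, and since orbits are closed, the orbit is open.\<close>

section \<open>Automorphisms of an algebraic closure\<close>

text \<open>The valuation of R has to be used on an algebraic closure of K, which is not complete.
  It is never extended as a function: \<open>int_closure\<close> plays the part of its valuation
  ring and \<open>small\<close> that of its maximal ideal. By Weierstrass factorization every
  element is a root of a distinguished polynomial or of one with constant term 1, and this dichotomy
  makes \<open>int_closure\<close> a valuation ring. Power series are evaluated by reduction modulo
  a distinguished polynomial instead of by limits. Every R-algebra homomorphism from R[[X]] is such
  an evaluation, so a point of the group scheme is determined by its value on X.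

  The polynomial attached to \<pi>^n is separable because h = [\<pi>^n] is an endomorphism of F:
  comparing the coefficients of X^Q in h(F(X,Y)) = F(h(X),h(Y)), where Q is the inseparability
  degree, shows that a derivative does not vanish at the zeros.

  As the torsion points may be inseparable, the Galois group is replaced by the automorphisms of the
  algebraic closure over K, and its compactness by the extension of partial automorphisms.
  Irreducibility follows because an orbit contains t + \<pi>^N T.\<close>

abbreviation aeval :: "'k :: field poly \<Rightarrow> 'k alg_closure \<Rightarrow> 'k alg_closure" where
  "aeval f x \<equiv> poly (map_poly to_ac f) x"

interpretation to_ac_hom: inj_idom_hom "to_ac :: 'k :: field \<Rightarrow> 'k alg_closure"
  by unfold_locales auto

interpretation to_ac_poly: map_poly_inj_idom_hom "to_ac :: 'k :: field \<Rightarrow> 'k alg_closure" ..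

text \<open>Stands in for the Galois group: restriction to \<open>sep_closure\<close> and
  \<open>gal_ext\<close> are inverse to each other, so orbits can be computed with automorphisms of
  the whole closure, which act on inseparable points as well.\<close>

definition closure_aut :: "('k :: field alg_closure \<Rightarrow> 'k alg_closure) \<Rightarrow> bool" where
  "closure_aut \<tau> \<longleftrightarrow> bij \<tau> \<and> comm_ring_hom \<tau> \<and> (\<forall>c. \<tau> (to_ac c) = to_ac c)"

text \<open>A partial automorphism is encoded by its graph. Inverses come for free because the extension is
  algebraic, so that unions of chains of graphs are again graphs.\<close>

definition partial_aut :: "('k :: field alg_closure \<times> 'k alg_closure) set \<Rightarrow> bool" where
  "partial_aut S \<longleftrightarrow> (\<forall>c. (to_ac c, to_ac c) \<in> S) \<and>
     (\<forall>a b c d. (a, b) \<in> S \<longrightarrow> (c, d) \<in> S \<longrightarrow> (a + c, b + d) \<in> S \<and> (a * c, b * d) \<in> S) \<and>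
     (\<forall>b. (0, b) \<in> S \<longrightarrow> b = 0)"

lemma partial_autD:
  assumes "partial_aut S"
  shows "(to_ac c, to_ac c) \<in> S"
    and "(a, b) \<in> S \<Longrightarrow> (a', b') \<in> S \<Longrightarrow> (a + a', b + b') \<in> S"
    and "(a, b) \<in> S \<Longrightarrow> (a', b') \<in> S \<Longrightarrow> (a * a', b * b') \<in> S"
    and "(0, b) \<in> S \<Longrightarrow> b = 0"
  using assms by (simp_all add: partial_aut_def)

lemma partial_aut_01:
  assumes "partial_aut S" shows "(0, 0) \<in> S" "(1, 1) \<in> S" "(-1, -1) \<in> S"
  using partial_autD(1)[OF assms, of 0] partial_autD(1)[OF assms, of 1]
    partial_autD(1)[OF assms, of "-1"] by simp_all

lemma partial_aut_diff:
  assumes "partial_aut S" "(a, b) \<in> S" "(a', b') \<in> S" shows "(a - a', b - b') \<in> S"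
  using partial_autD(2)[OF assms(1,2) partial_autD(3)[OF assms(1) partial_aut_01(3)[OF assms(1)] assms(3)]]
  by simp

lemma partial_aut_sum:
  assumes "partial_aut S" "\<And>i. i \<in> I \<Longrightarrow> (f i, g i) \<in> S"
  shows "(sum f I, sum g I) \<in> S"
  using assms(2)
  by (induction I rule: infinite_finite_induct)
     (simp_all add: partial_aut_01[OF assms(1)] partial_autD(2)[OF assms(1)])

lemma partial_aut_functional:
  assumes "partial_aut S" "(a, b) \<in> S" "(a, b') \<in> S" shows "b = b'"
proof -
  have "(0, b - b') \<in> S" using partial_aut_diff[OF assms] by simp
  from partial_autD(4)[OF assms(1) this] show ?thesis by simp
qed

lemma partial_aut_aeval:
  assumes "partial_aut S" "(a, b) \<in> S" shows "(aeval f a, aeval f b) \<in> S"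
proof (induction f)
  case 0 then show ?case using partial_aut_01[OF assms(1)] by simp
next
  case (pCons c f)
  then show ?case using assms partial_autD[OF assms(1)]
    by (simp add: to_ac_hom.map_poly_pCons_hom)
qed

text \<open>Factors X of an annihilating polynomial can be cancelled because a is not 0. The
  constant coefficient that remains is what expresses \<open>inverse a\<close> as a polynomial in
  a.\<close>

lemma root_const_coeff_nonzero:
  fixes a :: "'k :: field alg_closure"
  assumes "a \<noteq> 0" shows "\<exists>f. coeff f 0 \<noteq> 0 \<and> aeval f a = 0"
proof -
  obtain f :: "'k poly" where "f \<noteq> 0" "aeval f a = 0" by (rule alg_closure_algebraic)
  then show ?thesis
  proof (induction f)
    case (pCons c f)
    then show ?case using assms
      by (cases "c = 0") (auto simp: to_ac_hom.map_poly_pCons_hom intro: exI[of _ "pCons c f"])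
  qed simp
qed

text \<open>For an annihilating polynomial c + X f' with c not 0, the value of r = - f' / c at a is
  \<open>inverse a\<close>. The relation a r(a) = 1 only involves sums and products, so S carries it
  over to b.\<close>

lemma partial_aut_inverse:
  assumes "partial_aut S" "(a, b) \<in> S" "a \<noteq> 0"
  shows "(inverse a, inverse b) \<in> S" "b \<noteq> 0"
proof -
  obtain f where f: "coeff f 0 \<noteq> 0" "aeval f a = 0" using root_const_coeff_nonzero[OF assms(3)] by blast
  obtain c f' where f': "f = pCons c f'" by (cases f)
  define r where "r = smult (- inverse c) f'"
  have c: "c \<noteq> 0" "to_ac c + a * aeval f' a = 0"
    using f by (auto simp: f' to_ac_hom.map_poly_pCons_hom)
  then have "a * aeval f' a = - to_ac c" by (simp add: eq_neg_iff_add_eq_0 add.commute)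
  then have ra: "a * aeval r a = 1"
    using c(1) by (simp add: r_def to_ac_hom.map_poly_hom_smult to_ac_poly.hom_uminus
        mult.left_commute[of a] flip: minus_mult_right)
  have "(a * aeval r a - 1, b * aeval r b - 1) \<in> S"
    by (intro partial_aut_diff partial_autD(3) partial_aut_aeval partial_aut_01 assms)
  then have rb: "b * aeval r b = 1" using ra partial_autD(4)[OF assms(1)] by fastforce
  have "(aeval r a, aeval r b) \<in> S" by (intro partial_aut_aeval assms)
  moreover have "aeval r a = inverse a" "aeval r b = inverse b"
    using ra rb by (metis inverse_unique)+
  ultimately show "(inverse a, inverse b) \<in> S" by simp
  show "b \<noteq> 0" using rb by auto
qed

definition poly_pairs :: "('a \<times> 'a) set \<Rightarrow> ('a :: comm_ring_1 poly \<times> 'a poly) set" where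
  "poly_pairs S = {(f, h). \<forall>i. (coeff f i, coeff h i) \<in> S}"

lemma poly_pairs_closed:
  assumes "partial_aut S" "(f, h) \<in> poly_pairs S" "(f', h') \<in> poly_pairs S"
  shows "(f + f', h + h') \<in> poly_pairs S" "(f * f', h * h') \<in> poly_pairs S"
    "(f - f', h - h') \<in> poly_pairs S"
proof -
  have *: "(coeff f i, coeff h i) \<in> S" "(coeff f' i, coeff h' i) \<in> S" for i
    using assms(2,3) by (auto simp: poly_pairs_def)
  show "(f + f', h + h') \<in> poly_pairs S" "(f - f', h - h') \<in> poly_pairs S"
    using partial_autD(2)[OF assms(1)] partial_aut_diff[OF assms(1)] * by (simp_all add: poly_pairs_def)
  show "(f * f', h * h') \<in> poly_pairs S"
    using partial_autD(3)[OF assms(1)] *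
    by (simp add: poly_pairs_def coeff_mult partial_aut_sum[OF assms(1)])
qed

text \<open>This is the well-definedness of the map from f(x) to h(z). The division of f by the
  minimal m is carried out in both components at once: the quotients of the leading coefficients
  form a pair in S, so subtracting the multiple of m from f and that of m' from h stays in
  \<open>poly_pairs S\<close> and lowers the bound n.\<close>

lemma poly_pairs_vanish:
  assumes S: "partial_aut S" and m: "(m, m') \<in> poly_pairs S" "m \<noteq> 0" "poly m x = 0" "poly m' z = 0"
    and min: "\<And>f h. (f, h) \<in> poly_pairs S \<Longrightarrow> f \<noteq> 0 \<Longrightarrow> poly f x = 0 \<Longrightarrow> degree m \<le> degree f"
  shows "(f, h) \<in> poly_pairs S \<Longrightarrow> poly f x = 0 \<Longrightarrow> (\<forall>i\<ge>n. coeff f i = 0) \<Longrightarrow> poly h z = 0"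
proof (induction n arbitrary: f h)
  case 0
  then have "f = 0" by (auto intro: poly_eqI)
  then have "coeff h i = 0" for i using 0 partial_autD(4)[OF S] by (auto simp: poly_pairs_def)
  then have "h = 0" by (auto intro: poly_eqI)
  then show ?case by simp
next
  case (Suc n)
  show ?case
  proof (cases "coeff f n = 0")
    case True
    then show ?thesis using Suc by (metis Suc_leI le_eq_less_or_eq)
  next
    case False
    have dn: "degree f = n" using False Suc.prems(3) by (metis Suc_leI degree_le le_antisym le_degree)
    have dm: "degree m \<le> n" using min[OF Suc.prems(1) _ Suc.prems(2)] False dn by auto
    define c where "c = coeff f n * inverse (coeff m (degree m))"
    define c' where "c' = coeff h n * inverse (coeff m' (degree m))"
    define k where "k = n - degree m"
    have "(coeff f n, coeff h n) \<in> S" "(coeff m (degree m), coeff m' (degree m)) \<in> S"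
      using Suc.prems(1) m(1) by (auto simp: poly_pairs_def)
    then have cc: "(c, c') \<in> S" using m(2) unfolding c_def c'_def
      by (intro partial_autD(3)[OF S] partial_aut_inverse(1)[OF S]) auto
    have "(monom c k, monom c' k) \<in> poly_pairs S"
      using cc partial_aut_01[OF S] by (auto simp: poly_pairs_def)
    then have fh: "(f - monom c k * m, h - monom c' k * m') \<in> poly_pairs S"
      by (intro poly_pairs_closed[OF S] Suc.prems(1) m(1))
    have "\<forall>i\<ge>n. coeff (f - monom c k * m) i = 0"
    proof (intro allI impI)
      fix i assume i: "n \<le> i"
      then have "coeff (monom c k * m) i = c * coeff m (i - k)"
        by (simp add: coeff_monom_mult k_def)
      moreover have "coeff m (i - k) = (if i = n then coeff m (degree m) else 0)"
        using i dm by (auto simp: k_def intro: coeff_eq_0)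
      moreover have "coeff f i = (if i = n then coeff f n else 0)" using i Suc.prems(3) by auto
      ultimately show "coeff (f - monom c k * m) i = 0"
        using m(2) by (auto simp: c_def)
    qed
    then have "poly (h - monom c' k * m') z = 0"
      using Suc.IH[OF fh] Suc.prems(2) m(3) by simp
    then show ?thesis using m(4) by simp
  qed
qed

text \<open>Extension of a field embedding to a simple extension, x being sent to a root z of the
  transported minimal relation m'.\<close>

lemma partial_aut_adjoin:
  assumes S: "partial_aut S" and m: "(m, m') \<in> poly_pairs S" "m \<noteq> 0" "poly m x = 0" "poly m' z = 0"
    and min: "\<And>f h. (f, h) \<in> poly_pairs S \<Longrightarrow> f \<noteq> 0 \<Longrightarrow> poly f x = 0 \<Longrightarrow> degree m \<le> degree f"
  defines "S' \<equiv> {(poly f x, poly h z) | f h. (f, h) \<in> poly_pairs S}"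
  shows "partial_aut S'" "S \<subseteq> S'" "(x, z) \<in> S'"
proof -
  have const: "([:a:], [:b:]) \<in> poly_pairs S" if "(a, b) \<in> S" for a b
    using that partial_aut_01[OF S] by (auto simp: poly_pairs_def coeff_pCons split: nat.splits)
  show sub: "S \<subseteq> S'"
  proof safe
    fix a b assume "(a, b) \<in> S"
    then have "poly [:a:] x = a" "poly [:b:] z = b" "([:a:], [:b:]) \<in> poly_pairs S" using const by auto
    then show "(a, b) \<in> S'"
      unfolding S'_def by (intro CollectI exI[of _ "[:a:]"] exI[of _ "[:b:]"]) simp
  qed
  have "([:0, 1:], [:0, 1:]) \<in> poly_pairs S"
    using partial_aut_01[OF S] by (auto simp: poly_pairs_def coeff_pCons split: nat.splits)
  moreover have "poly [:0, 1:] x = x" "poly [:0, 1:] z = z" by auto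
  ultimately show "(x, z) \<in> S'"
    unfolding S'_def by (intro CollectI exI[of _ "[:0, 1:]"]) simp
  have "(to_ac c, to_ac c) \<in> S'" for c using sub partial_autD(1)[OF S] by blast
  moreover have "(a + c, b + d) \<in> S' \<and> (a * c, b * d) \<in> S'" if el: "(a, b) \<in> S'" "(c, d) \<in> S'" for a b c d
  proof -
    obtain f h f' h' where *: "(f, h) \<in> poly_pairs S" "(f', h') \<in> poly_pairs S"
      "a = poly f x" "b = poly h z" "c = poly f' x" "d = poly h' z" using el unfolding S'_def by blast
    have "a + c = poly (f + f') x" "b + d = poly (h + h') z"
      "a * c = poly (f * f') x" "b * d = poly (h * h') z" using * by auto
    then show ?thesis using poly_pairs_closed(1,2)[OF S *(1,2)] unfolding S'_def by blast
  qed
  moreover have "b = 0" if b: "(0, b) \<in> S'" for b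
  proof -
    obtain f h where fh: "(f, h) \<in> poly_pairs S" "poly f x = 0" "b = poly h z"
      using b unfolding S'_def by force
    have "\<forall>i\<ge>Suc (degree f). coeff f i = 0" by (simp add: coeff_eq_0)
    then show ?thesis using poly_pairs_vanish[OF S m, of f h] min fh by blast
  qed
  ultimately show "partial_aut S'" unfolding partial_aut_def by blast
qed

lemma finite_aeval_roots: "f \<noteq> 0 \<Longrightarrow> finite {w. aeval f w = 0}"
  by (simp add: poly_roots_finite)

text \<open>A relation m of least degree for x over the domain of M is transported to m'. Its
  leading coefficient does not become 0, so m' is not constant and has a root z. Adjoining (x, z)
  would enlarge M unless x already was in the domain.\<close>

lemma partial_aut_maximal_total:
  assumes M: "partial_aut M" and max: "\<And>S. partial_aut S \<Longrightarrow> M \<subseteq> S \<Longrightarrow> S = M"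
  shows "\<exists>b. (x, b) \<in> M"
proof -
  obtain p where p: "p \<noteq> 0" "aeval p x = 0" by (rule alg_closure_algebraic)
  let ?Q = "\<lambda>u. u \<in> poly_pairs M \<and> fst u \<noteq> 0 \<and> poly (fst u) x = 0"
  have "?Q (map_poly to_ac p, map_poly to_ac p)"
    using p partial_autD(1)[OF M] by (auto simp: poly_pairs_def)
  then obtain u where u: "?Q u" "\<And>v. ?Q v \<Longrightarrow> degree (fst u) \<le> degree (fst v)"
    using ex_has_least_nat[of ?Q _ "\<lambda>v. degree (fst v)"] by blast
  obtain m m' where um: "u = (m, m')" by (cases u)
  have m: "(m, m') \<in> poly_pairs M" "m \<noteq> 0" "poly m x = 0" using u um by auto
  have min: "degree m \<le> degree f" if "(f, h) \<in> poly_pairs M" "f \<noteq> 0" "poly f x = 0" for f h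
    using u(2)[of "(f, h)"] that um by auto
  have "degree m > 0" using m(2,3) by (intro Nat.gr0I) (auto elim!: degree_eq_zeroE)
  moreover have "(coeff m (degree m), coeff m' (degree m)) \<in> M" using m(1) by (auto simp: poly_pairs_def)
  then have "coeff m' (degree m) \<noteq> 0" using partial_aut_inverse(2)[OF M] m(2) by auto
  then have "degree m \<le> degree m'" by (rule le_degree)
  ultimately obtain z where z: "poly m' z = 0" using alg_closed_imp_poly_has_root[of m'] by auto
  show ?thesis
    using partial_aut_adjoin[OF M m z] min max by blast
qed

theorem partial_aut_extends:
  fixes S :: "('a :: field alg_closure \<times> 'a alg_closure) set"
  assumes S: "partial_aut S"
  shows "\<exists>\<tau>. closure_aut \<tau> \<and> (\<forall>(a, b)\<in>S. \<tau> a = b)"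
proof -
  let ?A = "{S'. partial_aut S' \<and> S \<subseteq> S'}"
  have "\<exists>M\<in>?A. \<forall>Z\<in>?A. M \<subseteq> Z \<longrightarrow> Z = M"
  proof (rule subset_Zorn_nonempty)
    show "?A \<noteq> {}" using S by blast
    fix C assume C: "C \<noteq> {}" "subset.chain ?A C"
    then have el: "partial_aut Z" "S \<subseteq> Z" if "Z \<in> C" for Z using that by (auto simp: subset.chain_def)
    have two: "\<exists>Z\<in>C. u \<in> Z \<and> v \<in> Z" if uv: "u \<in> \<Union>C" "v \<in> \<Union>C" for u v
    proof -
      obtain Y Z where "Y \<in> C" "Z \<in> C" "u \<in> Y" "v \<in> Z" using uv by blast
      moreover from this have "Y \<subseteq> Z \<or> Z \<subseteq> Y" using C(2) unfolding subset.chain_def by blast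
      ultimately show ?thesis by blast
    qed
    have "S \<subseteq> \<Union>C" using C(1) el(2) by blast
    moreover have "partial_aut (\<Union>C)"
      unfolding partial_aut_def
    proof (intro conjI allI impI)
      show "(to_ac c, to_ac c) \<in> \<Union>C" for c using C(1) el(1) partial_autD(1) by blast
      show "b = 0" if "(0, b) \<in> \<Union>C" for b using that el(1) partial_autD(4) by blast
      fix a b c d assume ab: "(a, b) \<in> \<Union>C" "(c, d) \<in> \<Union>C"
      then obtain Z where "Z \<in> C" "(a, b) \<in> Z" "(c, d) \<in> Z" using two by blast
      then show "(a + c, b + d) \<in> \<Union>C" "(a * c, b * d) \<in> \<Union>C"
        using el(1) partial_autD(2,3) by blast+
    qed
    ultimately show "\<Union>C \<in> ?A" by blast
  qed
  then obtain M where M0: "M \<in> ?A" "\<forall>Z\<in>?A. M \<subseteq> Z \<longrightarrow> Z = M" by (elim bexE)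
  have M: "partial_aut M" "S \<subseteq> M" using M0(1) by auto
  have max: "Z = M" if "partial_aut Z" "M \<subseteq> Z" for Z
    using that M0(2) M(2) by (metis (mono_tags, lifting) mem_Collect_eq order_trans)
  define \<tau> where "\<tau> = (\<lambda>a. THE b. (a, b) \<in> M)"
  have tau: "(a, b) \<in> M \<longleftrightarrow> \<tau> a = b" for a b
    unfolding \<tau>_def
    using partial_aut_maximal_total[OF M(1) max, of a] partial_aut_functional[OF M(1), of a]
    by (metis the_equality)
  have gr: "(a, \<tau> a) \<in> M" for a using tau by blast
  have hom: "comm_ring_hom \<tau>"
  proof
    show "\<tau> 0 = 0" "\<tau> 1 = 1" using partial_aut_01[OF M(1)] tau by blast+
    show "\<tau> (a + b) = \<tau> a + \<tau> b" "\<tau> (a * b) = \<tau> a * \<tau> b" for a b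
      using partial_autD(2,3)[OF M(1) gr[of a] gr[of b]] tau by blast+
  qed
  have fix_K: "\<tau> (to_ac c) = to_ac c" for c using partial_autD(1)[OF M(1)] tau by blast
  interpret \<tau>: comm_ring_hom \<tau> by (rule hom)
  have "inj \<tau>"
  proof (rule injI)
    fix a b assume "\<tau> a = \<tau> b"
    then have "\<tau> (a - b) = 0" by (simp add: \<tau>.hom_minus)
    then have "(a - b, 0) \<in> M" using tau by blast
    then have "a - b = 0" using partial_aut_inverse(2)[OF M(1)] by blast
    then show "a = b" by simp
  qed
  \<comment> \<open>Each w is a root of some p over K; \<tau> is injective and maps the finite root
    set of p to itself, hence onto it.\<close>
  moreover have "surj \<tau>"
    unfolding surj_def
  proof
    fix w :: "'a alg_closure"
    obtain p :: "'a poly" where p: "p \<noteq> 0" "aeval p w = 0" by (rule alg_closure_algebraic)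
    let ?R = "{w. aeval p w = 0}"
    have "aeval p (\<tau> a) = \<tau> (aeval p a)" for a
      using partial_aut_aeval[OF M(1) gr[of a], of p] tau by metis
    then have "\<tau> ` ?R \<subseteq> ?R" by auto
    then have "\<tau> ` ?R = ?R" using finite_aeval_roots[OF p(1)] \<open>inj \<tau>\<close>
      by (meson endo_inj_surj inj_on_subset subset_UNIV)
    then show "\<exists>a. w = \<tau> a" using p(2) by blast
  qed
  ultimately have "closure_aut \<tau>" using hom fix_K by (auto simp: closure_aut_def bij_def)
  then show ?thesis using M(2) tau by blast
qed

lemma closure_aut_aeval:
  assumes "closure_aut \<tau>" shows "aeval f (\<tau> a) = \<tau> (aeval f a)"
proof -
  interpret \<tau>: comm_ring_hom \<tau> using assms by (simp add: closure_aut_def)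
  have [simp]: "\<tau> (to_ac c) = to_ac c" for c using assms by (simp add: closure_aut_def)
  show ?thesis by (induction f) (auto simp: to_ac_hom.map_poly_pCons_hom \<tau>.hom_add \<tau>.hom_mult)
qed

lemma closure_aut_id: "closure_aut (id :: 'a :: field alg_closure \<Rightarrow> _)"
proof -
  have "comm_ring_hom (id :: 'a alg_closure \<Rightarrow> 'a alg_closure)" by unfold_locales simp_all
  then show ?thesis by (simp add: closure_aut_def)
qed

lemma closure_aut_comp:
  assumes "closure_aut \<sigma>" "closure_aut \<tau>" shows "closure_aut (\<sigma> \<circ> \<tau>)"
proof -
  interpret \<sigma>: comm_ring_hom \<sigma> using assms by (simp add: closure_aut_def)
  interpret \<tau>: comm_ring_hom \<tau> using assms by (simp add: closure_aut_def)
  have "comm_ring_hom (\<sigma> \<circ> \<tau>)"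
    by unfold_locales (auto simp: \<sigma>.hom_add \<tau>.hom_add \<sigma>.hom_mult \<tau>.hom_mult)
  then show ?thesis using assms by (auto simp: closure_aut_def bij_comp)
qed

lemma closure_aut_inv:
  assumes "closure_aut \<tau>" shows "closure_aut (inv_into UNIV \<tau>)"
proof -
  interpret \<tau>: comm_ring_hom \<tau> using assms by (simp add: closure_aut_def)
  have b: "bij \<tau>" and c: "\<tau> (to_ac c) = to_ac c" for c using assms by (auto simp: closure_aut_def)
  have eq: "inv_into UNIV \<tau> a = b \<longleftrightarrow> a = \<tau> b" for a b using b by (metis bij_inv_eq_iff)
  have "\<tau> (inv_into UNIV \<tau> a) = a" for a using eq by metis
  then have "comm_ring_hom (inv_into UNIV \<tau>)"
    by unfold_locales (simp_all add: eq \<tau>.hom_add \<tau>.hom_mult)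
  then show ?thesis using b by (auto simp: closure_aut_def bij_imp_bij_inv eq c)
qed

section \<open>Conjugates, minimal polynomials and norms\<close>

definition conjugates :: "'k :: field alg_closure \<Rightarrow> 'k alg_closure set" where
  "conjugates y = {\<tau> y | \<tau>. closure_aut \<tau>}"

text \<open>The divisibility comes from division with remainder. For a root z of m the pairs (f(y),
  f(z)) form a partial automorphism, since f(y) = 0 makes m divide f; extending it gives an
  automorphism that takes y to z.\<close>

lemma minimal_polynomial:
  fixes y :: "'k :: field alg_closure"
  obtains m :: "'k poly" where "m \<noteq> 0" "aeval m y = 0" "\<And>f. aeval f y = 0 \<Longrightarrow> m dvd f"
    "conjugates y = {z. aeval m z = 0}"
proof -
  let ?Q = "\<lambda>f :: 'k poly. f \<noteq> 0 \<and> aeval f y = 0"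
  obtain p where "?Q p" by (metis alg_closure_algebraic)
  then obtain m where m: "?Q m" "\<And>f. ?Q f \<Longrightarrow> degree m \<le> degree f"
    using ex_has_least_nat[of ?Q _ degree] by blast
  have dvd: "m dvd f" if "aeval f y = 0" for f
  proof -
    have "f = f div m * m + f mod m" by simp
    then have "aeval f y = aeval (f div m) y * aeval m y + aeval (f mod m) y"
      by (metis poly_add poly_mult to_ac_poly.hom_add to_ac_poly.hom_mult)
    then have "aeval (f mod m) y = 0" using m(1) that by simp
    then have "f mod m = 0" using m degree_mod_less[of m f] by (meson not_le)
    then show ?thesis by auto
  qed
  have "conjugates y = {z. aeval m z = 0}"
  proof safe
    fix z assume "z \<in> conjugates y"
    then obtain \<tau> where \<tau>: "closure_aut \<tau>" "z = \<tau> y" by (auto simp: conjugates_def)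
    interpret \<tau>: comm_ring_hom \<tau> using \<tau> by (simp add: closure_aut_def)
    show "aeval m z = 0" using m(1) closure_aut_aeval[OF \<tau>(1), of m y] \<tau>(2) by simp
  next
    fix z assume z: "aeval m z = 0"
    let ?S = "{(aeval f y, aeval f z) | f. True}"
    have "partial_aut ?S"
      unfolding partial_aut_def
    proof (intro conjI allI impI)
      fix c
      have "aeval [:c:] y = to_ac c" "aeval [:c:] z = to_ac c" by (simp_all add: to_ac_hom.map_poly_pCons_hom)
      then show "(to_ac c, to_ac c) \<in> ?S" by (intro CollectI exI[of _ "[:c:]"]) simp
    next
      fix b assume "(0, b) \<in> ?S"
      then obtain f where f: "aeval f y = 0" "b = aeval f z" by force
      then show "b = 0" using dvd[of f] z by (auto simp: to_ac_poly.hom_mult elim!: dvdE)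
    next
      fix a b c d assume "(a, b) \<in> ?S" "(c, d) \<in> ?S"
      then obtain f h where "a = aeval f y" "b = aeval f z" "c = aeval h y" "d = aeval h z" by blast
      then have *: "a + c = aeval (f + h) y" "b + d = aeval (f + h) z"
        "a * c = aeval (f * h) y" "b * d = aeval (f * h) z"
        by (simp_all add: to_ac_poly.hom_mult to_ac_poly.hom_add)
      show "(a + c, b + d) \<in> ?S" using * by (intro CollectI exI[of _ "f + h"]) simp
      show "(a * c, b * d) \<in> ?S" using * by (intro CollectI exI[of _ "f * h"]) simp
    qed
    then obtain \<tau> where \<tau>: "closure_aut \<tau>" "\<forall>(a, b)\<in>?S. \<tau> a = b" using partial_aut_extends by blast
    have "aeval [:0, 1:] y = y" "aeval [:0, 1:] z = z" by (simp_all add: to_ac_hom.map_poly_pCons_hom)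
    then have "(y, z) \<in> ?S" by (intro CollectI exI[of _ "[:0, 1:]"]) simp
    then show "z \<in> conjugates y" using \<tau> by (auto simp: conjugates_def)
  qed
  then show thesis using that m dvd by blast
qed

lemma finite_conjugates: "finite (conjugates y)"
proof -
  obtain m where "m \<noteq> 0" "conjugates y = {z. aeval m z = 0}" by (rule minimal_polynomial[of y]) blast
  then show ?thesis by (simp add: finite_aeval_roots)
qed

text \<open>When a factor X - z is split off, the condition on the derivative says that z is not a
  root of the cofactor, so every root is counted once.\<close>

lemma simple_roots_factorization:
  fixes p :: "'e :: alg_closed_field poly"
  assumes "p \<noteq> 0" "\<And>z. poly p z = 0 \<Longrightarrow> poly (pderiv p) z \<noteq> 0"
  shows "p = smult (lead_coeff p) (\<Prod>z\<in>{z. poly p z = 0}. [:-z, 1:])"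
    and "card {z. poly p z = 0} = degree p"
proof -
  have "p = smult (lead_coeff p) (\<Prod>z\<in>{z. poly p z = 0}. [:-z, 1:]) \<and> card {z. poly p z = 0} = degree p"
    using assms
  proof (induction "degree p" arbitrary: p)
    case 0
    then obtain c where "p = [:c:]" "c \<noteq> 0" by (metis degree_0_id pCons_0_0)
    then show ?case by simp
  next
    case (Suc n)
    then obtain z where z: "poly p z = 0" using alg_closed_imp_poly_has_root[of p] by auto
    then obtain q where q: "p = [:-z, 1:] * q" by (metis dvdE poly_eq_0_iff_dvd)
    have q0: "q \<noteq> 0" using q Suc.prems(1) by auto
    have pd: "pderiv p = [:-z, 1:] * pderiv q + q" unfolding q by (subst pderiv_mult) (simp add: pderiv_pCons)
    have zq: "poly q z \<noteq> 0" using Suc.prems(2)[OF z] pd by simp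
    have roots: "{w. poly p w = 0} = insert z {w. poly q w = 0}" unfolding q by auto
    have dq: "degree p = Suc (degree q)" unfolding q using q0 by (subst degree_mult_eq) auto
    have lc: "lead_coeff p = lead_coeff q" unfolding q by (subst lead_coeff_mult) simp
    have "poly (pderiv q) w \<noteq> 0" if w: "poly q w = 0" for w
      using Suc.prems(2)[of w] w pd by (auto simp: q)
    then have IH: "q = smult (lead_coeff q) (\<Prod>z\<in>{z. poly q z = 0}. [:-z, 1:])"
      "card {z. poly q z = 0} = degree q"
      using Suc.hyps(1)[of q] Suc.hyps(2) dq q0 by auto
    have fin: "finite {w. poly q w = 0}" using q0 by (rule poly_roots_finite)
    have "smult (lead_coeff p) (\<Prod>z\<in>{z. poly p z = 0}. [:-z, 1:]) = [:-z, 1:] *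
      smult (lead_coeff q) (\<Prod>z\<in>{z. poly q z = 0}. [:-z, 1:])"
      unfolding roots lc using fin zq by (subst prod.insert) auto
    also have "\<dots> = p" using IH(1) q by simp
    finally show ?case using roots fin zq IH(2) dq by simp
  qed
  then show "p = smult (lead_coeff p) (\<Prod>z\<in>{z. poly p z = 0}. [:-z, 1:])"
    "card {z. poly p z = 0} = degree p" by blast+
qed

text \<open>The norm of y. The hypothesis on f passes to the minimal polynomial of y, and
  conjugation transports it to all roots; hence the conjugates are simple roots, and their product
  is up to sign the quotient of the extreme coefficients.\<close>

lemma prod_conjugates_in_base:
  assumes "aeval f y = 0" "aeval (pderiv f) y \<noteq> 0"
  shows "\<exists>c. \<Prod>(conjugates y) = to_ac c"
proof -
  obtain m where m: "m \<noteq> 0" "aeval m y = 0" "\<And>f. aeval f y = 0 \<Longrightarrow> m dvd f"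
    and conj: "conjugates y = {z. aeval m z = 0}"
    by (rule minimal_polynomial[of y]) blast
  obtain k where k: "f = m * k" using m(3)[OF assms(1)] by (elim dvdE)
  have y: "aeval (pderiv m) y \<noteq> 0"
    using assms(2) m(2) unfolding k
    by (auto simp: pderiv_mult to_ac_poly.hom_add to_ac_poly.hom_mult)
  let ?m = "map_poly to_ac m"
  have "poly (pderiv ?m) z \<noteq> 0" if z: "poly ?m z = 0" for z
  proof -
    obtain \<tau> where \<tau>: "closure_aut \<tau>" "z = \<tau> y" using z conj unfolding conjugates_def by blast
    interpret \<tau>: comm_ring_hom \<tau> using \<tau> by (simp add: closure_aut_def)
    have "inj \<tau>" using \<tau> by (simp add: closure_aut_def bij_def)
    have "poly (pderiv ?m) z = \<tau> (aeval (pderiv m) y)"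
      unfolding to_ac_hom.map_poly_pderiv[symmetric] \<tau>(2) by (rule closure_aut_aeval[OF \<tau>(1)])
    then show ?thesis using y \<open>inj \<tau>\<close> by (metis \<tau>.hom_zero injD)
  qed
  then have fac: "?m = smult (lead_coeff ?m) (\<Prod>z\<in>{z. poly ?m z = 0}. [:-z, 1:])"
    using m(1) by (intro simple_roots_factorization) auto
  have "to_ac (coeff m 0) = poly ?m 0" by (simp add: poly_0_coeff_0)
  also have "\<dots> = lead_coeff ?m * (\<Prod>z\<in>conjugates y. - z)"
    using arg_cong[OF fac, of "\<lambda>p. poly p 0"] by (simp add: conj poly_prod)
  also have "\<dots> = to_ac (lead_coeff m) * ((- 1) ^ card (conjugates y) * \<Prod>(conjugates y))"
    using prod_constant[of "-1 :: 'a alg_closure" "conjugates y"]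
      prod.distrib[of "\<lambda>_. -1 :: 'a alg_closure" "\<lambda>z. z" "conjugates y"] by simp
  finally have eq: "to_ac (coeff m 0) = to_ac (lead_coeff m) * ((- 1) ^ card (conjugates y) * \<Prod>(conjugates y))" .
  have "to_ac (coeff m 0 / lead_coeff m * (- 1) ^ card (conjugates y)) =
    (- 1) ^ card (conjugates y) * ((- 1) ^ card (conjugates y) * \<Prod>(conjugates y))"
    using m(1) by (simp add: eq)
  also have "\<dots> = \<Prod>(conjugates y)" by (rule left_minus_one_mult_self)
  finally have "\<Prod>(conjugates y) = to_ac (coeff m 0 / lead_coeff m * (- 1) ^ card (conjugates y))" ..
  then show ?thesis by blast
qed

section \<open>The separable closure\<close>

text \<open>Coprimality of f and its derivative is a condition on all roots of f. The minimal
  polynomial m reduces it to a condition at x: a common divisor c of m and its derivative does not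
  vanish at x, so the cofactor does, is divisible by m, and c is a unit.\<close>

lemma sep_closure_iff:
  "x \<in> sep_closure \<longleftrightarrow> (\<exists>f. aeval f x = 0 \<and> aeval (pderiv f) x \<noteq> 0)"
proof
  obtain m where m: "m \<noteq> 0" "aeval m x = 0" "\<And>f. aeval f x = 0 \<Longrightarrow> m dvd f"
    by (rule minimal_polynomial[of x]) blast
  have not_unit: "\<not> m dvd 1"
  proof
    assume "m dvd 1"
    then obtain k where k: "1 = m * k" by (elim dvdE)
    have "aeval m x * aeval k x = aeval (m * k) x" by (simp add: to_ac_poly.hom_mult)
    also have "\<dots> = 1" by (simp add: k[symmetric])
    finally show False using m(2) by simp
  qed
  {
    assume "x \<in> sep_closure"
    then obtain f where f: "coprime f (pderiv f)" "aeval f x = 0" by (auto simp: sep_closure_def)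
    then have "aeval (pderiv f) x \<noteq> 0" using m(3) not_unit by (metis coprime_common_divisor)
    then show "\<exists>f. aeval f x = 0 \<and> aeval (pderiv f) x \<noteq> 0" using f by blast
  }
  assume "\<exists>f. aeval f x = 0 \<and> aeval (pderiv f) x \<noteq> 0"
  then obtain f where f: "aeval f x = 0" "aeval (pderiv f) x \<noteq> 0" by blast
  obtain k where k: "f = m * k" using m(3)[OF f(1)] by (elim dvdE)
  have y: "aeval (pderiv m) x \<noteq> 0"
    using f(2) m(2) unfolding k by (auto simp: pderiv_mult to_ac_poly.hom_add to_ac_poly.hom_mult)
  have "coprime m (pderiv m)"
  proof (rule coprimeI)
    fix c assume c: "c dvd m" "c dvd pderiv m"
    obtain j where j: "m = c * j" using c(1) by (elim dvdE)
    obtain i where i: "pderiv m = c * i" using c(2) by (elim dvdE)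
    have "aeval c x \<noteq> 0" using y i by (auto simp: to_ac_poly.hom_mult)
    then have "aeval j x = 0" using m(2) j by (auto simp: to_ac_poly.hom_mult)
    then have "m dvd j" by (rule m(3))
    then obtain l where "j = m * l" by (elim dvdE)
    then have "m * (c * l) = m * 1" using j by (simp add: algebra_simps)
    then have "c * l = 1" using m(1) mult_left_cancel by blast
    then show "c dvd 1" by (metis dvd_triv_left)
  qed
  then show "x \<in> sep_closure" using m(2) by (auto simp: sep_closure_def)
qed

lemma to_ac_in_sep_closure [simp]: "to_ac c \<in> sep_closure"
  unfolding sep_closure_iff
  by (rule exI[of _ "[:-c, 1:]"]) (simp add: to_ac_hom.map_poly_pCons_hom pderiv_pCons)

section \<open>Derivations, and closure of the separable elements under sums and products\<close>

definition derivation_graph :: "('k :: field alg_closure \<times> 'k alg_closure) set \<Rightarrow> bool" where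
  "derivation_graph S \<longleftrightarrow> (\<forall>c. (to_ac c, 0) \<in> S) \<and>
     (\<forall>a b a' b'. (a, b) \<in> S \<longrightarrow> (a', b') \<in> S \<longrightarrow> (a + a', b + b') \<in> S \<and> (a * a', a * b' + b * a') \<in> S) \<and>
     (\<forall>b. (0, b) \<in> S \<longrightarrow> b = 0)"

lemma derivation_graphD:
  assumes "derivation_graph S"
  shows "(to_ac c, 0) \<in> S"
    and "(a, b) \<in> S \<Longrightarrow> (a', b') \<in> S \<Longrightarrow> (a + a', b + b') \<in> S"
    and "(a, b) \<in> S \<Longrightarrow> (a', b') \<in> S \<Longrightarrow> (a * a', a * b' + b * a') \<in> S"
    and "(0, b) \<in> S \<Longrightarrow> b = 0"
  using assms by (simp_all add: derivation_graph_def)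

lemma derivation_graph_diff:
  assumes "derivation_graph S" "(a, b) \<in> S" "(a', b') \<in> S" shows "(a - a', b - b') \<in> S"
  using derivation_graphD(2)[OF assms(1,2)
      derivation_graphD(3)[OF assms(1) derivation_graphD(1)[OF assms(1), of "-1"] assms(3)]] by simp

lemma derivation_graph_sum:
  assumes "derivation_graph S" "\<And>i. i \<in> I \<Longrightarrow> (f i, g i) \<in> S"
  shows "(sum f I, sum g I) \<in> S"
  using assms(2) derivation_graphD(1)[OF assms(1), of 0]
  by (induction I rule: infinite_finite_induct) (simp_all add: derivation_graphD(2)[OF assms(1)])

text \<open>The inverse of a is a polynomial in a, and the polynomials in a belong to the domain of
  S by the sum and product rules.\<close>

lemma derivation_graph_inverse:
  assumes S: "derivation_graph S" and ab: "(a, b) \<in> S" and a: "a \<noteq> 0"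
  shows "\<exists>b'. (inverse a, b') \<in> S"
proof -
  have ev: "\<exists>b'. (aeval f a, b') \<in> S" for f
  proof (induction f)
    case 0
    then show ?case using derivation_graphD(1)[OF S, of 0] by auto
  next
    case (pCons c f)
    then obtain b' where "(aeval f a, b') \<in> S" by blast
    then have "(to_ac c + a * aeval f a, 0 + (a * b' + b * aeval f a)) \<in> S"
      by (intro derivation_graphD(2,3)[OF S] derivation_graphD(1)[OF S] ab)
    then show ?case by (auto simp: to_ac_hom.map_poly_pCons_hom)
  qed
  obtain r where "coeff r 0 \<noteq> 0" "aeval r a = 0" using root_const_coeff_nonzero[OF a] by blast
  moreover obtain c r' where r': "r = pCons c r'" by (cases r)
  ultimately have c: "c \<noteq> 0" "to_ac c + a * aeval r' a = 0"
    by (auto simp: to_ac_hom.map_poly_pCons_hom)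
  then have "a * aeval r' a = - to_ac c" by (simp add: eq_neg_iff_add_eq_0 add.commute)
  then have "a * (- inverse (to_ac c) * aeval r' a) = 1"
    using c(1) by (simp add: mult.left_commute[of a] flip: minus_mult_right)
  then have "inverse a = - inverse (to_ac c) * aeval r' a" by (metis inverse_unique)
  also have "\<dots> = aeval (smult (- inverse c) r') a"
    by (simp add: to_ac_hom.map_poly_hom_smult to_ac_poly.hom_uminus)
  finally show ?thesis using ev by metis
qed

text \<open>A derivation extends by \<open>z \<mapsto> 0\<close> to the ring generated by a separable \<open>z\<close>: every relation of \<open>z\<close> is a
  multiple of the minimal one, so that its pair of derivatives is a multiple of that of the minimal
  one, and by separability the latter vanishes.\<close>

lemma derivation_graph_adjoin:
  fixes z :: "'k :: field alg_closure"
  assumes S: "derivation_graph S" and z: "z \<in> sep_closure"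
  shows "\<exists>S'. derivation_graph S' \<and> S \<subseteq> S' \<and> (z, 0) \<in> S'"
proof -
  have S0: "(0, 0) \<in> S" using derivation_graphD(1)[OF S, of 0] by simp
  define PS where "PS = poly_pairs S"
  have PS_iff: "(f, h) \<in> PS \<longleftrightarrow> (\<forall>i. (coeff f i, coeff h i) \<in> S)" for f h
    by (simp add: PS_def poly_pairs_def)
  obtain p where p: "aeval p z = 0" "aeval (pderiv p) z \<noteq> 0" using z unfolding sep_closure_iff by blast
  have p0: "p \<noteq> 0" using p(2) by auto
  have pPS: "(map_poly to_ac p, 0) \<in> PS" unfolding PS_iff by (simp add: derivation_graphD(1)[OF S])
  let ?Q = "\<lambda>u. u \<in> PS \<and> fst u \<noteq> 0 \<and> poly (fst u) z = 0"
  have "?Q (map_poly to_ac p, 0)" using pPS p(1) p0 by simp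
  then obtain u where u: "?Q u" "\<And>v. ?Q v \<Longrightarrow> degree (fst u) \<le> degree (fst v)"
    using ex_has_least_nat[of ?Q _ "\<lambda>v. degree (fst v)"] by blast
  obtain m m' where um: "u = (m, m')" by (cases u)
  have m: "(m, m') \<in> PS" "m \<noteq> 0" "poly m z = 0" using u um by auto
  have min: "degree m \<le> degree f" if "(f, h) \<in> PS" "f \<noteq> 0" "poly f z = 0" for f h
    using u(2)[of "(f, h)"] that um by auto
  have proportional: "\<exists>\<kappa>. poly h z = \<kappa> * poly m' z \<and> poly (pderiv f) z = \<kappa> * poly (pderiv m) z"
    if "(f, h) \<in> PS" "poly f z = 0" "\<forall>i\<ge>n. coeff f i = 0" for f h n
    using that
  proof (induction n arbitrary: f h)
    case 0
    then have "f = 0" by (auto intro: poly_eqI)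
    moreover have "coeff h i = 0" for i using 0(1) derivation_graphD(4)[OF S] \<open>f = 0\<close> by (simp add: PS_iff)
    then have "h = 0" by (auto intro: poly_eqI)
    ultimately show ?case by (intro exI[of _ 0]) simp
  next
    case (Suc n)
    show ?case
    proof (cases "coeff f n = 0")
      case True
      then show ?thesis using Suc by (metis Suc_leI le_eq_less_or_eq)
    next
      case False
      have dn: "degree f = n" using False Suc.prems(3) by (metis Suc_leI degree_le le_antisym le_degree)
      have dm: "degree m \<le> n" using min[OF Suc.prems(1) _ Suc.prems(2)] False dn by auto
      define c where "c = coeff f n * inverse (coeff m (degree m))"
      define k where "k = n - degree m"
      have fS: "(coeff f n, coeff h n) \<in> S" and mS: "(coeff m (degree m), coeff m' (degree m)) \<in> S"
        using Suc.prems(1) m(1) by (auto simp: PS_iff)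
      obtain b' where "(inverse (coeff m (degree m)), b') \<in> S" using derivation_graph_inverse[OF S mS] m(2) by auto
      then obtain c' where cc: "(c, c') \<in> S" unfolding c_def using derivation_graphD(3)[OF S fS] by blast
      define f1 where "f1 = f - monom c k * m"
      \<comment> \<open>The product rule for c X^k m, where c' and m' are the derivatives of c and
        of the coefficients of m.\<close>
      define h1 where "h1 = h - (monom c k * m' + monom c' k * m)"
      have "(coeff f1 i, coeff h1 i) \<in> S" for i
      proof (cases "k \<le> i")
        case True
        then show ?thesis unfolding f1_def h1_def
          using derivation_graph_diff[OF S _ derivation_graphD(3)[OF S cc], of "coeff f i" "coeff h i" "coeff m (i - k)" "coeff m' (i - k)"]
            Suc.prems(1) m(1) by (simp add: PS_iff coeff_monom_mult)
      next
        case False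
        then show ?thesis unfolding f1_def h1_def
          using Suc.prems(1) by (simp add: PS_iff coeff_monom_mult)
      qed
      then have fh: "(f1, h1) \<in> PS" by (simp add: PS_iff)
      have "\<forall>i\<ge>n. coeff f1 i = 0"
      proof (intro allI impI)
        fix i assume i: "n \<le> i"
        then have "coeff (monom c k * m) i = c * coeff m (i - k)"
          by (simp add: coeff_monom_mult k_def)
        moreover have "coeff m (i - k) = (if i = n then coeff m (degree m) else 0)"
          using i dm by (auto simp: k_def intro: coeff_eq_0)
        moreover have "coeff f i = (if i = n then coeff f n else 0)" using i Suc.prems(3) by auto
        ultimately show "coeff f1 i = 0" using m(2) by (auto simp: c_def f1_def)
      qed
      moreover have "poly f1 z = 0" using Suc.prems(2) m(3) by (simp add: f1_def)
      ultimately obtain \<kappa> where \<kappa>: "poly h1 z = \<kappa> * poly m' z"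
        "poly (pderiv f1) z = \<kappa> * poly (pderiv m) z" using Suc.IH[OF fh] by blast
      have "poly h z = (\<kappa> + c * z ^ k) * poly m' z"
        using \<kappa>(1) m(3) by (simp add: h1_def poly_monom algebra_simps)
      moreover have "poly (pderiv f) z = (\<kappa> + c * z ^ k) * poly (pderiv m) z"
        using \<kappa>(2) m(3) by (simp add: f1_def poly_monom pderiv_diff pderiv_mult algebra_simps)
      ultimately show ?thesis by blast
    qed
  qed
  have vanish: "\<forall>i\<ge>Suc (degree f). coeff f i = 0" for f :: "'k alg_closure poly"
    by (simp add: coeff_eq_0)
  obtain \<kappa> where "poly 0 z = \<kappa> * poly m' z"
    "poly (pderiv (map_poly to_ac p)) z = \<kappa> * poly (pderiv m) z"
    using proportional[OF pPS p(1) vanish] by blast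
  then have m'z: "poly m' z = 0" using p(2) by (auto simp: to_ac_hom.map_poly_pderiv)
  have zero: "poly h z = 0" if "(f, h) \<in> PS" "poly f z = 0" for f h
    using proportional[OF that vanish] m'z by auto
  define S' where "S' = {(poly f z, poly h z) | f h. (f, h) \<in> PS}"
  have S'I: "(poly f z, poly h z) \<in> S'" if "(f, h) \<in> PS" for f h unfolding S'_def using that by blast
  have sub: "(a, b) \<in> S'" if "(a, b) \<in> S" for a b
  proof -
    have "([:a:], [:b:]) \<in> PS" using that S0 by (auto simp: PS_iff coeff_pCons split: nat.splits)
    from S'I[OF this] show ?thesis by simp
  qed
  have "([:0, 1:], 0) \<in> PS"
    using S0 derivation_graphD(1)[OF S, of 1] by (auto simp: PS_iff coeff_pCons split: nat.splits)
  from S'I[OF this] have z0: "(z, 0) \<in> S'" by simp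
  have "derivation_graph S'"
    unfolding derivation_graph_def
  proof (intro conjI allI impI)
    show "(to_ac c, 0) \<in> S'" for c by (rule sub[OF derivation_graphD(1)[OF S]])
    show "b = 0" if b: "(0, b) \<in> S'" for b
    proof -
      obtain f h where "(f, h) \<in> PS" "poly f z = 0" "b = poly h z" using b unfolding S'_def by force
      then show ?thesis using zero by simp
    qed
    fix a b a' b' assume ab: "(a, b) \<in> S'" "(a', b') \<in> S'"
    then obtain f h f' h' where f: "(f, h) \<in> PS" "(f', h') \<in> PS" and
      eq: "a = poly f z" "b = poly h z" "a' = poly f' z" "b' = poly h' z" unfolding S'_def by blast
    have fi: "(coeff f i, coeff h i) \<in> S" "(coeff f' i, coeff h' i) \<in> S" for i using f by (auto simp: PS_iff)
    have "(f + f', h + h') \<in> PS" unfolding PS_iff using fi derivation_graphD(2)[OF S] by simp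
    from S'I[OF this] show "(a + a', b + b') \<in> S'" by (simp add: eq)
    have "(f * f', f * h' + h * f') \<in> PS"
      unfolding PS_iff coeff_add coeff_mult sum.distrib[symmetric]
      by (intro allI derivation_graph_sum[OF S] derivation_graphD(3)[OF S] fi)
    from S'I[OF this] show "(a * a', a * b' + b * a') \<in> S'" by (simp add: eq)
  qed
  then show ?thesis using sub z0 by auto
qed

text \<open>If \<open>w\<close> is inseparable, then \<open>f(w) \<mapsto> f'(w)\<close> is a nonzero derivation.\<close>

lemma inseparable_derivation_graph:
  fixes w :: "'k :: field alg_closure"
  assumes "w \<notin> sep_closure"
  shows "\<exists>S. derivation_graph S \<and> (w, 1) \<in> S"
proof -
  have insep: "aeval (pderiv f) w = 0" if "aeval f w = 0" for f
    using that assms unfolding sep_closure_iff by blast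
  define S where "S = {(aeval f w, aeval (pderiv f) w) | f. True}"
  have SI: "(aeval f w, aeval (pderiv f) w) \<in> S" for f unfolding S_def by blast
  have "derivation_graph S"
    unfolding derivation_graph_def
  proof (intro conjI allI impI)
    show "(to_ac c, 0) \<in> S" for c
      using SI[of "[:c:]"] by (simp add: to_ac_hom.map_poly_pCons_hom pderiv_pCons)
    show "b = 0" if "(0, b) \<in> S" for b using that insep unfolding S_def by force
    fix a b a' b' assume s: "(a, b) \<in> S" "(a', b') \<in> S"
    then obtain f f' where eq: "a = aeval f w" "b = aeval (pderiv f) w"
      "a' = aeval f' w" "b' = aeval (pderiv f') w" unfolding S_def by blast
    show "(a + a', b + b') \<in> S" using SI[of "f + f'"] by (simp add: to_ac_poly.hom_add pderiv_add eq)
    show "(a * a', a * b' + b * a') \<in> S" using SI[of "f * f'"]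
      by (simp add: to_ac_poly.hom_mult to_ac_poly.hom_add pderiv_mult mult.commute add.commute eq)
  qed
  moreover have "(w, 1) \<in> S"
    using SI[of "[:0, 1:]"] by (simp add: to_ac_hom.map_poly_pCons_hom pderiv_pCons)
  ultimately show ?thesis by blast
qed

text \<open>If the sum or product w were inseparable, a derivation with value 1 at w could be
  extended so that it vanishes at x and at y, and then its value at w would also be 0.\<close>

lemma sep_closure_closed:
  assumes "x \<in> sep_closure" "y \<in> sep_closure"
  shows "x + y \<in> sep_closure" "x * y \<in> sep_closure"
proof -
  have "False" if w: "w \<notin> sep_closure" "w = x + y \<or> w = x * y" for w
  proof -
    obtain S where S: "derivation_graph S" "(w, 1) \<in> S" using inseparable_derivation_graph[OF w(1)] by blast
    obtain S' where S': "derivation_graph S'" "S \<subseteq> S'" "(x, 0) \<in> S'"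
      using derivation_graph_adjoin[OF S(1) assms(1)] by blast
    obtain S'' where S'': "derivation_graph S''" "S' \<subseteq> S''" "(y, 0) \<in> S''"
      using derivation_graph_adjoin[OF S'(1) assms(2)] by blast
    have x: "(x, 0) \<in> S''" and w1: "(w, 1) \<in> S''" using S S' S'' by auto
    have "(w, 0) \<in> S''"
      using w(2) derivation_graphD(2)[OF S''(1) x S''(3)] derivation_graphD(3)[OF S''(1) x S''(3)] by auto
    from derivation_graphD(4)[OF S''(1)] derivation_graph_diff[OF S''(1) w1 this] show False by fastforce
  qed
  then show "x + y \<in> sep_closure" "x * y \<in> sep_closure" by blast+
qed

lemma one_in_sep_closure: "1 \<in> sep_closure"
  using to_ac_in_sep_closure[of 1] by simp

lemma sep_closure_power: "z \<in> sep_closure \<Longrightarrow> z ^ n \<in> sep_closure"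
  by (induction n) (simp_all add: one_in_sep_closure sep_closure_closed)

section \<open>Characteristic p: purely inseparable powers and the extension of Galois
  elements\<close>

context
  fixes p :: nat
  assumes p: "prime p" "CHAR('k :: field) = p"
begin

lemma frobenius_add: "(x + y :: 'k alg_closure) ^ (p ^ n) = x ^ (p ^ n) + y ^ (p ^ n)"
  by (rule freshmans_dream') (simp_all add: p)

lemma frobenius_inj: "(x :: 'k alg_closure) ^ (p ^ n) = y ^ (p ^ n) \<longleftrightarrow> x = y"
proof
  assume eq: "x ^ (p ^ n) = y ^ (p ^ n)"
  have "(x - y) ^ (p ^ n) + y ^ (p ^ n) = x ^ (p ^ n)"
    by (metis diff_add_cancel frobenius_add)
  then show "x = y" using eq by simp
qed simp

text \<open>If the minimal polynomial m has derivative 0, only exponents divisible by p occur in it.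
  Then m = g(X^p), and g is a polynomial of smaller degree that annihilates x^p.\<close>

lemma power_in_sep_closure:
  "f \<noteq> 0 \<Longrightarrow> aeval f (x :: 'k alg_closure) = 0 \<Longrightarrow> \<exists>n. x ^ (p ^ n) \<in> sep_closure"
proof (induction "degree f" arbitrary: f x rule: less_induct)
  case less
  obtain m where m: "m \<noteq> 0" "aeval m x = 0" "\<And>f. aeval f x = 0 \<Longrightarrow> m dvd f"
    by (rule minimal_polynomial[of x]) blast
  have dm: "degree m \<le> degree f" using m(3)[OF less.prems(2)] less.prems(1) by (rule dvd_imp_degree_le)
  show ?case
  proof (cases "pderiv m = 0")
    case False
    have d0: "degree m \<noteq> 0" using False by (metis degree_0_id pderiv_singleton)
    then have "degree (pderiv m) < degree m" using degree_pderiv_le[of m] by linarith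
    then have "\<not> m dvd pderiv m" using False by (auto dest: dvd_imp_degree_le)
    then have "aeval (pderiv m) x \<noteq> 0" using m(3) by blast
    then have "x ^ (p ^ 0) \<in> sep_closure" using m(2) sep_closure_iff[of x] by auto
    then show ?thesis by blast
  next
    case True
    have p1: "p > 1" using p(1) by (rule prime_gt_1_nat)
    have supp: "coeff m i = 0" if "\<not> p dvd i" for i
    proof (cases i)
      case (Suc j)
      have "of_nat (Suc j) * coeff m (Suc j) = 0"
        using arg_cong[OF True, of "\<lambda>q. coeff q j"] by (simp add: coeff_pderiv)
      moreover have "of_nat (Suc j) \<noteq> (0 :: 'k)" using that Suc p(2) of_nat_eq_0_iff_char_dvd by metis
      ultimately show ?thesis using Suc by simp
    qed (use that in auto)
    define N where "N = degree m"
    \<comment> \<open>The sum runs beyond degree m / p; the coefficients of m with index p i beyond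
      its degree are 0, so \<open>cg\<close> holds for every i.\<close>
    define g where "g = (\<Sum>i\<le>N. monom (coeff m (p * i)) i)"
    have cg: "coeff g i = coeff m (p * i)" for i
    proof (cases "i \<le> N")
      case False
      moreover have "i \<le> p * i" using p1 by simp
      ultimately have "degree m < p * i" unfolding N_def by linarith
      then show ?thesis using False by (simp add: g_def coeff_sum coeff_eq_0)
    qed (simp add: g_def coeff_sum)
    have "aeval g (x ^ p) = (\<Sum>i\<le>N. to_ac (coeff m (p * i)) * x ^ (p * i))"
      by (simp add: g_def to_ac_poly.hom_sum poly_sum poly_monom power_mult)
    also have "\<dots> = (\<Sum>j\<in>(\<lambda>i. p * i) ` {..N}. to_ac (coeff m j) * x ^ j)"
      using p1 by (subst sum.reindex) (auto simp: inj_on_def)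
    also have "\<dots> = (\<Sum>j\<le>N. to_ac (coeff m j) * x ^ j)"
    proof (rule sum.mono_neutral_cong)
      show "to_ac (coeff m i) * x ^ i = 0" if "i \<in> (\<lambda>i. p * i) ` {..N} - {..N}" for i
        using that by (simp add: N_def coeff_eq_0)
      show "to_ac (coeff m i) * x ^ i = 0" if i: "i \<in> {..N} - (\<lambda>i. p * i) ` {..N}" for i
      proof -
        have "\<not> p dvd i"
        proof
          assume "p dvd i"
          then obtain j where j: "i = p * j" by (elim dvdE)
          then have "j \<le> i" using p1 by simp
          then have "j \<in> {..N}" using i by auto
          then have "i \<in> (\<lambda>i. p * i) ` {..N}" using j by blast
          then show False using i by blast
        qed
        then show ?thesis by (simp add: supp)
      qed
    qed auto
    also have "\<dots> = aeval m x" by (simp add: poly_altdef N_def)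
    finally have root: "aeval g (x ^ p) = 0" using m(2) by simp
    have "p dvd N" using supp[of N] m(1) by (auto simp: N_def)
    then obtain j where j: "N = p * j" by (elim dvdE)
    have "coeff g j \<noteq> 0" using cg[of j] j m(1) leading_coeff_0_iff[of m] by (simp add: N_def del: leading_coeff_0_iff)
    then have "g \<noteq> 0" by auto
    have "degree m \<noteq> 0"
    proof
      assume "degree m = 0"
      then obtain c where "m = [:c:]" by (elim degree_eq_zeroE)
      then show False using m(1,2) by (simp add: to_ac_hom.map_poly_pCons_hom)
    qed
    have "degree g \<le> j"
    proof (rule degree_le, intro allI impI)
      fix i assume "j < i"
      then have "N < p * i" using j p1 by simp
      then show "coeff g i = 0" by (simp add: cg N_def coeff_eq_0)
    qed
    also have "j < N" using j p1 \<open>degree m \<noteq> 0\<close> by (simp add: N_def)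
    finally have "degree g < degree f" using dm by (simp add: N_def)
    then obtain n where "(x ^ p) ^ (p ^ n) \<in> sep_closure" using less.hyps[OF _ \<open>g \<noteq> 0\<close> root] by blast
    then have "x ^ (p ^ Suc n) \<in> sep_closure" by (simp add: power_mult)
    then show ?thesis by blast
  qed
qed

lemma ex_power_in_sep_closure: "\<exists>n. (x :: 'k alg_closure) ^ (p ^ n) \<in> sep_closure"
proof -
  obtain f where "f \<noteq> 0" "aeval f x = 0" by (rule alg_closure_algebraic)
  then show ?thesis by (rule power_in_sep_closure)
qed

lemma power_in_sep_closure_mono:
  assumes "(x :: 'k alg_closure) ^ (p ^ n) \<in> sep_closure" "n \<le> N"
  shows "x ^ (p ^ N) \<in> sep_closure"
proof -
  have "x ^ (p ^ N) = (x ^ (p ^ n)) ^ (p ^ (N - n))"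
    using assms(2) by (simp flip: power_mult power_add)
  then show ?thesis using sep_closure_power[OF assms(1)] by simp
qed

text \<open>Every x has a power x^(p^n) in the separable closure, and p^n-th roots are unique in
  characteristic p.\<close>

lemma ring_hom_eq_on_sep_closure:
  fixes \<tau> \<tau>' :: "'k alg_closure \<Rightarrow> 'k alg_closure"
  assumes "comm_ring_hom \<tau>" "comm_ring_hom \<tau>'" "\<And>x. x \<in> sep_closure \<Longrightarrow> \<tau> x = \<tau>' x"
  shows "\<tau> = \<tau>'"
proof
  fix x :: "'k alg_closure"
  interpret \<tau>: comm_ring_hom \<tau> by fact
  interpret \<tau>': comm_ring_hom \<tau>' by fact
  obtain n where "x ^ (p ^ n) \<in> sep_closure" using ex_power_in_sep_closure by blast
  then have "\<tau> x ^ (p ^ n) = \<tau>' x ^ (p ^ n)" using assms(3) by (metis \<tau>.hom_power \<tau>'.hom_power)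
  then show "\<tau> x = \<tau>' x" by (simp add: frobenius_inj)
qed

lemma gal_ext_eqI:
  fixes \<tau> :: "'k alg_closure \<Rightarrow> 'k alg_closure"
  assumes "closure_aut \<tau>" "\<And>x. x \<in> sep_closure \<Longrightarrow> \<tau> x = \<sigma> x"
  shows "gal_ext \<sigma> = \<tau>"
  unfolding gal_ext_def
proof (rule the_equality)
  show "bij \<tau> \<and> comm_ring_hom \<tau> \<and> (\<forall>x\<in>sep_closure. \<tau> x = \<sigma> x)"
    using assms by (simp add: closure_aut_def)
  fix \<tau>' assume "bij \<tau>' \<and> comm_ring_hom \<tau>' \<and> (\<forall>x\<in>sep_closure. \<tau>' x = \<sigma> x)"
  then show "\<tau>' = \<tau>" using assms by (intro ring_hom_eq_on_sep_closure) (auto simp: closure_aut_def)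
qed

lemma Gal_sepD:
  assumes "\<sigma> \<in> carrier (Gal_sep :: ('k alg_closure \<Rightarrow> 'k alg_closure) monoid)"
  shows "\<sigma> (to_ac c) = to_ac c" "bij_betw \<sigma> sep_closure sep_closure"
    "x \<in> sep_closure \<Longrightarrow> y \<in> sep_closure \<Longrightarrow> \<sigma> (x + y) = \<sigma> x + \<sigma> y"
    "x \<in> sep_closure \<Longrightarrow> y \<in> sep_closure \<Longrightarrow> \<sigma> (x * y) = \<sigma> x * \<sigma> y"
  using assms by (auto simp: Gal_sep_def Bij_def)

lemma Gal_sep_power:
  assumes \<sigma>: "\<sigma> \<in> carrier (Gal_sep :: ('k alg_closure \<Rightarrow> 'k alg_closure) monoid)"
    and x: "x \<in> sep_closure"
  shows "\<sigma> (x ^ n) = \<sigma> x ^ n"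
proof (induction n)
  case 0
  then show ?case using Gal_sepD(1)[OF \<sigma>, of 1] by simp
next
  case (Suc n)
  then show ?case using Gal_sepD(4)[OF \<sigma> x sep_closure_power[OF x, of n]] by simp
qed

text \<open>The extension must send x to the y with y^(p^n) = \<sigma>(x^(p^n)) as soon as x^(p^n)
  is separable. The set S of such pairs is a partial automorphism, because by \<open>lift\<close> a
  single exponent N serves for several elements; \<open>partial_aut_extends\<close> turns it into a
  map.\<close>

lemma gal_ext_closure_aut:
  assumes \<sigma>: "\<sigma> \<in> carrier (Gal_sep :: ('k alg_closure \<Rightarrow> 'k alg_closure) monoid)"
  shows "closure_aut (gal_ext \<sigma>)" "x \<in> sep_closure \<Longrightarrow> gal_ext \<sigma> x = \<sigma> x"
proof -
  define S where "S = {(x, y). \<exists>n. x ^ (p ^ n) \<in> sep_closure \<and> y ^ (p ^ n) = \<sigma> (x ^ (p ^ n))}"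
  have lift: "x ^ (p ^ N) \<in> sep_closure \<and> y ^ (p ^ N) = \<sigma> (x ^ (p ^ N))"
    if "x ^ (p ^ n) \<in> sep_closure" "y ^ (p ^ n) = \<sigma> (x ^ (p ^ n))" "n \<le> N" for x y n N
  proof -
    have "u ^ (p ^ N) = (u ^ (p ^ n)) ^ (p ^ (N - n))" for u :: "'k alg_closure"
      using that(3) by (simp flip: power_mult power_add)
    then show ?thesis using that Gal_sep_power[OF \<sigma> that(1)] sep_closure_power[OF that(1)] by metis
  qed
  have SI: "(x, \<sigma> x) \<in> S" if "x \<in> sep_closure" for x
    unfolding S_def using that by (auto intro!: exI[of _ 0])
  have "partial_aut S"
    unfolding partial_aut_def
  proof (intro conjI allI impI)
    show "(to_ac c, to_ac c) \<in> S" for c using SI[of "to_ac c"] Gal_sepD(1)[OF \<sigma>] by simp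
    show "b = 0" if "(0, b) \<in> S" for b
      using that Gal_sepD(1)[OF \<sigma>, of 0] p(1) by (auto simp: S_def power_0_left prime_gt_0_nat split: if_splits)
    fix a b c d assume ab: "(a, b) \<in> S" "(c, d) \<in> S"
    obtain i j where i: "a ^ (p ^ i) \<in> sep_closure" "b ^ (p ^ i) = \<sigma> (a ^ (p ^ i))"
      and j: "c ^ (p ^ j) \<in> sep_closure" "d ^ (p ^ j) = \<sigma> (c ^ (p ^ j))" using ab unfolding S_def by blast
    obtain k l where k: "(a + c) ^ (p ^ k) \<in> sep_closure" and l: "(a * c) ^ (p ^ l) \<in> sep_closure"
      using ex_power_in_sep_closure by meson
    define N where "N = i + j + k + l"
    have a: "a ^ (p ^ N) \<in> sep_closure" "b ^ (p ^ N) = \<sigma> (a ^ (p ^ N))"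
      using lift[OF i, of N] by (auto simp: N_def)
    have c: "c ^ (p ^ N) \<in> sep_closure" "d ^ (p ^ N) = \<sigma> (c ^ (p ^ N))"
      using lift[OF j, of N] by (auto simp: N_def)
    have "(a + c) ^ (p ^ N) \<in> sep_closure" "(a * c) ^ (p ^ N) \<in> sep_closure"
      by (rule power_in_sep_closure_mono[OF k], simp add: N_def)
         (rule power_in_sep_closure_mono[OF l], simp add: N_def)
    moreover have "(b + d) ^ (p ^ N) = \<sigma> ((a + c) ^ (p ^ N))" "(b * d) ^ (p ^ N) = \<sigma> ((a * c) ^ (p ^ N))"
      using Gal_sepD(3,4)[OF \<sigma> a(1) c(1)] a(2) c(2) by (simp_all add: frobenius_add power_mult_distrib)
    ultimately show "(a + c, b + d) \<in> S" "(a * c, b * d) \<in> S" unfolding S_def by blast+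
  qed
  then obtain \<tau> where \<tau>: "closure_aut \<tau>" "\<forall>(a, b)\<in>S. \<tau> a = b" using partial_aut_extends by blast
  have eq: "\<tau> x = \<sigma> x" if "x \<in> sep_closure" for x using \<tau>(2) SI[OF that] by fastforce
  have "gal_ext \<sigma> = \<tau>" by (rule gal_ext_eqI[OF \<tau>(1) eq])
  then show "closure_aut (gal_ext \<sigma>)" "x \<in> sep_closure \<Longrightarrow> gal_ext \<sigma> x = \<sigma> x" using \<tau>(1) eq by auto
qed

lemma closure_aut_sep_closure:
  assumes "closure_aut \<tau>" "x \<in> sep_closure"
  shows "\<tau> x \<in> sep_closure"
proof -
  interpret \<tau>: comm_ring_hom \<tau> using assms(1) by (simp add: closure_aut_def)
  have i: "inj \<tau>" using assms(1) by (simp add: closure_aut_def bij_def)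
  obtain f where f: "aeval f x = 0" "aeval (pderiv f) x \<noteq> 0" using assms(2) unfolding sep_closure_iff by blast
  have "aeval f (\<tau> x) = 0" using f(1) by (simp add: closure_aut_aeval[OF assms(1)])
  moreover have "aeval (pderiv f) (\<tau> x) \<noteq> 0"
    using f(2) i \<tau>.hom_zero unfolding closure_aut_aeval[OF assms(1)] by (metis injD)
  ultimately show ?thesis unfolding sep_closure_iff by blast
qed

text \<open>The converse passage, from automorphisms of the closure to Galois elements. That the
  restriction is onto \<open>sep_closure\<close> follows by applying
  \<open>closure_aut_sep_closure\<close> to the inverse.\<close>

lemma restrict_closure_aut:
  fixes \<tau> :: "'k alg_closure \<Rightarrow> 'k alg_closure"
  assumes \<tau>: "closure_aut \<tau>"
  shows "restrict \<tau> sep_closure \<in> carrier Gal_sep" "gal_ext (restrict \<tau> sep_closure) = \<tau>"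
proof -
  interpret \<tau>: comm_ring_hom \<tau> using \<tau> by (simp add: closure_aut_def)
  have b: "bij \<tau>" and c: "\<tau> (to_ac c) = to_ac c" for c using \<tau> by (auto simp: closure_aut_def)
  show eq: "gal_ext (restrict \<tau> sep_closure) = \<tau>" by (rule gal_ext_eqI[OF \<tau>]) simp
  have "bij_betw \<tau> sep_closure sep_closure"
    unfolding bij_betw_def
  proof
    show "inj_on \<tau> sep_closure" using b by (meson bij_def inj_on_subset subset_UNIV)
    show "\<tau> ` sep_closure = sep_closure"
    proof (intro equalityI subsetI)
      fix x :: "'k alg_closure" assume "x \<in> sep_closure"
      then have "inv_into UNIV \<tau> x \<in> sep_closure" by (rule closure_aut_sep_closure[OF closure_aut_inv[OF \<tau>]])
      moreover have "\<tau> (inv_into UNIV \<tau> x) = x" using b by (simp add: bij_def surj_f_inv_f)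
      ultimately show "x \<in> \<tau> ` sep_closure" by (metis imageI)
    qed (use closure_aut_sep_closure[OF \<tau>] in auto)
  qed
  then have "restrict \<tau> sep_closure \<in> Bij sep_closure"
    by (simp add: Bij_def bij_betw_restrict_eq)
  moreover have "restrict \<tau> sep_closure (x + y) = restrict \<tau> sep_closure x + restrict \<tau> sep_closure y \<and>
      restrict \<tau> sep_closure (x * y) = restrict \<tau> sep_closure x * restrict \<tau> sep_closure y"
    if "x \<in> sep_closure" "y \<in> sep_closure" for x y
    using that sep_closure_closed[OF that] by (simp add: \<tau>.hom_add \<tau>.hom_mult)
  ultimately show "restrict \<tau> sep_closure \<in> carrier Gal_sep" by (auto simp: Gal_sep_def c)
qed

lemma gal_ext_mult:
  assumes "\<sigma> \<in> carrier (Gal_sep :: ('k alg_closure \<Rightarrow> 'k alg_closure) monoid)" "\<sigma>' \<in> carrier Gal_sep"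
  shows "gal_ext (\<sigma> \<otimes>\<^bsub>Gal_sep\<^esub> \<sigma>') = gal_ext \<sigma> \<circ> gal_ext \<sigma>'"
proof (rule gal_ext_eqI)
  show "closure_aut (gal_ext \<sigma> \<circ> gal_ext \<sigma>')"
    by (intro closure_aut_comp gal_ext_closure_aut assms)
  fix x :: "'k alg_closure" assume x: "x \<in> sep_closure"
  have "\<sigma>' x \<in> sep_closure" using Gal_sepD(2)[OF assms(2)] x by (auto simp: bij_betw_def)
  moreover have "\<sigma> \<in> Bij sep_closure" "\<sigma>' \<in> Bij sep_closure" using assms by (auto simp: Gal_sep_def)
  ultimately show "(gal_ext \<sigma> \<circ> gal_ext \<sigma>') x = (\<sigma> \<otimes>\<^bsub>Gal_sep\<^esub> \<sigma>') x"
    using x gal_ext_closure_aut(2)[OF assms(1)] gal_ext_closure_aut(2)[OF assms(2)]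
    by (simp add: Gal_sep_def BijGroup_def compose_eq)
qed

end

section \<open>Weierstrass division\<close>

lemma fps_ex_inverse:
  fixes f :: "'a :: comm_ring_1 fps"
  assumes "f $ 0 dvd 1" shows "\<exists>v. f * v = 1"
proof -
  obtain c where "1 = f $ 0 * c" using assms by (elim dvdE)
  then show ?thesis using fps_right_inverse[of f c] by auto
qed

lemma fps_dvd_one_iff:
  fixes f :: "'a :: comm_ring_1 fps"
  shows "f dvd 1 \<longleftrightarrow> f $ 0 dvd 1"
proof
  assume "f dvd 1"
  then obtain v where "1 = f * v" by (elim dvdE)
  then have "1 = f $ 0 * v $ 0" by (metis fps_mult_nth_0 fps_one_nth)
  then show "f $ 0 dvd 1" by (rule dvdI)
next
  assume "f $ 0 dvd 1"
  then obtain v where "f * v = 1" using fps_ex_inverse by blast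
  then show "f dvd 1" by (metis dvd_triv_left)
qed

text \<open>Applied twice, to R with uniformizer \<omega> and to A with uniformizer \<pi>.\<close>

locale complete_valuation_ring =
  fixes t :: "'r :: idom"
  assumes uniformizer: "uniformizer t"
    and complete: "(\<And>n. t ^ n dvd x (Suc n) - x n) \<Longrightarrow> \<exists>y. \<forall>n. t ^ n dvd y - x n"
begin

lemma t_nonzero: "t \<noteq> 0" and t_nonunit: "\<not> t dvd 1"
  and unit_times_power: "x \<noteq> 0 \<Longrightarrow> \<exists>u n. u dvd 1 \<and> x = u * t ^ n"
  using uniformizer by (auto simp: uniformizer_def)

lemma nonunit_iff: "\<not> x dvd 1 \<longleftrightarrow> t dvd x"
proof
  assume x: "\<not> x dvd 1"
  show "t dvd x"
  proof (cases "x = 0")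
    case False
    then obtain u n where un: "u dvd 1" "x = u * t ^ n" using unit_times_power by blast
    then have "n \<noteq> 0" using x by (cases n) auto
    then show ?thesis using un by (simp add: dvd_power)
  qed simp
qed (use t_nonunit dvd_trans in blast)

lemma t_prime: "t dvd a * b \<longleftrightarrow> t dvd a \<or> t dvd b"
  by (metis dvd_mult dvd_mult2 is_unit_mult_iff nonunit_iff)

lemma t_prime_power: "t dvd a ^ n \<Longrightarrow> t dvd a"
  by (induction n) (auto simp: t_prime t_nonunit)

lemma not_dvd_unit_times: "u dvd 1 \<Longrightarrow> \<not> t ^ Suc n dvd u * t ^ n"
proof
  assume u: "u dvd 1" and "t ^ Suc n dvd u * t ^ n"
  then have "t ^ n * t dvd t ^ n * u" by (simp add: mult.commute)
  then have "t dvd u" using t_nonzero by (simp add: dvd_mult_cancel_left)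
  then show False using u t_nonunit dvd_trans by blast
qed

lemma separated: "(\<And>n. t ^ n dvd x) \<Longrightarrow> x = 0"
  using unit_times_power not_dvd_unit_times by metis

text \<open>The Weierstrass degree of P, its order modulo t.\<close>

definition unit_index :: "'r fps \<Rightarrow> nat \<Rightarrow> bool" where
  "unit_index P k \<longleftrightarrow> (\<forall>i<k. t dvd P $ i) \<and> \<not> t dvd P $ k"

text \<open>Splits P at its Weierstrass degree. Up to the multiple t A, division by P is then a
  shift followed by multiplication with V, and t A is treated as a perturbation.\<close>

lemma unit_index_decompose:
  assumes "unit_index P k"
  obtains A U V where "P = fps_const t * A + fps_X ^ k * U" "U * V = 1" "U = fps_shift k P"
proof -
  define A where "A = Abs_fps (\<lambda>i. if i < k then SOME a. P $ i = t * a else 0)"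
  have A: "P $ i = t * A $ i" if "i < k" for i
  proof -
    have "\<exists>a. P $ i = t * a" using assms that by (auto simp: unit_index_def elim: dvdE)
    from someI_ex[OF this] show ?thesis using that by (simp add: A_def)
  qed
  have "(fps_shift k P) $ 0 dvd 1" using assms nonunit_iff by (auto simp: unit_index_def)
  then obtain V where V: "fps_shift k P * V = 1" using fps_ex_inverse by blast
  have "P = fps_const t * A + fps_X ^ k * fps_shift k P"
  proof (rule fps_ext)
    fix i show "P $ i = (fps_const t * A + fps_X ^ k * fps_shift k P) $ i"
    proof (cases "i < k")
      case True
      then show ?thesis by (simp add: fps_X_power_mult_nth A[symmetric])
    next
      case False
      then have "A $ i = 0" by (simp add: A_def)
      then show ?thesis using False by (simp add: fps_X_power_mult_nth)
    qed
  qed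
  then show thesis using that V by blast
qed

lemma fps_shift_const_mult: "fps_shift k (fps_const c * f) = fps_const c * fps_shift k (f :: 'r fps)"
  by (simp add: fps_eq_iff)

lemma fps_shift_X_power_mult: "fps_shift k (fps_X ^ k * f) = (f :: 'r fps)"
  by (simp add: fps_eq_iff fps_X_power_mult_nth)

lemma fps_separated:
  assumes "\<And>n. \<exists>w. f = fps_const (t ^ n) * w" shows "f = 0"
proof (rule fps_ext)
  fix i
  have "t ^ n dvd f $ i" for n using assms[of n] by auto
  then show "f $ i = 0 $ i" using separated by simp
qed

text \<open>Shifting by k leaves U q = - t shift(A q). So q is t times an expression that is linear
  in q, and iteration makes it divisible by every power of t.\<close>

lemma weierstrass_unique:
  assumes P: "unit_index P k" and z: "\<And>i. i \<ge> k \<Longrightarrow> (P * q) $ i = 0"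
  shows "q = 0"
proof -
  obtain A U V where AU: "P = fps_const t * A + fps_X ^ k * U" "U * V = 1"
    using unit_index_decompose[OF P] by metis
  have "0 = fps_shift k (P * q)" using z by (simp add: fps_eq_iff)
  also have "P * q = fps_const t * (A * q) + fps_X ^ k * (U * q)" by (simp add: AU(1) algebra_simps)
  also have "fps_shift k \<dots> = fps_const t * fps_shift k (A * q) + U * q"
    by (simp add: fps_shift_add fps_shift_const_mult fps_shift_X_power_mult)
  finally have "U * q = - (fps_const t * fps_shift k (A * q))"
    by (simp add: eq_neg_iff_add_eq_0 add.commute)
  then have "V * (U * q) = V * - (fps_const t * fps_shift k (A * q))" by simp
  moreover have "V * (U * q) = q" using AU(2) by (simp add: mult.assoc[symmetric] mult.commute[of V])
  ultimately have q: "q = fps_const t * (- V * fps_shift k (A * q))" by (simp add: algebra_simps)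
  have "\<exists>w. q = fps_const (t ^ n) * w" for n
  proof (induction n)
    case (Suc n)
    then obtain w where "q = fps_const (t ^ n) * w" by blast
    then have "fps_shift k (A * q) = fps_const (t ^ n) * fps_shift k (A * w)"
      by (simp add: mult.left_commute[of A] fps_shift_const_mult)
    then have "q = fps_const (t ^ Suc n) * (- V * fps_shift k (A * w))"
      by (subst q) (simp add: fps_const_mult[symmetric] ac_simps del: fps_const_mult)
    then show ?case by blast
  qed simp
  then show ?thesis by (rule fps_separated)
qed

text \<open>Dividing U q = shift(f - t A q) by U shows that the quotient has to be a fixed point of
  T. The factor t makes T contracting in the t-adic sense (\<open>Tdiff\<close>), so its iterates
  converge in each coefficient by completeness.\<close>

lemma weierstrass_division:
  assumes P: "unit_index P k"
  shows "\<exists>q. \<forall>i\<ge>k. (f - P * q) $ i = 0"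
proof -
  obtain A U V where AU: "P = fps_const t * A + fps_X ^ k * U" "U * V = 1"
    using unit_index_decompose[OF P] by metis
  define T where "T = (\<lambda>q. V * fps_shift k (f - fps_const t * (A * q)))"
  define Q where "Q = rec_nat 0 (\<lambda>_. T)"
  have Q0: "Q 0 = 0" and QS: "Q (Suc n) = T (Q n)" for n by (auto simp: Q_def)
  have Tdiff: "T a - T b = fps_const (t * c) * (- V * fps_shift k (A * w))"
    if "a - b = fps_const c * w" for a b c w
  proof -
    have "fps_shift k (f - fps_const t * (A * a)) - fps_shift k (f - fps_const t * (A * b)) =
      fps_shift k (- (fps_const t * (A * (a - b))))"
      unfolding fps_shift_diff[symmetric] by (simp add: algebra_simps)
    then have "T a - T b = V * fps_shift k (- (fps_const t * (A * (a - b))))"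
      by (simp add: T_def flip: right_diff_distrib)
    also have "\<dots> = V * (- (fps_const t * fps_shift k (A * (fps_const c * w))))"
      unfolding that by (simp add: fps_shift_uminus fps_shift_const_mult)
    also have "A * (fps_const c * w) = fps_const c * (A * w)" by (simp add: mult.left_commute)
    also have "fps_shift k \<dots> = fps_const c * fps_shift k (A * w)" by (rule fps_shift_const_mult)
    also have "V * - (fps_const t * \<dots>) = fps_const (t * c) * (- V * fps_shift k (A * w))"
      by (simp add: mult.left_commute mult.assoc flip: fps_const_mult)
    finally show ?thesis .
  qed
  have step: "\<exists>w. Q (Suc n) - Q n = fps_const (t ^ n) * w" for n
  proof (induction n)
    case (Suc n)
    then obtain w where "Q (Suc n) - Q n = fps_const (t ^ n) * w" by blast
    from Tdiff[OF this] show ?case unfolding QS power_Suc by blast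
  qed simp
  have "\<exists>y. \<forall>n. t ^ n dvd y - Q n $ i" for i
  proof (rule complete)
    fix n
    obtain w where "Q (Suc n) - Q n = fps_const (t ^ n) * w" using step by blast
    then have "(Q (Suc n) - Q n) $ i = t ^ n * w $ i" by simp
    then show "t ^ n dvd Q (Suc n) $ i - Q n $ i" by simp
  qed
  then obtain y where y: "\<And>i n. t ^ n dvd y i - Q n $ i" by metis
  define q where "q = Abs_fps y"
  have lim: "\<exists>w. q - Q n = fps_const (t ^ n) * w" for n
  proof -
    have "\<forall>i. \<exists>a. y i - Q n $ i = t ^ n * a" using y by (auto simp: dvd_def)
    then obtain a where "\<And>i. y i - Q n $ i = t ^ n * a i" by metis
    then have "q - Q n = fps_const (t ^ n) * Abs_fps a" by (simp add: q_def fps_eq_iff)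
    then show ?thesis by blast
  qed
  have "\<exists>w. q - T q = fps_const (t ^ n) * w" for n
  proof -
    obtain w where w: "q - Q n = fps_const (t ^ n) * w" using lim by blast
    obtain w' where w': "q - Q (Suc n) = fps_const (t ^ Suc n) * w'" using lim by blast
    have "q - T q = (q - Q (Suc n)) - (T q - T (Q n))" by (simp add: QS)
    also have "\<dots> = fps_const (t ^ n) * (fps_const t * w' - fps_const t * (- V * fps_shift k (A * w)))"
    proof -
      have "fps_const (t ^ Suc n) * w' - fps_const (t * t ^ n) * z =
        fps_const (t ^ n) * (fps_const t * w' - fps_const t * z)" for z
        by (simp add: right_diff_distrib mult.assoc[symmetric] mult.commute[of "t ^ n" t])
      then show ?thesis unfolding w' Tdiff[OF w] .
    qed
    finally show ?thesis by blast
  qed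
  then have "q - T q = 0" by (rule fps_separated)
  then have "U * q = U * T q" by simp
  also have "\<dots> = fps_shift k (f - fps_const t * (A * q))"
    unfolding T_def using AU(2) by (simp add: mult.assoc[symmetric])
  finally have Uq: "U * q = fps_shift k (f - fps_const t * (A * q))" .
  have "f - P * q = (f - fps_const t * (A * q)) - fps_X ^ k * (U * q)" by (simp add: AU(1) algebra_simps)
  then have "fps_shift k (f - P * q) =
    fps_shift k (f - fps_const t * (A * q)) - fps_shift k (fps_X ^ k * (U * q))" by (simp only: fps_shift_diff)
  then have "fps_shift k (f - P * q) = 0" by (simp only: fps_shift_X_power_mult Uq) simp
  then have "(f - P * q) $ (i + k) = 0" for i by (metis fps_shift_nth fps_zero_nth)
  then show ?thesis by (metis le_add_diff_inverse2)
qed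

definition distinguished :: "'r poly \<Rightarrow> bool" where
  "distinguished W \<longleftrightarrow> lead_coeff W = 1 \<and> (\<forall>i<degree W. t dvd coeff W i)"

lemma distinguished_unit_index: "distinguished W \<Longrightarrow> unit_index (fps_of_poly W) (degree W)"
  by (auto simp: distinguished_def unit_index_def t_nonunit)

text \<open>X^k is divided by P. The product P q is then X^k plus lower terms, which are divisible
  by t since those of P are; and q is a unit, because otherwise t would also divide the coefficient
  1 of X^k.\<close>

lemma weierstrass_preparation:
  assumes P: "unit_index P k"
  shows "\<exists>W u v. distinguished W \<and> degree W = k \<and> fps_of_poly W = P * u \<and> u * v = 1"
proof -
  obtain q where q: "\<And>i. i \<ge> k \<Longrightarrow> (fps_X ^ k - P * q) $ i = 0"
    using weierstrass_division[OF P, of "fps_X ^ k"] by blast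
  define W where "W = monom 1 k - truncate_fps k (fps_X ^ k - P * q)"
  have W: "fps_of_poly W = P * q"
  proof (rule fps_ext)
    fix i show "fps_of_poly W $ i = (P * q) $ i"
    proof (cases "i < k")
      case False
      then show ?thesis using q[of i] by (auto simp: W_def coeff_truncate_fps)
    qed (simp add: W_def coeff_truncate_fps)
  qed
  have ck: "coeff W k = 1" by (simp add: W_def coeff_truncate_fps)
  have "degree W = k"
  proof (rule antisym)
    show "degree W \<le> k" by (rule degree_le) (auto simp: W_def coeff_truncate_fps)
    show "k \<le> degree W" using ck by (intro le_degree) simp
  qed
  moreover have low: "t dvd (P * q) $ i" if "i < k" for i
    unfolding fps_mult_nth using P that by (intro dvd_sum) (auto simp: unit_index_def intro!: dvd_mult2)
  then have "t dvd coeff W i" if "i < k" for i using that W by (metis fps_of_poly_nth)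
  ultimately have "distinguished W" using ck by (simp add: distinguished_def)
  have "q $ 0 dvd 1"
  proof (rule ccontr)
    assume "\<not> q $ 0 dvd 1"
    then have tq: "t dvd q $ 0" using nonunit_iff by blast
    have "t dvd (P * q) $ k" unfolding fps_mult_nth
    proof (rule dvd_sum)
      fix i assume i: "i \<in> {0..k}"
      show "t dvd P $ i * q $ (k - i)"
        using P i tq by (cases "i = k") (auto simp: unit_index_def)
    qed
    then show False using ck W t_nonunit by (metis fps_of_poly_nth)
  qed
  then obtain v where "q * v = 1" using fps_ex_inverse by blast
  then show ?thesis using \<open>distinguished W\<close> \<open>degree W = k\<close> W by blast
qed

lemma monic_division:
  fixes W f :: "'r poly"
  assumes "lead_coeff W = 1"
  shows "\<exists>q r. f = W * q + r \<and> (\<forall>i\<ge>degree W. coeff r i = 0)"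
proof -
  obtain q r where qr: "pseudo_divmod f W = (q, r)" by (cases "pseudo_divmod f W")
  have W0: "W \<noteq> 0" using assms by auto
  from pseudo_divmod[OF W0 qr] have "f = W * q + r" "r = 0 \<or> degree r < degree W"
    using assms by auto
  then show ?thesis by (metis coeff_0 coeff_eq_0 order_less_le_trans)
qed

text \<open>Polynomial division by the monic W leaves a remainder r. Among power series r is W times
  the difference of the two quotients, and the uniqueness in Weierstrass division makes this
  difference 0.\<close>

lemma distinguished_dvd_cofactor:
  assumes W: "distinguished W" and f: "fps_of_poly f = fps_of_poly W * v"
  shows "\<exists>q. f = W * q"
proof -
  have lW: "lead_coeff W = 1" using W by (simp add: distinguished_def)
  obtain q r where qr: "f = W * q + r" "\<forall>i\<ge>degree W. coeff r i = 0" using monic_division[OF lW] by blast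
  have "fps_of_poly W * (v - fps_of_poly q) = fps_of_poly r"
    using f qr(1) by (simp add: fps_of_poly_add fps_of_poly_mult algebra_simps)
  then have "v - fps_of_poly q = 0"
    using qr(2) by (intro weierstrass_unique[OF distinguished_unit_index[OF W]]) simp
  then have "fps_of_poly f = fps_of_poly (W * q)" using f by (simp add: fps_of_poly_mult)
  then show ?thesis by (auto simp: fps_of_poly_eq_iff)
qed

lemma poly_content:
  assumes "f \<noteq> (0 :: 'r poly)"
  shows "\<exists>j f'. f = smult (t ^ j) f' \<and> (\<exists>i. \<not> t dvd coeff f' i)"
proof -
  let ?J = "\<lambda>j. \<forall>i. t ^ j dvd coeff f i"
  obtain u n where u: "u dvd 1" "lead_coeff f = u * t ^ n" using unit_times_power assms by (metis leading_coeff_0_iff)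
  have bound: "j \<le> n" if "?J j" for j
  proof (rule ccontr)
    assume "\<not> j \<le> n"
    then have "t ^ Suc n dvd t ^ j" by (intro le_imp_power_dvd) simp
    then have "t ^ Suc n dvd u * t ^ n" using that u(2) by (metis dvd_trans)
    then show False using not_dvd_unit_times[OF u(1)] by blast
  qed
  \<comment> \<open>The valuation n of the leading coefficient bounds the exponents in
    \<open>?J\<close>, so that a greatest one exists.\<close>
  define j where "j = (GREATEST j. ?J j)"
  have j: "?J j" unfolding j_def by (rule GreatestI_nat[of ?J 0 n]) (use bound in auto)
  then have "[:t ^ j:] dvd f" by (simp add: const_poly_dvd_iff)
  then obtain f' where f': "f = [:t ^ j:] * f'" by (elim dvdE)
  have "\<exists>i. \<not> t dvd coeff f' i"
  proof (rule ccontr)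
    assume "\<nexists>i. \<not> t dvd coeff f' i"
    then have "?J (Suc j)" using f' by (auto simp: mult.commute intro: mult_dvd_mono)
    then have "Suc j \<le> j" unfolding j_def using bound by (intro Greatest_le_nat[of ?J _ n]) auto
    then show False by simp
  qed
  then show ?thesis using f' by auto
qed

end

section \<open>The integral closure of a complete discrete valuation ring\<close>

locale complete_dvr_closure = complete_valuation_ring t + e: inj_idom_hom e
  for t :: "'r :: idom" and e :: "'r \<Rightarrow> 'e :: alg_closed_field" +
  assumes algebraic: "\<exists>f :: 'r poly. f \<noteq> 0 \<and> poly (map_poly e f) x = 0"
begin

sublocale ep: map_poly_inj_idom_hom e ..

abbreviation ev :: "'r poly \<Rightarrow> 'e \<Rightarrow> 'e" where "ev f x \<equiv> poly (map_poly e f) x"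

text \<open>Positive valuation, expressed without a valuation on \<open>'e\<close>. The
  distinguished polynomial of degree 0 is 1, which has no root.\<close>

definition small :: "'e \<Rightarrow> bool" where
  "small x \<longleftrightarrow> (\<exists>W. distinguished W \<and> ev W x = 0)"

text \<open>Rests on the completeness of R; the second case stands for valuation at most 0. An
  annihilating polynomial of least degree, freed of its content, factors as W q with W distinguished
  of degree k. If k > 0, then q has smaller degree and cannot vanish at x, so W does; if k = 0, the
  constant coefficient is a unit.\<close>

lemma small_or_const_one: "small x \<or> (\<exists>f. coeff f 0 = 1 \<and> ev f x = 0)"
proof -
  let ?Q = "\<lambda>f :: 'r poly. f \<noteq> 0 \<and> ev f x = 0"
  obtain f where f: "?Q f" "\<And>h. ?Q h \<Longrightarrow> degree f \<le> degree h"
    using algebraic[of x] ex_has_least_nat[of ?Q _ degree] by blast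
  obtain j f' where f': "f = smult (t ^ j) f'" "\<exists>i. \<not> t dvd coeff f' i" 
    using poly_content[of f] f(1) by auto
  have f'0: "f' \<noteq> 0" "degree f' = degree f" using f(1) f'(1) by auto
  have f'x: "ev f' x = 0" using f(1) f'(1) t_nonzero by (simp add: e.map_poly_hom_smult)
  define k where "k = (LEAST i. \<not> t dvd coeff f' i)"
  have k1: "\<not> t dvd coeff f' k" unfolding k_def by (rule LeastI_ex[OF f'(2)])
  have "t dvd coeff f' i" if "i < k" for i
    using not_less_Least[of i "\<lambda>i. \<not> t dvd coeff f' i"] that unfolding k_def by blast
  then have "unit_index (fps_of_poly f') k" using k1 by (simp add: unit_index_def)
  from weierstrass_preparation[OF this] obtain W u v where W: "distinguished W" "degree W = k"
    "fps_of_poly W = fps_of_poly f' * u" "u * v = 1" by blast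
  have "fps_of_poly f' = fps_of_poly W * v" using W(3,4) by (simp add: mult.assoc)
  then obtain q where q: "f' = W * q" using distinguished_dvd_cofactor[OF W(1)] by blast
  show ?thesis
  proof (cases "k = 0")
    case True
    then have "coeff f' 0 dvd 1" using k1 nonunit_iff by blast
    then obtain c where "1 = coeff f' 0 * c" by (elim dvdE)
    then have "coeff (smult c f') 0 = 1 \<and> ev (smult c f') x = 0"
      using f'x by (simp add: mult.commute e.map_poly_hom_smult)
    then show ?thesis by blast
  next
    case False
    have "W \<noteq> 0" "q \<noteq> 0" using f'0 q by auto
    then have "degree f = k + degree q" using f'0(2) q W(2) by (simp add: degree_mult_eq)
    then have "ev q x \<noteq> 0" using f(2)[of q] \<open>q \<noteq> 0\<close> False by auto
    then have "ev W x = 0" using f'x q by (simp add: ep.hom_mult)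
    then show ?thesis using W(1) by (auto simp: small_def)
  qed
qed

sublocale M: Modules.module "\<lambda>r z. e r * z"
  by unfold_locales (simp_all add: algebra_simps e.hom_add e.hom_mult)

declare M.scale_scale [simp del]

text \<open>Integrality through a finitely generated module that contains 1 and is stable under z.
  For sums and products the products of two generating sets serve as generators, so no monic
  equation has to be found.\<close>

definition int_closure :: "'e set" where
  "int_closure = {z. \<exists>B. finite B \<and> 1 \<in> B \<and> (\<forall>b\<in>B. z * b \<in> M.span B)}"

lemma span_mult:
  assumes "\<And>b. b \<in> B \<Longrightarrow> z * b \<in> M.span C" "v \<in> M.span B" shows "z * v \<in> M.span C"
  using assms(2)
proof (induction rule: M.span_induct_alt)
  case base
  then show ?case by (simp add: M.span_zero)
next
  case (step c x y)
  have "z * (e c * x + y) = e c * (z * x) + z * y" by (simp add: algebra_simps)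
  then show ?case using step assms(1) by (simp add: M.span_add M.span_scale)
qed

lemma int_closure_closed:
  assumes "z \<in> int_closure" "w \<in> int_closure"
  shows "z + w \<in> int_closure" "z * w \<in> int_closure"
proof -
  obtain B where B: "finite B" "1 \<in> B" "\<And>b. b \<in> B \<Longrightarrow> z * b \<in> M.span B"
    using assms(1) by (auto simp: int_closure_def)
  obtain C where C: "finite C" "1 \<in> C" "\<And>b. b \<in> C \<Longrightarrow> w * b \<in> M.span C"
    using assms(2) by (auto simp: int_closure_def)
  define D where "D = (\<lambda>(b, c). b * c) ` (B \<times> C)"
  have D: "finite D" "1 \<in> D" using B C by (auto simp: D_def intro!: image_eqI[of _ _ "(1, 1)"])
  have DI: "b * c \<in> D" if "b \<in> B" "c \<in> C" for b c using that by (auto simp: D_def)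
  have zD: "z * d \<in> M.span D" if d: "d \<in> D" for d
  proof -
    obtain b c where bc: "b \<in> B" "c \<in> C" "d = b * c" using d by (auto simp: D_def)
    have "c * b' \<in> M.span D" if "b' \<in> B" for b'
      using M.span_base[OF DI[OF that bc(2)]] by (simp add: mult.commute)
    then have "c * (z * b) \<in> M.span D" by (rule span_mult[OF _ B(3)[OF bc(1)]])
    then show ?thesis by (simp add: bc mult_ac)
  qed
  have wD: "w * d \<in> M.span D" if d: "d \<in> D" for d
  proof -
    obtain b c where bc: "b \<in> B" "c \<in> C" "d = b * c" using d by (auto simp: D_def)
    have "b * c' \<in> M.span D" if "c' \<in> C" for c' by (rule M.span_base[OF DI[OF bc(1) that]])
    then have "b * (w * c) \<in> M.span D" by (rule span_mult[OF _ C(3)[OF bc(2)]])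
    then show ?thesis by (simp add: bc mult_ac)
  qed
  have "(z + w) * d \<in> M.span D" if "d \<in> D" for d
    using zD[OF that] wD[OF that] by (simp add: distrib_right M.span_add)
  then show "z + w \<in> int_closure" using D by (auto simp: int_closure_def)
  have "(z * w) * d \<in> M.span D" if "d \<in> D" for d
    using span_mult[OF zD wD[OF that]] by (simp add: mult.assoc)
  then show "z * w \<in> int_closure" using D by (auto simp: int_closure_def)
qed

lemma int_closure_base [simp]: "e r \<in> int_closure"
  unfolding int_closure_def by (intro CollectI exI[of _ "{1}"]) (simp add: M.span_singleton)

lemma int_closure_01 [simp]: "0 \<in> int_closure" "1 \<in> int_closure"
  using int_closure_base[of 0] int_closure_base[of 1] by simp_all

lemma int_closure_uminus: "z \<in> int_closure \<Longrightarrow> - z \<in> int_closure"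
  using int_closure_closed(2)[OF int_closure_base[of "-1"], of z] by (simp add: e.hom_uminus)

lemma int_closure_diff: "z \<in> int_closure \<Longrightarrow> w \<in> int_closure \<Longrightarrow> z - w \<in> int_closure"
  using int_closure_closed(1)[OF _ int_closure_uminus] by fastforce

lemma int_closure_power: "z \<in> int_closure \<Longrightarrow> z ^ n \<in> int_closure"
  by (induction n) (simp_all add: int_closure_closed)

lemma int_closure_sum: "(\<And>i. i \<in> I \<Longrightarrow> f i \<in> int_closure) \<Longrightarrow> sum f I \<in> int_closure"
  by (induction I rule: infinite_finite_induct) (simp_all add: int_closure_closed)

lemma int_closure_ev: "x \<in> int_closure \<Longrightarrow> ev f x \<in> int_closure"
  by (induction f) (simp_all add: e.map_poly_pCons_hom int_closure_closed)

lemma span_nakayama: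
  assumes "finite B" "\<And>b. b \<in> B \<Longrightarrow> \<exists>v\<in>M.span B. b = e t * v"
  shows "M.span B = {0}"
  using assms
proof (induction B rule: finite_induct)
  case (insert b B)
  obtain v where v: "v \<in> M.span (insert b B)" "b = e t * v" using insert.prems by blast
  then obtain r where r: "v - e r * b \<in> M.span B" by (auto simp: M.span_insert)
  have "\<not> t dvd 1 - t * r"
    using t_nonunit by (metis diff_add_cancel dvd_add dvd_triv_left)
  then obtain c where c: "1 = (1 - t * r) * c" using nonunit_iff by (metis dvdE)
  have "e (1 - t * r) * b = e t * (v - e r * b)"
  proof -
    have "e (1 - t * r) * b = b - e t * (e r * b)"
      by (simp add: e.hom_minus e.hom_mult left_diff_distrib mult.assoc)
    also have "\<dots> = e t * v - e t * (e r * b)" using v(2) by simp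
    finally show ?thesis by (simp add: right_diff_distrib)
  qed
  then have "e c * (e (1 - t * r) * b) = e c * (e t * (v - e r * b))" by simp
  moreover have "e c * (e (1 - t * r) * b) = b"
    using arg_cong[OF c, of e] by (simp add: e.hom_mult mult_ac)
  ultimately have b: "b \<in> M.span B" using r by (metis M.span_scale)
  have eq: "M.span (insert b B) = M.span B"
  proof
    show "M.span (insert b B) \<subseteq> M.span B"
      using b M.span_superset[of B] by (intro M.span_minimal M.subspace_span) auto
  qed (rule M.span_mono, blast)
  then show ?case using insert.IH insert.prems by auto
qed simp

text \<open>Otherwise the module M from \<open>int_closure\<close> would satisfy M = t M and vanish,
  although it contains 1.\<close>

lemma inverse_t_notin: "inverse (e t) \<notin> int_closure"
proof
  assume "inverse (e t) \<in> int_closure"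
  then obtain B where B: "finite B" "1 \<in> B" "\<And>b. b \<in> B \<Longrightarrow> inverse (e t) * b \<in> M.span B"
    by (auto simp: int_closure_def)
  have "b = e t * (inverse (e t) * b)" for b using t_nonzero by simp
  then have "M.span B = {0}" using B by (intro span_nakayama) blast+
  then show False using M.span_base[OF B(2)] by simp
qed

lemma monic_root_in_int_closure:
  assumes f: "lead_coeff f = 1" "ev f x = 0"
  shows "x \<in> int_closure"
proof -
  define n where "n = degree f"
  define B where "B = insert 1 ((\<lambda>i. x ^ i) ` {..<n})"
  have xB: "x ^ i \<in> M.span B" if "i < n" for i using that by (auto simp: B_def intro: M.span_base)
  have "ev f x = (\<Sum>i<n. e (coeff f i) * x ^ i) + x ^ n"
    using f(1) by (simp add: poly_altdef n_def lessThan_Suc_atMost[symmetric])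
  then have xn: "x ^ n = - (\<Sum>i<n. e (coeff f i) * x ^ i)" using f(2) by (simp add: eq_neg_iff_add_eq_0 add.commute)
  have xn': "x ^ n \<in> M.span B" unfolding xn by (intro M.span_neg M.span_sum M.span_scale xB) simp
  have n0: "n \<noteq> 0" using xn by (cases n) auto
  have "x * b \<in> M.span B" if b: "b \<in> B" for b
  proof -
    obtain i where i: "i < n" "b = x ^ i" using b n0 by (auto simp: B_def intro: that[of 0])
    then have "x * b = x ^ Suc i" by simp
    then show ?thesis using i xB[of "Suc i"] xn' by (cases "Suc i = n") auto
  qed
  then show ?thesis unfolding int_closure_def by (intro CollectI exI[of _ B]) (simp add: B_def)
qed

lemma small_in_int_closure: "small x \<Longrightarrow> x \<in> int_closure"
  unfolding small_def distinguished_def using monic_root_in_int_closure by blast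

text \<open>The reversed polynomial is monic and has the root \<open>inverse x\<close>.\<close>

lemma const_one_root_inverse:
  assumes f: "coeff f 0 = 1" "ev f x = 0"
  shows "x \<noteq> 0" "inverse x \<in> int_closure"
proof -
  show x: "x \<noteq> 0" using f by (auto simp: poly_0_coeff_0)
  have m: "map_poly e (reflect_poly f) = reflect_poly (map_poly e f)"
    by (rule poly_eqI) (simp add: coeff_reflect_poly)
  have "ev (reflect_poly f) (inverse x) = 0" unfolding m
    using x f(2) by (simp add: poly_reflect_poly_nz)
  moreover have "lead_coeff (reflect_poly f) = 1"
    using f(1) by (simp add: coeff_reflect_poly)
  ultimately show "inverse x \<in> int_closure" using monic_root_in_int_closure by blast
qed

lemma small_power_divisible:
  assumes "small x" shows "\<exists>n>0. x ^ n / e t \<in> int_closure"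
proof -
  obtain W where W: "lead_coeff W = 1" "\<And>i. i < degree W \<Longrightarrow> t dvd coeff W i" "ev W x = 0"
    using assms by (auto simp: small_def distinguished_def)
  define n where "n = degree W"
  have "\<forall>i\<in>{..<n}. \<exists>a. coeff W i = t * a" using W(2) by (auto simp: n_def elim!: dvdE)
  then obtain a where a: "\<And>i. i < n \<Longrightarrow> coeff W i = t * a i" by (metis lessThan_iff)
  have "ev W x = (\<Sum>i<n. e (coeff W i) * x ^ i) + x ^ n"
    using W(1) by (simp add: poly_altdef n_def lessThan_Suc_atMost[symmetric])
  then have xn: "x ^ n = - (\<Sum>i<n. e (coeff W i) * x ^ i)" using W(3) by (simp add: eq_neg_iff_add_eq_0 add.commute)
  also have "\<dots> = e t * - (\<Sum>i<n. e (a i) * x ^ i)"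
  proof -
    have "(\<Sum>i<n. e (coeff W i) * x ^ i) = (\<Sum>i<n. e t * (e (a i) * x ^ i))"
      by (rule sum.cong) (simp_all add: a e.hom_mult mult.assoc)
    then show ?thesis by (simp add: sum_distrib_left)
  qed
  finally have "x ^ n / e t = - (\<Sum>i<n. e (a i) * x ^ i)" using t_nonzero by simp
  also have "\<dots> \<in> int_closure"
    by (intro int_closure_uminus int_closure_sum int_closure_closed int_closure_base int_closure_power
        small_in_int_closure assms)
  finally have "x ^ n / e t \<in> int_closure" .
  moreover have "n \<noteq> 0" using xn by (cases n) auto
  ultimately show ?thesis by blast
qed

text \<open>If x is small, some x^n is divisible by t, so an integral inverse of x would make 1 / t
  integral. Conversely a root of a polynomial with constant term 1 has an integral inverse. Together
  with \<open>int_closure_valuation\<close> this makes \<open>int_closure\<close> a valuation ring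
  with maximal ideal \<open>small\<close>.\<close>

lemma small_iff: "small x \<longleftrightarrow> x = 0 \<or> inverse x \<notin> int_closure"
proof
  assume s: "small x"
  obtain n where n: "x ^ n / e t \<in> int_closure" using small_power_divisible[OF s] by blast
  show "x = 0 \<or> inverse x \<notin> int_closure"
  proof (rule ccontr)
    assume "\<not> ?thesis"
    then have x: "x \<noteq> 0" "inverse x \<in> int_closure" by auto
    have "inverse x ^ n * (x ^ n / e t) \<in> int_closure" by (intro int_closure_closed int_closure_power x n)
    moreover have "inverse x ^ n * (x ^ n / e t) = inverse (e t)" using x(1) by (simp add: field_simps)
    ultimately show False using inverse_t_notin by metis
  qed
next
  assume "x = 0 \<or> inverse x \<notin> int_closure"
  then show "small x"
    using small_or_const_one[of x] const_one_root_inverse(1)[of _ x] const_one_root_inverse(2)[of _ x] by blast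
qed

lemma int_closure_valuation: "z \<in> int_closure \<or> inverse z \<in> int_closure"
  using small_iff small_in_int_closure by blast

lemma small_mult: "small x \<Longrightarrow> y \<in> int_closure \<Longrightarrow> small (x * y)"
proof -
  assume x: "small x" and y: "y \<in> int_closure"
  show "small (x * y)"
  proof (rule ccontr)
    assume "\<not> small (x * y)"
    then have *: "x * y \<noteq> 0" "inverse (x * y) \<in> int_closure" by (auto simp: small_iff)
    then have "y * inverse (x * y) \<in> int_closure" using y by (intro int_closure_closed)
    moreover have "y * inverse (x * y) = inverse x" using *(1) by simp
    ultimately have "inverse x \<in> int_closure" by metis
    then show False using x *(1) by (auto simp: small_iff)
  qed
qed

lemma small_add: "small x \<Longrightarrow> small y \<Longrightarrow> small (x + y)"
proof -
  \<comment> \<open>Of the two quotients x / y and y / x one is integral. By symmetry it is x / y,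
    and then y can be factored out of the sum.\<close>
  have aux: "small (x + y)" if xy: "small x" "small y" "y \<noteq> 0" "x / y \<in> int_closure" for x y
  proof -
    have "x + y = y * (x / y + 1)" using xy(3) by (simp add: distrib_left)
    then show ?thesis using small_mult[OF xy(2), of "x / y + 1"] xy by (simp add: int_closure_closed)
  qed
  assume xy: "small x" "small y"
  show "small (x + y)"
  proof (cases "x = 0 \<or> y = 0")
    case False
    then show ?thesis using aux[OF xy] aux[OF xy(2,1)] int_closure_valuation[of "x / y"]
      by (auto simp: add.commute)
  qed (use xy in auto)
qed

lemma small_0 [simp]: "small 0" by (simp add: small_iff)

lemma small_uminus: "small x \<Longrightarrow> small (- x)"
  using small_mult[of x "-1"] int_closure_uminus[of 1] by simp

lemma small_diff: "small x \<Longrightarrow> small y \<Longrightarrow> small (x - y)"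
  using small_add[OF _ small_uminus] by fastforce

lemma small_power: "small x \<Longrightarrow> n > 0 \<Longrightarrow> small (x ^ n)"
  using small_mult[of x "x ^ (n - 1)"] small_in_int_closure int_closure_power
  by (cases n) auto

lemma not_small_1 [simp]: "\<not> small 1" by (simp add: small_iff)

lemma one_plus_small: "small x \<Longrightarrow> 1 + x \<noteq> 0"
  using small_uminus[of x] not_small_1 by (metis add.commute add_eq_0_iff)

text \<open>The valuation has rank one: the nonzero constant coefficient of a suitable annihilating
  polynomial is a multiple of x, so x divides some t^n. If t^(n + 1) also divided x, then 1 / t
  would be integral.\<close>

lemma int_closure_separated:
  assumes "\<And>k. x / e t ^ k \<in> int_closure" shows "x = 0"
proof (rule ccontr)
  assume x0: "x \<noteq> 0"
  have xO: "x \<in> int_closure" using assms[of 0] by simp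
  obtain f where f: "f \<noteq> 0" "ev f x = 0" using algebraic[of x] by auto
  then have "\<exists>f. coeff f 0 \<noteq> 0 \<and> ev f x = 0"
  proof (induction f)
    case (pCons c f)
    show ?case
    proof (cases "c = 0")
      case True
      then show ?thesis using pCons x0 by (simp add: e.map_poly_pCons_hom)
    next
      case False
      then show ?thesis using pCons.prems by (intro exI[of _ "pCons c f"]) simp
    qed
  qed simp
  then obtain f where f: "coeff f 0 \<noteq> 0" "ev f x = 0" by blast
  obtain c h where ch: "f = pCons c h" by (cases f)
  then have c: "c \<noteq> 0" "e c = - (x * ev h x)" using f
    by (auto simp: e.map_poly_pCons_hom eq_neg_iff_add_eq_0)
  obtain u n where un: "u dvd 1" "c = u * t ^ n" using unit_times_power[OF c(1)] by blast
  obtain u' where u': "1 = u * u'" using un(1) by (elim dvdE)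
  have "e (t ^ n) = e (u' * c)" using un(2) u' by (simp add: mult.assoc[symmetric] mult.commute[of u'])
  also have "\<dots> = x * (- (e u' * ev h x))" using c(2) by (simp add: e.hom_mult algebra_simps)
  finally have tn: "e t ^ n / x = - (e u' * ev h x)" using x0 by (simp add: e.hom_power field_simps)
  have "e t ^ n / x \<in> int_closure" unfolding tn
    by (intro int_closure_uminus int_closure_closed int_closure_base int_closure_ev xO)
  from int_closure_closed(2)[OF this assms[of "Suc n"]] show False
    using x0 t_nonzero inverse_t_notin by (simp add: field_simps)
qed

lemma t_power_unit_imp_eq:
  assumes "e t ^ a / e t ^ b \<in> int_closure" shows "b \<le> a"
proof (rule ccontr)
  assume "\<not> b \<le> a"
  then obtain k where k: "b = a + Suc k" by (metis less_imp_Suc_add add_Suc_right not_le)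
  have "e t ^ k * (e t ^ a / e t ^ b) \<in> int_closure"
    by (intro int_closure_closed int_closure_power int_closure_base assms)
  then show False using inverse_t_notin t_nonzero by (simp add: k power_add field_simps)
qed

lemma small_image:
  assumes "comm_ring_hom \<tau>" "\<And>r. \<tau> (e r) = e r" "small z"
  shows "small (\<tau> z)"
proof -
  interpret \<tau>: comm_ring_hom \<tau> by fact
  have "ev f (\<tau> z) = \<tau> (ev f z)" for f
    by (induction f) (simp_all add: e.map_poly_pCons_hom \<tau>.hom_add \<tau>.hom_mult assms(2))
  then show ?thesis using assms(3) unfolding small_def by (metis \<tau>.hom_zero)
qed

end

section \<open>Evaluation of power series\<close>

context complete_dvr_closure
begin

text \<open>No continuity is demanded of \<phi>. It follows from \<open>eval1_hom_small\<close>, and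
  by \<open>eval1_hom_eq\<close> every such \<phi> is the evaluation at its value on X.\<close>

definition eval1_hom :: "('r fps \<Rightarrow> 'e) \<Rightarrow> bool" where
  "eval1_hom \<phi> \<longleftrightarrow> comm_ring_hom \<phi> \<and> (\<forall>r. \<phi> (fps_const r) = e r)"

definition eval2_hom :: "('r fps fps \<Rightarrow> 'e) \<Rightarrow> bool" where
  "eval2_hom \<psi> \<longleftrightarrow> comm_ring_hom \<psi> \<and> (\<forall>r. \<psi> (fps_const (fps_const r)) = e r)"

text \<open>Were \<phi>(a) not small, it would be a root of some f with constant term 1. But f(a) is
  a unit already in the source ring, so its image is not 0. The source ring is general in order to
  cover series in one and in two variables.\<close>

lemma small_of_no_unit_root:
  fixes \<phi> :: "'s :: comm_ring_1 \<Rightarrow> 'e"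
  assumes "comm_ring_hom \<phi>" "\<And>r. \<phi> (c r) = e r" "c 0 = 0"
    and "\<And>f. coeff f 0 = 1 \<Longrightarrow> poly (map_poly c f) a dvd 1"
  shows "small (\<phi> a)"
proof (rule ccontr)
  interpret \<phi>: comm_ring_hom \<phi> by fact
  assume "\<not> small (\<phi> a)"
  then obtain f where f: "coeff f 0 = 1" "ev f (\<phi> a) = 0" using small_or_const_one by blast
  have "\<phi> (poly (map_poly c h) a) = ev h (\<phi> a)" for h
    by (induction h) (simp_all add: map_poly_pCons assms(2,3) e.map_poly_pCons_hom \<phi>.hom_add \<phi>.hom_mult)
  then have "\<phi> (poly (map_poly c f) a) = 0" using f(2) by simp
  moreover obtain b where "1 = poly (map_poly c f) a * b" using assms(4)[OF f(1)] by (elim dvdE)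
  then have "\<phi> 1 = \<phi> (poly (map_poly c f) a) * \<phi> b" by (metis \<phi>.hom_mult)
  ultimately show False by simp
qed

lemma eval1_hom_small:
  assumes "eval1_hom \<phi>" "f $ 0 = 0" shows "small (\<phi> f)"
proof (rule small_of_no_unit_root[of _ fps_const])
  fix h :: "'r poly" assume h: "coeff h 0 = 1"
  obtain a h' where "h = pCons a h'" by (cases h)
  then have "poly (map_poly fps_const h) f $ 0 = 1"
    using h assms(2) by (simp add: map_poly_pCons fps_mult_nth_0)
  then show "poly (map_poly fps_const h) f dvd 1" by (simp add: fps_dvd_one_iff)
qed (use assms in \<open>auto simp: eval1_hom_def\<close>)

lemma eval2_hom_small:
  assumes "eval2_hom \<psi>" "f $ 0 $ 0 = 0" shows "small (\<psi> f)"
proof (rule small_of_no_unit_root[of _ "\<lambda>r. fps_const (fps_const r)"])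
  fix h :: "'r poly" assume h: "coeff h 0 = 1"
  obtain a h' where "h = pCons a h'" by (cases h)
  then have "poly (map_poly (\<lambda>r. fps_const (fps_const r)) h) f $ 0 $ 0 = 1"
    using h assms(2) by (simp add: map_poly_pCons fps_mult_nth_0)
  then show "poly (map_poly (\<lambda>r. fps_const (fps_const r)) h) f dvd 1" by (simp add: fps_dvd_one_iff)
qed (use assms in \<open>auto simp: eval2_hom_def\<close>)

lemma eval1_hom_int: assumes "eval1_hom \<phi>" shows "\<phi> f \<in> int_closure"
proof -
  interpret \<phi>: comm_ring_hom \<phi> using assms by (simp add: eval1_hom_def)
  have "small (\<phi> (f - fps_const (f $ 0)))" by (rule eval1_hom_small[OF assms]) simp
  moreover have "\<phi> f = \<phi> (f - fps_const (f $ 0)) + e (f $ 0)"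
    using assms by (simp add: \<phi>.hom_minus eval1_hom_def)
  ultimately show ?thesis by (metis int_closure_closed(1) int_closure_base small_in_int_closure)
qed

lemma eval2_hom_int: assumes "eval2_hom \<psi>" shows "\<psi> f \<in> int_closure"
proof -
  interpret \<psi>: comm_ring_hom \<psi> using assms by (simp add: eval2_hom_def)
  let ?c = "fps_const (fps_const (f $ 0 $ 0))"
  have "small (\<psi> (f - ?c))" by (rule eval2_hom_small[OF assms]) simp
  moreover have "\<psi> f = \<psi> (f - ?c) + e (f $ 0 $ 0)"
    using assms by (simp add: \<psi>.hom_minus eval2_hom_def)
  ultimately show ?thesis by (metis int_closure_closed(1) int_closure_base small_in_int_closure)
qed

lemma small_common_power:
  assumes "small x" "small y"
  shows "\<exists>n. x ^ n / e t \<in> int_closure \<and> y ^ n / e t \<in> int_closure"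
proof -
  obtain a where a: "x ^ a / e t \<in> int_closure" using small_power_divisible[OF assms(1)] by blast
  obtain b where b: "y ^ b / e t \<in> int_closure" using small_power_divisible[OF assms(2)] by blast
  have "x ^ (a + b) / e t = (x ^ a / e t) * x ^ b" "y ^ (a + b) / e t = (y ^ b / e t) * y ^ a"
    by (simp_all add: power_add)
  then show ?thesis using a b assms
    by (metis int_closure_closed(2) int_closure_power small_in_int_closure)
qed

lemma power_divisible_mult:
  assumes "x ^ n / e t \<in> int_closure" "z \<in> int_closure"
  shows "x ^ (n * k) * z / e t ^ k \<in> int_closure"
proof -
  have "x ^ (n * k) * z / e t ^ k = (x ^ n / e t) ^ k * z" by (simp add: power_mult power_divide)
  then show ?thesis using assms by (simp add: int_closure_closed int_closure_power)
qed

text \<open>Continuity of \<phi>: some \<phi>(X)^n is divisible by t, and a series without terms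
  below n k is a multiple of X^(n k).\<close>

lemma eval1_hom_tail:
  assumes "eval1_hom \<phi>"
  shows "\<exists>m. \<forall>f. (\<forall>i<m. f $ i = 0) \<longrightarrow> \<phi> f / e t ^ k \<in> int_closure"
proof -
  interpret \<phi>: comm_ring_hom \<phi> using assms by (simp add: eval1_hom_def)
  have "small (\<phi> fps_X)" by (rule eval1_hom_small[OF assms]) simp
  then obtain n where n: "\<phi> fps_X ^ n / e t \<in> int_closure" using small_power_divisible by blast
  have "\<phi> f / e t ^ k \<in> int_closure" if "\<forall>i<n * k. f $ i = 0" for f
  proof -
    have "f = fps_X ^ (n * k) * fps_shift (n * k) f"
      using that by (auto simp: fps_eq_iff fps_X_power_mult_nth)
    then have "\<phi> f = \<phi> fps_X ^ (n * k) * \<phi> (fps_shift (n * k) f)" by (metis \<phi>.hom_mult \<phi>.hom_power)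
    then show ?thesis using power_divisible_mult[OF n eval1_hom_int[OF assms]] by metis
  qed
  then show ?thesis by blast
qed

definition ord2 :: "nat \<Rightarrow> 'b :: comm_ring_1 fps fps \<Rightarrow> bool" where
  "ord2 m f \<longleftrightarrow> (\<forall>a b. a + b < m \<longrightarrow> f $ a $ b = 0)"

lemma eval2_hom_tail:
  assumes "eval2_hom \<psi>"
  shows "\<exists>m. \<forall>f. ord2 m f \<longrightarrow> \<psi> f / e t ^ k \<in> int_closure"
proof -
  interpret \<psi>: comm_ring_hom \<psi> using assms by (simp add: eval2_hom_def)
  let ?x = "\<psi> fps_X" and ?y = "\<psi> (fps_const fps_X)"
  have "small ?x" "small ?y" by (rule eval2_hom_small[OF assms], simp)+
  then obtain n where n: "?x ^ n / e t \<in> int_closure" "?y ^ n / e t \<in> int_closure"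
    using small_common_power by blast
  define M where "M = n * k"
  \<comment> \<open>A monomial of total degree at least 2 M has an exponent that is at least M: X^M
    \<open>f1\<close> collects the terms divisible by X^M, and \<open>f2\<close> the remaining ones,
    freed of Y^M.\<close>
  have "\<psi> f / e t ^ k \<in> int_closure" if f: "ord2 (2 * M) f" for f
  proof -
    define f1 where "f1 = fps_shift M f"
    define f2 where "f2 = (\<Sum>a<M. fps_X ^ a * fps_const (fps_shift M (f $ a)))"
    have "f = fps_X ^ M * f1 + (fps_const fps_X) ^ M * f2"
    proof (rule fps_ext)
      fix a
      have "((fps_const fps_X) ^ M * f2) $ a =
          fps_X ^ M * (\<Sum>i<M. (fps_X ^ i * fps_const (fps_shift M (f $ i))) $ a)"
        by (simp add: f2_def fps_sum_nth fps_const_power)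
      also have "(\<Sum>i<M. (fps_X ^ i * fps_const (fps_shift M (f $ i))) $ a) =
          (\<Sum>i<M. if i = a then fps_shift M (f $ a) else 0)"
        by (rule sum.cong) (auto simp: fps_X_power_mult_nth)
      also have "\<dots> = (if a < M then fps_shift M (f $ a) else 0)" by simp
      finally have 2: "((fps_const fps_X) ^ M * f2) $ a =
          (if a < M then fps_X ^ M * fps_shift M (f $ a) else 0)" by simp
      show "f $ a = (fps_X ^ M * f1 + (fps_const fps_X) ^ M * f2) $ a"
      proof (cases "a < M")
        case True
        have "f $ a = fps_X ^ M * fps_shift M (f $ a)"
          using f True by (auto simp: fps_eq_iff fps_X_power_mult_nth ord2_def)
        then show ?thesis unfolding fps_add_nth 2 using True by (simp add: fps_X_power_mult_nth)
      next
        case False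
        then show ?thesis unfolding fps_add_nth 2 by (simp add: fps_X_power_mult_nth f1_def)
      qed
    qed
    then have "\<psi> f = ?x ^ M * \<psi> f1 + ?y ^ M * \<psi> f2"
      by (metis \<psi>.hom_mult \<psi>.hom_power \<psi>.hom_add)
    then have "\<psi> f / e t ^ k = ?x ^ M * \<psi> f1 / e t ^ k + ?y ^ M * \<psi> f2 / e t ^ k"
      by (simp add: add_divide_distrib)
    then show ?thesis unfolding M_def
      using power_divisible_mult[OF n(1) eval2_hom_int[OF assms]]
        power_divisible_mult[OF n(2) eval2_hom_int[OF assms]] by (simp add: int_closure_closed)
  qed
  then show ?thesis by blast
qed

lemma eval1_hom_poly:
  assumes "eval1_hom \<phi>" shows "\<phi> (fps_of_poly f) = ev f (\<phi> fps_X)"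
proof -
  interpret \<phi>: comm_ring_hom \<phi> using assms by (simp add: eval1_hom_def)
  have [simp]: "\<phi> (fps_const r) = e r" for r using assms by (simp add: eval1_hom_def)
  show ?thesis
    by (induction f) (simp_all add: fps_of_poly_pCons e.map_poly_pCons_hom \<phi>.hom_add \<phi>.hom_mult mult.commute)
qed

text \<open>Both homomorphisms agree on truncations, and on the tails both values are divisible by
  arbitrarily high powers of t.\<close>

lemma eval1_hom_unique:
  assumes "eval1_hom \<phi>" "eval1_hom \<phi>'" "\<phi> fps_X = \<phi>' fps_X"
  shows "\<phi> = \<phi>'"
proof
  fix f
  interpret \<phi>: comm_ring_hom \<phi> using assms by (simp add: eval1_hom_def)
  interpret \<phi>': comm_ring_hom \<phi>' using assms by (simp add: eval1_hom_def)
  have "(\<phi> f - \<phi>' f) / e t ^ k \<in> int_closure" for k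
  proof -
    obtain m where m: "\<And>f. (\<forall>i<m. f $ i = 0) \<Longrightarrow> \<phi> f / e t ^ k \<in> int_closure"
      using eval1_hom_tail[OF assms(1), of k] by blast
    obtain m' where m': "\<And>f. (\<forall>i<m'. f $ i = 0) \<Longrightarrow> \<phi>' f / e t ^ k \<in> int_closure"
      using eval1_hom_tail[OF assms(2), of k] by blast
    define h where "h = fps_of_poly (truncate_fps (max m m') f)"
    have "\<phi> h = \<phi>' h" using assms by (simp add: h_def eval1_hom_poly del: fps_of_poly_truncate)
    then have eq: "(\<phi> f - \<phi>' f) / e t ^ k = \<phi> (f - h) / e t ^ k - \<phi>' (f - h) / e t ^ k"
      by (simp add: \<phi>.hom_minus \<phi>'.hom_minus diff_divide_distrib)
    have "\<forall>i<max m m'. (f - h) $ i = 0" by (simp add: h_def coeff_truncate_fps)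
    then show ?thesis unfolding eq by (intro int_closure_diff m m') auto
  qed
  then show "\<phi> f = \<phi>' f" using int_closure_separated[of "\<phi> f - \<phi>' f"] by simp
qed

text \<open>Instead of a limit in the closure, f is replaced by its Weierstrass remainder modulo a
  distinguished polynomial W of x. Two remainders differ by a polynomial multiple of W by
  \<open>distinguished_dvd_cofactor\<close>, so they have the same value at x.\<close>

lemma eval1_hom_exists:
  assumes "small x" shows "\<exists>\<phi>. eval1_hom \<phi> \<and> \<phi> fps_X = x"
proof -
  obtain W where W: "distinguished W" "ev W x = 0" using assms by (auto simp: small_def)
  let ?rep = "\<lambda>f p. \<exists>q. f = fps_of_poly W * q + fps_of_poly p"
  have ex: "\<exists>p. ?rep f p" for f
  proof -
    obtain q where q: "\<forall>i\<ge>degree W. (f - fps_of_poly W * q) $ i = 0"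
      using weierstrass_division[OF distinguished_unit_index[OF W(1)]] by blast
    have "f = fps_of_poly W * q + fps_of_poly (truncate_fps (degree W) (f - fps_of_poly W * q))"
      using q by (intro fps_ext) (auto simp: coeff_truncate_fps not_less simp del: fps_of_poly_truncate)
    then show ?thesis by blast
  qed
  define \<phi> where "\<phi> = (\<lambda>f. ev (SOME p. ?rep f p) x)"
  have phi: "\<phi> f = ev p x" if fp: "?rep f p" for f p
  proof -
    let ?p = "SOME p. ?rep f p"
    obtain q where q: "f = fps_of_poly W * q + fps_of_poly p" using fp by blast
    have "?rep f ?p" using ex[of f] by (rule someI_ex)
    then obtain q' where q': "f = fps_of_poly W * q' + fps_of_poly ?p" by blast
    have "fps_of_poly (?p - p) = fps_of_poly W * (q - q')"
      using q q' by (simp add: fps_of_poly_diff algebra_simps)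
    then obtain r where "?p - p = W * r" using distinguished_dvd_cofactor[OF W(1)] by blast
    then have "?p = p + W * r" by (simp add: algebra_simps)
    then have "ev ?p x = ev p x" using W(2) by (simp add: ep.hom_add ep.hom_mult)
    then show ?thesis by (simp add: \<phi>_def)
  qed
  have poly: "\<phi> (fps_of_poly p) = ev p x" for p by (rule phi) (auto intro: exI[of _ 0])
  have "eval1_hom \<phi>"
    unfolding eval1_hom_def
  proof (intro conjI allI)
    show "\<phi> (fps_const r) = e r" for r using poly[of "[:r:]"] by (simp add: fps_of_poly_const e.map_poly_pCons_hom)
    show "comm_ring_hom \<phi>"
    proof
      show "\<phi> 0 = 0" "\<phi> 1 = 1" using poly[of 0] poly[of 1] by simp_all
      fix f g
      obtain p q where p: "f = fps_of_poly W * q + fps_of_poly p" using ex by blast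
      obtain p' q' where p': "g = fps_of_poly W * q' + fps_of_poly p'" using ex by blast
      have "f + g = fps_of_poly W * (q + q') + fps_of_poly (p + p')"
        by (simp add: p p' fps_of_poly_add algebra_simps)
      then have "\<phi> (f + g) = ev (p + p') x" by (intro phi) blast
      moreover have "f * g = fps_of_poly W * (q * g + fps_of_poly p * q') + fps_of_poly (p * p')"
        by (simp add: p p' fps_of_poly_mult algebra_simps)
      then have "\<phi> (f * g) = ev (p * p') x" by (intro phi) blast
      moreover have "\<phi> f = ev p x" "\<phi> g = ev p' x" using p p' phi by blast+
      ultimately show "\<phi> (f + g) = \<phi> f + \<phi> g" "\<phi> (f * g) = \<phi> f * \<phi> g"
        by (simp_all add: ep.hom_add ep.hom_mult)
    qed
  qed
  moreover have "\<phi> fps_X = x" using poly[of "[:0, 1:]"] by (simp add: e.map_poly_pCons_hom)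
  ultimately show ?thesis by blast
qed

definition eval1 :: "'e \<Rightarrow> 'r fps \<Rightarrow> 'e" where
  "eval1 x = (SOME \<phi>. eval1_hom \<phi> \<and> \<phi> fps_X = x)"

lemma eval1:
  assumes "small x" shows "eval1_hom (eval1 x)" "eval1 x fps_X = x"
  using someI_ex[OF eval1_hom_exists[OF assms]] by (simp_all add: eval1_def)

lemma eval1_hom_eq: "eval1_hom \<phi> \<Longrightarrow> \<phi> = eval1 (\<phi> fps_X)"
  by (intro eval1_hom_unique eval1) (simp_all add: eval1 eval1_hom_small)

lemma eval1_simps:
  assumes "small x"
  shows "eval1 x (f + g) = eval1 x f + eval1 x g" "eval1 x (f * g) = eval1 x f * eval1 x g"
    "eval1 x (fps_const r) = e r" "eval1 x 0 = 0" "eval1 x 1 = 1" "eval1 x (f ^ n) = eval1 x f ^ n"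
    "eval1 x (f - g) = eval1 x f - eval1 x g" "eval1 x fps_X = x"
proof -
  interpret h: comm_ring_hom "eval1 x" using eval1[OF assms] by (simp add: eval1_hom_def)
  show "eval1 x (f + g) = eval1 x f + eval1 x g" "eval1 x (f * g) = eval1 x f * eval1 x g"
    "eval1 x 0 = 0" "eval1 x 1 = 1" "eval1 x (f ^ n) = eval1 x f ^ n"
    "eval1 x (f - g) = eval1 x f - eval1 x g"
    by (simp_all add: h.hom_add h.hom_mult h.hom_power h.hom_minus)
  show "eval1 x (fps_const r) = e r" "eval1 x fps_X = x" using eval1[OF assms] by (simp_all add: eval1_hom_def)
qed

lemma eval1_int: "small x \<Longrightarrow> eval1 x f \<in> int_closure"
  by (rule eval1_hom_int[OF eval1(1)])

lemma eval1_small: "small x \<Longrightarrow> f $ 0 = 0 \<Longrightarrow> small (eval1 x f)"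
  by (rule eval1_hom_small[OF eval1(1)])

lemma eval1_sum: "small x \<Longrightarrow> eval1 x (sum f A) = (\<Sum>i\<in>A. eval1 x (f i))"
  by (induction A rule: infinite_finite_induct) (simp_all add: eval1_simps)

text \<open>Both sides are R-algebra homomorphisms in f, and they agree on X.\<close>

lemma eval1_compose:
  assumes "small x" "g $ 0 = 0" shows "eval1 x (f oo g) = eval1 (eval1 x g) f"
proof -
  define \<phi> where "\<phi> = (\<lambda>f. eval1 x (f oo g))"
  have "eval1_hom \<phi>"
    unfolding eval1_hom_def \<phi>_def
    by (intro conjI allI) (unfold_locales, simp_all add: eval1_simps[OF assms(1)] fps_compose_add_distrib
        fps_compose_mult_distrib[OF assms(2)])
  then have "\<phi> = eval1 (\<phi> fps_X)" by (rule eval1_hom_eq)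
  moreover have "\<phi> fps_X = eval1 x g" using assms(2) by (simp add: \<phi>_def fps_X_fps_compose_startby0)
  ultimately show ?thesis unfolding \<phi>_def by metis
qed

lemma eval1_unit:
  assumes "small x" "f $ 0 dvd 1"
  shows "eval1 x f \<noteq> 0" "inverse (eval1 x f) \<in> int_closure"
proof -
  obtain v where "f * v = 1" using fps_ex_inverse[OF assms(2)] by blast
  then have *: "eval1 x f * eval1 x v = 1" by (metis eval1_simps(2,5)[OF assms(1)])
  then show "eval1 x f \<noteq> 0" by auto
  have "inverse (eval1 x f) = eval1 x v" using * by (metis inverse_unique)
  then show "inverse (eval1 x f) \<in> int_closure" using eval1_int[OF assms(1)] by simp
qed

lemma eval1_poly: "small x \<Longrightarrow> eval1 x (fps_of_poly f) = ev f x"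
  using eval1_hom_poly[OF eval1(1)] by (simp add: eval1_simps)

lemma eval1_image:
  assumes "comm_ring_hom \<tau>" "\<And>r. \<tau> (e r) = e r" "small x"
  shows "\<tau> (eval1 x f) = eval1 (\<tau> x) f"
proof -
  interpret \<tau>: comm_ring_hom \<tau> by fact
  define \<phi> where "\<phi> = (\<lambda>f. \<tau> (eval1 x f))"
  have "eval1_hom \<phi>"
    unfolding eval1_hom_def \<phi>_def
    by (intro conjI allI) (unfold_locales, simp_all add: eval1_simps[OF assms(3)] assms(2) \<tau>.hom_add \<tau>.hom_mult)
  then have "\<phi> = eval1 (\<phi> fps_X)" by (rule eval1_hom_eq)
  then show ?thesis unfolding \<phi>_def using eval1_simps(8)[OF assms(3)] by metis
qed

section \<open>Substitution into series in two variables\<close>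

lemma ord2_mult:
  fixes f g :: "'b :: comm_ring_1 fps fps"
  assumes "ord2 m f" "ord2 n g" shows "ord2 (m + n) (f * g)"
  unfolding ord2_def
proof (intro allI impI)
  fix a b assume ab: "a + b < m + n"
  have "f $ i $ j * g $ (a - i) $ (b - j) = 0" if "i \<le> a" "j \<le> b" for i j
  proof (cases "i + j < m")
    case True
    then show ?thesis using assms(1) by (simp add: ord2_def)
  next
    case False
    then have "(a - i) + (b - j) < n" using ab that by linarith
    then show ?thesis using assms(2) by (simp add: ord2_def)
  qed
  then show "(f * g) $ a $ b = 0" by (simp add: fps_mult_nth fps_sum_nth)
qed

lemma ord2_power: "f $ 0 $ 0 = 0 \<Longrightarrow> ord2 n (f ^ n)"
proof (induction n)
  case (Suc n)
  have "ord2 1 f" using Suc.prems by (simp add: ord2_def)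
  from ord2_mult[OF this Suc.IH[OF Suc.prems]] show ?case by simp
qed (simp add: ord2_def)

lemma ord1_power_mult:
  fixes g h :: "'b :: comm_ring_1 fps"
  assumes "g $ 0 = 0" "h $ 0 = 0" "a < i + j" shows "(g ^ i * h ^ j) $ a = 0"
proof -
  have "(g ^ i) $ u * (h ^ j) $ (a - u) = 0" if "u \<le> a" for u
  proof (cases "u < i")
    case True
    then show ?thesis using startsby_zero_power_prefix[OF assms(1)] by simp
  next
    case False
    then have "a - u < j" using assms(3) that by linarith
    then show ?thesis using startsby_zero_power_prefix[OF assms(2)] by simp
  qed
  then show ?thesis by (simp add: fps_mult_nth)
qed

text \<open>The truncation of a two-variable series, evaluated at two elements of an algebra over \<open>R\<close> with
  structure map \<open>c\<close>.\<close>

definition trunc2 :: "('r \<Rightarrow> 's) \<Rightarrow> 'r fps fps \<Rightarrow> nat \<Rightarrow> 's \<Rightarrow> 's \<Rightarrow> 's :: comm_ring_1" where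
  "trunc2 c F m g h = (\<Sum>i\<le>m. \<Sum>j\<le>m. c (F $ i $ j) * (g ^ i * h ^ j))"

lemma trunc2_hom:
  assumes "comm_ring_hom \<phi>" "\<And>r. \<phi> (c r) = e r"
  shows "\<phi> (trunc2 c F m g h) = trunc2 e F m (\<phi> g) (\<phi> h)"
proof -
  interpret \<phi>: comm_ring_hom \<phi> by fact
  show ?thesis by (simp add: trunc2_def \<phi>.hom_sum \<phi>.hom_mult \<phi>.hom_power assms(2))
qed

lemma trunc2_ord2: "ord2 m (F - trunc2 (\<lambda>r. fps_const (fps_const r)) F m fps_X (fps_const fps_X))"
  unfolding ord2_def
proof (intro allI impI)
  fix a b assume ab: "a + b < m"
  have "(fps_const (fps_const c) * (fps_X ^ i * fps_const fps_X ^ j)) $ a $ b =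
      (if i = a \<and> j = b then c else (0 :: 'r))" for c i j
    by (auto simp: fps_const_power fps_X_power_mult_nth fps_X_power_nth)
  then have "trunc2 (\<lambda>r. fps_const (fps_const r)) F m fps_X (fps_const fps_X) $ a $ b =
      (\<Sum>i\<le>m. \<Sum>j\<le>m. if i = a \<and> j = b then F $ i $ j else 0)"
    unfolding trunc2_def by (simp add: fps_sum_nth del: fps_const_power)
  also have "\<dots> = (\<Sum>i\<le>m. if i = a then F $ i $ b else 0)"
    using ab by (intro sum.cong) auto
  also have "\<dots> = F $ a $ b" using ab by simp
  finally show "(F - trunc2 (\<lambda>r. fps_const (fps_const r)) F m fps_X (fps_const fps_X)) $ a $ b = 0" by simp
qed

lemma subst_2_1_trunc:
  assumes "g $ 0 = 0" "h $ 0 = 0" "a < m"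
  shows "(subst_2_1 F g h - trunc2 fps_const F m g h) $ a = 0"
proof -
  have "subst_2_1 F g h $ a = (\<Sum>i\<le>a. \<Sum>j\<le>a. F $ i $ j * (g ^ i * h ^ j) $ a)" by (simp add: subst_2_1_def)
  also have "\<dots> = (\<Sum>i\<le>a. \<Sum>j\<le>m. F $ i $ j * (g ^ i * h ^ j) $ a)"
    using assms(3) ord1_power_mult[OF assms(1,2)] by (intro sum.cong sum.mono_neutral_left) auto
  also have "\<dots> = (\<Sum>i\<le>m. \<Sum>j\<le>m. F $ i $ j * (g ^ i * h ^ j) $ a)"
    using assms(3) ord1_power_mult[OF assms(1,2)] by (intro sum.mono_neutral_left) auto
  finally show ?thesis by (simp add: trunc2_def fps_sum_nth)
qed

lemma subst_2_2_trunc: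
  assumes "g $ 0 $ 0 = 0" "h $ 0 $ 0 = 0"
  shows "ord2 m (subst_2_2 F g h - trunc2 (\<lambda>r. fps_const (fps_const r)) F m g h)"
  unfolding ord2_def
proof (intro allI impI)
  fix a b assume ab: "a + b < m"
  have z: "(g ^ i * h ^ j) $ a $ b = 0" if "a + b < i + j" for i j
    using ord2_mult[OF ord2_power[OF assms(1), of i] ord2_power[OF assms(2), of j]] that by (simp add: ord2_def)
  have "subst_2_2 F g h $ a $ b = (\<Sum>i\<le>a + b. \<Sum>j\<le>a + b. F $ i $ j * (g ^ i * h ^ j) $ a $ b)"
    by (simp add: subst_2_2_def)
  also have "\<dots> = (\<Sum>i\<le>a + b. \<Sum>j\<le>m. F $ i $ j * (g ^ i * h ^ j) $ a $ b)"
    using ab z by (intro sum.cong sum.mono_neutral_left) auto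
  also have "\<dots> = (\<Sum>i\<le>m. \<Sum>j\<le>m. F $ i $ j * (g ^ i * h ^ j) $ a $ b)"
    using ab z by (intro sum.mono_neutral_left) auto
  finally show "(subst_2_2 F g h - trunc2 (\<lambda>r. fps_const (fps_const r)) F m g h) $ a $ b = 0"
    by (simp add: trunc2_def fps_sum_nth)
qed

lemma eval2_hom_approx:
  assumes "eval2_hom \<psi>"
  shows "\<exists>m0. \<forall>m\<ge>m0. (\<psi> F - trunc2 e F m (\<psi> fps_X) (\<psi> (fps_const fps_X))) / e t ^ k \<in> int_closure"
proof -
  interpret \<psi>: comm_ring_hom \<psi> using assms by (simp add: eval2_hom_def)
  obtain m0 where m0: "\<And>f. ord2 m0 f \<Longrightarrow> \<psi> f / e t ^ k \<in> int_closure"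
    using eval2_hom_tail[OF assms] by blast
  have "(\<psi> F - trunc2 e F m (\<psi> fps_X) (\<psi> (fps_const fps_X))) / e t ^ k \<in> int_closure" if "m \<ge> m0" for m
  proof -
    let ?P = "trunc2 (\<lambda>r. fps_const (fps_const r)) F m fps_X (fps_const fps_X)"
    have "ord2 m0 (F - ?P)" using trunc2_ord2[of m F] that by (simp add: ord2_def)
    from m0[OF this] show ?thesis
      using assms trunc2_hom[OF \<psi>.comm_ring_hom_axioms, of "\<lambda>r. fps_const (fps_const r)"]
      by (simp add: \<psi>.hom_minus eval2_hom_def)
  qed
  then show ?thesis by blast
qed

text \<open>For each k both sides are congruent modulo t^k to the value of one truncation of F: the
  left side because g and h have no constant term, the right side by continuity of \<psi>. The
  evaluation of F at a pair is given as a homomorphism \<psi>, so that it can be taken from points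
  of the group scheme.\<close>

lemma eval_subst_2_1:
  assumes \<phi>: "eval1_hom \<phi>" and \<psi>: "eval2_hom \<psi>" and gh: "g $ 0 = 0" "h $ 0 = 0"
    and eq: "\<phi> g = \<psi> fps_X" "\<phi> h = \<psi> (fps_const fps_X)"
  shows "\<phi> (subst_2_1 F g h) = \<psi> F"
proof -
  interpret \<phi>: comm_ring_hom \<phi> using \<phi> by (simp add: eval1_hom_def)
  have "(\<phi> (subst_2_1 F g h) - \<psi> F) / e t ^ k \<in> int_closure" for k
  proof -
    obtain m0 where m0: "\<And>f. (\<forall>i<m0. f $ i = 0) \<Longrightarrow> \<phi> f / e t ^ k \<in> int_closure"
      using eval1_hom_tail[OF \<phi>] by blast
    obtain m1 where m1: "\<And>m. m \<ge> m1 \<Longrightarrow>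
        (\<psi> F - trunc2 e F m (\<psi> fps_X) (\<psi> (fps_const fps_X))) / e t ^ k \<in> int_closure"
      using eval2_hom_approx[OF \<psi>] by blast
    define m where "m = max m0 m1"
    have "\<phi> (subst_2_1 F g h - trunc2 fps_const F m g h) / e t ^ k \<in> int_closure"
      using subst_2_1_trunc[OF gh] by (intro m0) (simp add: m_def del: fps_sub_nth)
    then have "(\<phi> (subst_2_1 F g h) - trunc2 e F m (\<psi> fps_X) (\<psi> (fps_const fps_X))) / e t ^ k \<in> int_closure"
      using \<phi> trunc2_hom[OF \<phi>.comm_ring_hom_axioms, of fps_const] eq
      by (simp add: \<phi>.hom_minus eval1_hom_def)
    from int_closure_diff[OF this m1[of m]] show ?thesis
      by (simp add: m_def diff_divide_distrib)
  qed
  then show ?thesis using int_closure_separated[of "\<phi> (subst_2_1 F g h) - \<psi> F"] by simp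
qed

lemma eval_subst_2_2:
  assumes \<phi>: "eval2_hom \<phi>" and \<psi>: "eval2_hom \<psi>" and gh: "g $ 0 $ 0 = 0" "h $ 0 $ 0 = 0"
    and eq: "\<phi> g = \<psi> fps_X" "\<phi> h = \<psi> (fps_const fps_X)"
  shows "\<phi> (subst_2_2 F g h) = \<psi> F"
proof -
  interpret \<phi>: comm_ring_hom \<phi> using \<phi> by (simp add: eval2_hom_def)
  have "(\<phi> (subst_2_2 F g h) - \<psi> F) / e t ^ k \<in> int_closure" for k
  proof -
    obtain m0 where m0: "\<And>f. ord2 m0 f \<Longrightarrow> \<phi> f / e t ^ k \<in> int_closure"
      using eval2_hom_tail[OF \<phi>] by blast
    obtain m1 where m1: "\<And>m. m \<ge> m1 \<Longrightarrow>
        (\<psi> F - trunc2 e F m (\<psi> fps_X) (\<psi> (fps_const fps_X))) / e t ^ k \<in> int_closure"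
      using eval2_hom_approx[OF \<psi>] by blast
    define m where "m = max m0 m1"
    have "ord2 m0 (subst_2_2 F g h - trunc2 (\<lambda>r. fps_const (fps_const r)) F m g h)"
      using subst_2_2_trunc[OF gh, of m F] by (simp add: m_def ord2_def)
    from m0[OF this]
    have "(\<phi> (subst_2_2 F g h) - trunc2 e F m (\<psi> fps_X) (\<psi> (fps_const fps_X))) / e t ^ k \<in> int_closure"
      using \<phi> trunc2_hom[OF \<phi>.comm_ring_hom_axioms, of "\<lambda>r. fps_const (fps_const r)"] eq
      by (simp add: \<phi>.hom_minus eval2_hom_def)
    from int_closure_diff[OF this m1[of m]] show ?thesis
      by (simp add: m_def diff_divide_distrib)
  qed
  then show ?thesis using int_closure_separated[of "\<phi> (subst_2_2 F g h) - \<psi> F"] by simp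
qed

lemma eval2_hom_unique:
  assumes "eval2_hom \<phi>" "eval2_hom \<psi>" "\<phi> fps_X = \<psi> fps_X" "\<phi> (fps_const fps_X) = \<psi> (fps_const fps_X)"
  shows "\<phi> F = \<psi> F"
proof -
  have "(\<phi> F - \<psi> F) / e t ^ k \<in> int_closure" for k
  proof -
    obtain m0 where m0: "\<And>m. m \<ge> m0 \<Longrightarrow>
        (\<phi> F - trunc2 e F m (\<phi> fps_X) (\<phi> (fps_const fps_X))) / e t ^ k \<in> int_closure"
      using eval2_hom_approx[OF assms(1)] by blast
    obtain m1 where m1: "\<And>m. m \<ge> m1 \<Longrightarrow>
        (\<psi> F - trunc2 e F m (\<psi> fps_X) (\<psi> (fps_const fps_X))) / e t ^ k \<in> int_closure"
      using eval2_hom_approx[OF assms(2)] by blast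
    from int_closure_diff[OF m0[of "max m0 m1"] m1[of "max m0 m1"]] show ?thesis
      using assms by (simp add: diff_divide_distrib)
  qed
  then show ?thesis using int_closure_separated[of "\<phi> F - \<psi> F"] by simp
qed

end

section \<open>Zeros of a formal endomorphism in characteristic \<open>p\<close>\<close>

text \<open>Leading terms modulo d. The case d = 0 gives exact orders, as on the generic fibre, and
  d = \<omega> gives orders modulo the maximal ideal of R, as on the special fibre.\<close>

lemma fps_power_order:
  fixes h :: "'a :: comm_ring_1 fps"
  assumes "\<And>a. a < k \<Longrightarrow> d dvd h $ a"
  shows "(\<forall>a<k * i. d dvd (h ^ i) $ a) \<and> d dvd (h ^ i) $ (k * i) - (h $ k) ^ i"
proof (induction i)
  case (Suc i)
  have low: "d dvd h $ u * (h ^ i) $ (a - u)" if "u < k \<or> a - u < k * i" for a u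
    using that assms Suc.IH by (auto intro: dvd_mult dvd_mult2)
  have "d dvd (h ^ Suc i) $ a" if "a < k * Suc i" for a
    unfolding power_Suc fps_mult_nth
  proof (rule dvd_sum)
    fix u assume "u \<in> {0..a}"
    then have "u < k \<or> a - u < k * i" using that by auto
    then show "d dvd h $ u * (h ^ i) $ (a - u)" by (rule low)
  qed
  moreover have "d dvd (h ^ Suc i) $ (k * Suc i) - (h $ k) ^ Suc i"
  proof -
    let ?a = "k * Suc i"
    have "(h ^ Suc i) $ ?a = (\<Sum>u=0..?a. h $ u * (h ^ i) $ (?a - u))" by (simp add: fps_mult_nth)
    also have "\<dots> = h $ k * (h ^ i) $ (?a - k) + (\<Sum>u\<in>{0..?a} - {k}. h $ u * (h ^ i) $ (?a - u))"
      by (rule sum.remove) auto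
    finally have "(h ^ Suc i) $ ?a - (h $ k) ^ Suc i =
        h $ k * ((h ^ i) $ (k * i) - (h $ k) ^ i) + (\<Sum>u\<in>{0..?a} - {k}. h $ u * (h ^ i) $ (?a - u))"
      by (simp add: algebra_simps)
    moreover have "d dvd (\<Sum>u\<in>{0..?a} - {k}. h $ u * (h ^ i) $ (?a - u))"
    proof (rule dvd_sum)
      fix u assume "u \<in> {0..?a} - {k}"
      then have "u < k \<or> ?a - u < k * i" by auto
      then show "d dvd h $ u * (h ^ i) $ (?a - u)" by (rule low)
    qed
    ultimately show ?thesis using Suc.IH by (simp add: dvd_add dvd_mult)
  qed
  ultimately show ?case by blast
qed simp

lemma fps_compose_order:
  fixes f h :: "'a :: comm_ring_1 fps"
  assumes f: "\<And>i. i < m \<Longrightarrow> d dvd f $ i" and h: "\<And>a. a < k \<Longrightarrow> d dvd h $ a" and k: "k > 0"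
  shows "a < m * k \<Longrightarrow> d dvd (f oo h) $ a"
    and "d dvd (f oo h) $ (m * k) - f $ m * (h $ k) ^ m"
proof -
  have ord: "d dvd (h ^ i) $ a" if "a < k * i" for a i using fps_power_order[of k d h i] h that by blast
  show "d dvd (f oo h) $ a" if "a < m * k"
    unfolding fps_compose_nth
  proof (rule dvd_sum)
    fix i show "d dvd f $ i * (h ^ i) $ a"
    proof (cases "i < m")
      case False
      then have "m * k \<le> k * i" by (metis mult.commute mult_le_mono2 not_less)
      then have "a < k * i" using that by linarith
      then show ?thesis by (intro dvd_mult ord)
    qed (simp add: f dvd_mult2)
  qed
  have "(f oo h) $ (m * k) = f $ m * (h ^ m) $ (m * k) + (\<Sum>i\<in>{0..m * k} - {m}. f $ i * (h ^ i) $ (m * k))"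
  proof -
    have "m \<in> {0..m * k}" using k by (cases k) auto
    then show ?thesis unfolding fps_compose_nth by (rule sum.remove[OF finite_atLeastAtMost])
  qed
  then have "(f oo h) $ (m * k) - f $ m * (h $ k) ^ m =
      f $ m * ((h ^ m) $ (k * m) - (h $ k) ^ m) + (\<Sum>i\<in>{0..m * k} - {m}. f $ i * (h ^ i) $ (m * k))"
    by (simp add: algebra_simps)
  moreover have "d dvd (\<Sum>i\<in>{0..m * k} - {m}. f $ i * (h ^ i) $ (m * k))"
  proof (rule dvd_sum)
    fix i assume i: "i \<in> {0..m * k} - {m}"
    show "d dvd f $ i * (h ^ i) $ (m * k)"
    proof (cases "i < m")
      case False
      then have "m < i" using i by auto
      then have "k * m < k * i" using k by (metis mult_less_mono2)
      then show ?thesis by (intro dvd_mult ord) (simp add: mult.commute)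
    qed (simp add: f dvd_mult2)
  qed
  moreover have "d dvd (h ^ m) $ (k * m) - (h $ k) ^ m" using fps_power_order[of k d h m] h by blast
  ultimately show "d dvd (f oo h) $ (m * k) - f $ m * (h $ k) ^ m" by (simp add: dvd_add dvd_mult)
qed

text \<open>The coefficient at i only depends on the terms of h up to i. Their sum is finite, so
  that the additivity of the Frobenius applies, and the rest of the series acquires the factor X^((i
  + 1) q).\<close>

lemma fps_frobenius_nth:
  fixes h :: "'a :: comm_ring_1 fps"
  assumes "prime CHAR('a)" "q = CHAR('a) ^ k"
  shows "(h ^ q) $ i = (if q dvd i then (h $ (i div q)) ^ q else 0)"
proof -
  have q: "q > 0" using assms by (simp add: prime_gt_0_nat)
  have pc: "prime CHAR('a fps)" "q = CHAR('a fps) ^ k" using assms by (simp_all add: semiring_char_fps)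
  define r where "r = fps_shift (Suc i) h"
  have h: "h = (\<Sum>j\<le>i. fps_const (h $ j) * fps_X ^ j) + fps_X ^ Suc i * r"
  proof (rule fps_ext)
    fix n
    have "(\<Sum>j\<le>i. fps_const (h $ j) * fps_X ^ j) $ n = (\<Sum>j\<le>i. if j = n then h $ j else 0)"
      unfolding fps_sum_nth by (intro sum.cong) (auto simp: fps_X_power_nth)
    then show "h $ n = ((\<Sum>j\<le>i. fps_const (h $ j) * fps_X ^ j) + fps_X ^ Suc i * r) $ n"
      unfolding fps_add_nth fps_X_power_mult_nth by (auto simp: r_def)
  qed
  have "h ^ q = (\<Sum>j\<le>i. fps_const (h $ j) * fps_X ^ j) ^ q + (fps_X ^ Suc i * r) ^ q"
    by (subst h) (rule freshmans_dream'[OF pc])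
  also have "(\<Sum>j\<le>i. fps_const (h $ j) * fps_X ^ j) ^ q = (\<Sum>j\<le>i. (fps_const (h $ j) * fps_X ^ j) ^ q)"
    by (rule freshmans_dream_sum'[OF pc])
  also have "\<dots> = (\<Sum>j\<le>i. fps_const ((h $ j) ^ q) * fps_X ^ (j * q))"
    by (simp add: power_mult_distrib fps_const_power power_mult)
  also have "(fps_X ^ Suc i * r) ^ q = fps_X ^ (Suc i * q) * r ^ q"
    by (simp only: power_mult_distrib power_mult)
  finally have hq: "h ^ q = (\<Sum>j\<le>i. fps_const ((h $ j) ^ q) * fps_X ^ (j * q)) + fps_X ^ (Suc i * q) * r ^ q" .
  have "i < Suc i * q" using q by (metis less_Suc_eq_le less_le_trans mult_le_mono2 nat_mult_1_right Suc_leI One_nat_def lessI)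
  then have "(h ^ q) $ i = (\<Sum>j\<le>i. if j * q = i then (h $ j) ^ q else 0)"
    unfolding hq fps_add_nth fps_X_power_mult_nth fps_sum_nth by (auto simp: fps_X_power_nth intro!: sum.cong)
  also have "\<dots> = (if q dvd i then (h $ (i div q)) ^ q else 0)"
  proof (cases "q dvd i")
    case True
    have "(\<Sum>j\<le>i. if j * q = i then (h $ j) ^ q else 0) = (\<Sum>j\<le>i. if j = i div q then (h $ j) ^ q else 0)"
      using q True by (intro sum.cong) auto
    then show ?thesis using True by simp
  next
    case False
    then have "j * q \<noteq> i" for j by auto
    then show ?thesis using False by simp
  qed
  finally show ?thesis .
qed

definition supp_mult :: "nat \<Rightarrow> 'a :: zero fps \<Rightarrow> bool" where
  "supp_mult q f \<longleftrightarrow> (\<forall>i. f $ i \<noteq> 0 \<longrightarrow> q dvd i)"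

lemma supp_mult_mult:
  fixes f g :: "'a :: comm_ring_1 fps"
  assumes "supp_mult q f" "supp_mult q g" shows "supp_mult q (f * g)"
  unfolding supp_mult_def
proof (intro allI impI)
  fix i assume "(f * g) $ i \<noteq> 0"
  then obtain j where j: "j \<le> i" "f $ j * g $ (i - j) \<noteq> 0"
    unfolding fps_mult_nth by (metis (no_types, lifting) atLeastAtMost_iff sum.neutral)
  then have "f $ j \<noteq> 0" "g $ (i - j) \<noteq> 0" by auto
  then have "q dvd j" "q dvd i - j" using assms by (auto simp: supp_mult_def)
  then show "q dvd i" using j(1) by (metis dvd_add le_add_diff_inverse)
qed

lemma supp_mult_power: "supp_mult q f \<Longrightarrow> supp_mult q ((f :: 'a :: comm_ring_1 fps) ^ n)"
proof (induction n)
  case 0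
  then show ?case by (simp add: supp_mult_def)
qed (simp add: supp_mult_mult)

text \<open>f only contributes powers of h^q, and by the Frobenius the exponents in h^q are q times
  those in h.\<close>

lemma supp_mult_compose:
  fixes f h :: "'a :: comm_ring_1 fps"
  assumes "prime CHAR('a)" "q = CHAR('a) ^ k" "supp_mult q f" "supp_mult r h"
  shows "supp_mult (q * r) (f oo h)"
  unfolding supp_mult_def
proof (intro allI impI)
  fix a assume "(f oo h) $ a \<noteq> 0"
  then obtain i where i: "f $ i * (h ^ i) $ a \<noteq> 0"
    unfolding fps_compose_nth by (metis (no_types, lifting) sum.neutral)
  then have "f $ i \<noteq> 0" by auto
  then have "q dvd i" using assms(3) by (simp add: supp_mult_def)
  then obtain j where j: "i = q * j" by (elim dvdE)
  have "supp_mult (q * r) (h ^ q)"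
    unfolding supp_mult_def
  proof (intro allI impI)
    fix l assume l: "(h ^ q) $ l \<noteq> 0"
    have ql: "q dvd l" "(h $ (l div q)) ^ q \<noteq> 0"
      using l fps_frobenius_nth[OF assms(1,2), of h l] by (auto split: if_splits)
    have "h $ (l div q) \<noteq> 0"
    proof
      assume "h $ (l div q) = 0"
      then show False using ql(2) assms(1,2) by (simp add: power_0_left prime_gt_0_nat)
    qed
    then have "r dvd l div q" using assms(4) by (simp add: supp_mult_def)
    then have "q * r dvd q * (l div q)" by (rule mult_dvd_mono[OF dvd_refl])
    then show "q * r dvd l" using ql(1) by simp
  qed
  then have "supp_mult (q * r) (h ^ i)" unfolding j power_mult by (rule supp_mult_power)
  moreover have "(h ^ i) $ a \<noteq> 0" using i by auto
  ultimately show "q * r dvd a" by (simp add: supp_mult_def)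
qed

lemma fps_compose_X_power_nth:
  fixes f :: "'a :: comm_ring_1 fps"
  assumes "q > 0"
  shows "(f oo fps_X ^ q) $ n = (if q dvd n then f $ (n div q) else 0)"
proof -
  have "(f oo fps_X ^ q) $ n = (\<Sum>i=0..n. f $ i * (fps_X ^ (q * i)) $ n)"
    by (simp add: fps_compose_nth power_mult)
  also have "\<dots> = (\<Sum>i=0..n. if q * i = n then f $ i else 0)"
    by (intro sum.cong) (auto simp: fps_X_power_nth)
  also have "\<dots> = (if q dvd n then f $ (n div q) else 0)"
  proof (cases "q dvd n")
    case True
    have "(\<Sum>i=0..n. if q * i = n then f $ i else 0) = (\<Sum>i=0..n. if i = n div q then f $ i else 0)"
      using assms True by (intro sum.cong) auto
    then show ?thesis using True by simp
  next
    case False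
    then have "q * i \<noteq> n" for i by auto
    then show ?thesis using False by simp
  qed
  finally show ?thesis .
qed

text \<open>Between degree 0 and degree q nothing is available, so exactly one factor contributes
  its term of degree q. For G = F^Q this produces the factor k of a derivative.\<close>

lemma fps_power_nth_gap:
  fixes G :: "'a :: comm_ring_1 fps"
  assumes gap: "\<And>a. 0 < a \<Longrightarrow> a < q \<Longrightarrow> G $ a = 0" and q: "q > 0"
  shows "(\<forall>a. 0 < a \<and> a < q \<longrightarrow> (G ^ k) $ a = 0) \<and> (G ^ k) $ 0 = (G $ 0) ^ k \<and>
    (G ^ k) $ q = of_nat k * (G $ 0) ^ (k - 1) * G $ q"
proof (induction k)
  case (Suc k)
  have "(G ^ Suc k) $ a = 0" if "0 < a" "a < q" for a
  proof -
    have "G $ u * (G ^ k) $ (a - u) = 0" if "u \<le> a" for u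
      using that \<open>0 < a\<close> \<open>a < q\<close> gap Suc.IH by (cases "u = 0") auto
    then show ?thesis by (simp add: fps_mult_nth)
  qed
  moreover have "(G ^ Suc k) $ q = of_nat (Suc k) * (G $ 0) ^ k * G $ q"
  proof -
    have "(G ^ Suc k) $ q = (\<Sum>u\<in>{0..q}. G $ u * (G ^ k) $ (q - u))" by (simp add: fps_mult_nth)
    also have "\<dots> = (\<Sum>u\<in>{0, q}. G $ u * (G ^ k) $ (q - u))"
      using gap by (intro sum.mono_neutral_right) auto
    also have "\<dots> = G $ 0 * (G ^ k) $ q + G $ q * (G ^ k) $ 0" using q by simp
    also have "\<dots> = of_nat (Suc k) * (G $ 0) ^ k * G $ q"
      using Suc.IH by (cases k) (simp_all add: algebra_simps)
    finally show ?thesis .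
  qed
  ultimately show ?case using Suc.IH by (simp add: fps_mult_nth_0)
qed (use q in simp)

lemma ex_nth_root:
  assumes "n > 0" shows "\<exists>x :: 'e :: alg_closed_field. x ^ n = y"
proof -
  have "coeff (monom 1 n - [:y:]) n = 1" using assms by (simp add: coeff_pCons split: nat.splits)
  then have "n \<le> degree (monom 1 n - [:y:])" by (intro le_degree) simp
  then obtain x where "poly (monom 1 n - [:y:]) x = 0"
    using assms alg_closed_imp_poly_has_root[of "monom 1 n - [:y:]"] by auto
  then show ?thesis by (auto simp: poly_monom)
qed

context complete_dvr_closure
begin

lemma CHAR_closure: "CHAR('e) = CHAR('r)"
proof (rule CHAR_eqI)
  have of_nat: "of_nat n = e (of_nat n)" for n by (induction n) (simp_all add: e.hom_add)
  show "of_nat CHAR('r) = (0 :: 'e)" unfolding of_nat by simp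
  fix n :: nat assume "of_nat n = (0 :: 'e)"
  then have "of_nat n = (0 :: 'r)" unfolding of_nat by simp
  then show "CHAR('r) dvd n" by (simp add: of_nat_eq_0_iff_char_dvd)
qed

lemma eval1_0: "eval1 0 f = e (f $ 0)"
proof -
  have "eval1_hom (\<lambda>f. e (f $ 0))"
    unfolding eval1_hom_def by (intro conjI allI) (unfold_locales, simp_all add: e.hom_add e.hom_mult fps_mult_nth_0)
  from eval1_hom_eq[OF this] show ?thesis by (metis (no_types, lifting) e.hom_zero fps_X_nth zero_neq_one)
qed

end

text \<open>The situation of h = [\<pi>^n]: h is f(X^Q) with f'(0) not 0, Q is the inseparability
  degree, and the Weierstrass degree M of f will be the number of zeros.\<close>

locale formal_endomorphism = complete_dvr_closure t e
  for t :: "'r :: idom" and e :: "'r \<Rightarrow> 'e :: alg_closed_field" +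
  fixes p k Q M :: nat and F :: "'r fps fps" and h :: "'r fps"
  assumes p: "prime p" "CHAR('r) = p" and Q: "Q = p ^ k"
    and F0: "F $ 0 = fps_X" and F10: "F $ 1 $ 0 = 1"
    and endo: "subst_1_2 h F = subst_2_2 F (in_X h) (in_Y h)"
    and supp: "supp_mult Q h" and low: "\<And>i. i < Q \<Longrightarrow> h $ i = 0" and hQ: "h $ Q \<noteq> 0"
    and unit_idx: "unit_index h (Q * M)"
begin

lemma Q_pos: "Q > 0" using p Q by (simp add: prime_gt_0_nat)

definition f where "f = Abs_fps (\<lambda>i. h $ (Q * i))"

lemma h_eq: "h = f oo fps_X ^ Q"
proof (rule fps_ext)
  fix n show "h $ n = (f oo fps_X ^ Q) $ n"
    using supp by (auto simp: fps_compose_X_power_nth[OF Q_pos] f_def supp_mult_def)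
qed

text \<open>The coefficient of X^Q as a series in Y. In h(F) = f(F^Q) the Frobenius gives F^Q = Y^Q
  + F_1(Y)^Q X^Q + ..., where F_1 is \<open>F $ 1\<close>, so the result is that of the chain rule:
  f'(Y^Q) F_1(Y)^Q.\<close>

lemma subst_1_2_nth_Q: "subst_1_2 h F $ Q = (fps_deriv f oo fps_X ^ Q) * (F $ 1) ^ Q"
proof (rule fps_ext)
  fix b
  have pc: "prime CHAR('r fps)" "Q = CHAR('r fps) ^ k" using p Q by (simp_all add: semiring_char_fps)
  define G where "G = F ^ Q"
  have G: "G $ a = (if Q dvd a then (F $ (a div Q)) ^ Q else 0)" for a
    unfolding G_def by (rule fps_frobenius_nth[OF pc])
  have G0: "G $ 0 = fps_X ^ Q" "G $ Q = (F $ 1) ^ Q" using G F0 Q_pos by auto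
  have gap: "G $ a = 0" if "0 < a" "a < Q" for a using G that by (auto dest: dvd_imp_le)
  have Gk: "(G ^ j) $ Q = of_nat j * fps_X ^ (Q * (j - 1)) * (F $ 1) ^ Q" for j
    using fps_power_nth_gap[of Q G j] gap Q_pos by (simp add: G0 power_mult)
  have "subst_1_2 h F $ Q $ b = (\<Sum>i\<le>Q + b. h $ i * (F ^ i) $ Q $ b)" by (simp add: subst_1_2_def)
  also have "\<dots> = (\<Sum>i\<in>(\<lambda>u. Q + u) ` {..b}. h $ i * (F ^ i) $ Q $ b)"
  proof (rule sum.mono_neutral_right)
    show "\<forall>i\<in>{..Q + b} - (\<lambda>u. Q + u) ` {..b}. h $ i * (F ^ i) $ Q $ b = 0"
    proof
      fix i assume i: "i \<in> {..Q + b} - (\<lambda>u. Q + u) ` {..b}"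
      have "i < Q"
      proof (rule ccontr)
        assume "\<not> i < Q"
        then have "i = Q + (i - Q)" "i - Q \<le> b" using i by auto
        then show False using i by blast
      qed
      then show "h $ i * (F ^ i) $ Q $ b = 0" by (simp add: low)
    qed
  qed auto
  also have "\<dots> = (\<Sum>u\<le>b. h $ (Q + u) * (F ^ (Q + u)) $ Q $ b)"
    by (subst sum.reindex) (auto simp: inj_on_def)
  also have "\<dots> = (\<Sum>u\<le>b. (fps_deriv f oo fps_X ^ Q) $ u * ((F $ 1) ^ Q) $ (b - u))"
  proof (rule sum.cong)
    fix u assume "u \<in> {..b}"
    show "h $ (Q + u) * (F ^ (Q + u)) $ Q $ b = (fps_deriv f oo fps_X ^ Q) $ u * ((F $ 1) ^ Q) $ (b - u)"
    proof (cases "Q dvd u")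
      case True
      then obtain j where j: "u = Q * j" by (elim dvdE)
      have "F ^ (Q + u) = G ^ Suc j" by (simp add: G_def j power_mult power_add)
      then have "(F ^ (Q + u)) $ Q = of_nat (Suc j) * fps_X ^ u * (F $ 1) ^ Q" using Gk[of "Suc j"] j by simp
      moreover have "(of_nat (Suc j) * fps_X ^ u * (F $ 1) ^ Q) $ b =
          of_nat (Suc j) * ((F $ 1) ^ Q) $ (b - u)"
        using \<open>u \<in> {..b}\<close> unfolding mult.assoc
        by (simp add: fps_of_nat[symmetric] fps_X_power_mult_nth not_less del: fps_of_nat of_nat_Suc)
      moreover have "(fps_deriv f oo fps_X ^ Q) $ u = of_nat (Suc j) * h $ (Q + u)"
        using Q_pos by (simp add: fps_compose_X_power_nth[OF Q_pos] j f_def)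
      ultimately show ?thesis by (simp add: mult_ac)
    next
      case False
      then have "\<not> Q dvd Q + u" by simp
      then have "h $ (Q + u) = 0" using supp unfolding supp_mult_def by blast
      then show ?thesis using False by (simp add: fps_compose_X_power_nth[OF Q_pos])
    qed
  qed simp
  also have "\<dots> = ((fps_deriv f oo fps_X ^ Q) * (F $ 1) ^ Q) $ b"
    by (simp add: fps_mult_nth atLeast0AtMost)
  finally show "subst_1_2 h F $ Q $ b = ((fps_deriv f oo fps_X ^ Q) * (F $ 1) ^ Q) $ b" .
qed

text \<open>The coefficient of X^Q on the other side. As h has order Q, only the first power of h(X)
  contributes.\<close>

lemma subst_2_2_nth_Q:
  "subst_2_2 F (in_X h) (in_Y h) $ Q = fps_const (h $ Q) * ((F $ 1) oo h)"
proof (rule fps_ext)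
  fix b
  have inX: "(in_X h) ^ i = Abs_fps (\<lambda>a. fps_const ((h ^ i) $ a))" for i
  proof (induction i)
    case 0
    show ?case by (auto simp: fps_eq_iff)
  next
    case (Suc i)
    have sc: "(\<Sum>i\<in>A. fps_const (c i)) = fps_const (\<Sum>i\<in>A. c i :: 'r)" for c and A :: "nat set"
      by (induction A rule: infinite_finite_induct) auto
    show ?case unfolding power_Suc Suc.IH
      by (rule fps_ext) (simp add: fps_mult_nth in_X_def sc)
  qed
  have trm: "((in_X h) ^ i * (in_Y h) ^ j) $ Q $ b = (h ^ i) $ Q * (h ^ j) $ b" for i j
    unfolding inX in_Y_def fps_const_power[symmetric]
    by (simp add: fps_const_power)
  have h0: "h $ 0 = 0" using low Q_pos by blast
  have hi: "(h ^ i) $ Q = (if i = 1 then h $ Q else 0)" for i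
  proof -
    consider "i = 0" | "i = 1" | "i \<ge> 2" by linarith
    then show ?thesis
    proof cases
      case 3
      then have "Q * 2 \<le> Q * i" by simp
      then have "Q < Q * i" using Q_pos by linarith
      then show ?thesis using fps_power_order[of Q 0 h i] low 3 by auto
    qed (use Q_pos in auto)
  qed
  have "subst_2_2 F (in_X h) (in_Y h) $ Q $ b =
      (\<Sum>i\<le>Q + b. \<Sum>j\<le>Q + b. F $ i $ j * ((h ^ i) $ Q * (h ^ j) $ b))"
    by (simp add: subst_2_2_def trm)
  also have "\<dots> = (\<Sum>i\<le>Q + b. if i = 1 then (\<Sum>j\<le>Q + b. F $ 1 $ j * (h $ Q * (h ^ j) $ b)) else 0)"
    by (rule sum.cong) (auto simp: hi)
  also have "\<dots> = (\<Sum>j\<le>Q + b. F $ 1 $ j * (h $ Q * (h ^ j) $ b))" using Q_pos by simp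
  also have "\<dots> = h $ Q * (\<Sum>j\<le>Q + b. F $ 1 $ j * (h ^ j) $ b)"
    by (simp add: sum_distrib_left mult_ac)
  also have "(\<Sum>j\<le>Q + b. F $ 1 $ j * (h ^ j) $ b) = (\<Sum>j=0..b. F $ 1 $ j * (h ^ j) $ b)"
    using startsby_zero_power_prefix[OF h0] by (intro sum.mono_neutral_right) auto
  finally show "subst_2_2 F (in_X h) (in_Y h) $ Q $ b = (fps_const (h $ Q) * ((F $ 1) oo h)) $ b"
    by (simp add: fps_compose_nth)
qed

text \<open>Equating the two coefficients gives f'(Y^Q) F_1(Y)^Q = h_Q F_1(h(Y)). At a zero of h the
  right side is h_Q F_1(0) = h_Q, which is not 0. This is the invariance of the differential of F in
  a form that survives inseparability.\<close>

lemma deriv_nonzero_at_zero: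
  assumes x: "small x" and zero: "eval1 x h = 0"
  shows "eval1 (x ^ Q) (fps_deriv f) \<noteq> 0"
proof
  assume d: "eval1 (x ^ Q) (fps_deriv f) = 0"
  have h0: "h $ 0 = 0" using low Q_pos by blast
  have "(fps_deriv f oo fps_X ^ Q) * (F $ 1) ^ Q = fps_const (h $ Q) * ((F $ 1) oo h)"
    using subst_1_2_nth_Q subst_2_2_nth_Q endo by simp
  then have "eval1 x ((fps_deriv f oo fps_X ^ Q) * (F $ 1) ^ Q) = eval1 x (fps_const (h $ Q) * ((F $ 1) oo h))"
    by simp
  moreover have "eval1 x (fps_deriv f oo fps_X ^ Q) = eval1 (x ^ Q) (fps_deriv f)"
    using Q_pos by (simp add: eval1_compose[OF x] eval1_simps[OF x])
  moreover have "eval1 x ((F $ 1) oo h) = 1"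
    using zero F10 by (simp add: eval1_compose[OF x h0] eval1_0)
  ultimately have "e (h $ Q) = 0" using d by (simp add: eval1_simps[OF x])
  then show False using hQ by simp
qed

lemma small_root:
  assumes "small (x ^ Q)" shows "small x"
proof (rule ccontr)
  assume "\<not> small x"
  then have "x \<noteq> 0" "inverse x \<in> int_closure" by (auto simp: small_iff)
  then have "inverse (x ^ Q) \<in> int_closure" "x ^ Q \<noteq> 0" using int_closure_power[of "inverse x" Q]
    by (simp_all add: power_inverse)
  then show False using assms by (simp add: small_iff)
qed

text \<open>W is prepared from f and not from h, so its roots are the powers x^Q of the zeros of h;
  every root has a Q-th root, which is again small. By the product rule for f = W v, a double root
  of W would be a zero of f', which \<open>deriv_nonzero_at_zero\<close> excludes.\<close>

lemma weierstrass_polynomial: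
  obtains W where "degree W = M" "\<And>y. ev W y = 0 \<Longrightarrow> small y"
    "\<And>x. small x \<Longrightarrow> eval1 x h = 0 \<longleftrightarrow> ev W (x ^ Q) = 0"
    "\<And>y. ev W y = 0 \<Longrightarrow> ev (pderiv W) y \<noteq> 0"
proof -
  have "unit_index f M" using unit_idx Q_pos by (auto simp: unit_index_def f_def)
  from weierstrass_preparation[OF this] obtain W u v where
    W: "distinguished W" "degree W = M" "fps_of_poly W = f * u" "u * v = 1" by blast
  have f: "f = fps_of_poly W * v" using W(3,4) by (simp add: mult.assoc)
  have sm: "small y" if "ev W y = 0" for y using that W(1) by (auto simp: small_def)
  have v0: "v $ 0 dvd 1" 
  proof -
    have "u $ 0 * v $ 0 = 1" using arg_cong[OF W(4), of "\<lambda>f. f $ 0"] by (simp add: fps_mult_nth_0)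
    then show ?thesis by (metis dvd_triv_right)
  qed
  have hx: "eval1 x h = ev W (x ^ Q) * eval1 (x ^ Q) v" if "small x" for x
  proof -
    have "eval1 x h = eval1 x (f oo fps_X ^ Q)" by (rule arg_cong[OF h_eq])
    also have "\<dots> = eval1 (x ^ Q) f"
      using Q_pos by (simp add: eval1_compose[OF that] eval1_simps[OF that])
    finally have "eval1 x h = eval1 (x ^ Q) f" .
    moreover have "small (x ^ Q)" using that Q_pos by (rule small_power)
    ultimately show ?thesis by (simp add: f eval1_simps eval1_poly)
  qed
  have zero: "eval1 x h = 0 \<longleftrightarrow> ev W (x ^ Q) = 0" if "small x" for x
    using hx[OF that] eval1_unit(1)[OF small_power[OF that Q_pos] v0] by simp
  have simple: "ev (pderiv W) y \<noteq> 0" if y: "ev W y = 0" for y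
  proof -
    obtain x where x: "x ^ Q = y" using ex_nth_root[OF Q_pos] by blast
    have sx: "small x" using small_root sm[OF y] x by simp
    have "eval1 x h = 0" using zero[OF sx] x y by simp
    from deriv_nonzero_at_zero[OF sx this] have "eval1 y (fps_deriv f) \<noteq> 0" using x by simp
    moreover have "fps_deriv f = fps_of_poly W * fps_deriv v + fps_of_poly (pderiv W) * v"
      unfolding f by (simp add: fps_of_poly_pderiv)
    ultimately show ?thesis using y sm[OF y] by (auto simp: eval1_simps eval1_poly)
  qed
  show thesis using that W(2) sm zero simple by blast
qed

lemma card_zeros: "card {x. small x \<and> eval1 x h = 0} = M" "finite {x. small x \<and> eval1 x h = 0}"
proof -
  obtain W where W: "degree W = M" "\<And>y. ev W y = 0 \<Longrightarrow> small y"
    "\<And>x. small x \<Longrightarrow> eval1 x h = 0 \<longleftrightarrow> ev W (x ^ Q) = 0"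
    "\<And>y. ev W y = 0 \<Longrightarrow> ev (pderiv W) y \<noteq> 0" by (rule weierstrass_polynomial) blast
  have W0: "W \<noteq> 0"
  proof
    assume "W = 0"
    then have "ev (pderiv W) 0 = 0" "ev W 0 = 0" by simp_all
    then show False using W(4) by blast
  qed
  have card: "card {y. ev W y = 0} = M"
    using simple_roots_factorization(2)[of "map_poly e W"] W W0 by (simp add: e.map_poly_pderiv)
  \<comment> \<open>In characteristic p the map x to x^Q is injective, so the zeros of h correspond
    one to one to the roots of W.\<close>
  have inj: "inj (\<lambda>x :: 'e. x ^ Q)"
  proof (rule injI)
    fix x y :: 'e assume "x ^ Q = y ^ Q"
    moreover have "(x - y) ^ Q + y ^ Q = (x - y + y) ^ Q"
      using p Q by (intro freshmans_dream'[symmetric]) (simp_all add: CHAR_closure)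
    ultimately have "(x - y) ^ Q = 0" by simp
    then show "x = y" by simp
  qed
  have img: "(\<lambda>x. x ^ Q) ` {x. small x \<and> eval1 x h = 0} = {y. ev W y = 0}"
  proof (intro equalityI subsetI)
    fix y assume "y \<in> {y. ev W y = 0}"
    then have y: "ev W y = 0" by simp
    obtain x where x: "x ^ Q = y" using ex_nth_root[OF Q_pos] by blast
    have sx: "small x" using small_root W(2)[OF y] x by simp
    then show "y \<in> (\<lambda>x. x ^ Q) ` {x. small x \<and> eval1 x h = 0}" using W(3)[OF sx] x y by auto
  qed (use W(3) in auto)
  have "card ((\<lambda>x. x ^ Q) ` {x. small x \<and> eval1 x h = 0}) = card {x. small x \<and> eval1 x h = 0}"
    by (rule card_image) (rule inj_on_subset[OF inj], simp)
  then show "card {x. small x \<and> eval1 x h = 0} = M" using card img by simp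
  have "finite {y. ev W y = 0}" using W0 by (simp add: poly_roots_finite)
  then show "finite {x. small x \<and> eval1 x h = 0}"
    using img inj by (metis finite_imageD inj_on_subset subset_UNIV)
qed

end

section \<open>Completeness of a \<open>p\<close>-adic integer ring\<close>

lemma Rep_padic_of_nat: "Rep_padic_int (of_nat m :: 'p :: prime_card padic_int) n = int m mod int CARD('p) ^ n"
  by (induction m) (simp_all add: zero_padic_int.rep_eq plus_padic_int.rep_eq one_padic_int.rep_eq mod_simps add.commute)

lemma Rep_padic_Suc: "Rep_padic_int (z :: 'p :: prime_card padic_int) (Suc n) mod int CARD('p) ^ n = Rep_padic_int z n"
  using Rep_padic_int[of z] by simp

lemma Rep_padic_mod:
  "Rep_padic_int (z :: 'p :: prime_card padic_int) (m + n) mod int CARD('p) ^ n = Rep_padic_int z n"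
proof (induction m)
  case 0
  show ?case by (metis Rep_padic_Suc add_0 mod_mod_trivial)
next
  case (Suc m)
  have "Rep_padic_int z (Suc m + n) mod int CARD('p) ^ n =
      Rep_padic_int z (Suc (m + n)) mod int CARD('p) ^ (m + n) mod int CARD('p) ^ n"
    by (simp add: mod_mod_cancel le_imp_power_dvd)
  then show ?case using Suc by (simp only: Rep_padic_Suc)
qed

lemma padic_power_dvd:
  fixes z :: "'p :: prime_card padic_int"
  assumes "Rep_padic_int z n = 0" shows "of_nat CARD('p) ^ n dvd z"
proof -
  let ?p = "int CARD('p)"
  have p0: "?p > 0" using prime_gt_0_nat[OF prime_card[where 'a = 'p]] by simp
  \<comment> \<open>The residue of the quotient modulo p^m is read off from z modulo p^(m + n),
    whence the shifted index.\<close>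
  define v where "v = (\<lambda>m. Rep_padic_int z (m + n) div ?p ^ n)"
  have zv: "Rep_padic_int z (m + n) = ?p ^ n * v m" for m
    using Rep_padic_mod[of z m n] assms unfolding v_def by (metis add_0_right mult_div_mod_eq)
  have "v (Suc m) mod ?p ^ m = v m" for m
  proof -
    have "?p ^ n * (v (Suc m) mod ?p ^ m) = (?p ^ n * v (Suc m)) mod (?p ^ n * ?p ^ m)"
      by (rule mult_mod_right)
    also have "\<dots> = Rep_padic_int z (Suc (m + n)) mod ?p ^ (m + n)"
      using zv[of "Suc m"] by (simp add: power_add mult.commute)
    also have "\<dots> = ?p ^ n * v m" by (simp only: Rep_padic_Suc zv)
    finally show ?thesis using p0 by simp
  qed
  then have w: "Rep_padic_int (Abs_padic_int v :: 'p padic_int) = v" by (simp add: Abs_padic_int_inverse)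
  have "z = of_nat (CARD('p) ^ n) * Abs_padic_int v"
  proof -
    have "Rep_padic_int z m = Rep_padic_int (of_nat (CARD('p) ^ n) * Abs_padic_int v :: 'p padic_int) m" for m
    proof -
      have "Rep_padic_int (of_nat (CARD('p) ^ n) * Abs_padic_int v :: 'p padic_int) m = (?p ^ n * v m) mod ?p ^ m"
        by (simp only: times_padic_int.rep_eq Rep_padic_of_nat w) (simp add: mod_simps)
      also have "\<dots> = Rep_padic_int z m" using Rep_padic_mod[of z n m] zv[of m] by (simp add: add.commute)
      finally show ?thesis by simp
    qed
    then show ?thesis by (metis Rep_padic_int_inject ext)
  qed
  then show ?thesis by (metis dvd_triv_left of_nat_power)
qed

lemma padic_sum_of_powers:
  fixes S :: "nat set"
  shows "\<exists>z :: 'p :: prime_card padic_int. \<forall>n. of_nat CARD('p) ^ n dvd z - (\<Sum>i\<in>{i. i < n \<and> i \<in> S}. of_nat CARD('p) ^ i)"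
proof -
  let ?p = "int CARD('p)" and ?s = "\<lambda>n. \<Sum>i\<in>{i. i < n \<and> i \<in> S}. CARD('p) ^ i"
  define x where "x = (\<lambda>n. int (?s n) mod ?p ^ n)"
  have "x (Suc n) mod ?p ^ n = x n" for n
  proof -
    have "{i. i < Suc n \<and> i \<in> S} = (if n \<in> S then insert n {i. i < n \<and> i \<in> S} else {i. i < n \<and> i \<in> S})"
      by (auto simp: less_Suc_eq)
    then have "?s (Suc n) = ?s n + (if n \<in> S then CARD('p) ^ n else 0)" by simp
    then have "int (?s (Suc n)) mod ?p ^ n = int (?s n) mod ?p ^ n" by simp
    then show ?thesis unfolding x_def by (simp only: padic_mod_Suc)
  qed
  then have w: "Rep_padic_int (Abs_padic_int x :: 'p padic_int) = x" by (simp add: Abs_padic_int_inverse)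
  have "of_nat CARD('p) ^ n dvd (Abs_padic_int x :: 'p padic_int) - of_nat (?s n)" for n
    by (rule padic_power_dvd, simp only: minus_padic_int.rep_eq w Rep_padic_of_nat) (simp add: x_def mod_simps)
  then show ?thesis by (intro exI[of _ "Abs_padic_int x"]) simp
qed

lemma to_fract_of_nat_eq: "to_fract (of_nat n :: 'a :: idom) = of_nat n"
  by (induction n) simp_all

text \<open>A p-adic integer z is a root of X - z, so its image lies in the integral closure, which
  is A. That p is not 0 in A holds because \<iota> is a homomorphism of fields.\<close>

lemma padic_integer_ring_structure_map:
  assumes "padic_integer_ring TYPE('p :: prime_card) TYPE('a :: idom)"
  shows "\<exists>j :: 'p padic_int \<Rightarrow> 'a. comm_ring_hom j \<and> of_nat CARD('p) \<noteq> (0 :: 'a)"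
proof -
  obtain \<iota> :: "'p padic \<Rightarrow> 'a fract" where \<iota>: "comm_ring_hom \<iota>" and
    range: "range (to_fract :: 'a \<Rightarrow> 'a fract) =
      {x. \<exists>f :: 'p padic_int poly. lead_coeff f = 1 \<and> poly (map_poly (\<iota> \<circ> to_fract) f) x = 0}"
    using assms unfolding padic_integer_ring_def by blast
  interpret \<iota>: comm_ring_hom \<iota> by (rule \<iota>)
  have "\<iota> (to_fract z) \<in> range (to_fract :: 'a \<Rightarrow> 'a fract)" for z
    unfolding range by (intro CollectI exI[of _ "[:- z, 1:]"]) (simp add: map_poly_pCons \<iota>.hom_uminus)
  then have "\<exists>a. to_fract a = \<iota> (to_fract z)" for z by (metis imageE)
  then obtain j :: "'p padic_int \<Rightarrow> 'a" where j: "\<And>z. to_fract (j z) = \<iota> (to_fract z)" by metis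
  have "comm_ring_hom j"
  proof
    show "j 0 = 0" "j 1 = 1" using j[of 0] j[of 1] by (metis to_fract_0 to_fract_1 \<iota>.hom_zero \<iota>.hom_one to_fract_eq_iff)+
    fix x y
    have "to_fract (j (x + y)) = to_fract (j x + j y)" "to_fract (j (x * y)) = to_fract (j x * j y)"
      by (simp_all add: j \<iota>.hom_add \<iota>.hom_mult)
    then show "j (x + y) = j x + j y" "j (x * y) = j x * j y" by (simp_all only: to_fract_eq_iff)
  qed
  moreover have "of_nat CARD('p) \<noteq> (0 :: 'a)"
  proof
    assume z: "of_nat CARD('p) = (0 :: 'a)"
    have p1: "CARD('p) > 1" using prime_gt_1_nat[OF prime_card[where 'a = 'p]] .
    \<comment> \<open>Level 2 is the first one at which the residue of p is not 0.\<close>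
    have "Rep_padic_int (of_nat CARD('p) :: 'p padic_int) 2 = int CARD('p)"
    proof -
      have "CARD('p) < CARD('p) ^ 2" using p1 by (simp add: power2_eq_square)
      then have "int CARD('p) < int CARD('p) ^ 2" by (metis of_nat_less_iff of_nat_power)
      then show ?thesis unfolding Rep_padic_of_nat by (intro mod_pos_pos_trivial) simp_all
    qed
    then have nz: "of_nat CARD('p) \<noteq> (0 :: 'p padic_int)"
      using p1 by (auto simp: zero_padic_int.rep_eq)
    then have "(of_nat CARD('p) :: 'p padic) \<noteq> 0" by (simp flip: to_fract_of_nat_eq)
    then have "\<iota> (of_nat CARD('p) * inverse (of_nat CARD('p))) = 1" by simp
    moreover have "\<iota> (of_nat CARD('p)) = 0"
      using z to_fract_of_nat_eq[of "CARD('p)", where 'a = 'a] by (simp add: \<iota>.hom_of_nat)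
    ultimately show False by (simp add: \<iota>.hom_mult)
  qed
  ultimately show ?thesis by blast
qed

lemma finite_residues_power:
  fixes \<pi> :: "'a :: idom"
  assumes "finite D" "\<And>a. \<exists>d\<in>D. \<pi> dvd a - d"
  shows "\<exists>E. finite E \<and> (\<forall>a. \<exists>d\<in>E. \<pi> ^ n dvd a - d)"
proof (induction n)
  case 0
  show ?case by (intro exI[of _ "{0}"]) simp
next
  case (Suc n)
  then obtain E where E: "finite E" "\<And>a. \<exists>d\<in>E. \<pi> ^ n dvd a - d" by blast
  let ?E = "(\<lambda>(d, d'). d + \<pi> ^ n * d') ` (E \<times> D)"
  have "\<exists>d\<in>?E. \<pi> ^ Suc n dvd a - d" for a
  proof -
    obtain d where d: "d \<in> E" "\<pi> ^ n dvd a - d" using E(2) by blast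
    obtain b where b: "a - d = \<pi> ^ n * b" using d(2) by (elim dvdE)
    obtain d' where d': "d' \<in> D" "\<pi> dvd b - d'" using assms(2) by blast
    obtain c where c: "b - d' = \<pi> * c" using d'(2) by (elim dvdE)
    have "a - (d + \<pi> ^ n * d') = \<pi> ^ n * (b - d')" using b by (simp add: algebra_simps)
    then have "\<pi> ^ Suc n dvd a - (d + \<pi> ^ n * d')" by (simp add: c)
    then show ?thesis using d(1) d'(1) by force
  qed
  then show ?case using E(1) assms(1) by (intro exI[of _ ?E]) simp
qed

text \<open>Expanding in digits \<open>d\<close> from a finite set and collecting the places of each digit reduces the
  convergence of \<open>\<Sum>\<^sub>n d\<^sub>n p\<^sup>n\<close> to that of \<open>\<Sum>\<^sub>n\<^sub>\<in>\<^sub>S p\<^sup>n\<close> in \<open>\<int>\<^sub>p\<close>.\<close>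

lemma p_adic_series_converges:
  fixes j :: "'p :: prime_card padic_int \<Rightarrow> 'a :: idom" and D :: "'a set" and y :: "nat \<Rightarrow> 'a"
  assumes j: "comm_ring_hom j" and D: "finite D" "\<And>a. \<exists>d\<in>D. of_nat CARD('p) dvd a - d"
  shows "\<exists>s. \<forall>n. of_nat CARD('p) ^ n dvd s - (\<Sum>i<n. of_nat CARD('p) ^ i * y i)"
proof -
  interpret j: comm_ring_hom j by (rule j)
  let ?P = "of_nat CARD('p) :: 'a"
  have "\<exists>d q. d \<in> D \<and> a = d + ?P * q" for a
    using D(2)[of a] by (force simp: dvd_def algebra_simps)
  then obtain dg qt where dq: "\<And>a. dg a \<in> D" "\<And>a. a = dg a + ?P * qt a" by metis
  \<comment> \<open>The carries of the expansion: y n + c n is a digit plus p times the next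
    carry.\<close>
  define c where "c = rec_nat 0 (\<lambda>n c. qt (y n + c))"
  have c: "c 0 = 0" "c (Suc n) = qt (y n + c n)" for n by (simp_all add: c_def)
  define d where "d = (\<lambda>n. dg (y n + c n))"
  have dD: "d n \<in> D" for n by (simp add: d_def dq)
  have step: "y n + c n = d n + ?P * c (Suc n)" for n unfolding d_def c(2) by (rule dq(2))
  have sum: "(\<Sum>i<n. ?P ^ i * y i) = (\<Sum>i<n. ?P ^ i * d i) + ?P ^ n * c n" for n
  proof (induction n)
    case (Suc n)
    have "(\<Sum>i<Suc n. ?P ^ i * y i) = (\<Sum>i<n. ?P ^ i * d i) + ?P ^ n * (y n + c n)"
      using Suc by (simp add: algebra_simps)
    also have "\<dots> = (\<Sum>i<Suc n. ?P ^ i * d i) + ?P ^ Suc n * c (Suc n)"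
      unfolding step by (simp add: algebra_simps)
    finally show ?case .
  qed (simp add: c)
  have "\<forall>\<delta>. \<exists>z :: 'p padic_int. \<forall>n. of_nat CARD('p) ^ n dvd z - (\<Sum>i\<in>{i. i < n \<and> i \<in> {i. d i = \<delta>}}. of_nat CARD('p) ^ i)"
    using padic_sum_of_powers by blast
  then obtain z :: "'a \<Rightarrow> 'p padic_int" where
    z: "\<And>\<delta> n. of_nat CARD('p) ^ n dvd z \<delta> - (\<Sum>i\<in>{i. i < n \<and> i \<in> {i. d i = \<delta>}}. of_nat CARD('p) ^ i)" by metis
  define s where "s = (\<Sum>\<delta>\<in>D. \<delta> * j (z \<delta>))"
  have "?P ^ n dvd s - (\<Sum>i<n. ?P ^ i * y i)" for n
  proof -
    have "(\<Sum>i<n. ?P ^ i * d i) = (\<Sum>\<delta>\<in>D. \<Sum>i\<in>{i\<in>{..<n}. d i = \<delta>}. ?P ^ i * d i)"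
      by (rule sum.group[symmetric]) (use D(1) dD in auto)
    also have "\<dots> = (\<Sum>\<delta>\<in>D. \<delta> * (\<Sum>i\<in>{i. i < n \<and> i \<in> {i. d i = \<delta>}}. ?P ^ i))"
      unfolding sum_distrib_left by (intro sum.cong) (auto simp: mult.commute)
    also have "\<dots> = (\<Sum>\<delta>\<in>D. \<delta> * j (\<Sum>i\<in>{i. i < n \<and> i \<in> {i. d i = \<delta>}}. of_nat CARD('p) ^ i))"
      by (simp add: j.hom_sum j.hom_power j.hom_of_nat)
    finally have "s - (\<Sum>i<n. ?P ^ i * d i) =
        (\<Sum>\<delta>\<in>D. \<delta> * j (z \<delta> - (\<Sum>i\<in>{i. i < n \<and> i \<in> {i. d i = \<delta>}}. of_nat CARD('p) ^ i)))"
      by (simp add: s_def sum_subtractf[symmetric] j.hom_minus right_diff_distrib)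
    moreover have "?P ^ n dvd j (z \<delta> - (\<Sum>i\<in>{i. i < n \<and> i \<in> {i. d i = \<delta>}}. of_nat CARD('p) ^ i))" for \<delta>
      using j.hom_dvd[OF z[of n \<delta>]] by (simp only: j.hom_power j.hom_of_nat)
    ultimately have "?P ^ n dvd s - (\<Sum>i<n. ?P ^ i * d i)" by (simp add: dvd_sum dvd_mult)
    then have "?P ^ n dvd s - (\<Sum>i<n. ?P ^ i * d i) - ?P ^ n * c n" by (rule dvd_diff[OF _ dvd_triv_left])
    then show ?thesis unfolding sum by (simp add: algebra_simps)
  qed
  then show ?thesis by blast
qed

text \<open>\<open>card\<close> of an infinite set is 0, so the hypothesis states that the residue
  field is finite.\<close>

lemma residue_representatives:
  fixes \<pi> :: "'a :: idom"
  assumes "residue_card \<pi> \<noteq> 0"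
  obtains D where "finite D" "card D = residue_card \<pi>" "\<And>a. \<exists>!d. d \<in> D \<and> \<pi> dvd a - d"
proof -
  let ?c = "\<lambda>a. {b. \<pi> dvd b - a}"
  have fin: "finite (range ?c)" by (rule ccontr) (use assms in \<open>simp add: residue_card_def\<close>)
  have eq: "?c a = ?c b \<longleftrightarrow> \<pi> dvd a - b" for a b
  proof
    assume eq: "?c a = ?c b"
    have "a \<in> ?c a" by simp
    then have "a \<in> ?c b" unfolding eq .
    then show "\<pi> dvd a - b" by simp
  next
    assume d: "\<pi> dvd a - b"
    have "\<pi> dvd x - a \<longleftrightarrow> \<pi> dvd x - b" for x
    proof -
      have "x - b = (x - a) + (a - b)" by simp
      then show ?thesis using d by (metis dvd_add_left_iff)
    qed
    then show "?c a = ?c b" by blast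
  qed
  define r where "r = (\<lambda>S. SOME a. ?c a = S)"
  have r: "?c (r S) = S" if S: "S \<in> range ?c" for S
  proof -
    have "\<exists>a. ?c a = S" using S by blast
    then show ?thesis unfolding r_def by (rule someI_ex)
  qed
  define D where "D = r ` range ?c"
  have inj: "inj_on r (range ?c)" by (rule inj_on_inverseI[where g = ?c]) (rule r)
  show thesis
  proof (rule that[of D])
    show "finite D" using fin by (simp add: D_def)
    show "card D = residue_card \<pi>" unfolding D_def residue_card_def by (rule card_image[OF inj])
    fix a
    show "\<exists>!d. d \<in> D \<and> \<pi> dvd a - d"
    proof
      show "r (?c a) \<in> D \<and> \<pi> dvd a - r (?c a)"
        using r[of "?c a"] eq[of "r (?c a)" a] by (auto simp: D_def dvd_diff_commute)
      fix d assume d: "d \<in> D \<and> \<pi> dvd a - d"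
      then obtain S where S: "S \<in> range ?c" "d = r S" by (auto simp: D_def)
      have "?c a = ?c d" using d eq by blast
      then show "d = r (?c a)" using r[OF S(1)] S(2) by simp
    qed
  qed
qed

text \<open>Completeness is inherited from the p-adic integers. With p = u \<pi>^e, the subsequence
  x (e n) of a \<pi>-adic Cauchy sequence has increments divisible by p^n, so it is given by a
  p-adic series, and such series converge because A has finitely many residues modulo p.\<close>

theorem padic_integer_ring_complete:
  fixes \<pi> :: "'a :: idom"
  assumes A: "padic_integer_ring TYPE('p :: prime_card) TYPE('a)" and unif: "uniformizer \<pi>"
    and res: "residue_card \<pi> \<noteq> 0" and dvd: "\<pi> dvd of_nat CARD('p)"
  shows "complete_valuation_ring \<pi>"
proof
  show "uniformizer \<pi>" by (rule unif)
  fix x :: "nat \<Rightarrow> 'a" assume x: "\<And>n. \<pi> ^ n dvd x (Suc n) - x n"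
  let ?P = "of_nat CARD('p) :: 'a"
  obtain j :: "'p padic_int \<Rightarrow> 'a" where j: "comm_ring_hom j" and P0: "?P \<noteq> 0"
    using padic_integer_ring_structure_map[OF A] by blast
  obtain u e where u: "u dvd 1" "?P = u * \<pi> ^ e"
    using unif P0 unfolding uniformizer_def by blast
  have e: "e > 0"
  proof (rule ccontr)
    assume "\<not> e > 0"
    then have "\<pi> dvd u" using dvd u(2) by simp
    then have "\<pi> dvd 1" using u(1) dvd_trans by blast
    then show False using unif by (simp add: uniformizer_def)
  qed
  obtain w where w: "1 = u * w" using u(1) by (elim dvdE)
  have pi_P: "\<pi> ^ (e * n) = ?P ^ n * w ^ n" for n
  proof -
    have "?P * w = \<pi> ^ e" using w u(2) by (simp add: mult.commute mult.left_commute)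
    then show ?thesis by (metis power_mult power_mult_distrib)
  qed
  obtain D where D: "finite D" "\<And>a. \<exists>!d. d \<in> D \<and> \<pi> dvd a - d" by (rule residue_representatives[OF res]) blast
  obtain E where E: "finite E" "\<And>a. \<exists>d\<in>E. \<pi> ^ e dvd a - d"
    using finite_residues_power[OF D(1), of \<pi> e] D(2) by meson
  have E': "\<exists>d\<in>E. ?P dvd a - d" for a
  proof -
    obtain d where "d \<in> E" "\<pi> ^ e dvd a - d" using E(2) by blast
    moreover have "?P dvd \<pi> ^ e" using pi_P[of 1] by simp
    ultimately show ?thesis using dvd_trans by blast
  qed
  have cauchy: "\<pi> ^ m dvd x (m + k) - x m" for m k
  proof (induction k)
    case (Suc k)
    have "\<pi> ^ m dvd \<pi> ^ (m + k)" by (simp add: le_imp_power_dvd)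
    then have "\<pi> ^ m dvd x (Suc (m + k)) - x (m + k)" using x dvd_trans by blast
    from dvd_add[OF this Suc] show ?case by simp
  qed simp
  have "\<exists>y. x (e * Suc n) - x (e * n) = ?P ^ n * y" for n
    using cauchy[of "e * n" e] by (auto simp: pi_P mult.assoc add.commute elim!: dvdE)
  then obtain y where y: "\<And>n. x (e * Suc n) - x (e * n) = ?P ^ n * y n" by metis
  obtain s where s: "\<And>n. ?P ^ n dvd s - (\<Sum>i<n. ?P ^ i * y i)"
    using p_adic_series_converges[OF j E(1) E'] by blast
  have tel: "(\<Sum>i<n. ?P ^ i * y i) = x (e * n) - x 0" for n
    by (induction n) (simp_all flip: y)
  have "\<pi> ^ m dvd (s + x 0) - x m" for m
  proof -
    have me: "m \<le> e * m" using e by simp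
    have "\<pi> ^ m dvd ?P ^ m" using dvd by (rule dvd_power_same)
    then have "\<pi> ^ m dvd (s + x 0) - x (e * m)" 
    proof -
      have "s + x 0 - x (e * m) = s - (\<Sum>i<m. ?P ^ i * y i)" by (simp add: tel)
      then show ?thesis using s[of m] \<open>\<pi> ^ m dvd ?P ^ m\<close> dvd_trans by metis
    qed
    moreover have "\<pi> ^ m dvd x (e * m) - x m" using cauchy[of m "e * m - m"] me by simp
    ultimately have "\<pi> ^ m dvd ((s + x 0) - x (e * m)) + (x (e * m) - x m)" by (rule dvd_add)
    then show ?thesis by (simp add: algebra_simps)
  qed
  then show "\<exists>y. \<forall>n. \<pi> ^ n dvd y - x n" by blast
qed

section \<open>Free modules over a complete discrete valuation ring\<close>

lemma tendsto_sum_digits: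
  assumes "complete_valuation_ring (\<pi> :: 'a :: idom)"
  shows "\<exists>y. \<forall>n. \<pi> ^ n dvd y - (\<Sum>i<n. \<pi> ^ i * c i)"
proof -
  interpret complete_valuation_ring \<pi> by fact
  show ?thesis by (rule complete) simp
qed

locale class_module = T: Module.module class_ring T
  for T :: "('a :: idom, 't) module"
begin

lemma smult_closed' [simp]: "x \<in> carrier T \<Longrightarrow> a \<odot>\<^bsub>T\<^esub> x \<in> carrier T"
  by (rule T.smult_closed) simp

lemma smult_add: "x \<in> carrier T \<Longrightarrow> (a + b) \<odot>\<^bsub>T\<^esub> x = a \<odot>\<^bsub>T\<^esub> x \<oplus>\<^bsub>T\<^esub> b \<odot>\<^bsub>T\<^esub> x"
  using T.smult_l_distr[of a b x] by simp

lemma smult_add_right: "x \<in> carrier T \<Longrightarrow> y \<in> carrier T \<Longrightarrow> a \<odot>\<^bsub>T\<^esub> (x \<oplus>\<^bsub>T\<^esub> y) = a \<odot>\<^bsub>T\<^esub> x \<oplus>\<^bsub>T\<^esub> a \<odot>\<^bsub>T\<^esub> y"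
  using T.smult_r_distr[of a x y] by simp

lemma smult_mult: "x \<in> carrier T \<Longrightarrow> (a * b) \<odot>\<^bsub>T\<^esub> x = a \<odot>\<^bsub>T\<^esub> (b \<odot>\<^bsub>T\<^esub> x)"
  using T.smult_assoc1[of a b x] by simp

lemma smult_1 [simp]: "x \<in> carrier T \<Longrightarrow> 1 \<odot>\<^bsub>T\<^esub> x = x"
  using T.smult_one[of x] by simp

lemma smult_0 [simp]: "x \<in> carrier T \<Longrightarrow> 0 \<odot>\<^bsub>T\<^esub> x = \<zero>\<^bsub>T\<^esub>"
  using T.smult_l_null[of x] by simp

lemma smult_zero [simp]: "a \<odot>\<^bsub>T\<^esub> \<zero>\<^bsub>T\<^esub> = \<zero>\<^bsub>T\<^esub>"
  using T.smult_r_null[of a] by simp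

lemma smult_neg: "x \<in> carrier T \<Longrightarrow> x \<oplus>\<^bsub>T\<^esub> (-1) \<odot>\<^bsub>T\<^esub> x = \<zero>\<^bsub>T\<^esub>"
  using smult_add[of x 1 "-1"] by simp

lemma eq_of_diff_zero:
  assumes "x \<in> carrier T" "y \<in> carrier T" "x \<oplus>\<^bsub>T\<^esub> (-1) \<odot>\<^bsub>T\<^esub> y = \<zero>\<^bsub>T\<^esub>" shows "x = y"
proof -
  have "y = (x \<oplus>\<^bsub>T\<^esub> (-1) \<odot>\<^bsub>T\<^esub> y) \<oplus>\<^bsub>T\<^esub> y" using assms by simp
  also have "\<dots> = x \<oplus>\<^bsub>T\<^esub> (y \<oplus>\<^bsub>T\<^esub> (-1) \<odot>\<^bsub>T\<^esub> y)" using assms(1,2) by (simp add: T.a_ac)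
  finally show ?thesis using assms(1,2) by (simp add: smult_neg)
qed

lemma add_diff_cancel: "x \<in> carrier T \<Longrightarrow> y \<in> carrier T \<Longrightarrow> (x \<oplus>\<^bsub>T\<^esub> y) \<oplus>\<^bsub>T\<^esub> (-1) \<odot>\<^bsub>T\<^esub> y = x"
  using smult_neg[of y] by (simp add: T.a_assoc)

definition lc :: "'i set \<Rightarrow> ('i \<Rightarrow> 't) \<Rightarrow> ('i \<Rightarrow> 'a) \<Rightarrow> 't" where
  "lc I b c = (\<Oplus>\<^bsub>T\<^esub>i\<in>I. c i \<odot>\<^bsub>T\<^esub> b i)"

lemma lc_closed [simp]: "b \<in> I \<rightarrow> carrier T \<Longrightarrow> lc I b c \<in> carrier T"
  unfolding lc_def by (rule T.finsum_closed) auto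

lemma lc_cong: "b \<in> I \<rightarrow> carrier T \<Longrightarrow> (\<And>i. i \<in> I \<Longrightarrow> c i = c' i) \<Longrightarrow> lc I b c = lc I b c'"
  unfolding lc_def by (rule T.finsum_cong') auto

lemma lc_add: "b \<in> I \<rightarrow> carrier T \<Longrightarrow> lc I b (\<lambda>i. c i + c' i) = lc I b c \<oplus>\<^bsub>T\<^esub> lc I b c'"
proof -
  assume b: "b \<in> I \<rightarrow> carrier T"
  have "lc I b (\<lambda>i. c i + c' i) = (\<Oplus>\<^bsub>T\<^esub>i\<in>I. c i \<odot>\<^bsub>T\<^esub> b i \<oplus>\<^bsub>T\<^esub> c' i \<odot>\<^bsub>T\<^esub> b i)"
    unfolding lc_def using b by (intro T.finsum_cong') (auto simp: smult_add Pi_iff)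
  also have "\<dots> = lc I b c \<oplus>\<^bsub>T\<^esub> lc I b c'"
    unfolding lc_def using b by (intro T.finsum_addf) auto
  finally show ?thesis .
qed

lemma lc_smult:
  assumes "finite I" "b \<in> I \<rightarrow> carrier T" shows "lc I b (\<lambda>i. a * c i) = a \<odot>\<^bsub>T\<^esub> lc I b c"
proof -
  have "a \<odot>\<^bsub>T\<^esub> lc I b c = (\<Oplus>\<^bsub>T\<^esub>i\<in>I. a \<odot>\<^bsub>T\<^esub> (c i \<odot>\<^bsub>T\<^esub> b i))"
    unfolding lc_def using assms by (intro T.finsum_smult_ldistr) auto
  also have "\<dots> = lc I b (\<lambda>i. a * c i)"
    unfolding lc_def using assms by (intro T.finsum_cong') (auto simp: smult_mult Pi_iff)
  finally show ?thesis by simp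
qed

lemma lc_diff:
  assumes "finite I" "b \<in> I \<rightarrow> carrier T"
  shows "lc I b (\<lambda>i. c i - c' i) = lc I b c \<oplus>\<^bsub>T\<^esub> (-1) \<odot>\<^bsub>T\<^esub> lc I b c'"
  using lc_add[OF assms(2), of c "\<lambda>i. (-1) * c' i"] lc_smult[OF assms, of "-1" c'] by simp

lemma lc_delta:
  assumes "finite I" "b \<in> I \<rightarrow> carrier T" "i \<in> I"
  shows "lc I b (\<lambda>j. if j = i then a else 0) = a \<odot>\<^bsub>T\<^esub> b i"
proof -
  have "lc I b (\<lambda>j. if j = i then a else 0) = (\<Oplus>\<^bsub>T\<^esub>j\<in>I. if i = j then a \<odot>\<^bsub>T\<^esub> b j else \<zero>\<^bsub>T\<^esub>)"
    unfolding lc_def using assms by (intro T.finsum_cong') (auto simp: Pi_iff)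
  also have "\<dots> = a \<odot>\<^bsub>T\<^esub> b i" using assms by (intro T.finsum_singleton) auto
  finally show ?thesis .
qed

lemma lc_insert:
  assumes "finite I" "b \<in> insert i I \<rightarrow> carrier T" "i \<notin> I"
  shows "lc (insert i I) b c = c i \<odot>\<^bsub>T\<^esub> b i \<oplus>\<^bsub>T\<^esub> lc I b c"
  unfolding lc_def using assms by (intro T.finsum_insert) auto

lemma lc_remove:
  assumes "finite I" "b \<in> I \<rightarrow> carrier T" "i \<in> I" "c i = 0"
  shows "lc I b c = lc (I - {i}) b c"
proof -
  have I: "I = insert i (I - {i})" using assms(3) by auto
  have b: "b i \<in> carrier T" using assms by auto
  have "lc I b c = c i \<odot>\<^bsub>T\<^esub> b i \<oplus>\<^bsub>T\<^esub> lc (I - {i}) b c"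
    by (subst I, rule lc_insert) (use assms in auto)
  moreover have "lc (I - {i}) b c \<in> carrier T" using assms by (intro lc_closed) auto
  ultimately show ?thesis using assms(4) b by simp
qed

lemma lc_reindex:
  assumes "bij_betw f J I" "b \<in> I \<rightarrow> carrier T"
  shows "lc I b c = lc J (b \<circ> f) (c \<circ> f)"
proof -
  have I: "I = f ` J" and inj: "inj_on f J" using assms(1) by (auto simp: bij_betw_def)
  show ?thesis unfolding lc_def I
    by (subst T.finsum_reindex) (use assms inj in \<open>auto simp: I Pi_iff o_def\<close>)
qed

end

locale dvr_module = class_module T + D: complete_valuation_ring \<pi>
  for T :: "('a :: idom, 't) module" and \<pi> :: 'a +
  assumes torsion_free: "t \<in> carrier T \<Longrightarrow> \<pi> \<odot>\<^bsub>T\<^esub> t = \<zero>\<^bsub>T\<^esub> \<Longrightarrow> t = \<zero>\<^bsub>T\<^esub>"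
    and module_separated: "t \<in> carrier T \<Longrightarrow> (\<And>n. \<exists>u\<in>carrier T. t = \<pi> ^ n \<odot>\<^bsub>T\<^esub> u) \<Longrightarrow> t = \<zero>\<^bsub>T\<^esub>"
begin

definition spans_mod :: "'t set \<Rightarrow> bool" where
  "spans_mod B \<longleftrightarrow> finite B \<and> B \<subseteq> carrier T \<and>
     (\<forall>t\<in>carrier T. \<exists>c. \<exists>v\<in>carrier T. t = lc B (\<lambda>x. x) c \<oplus>\<^bsub>T\<^esub> \<pi> \<odot>\<^bsub>T\<^esub> v)"

text \<open>A relation modulo \<pi> with a unit coefficient at x allows x to be eliminated, so that
  B - {x} would still span modulo \<pi>, against minimality.\<close>

lemma minimal_independent_mod:
  assumes B: "spans_mod B" and min: "\<And>B'. spans_mod B' \<Longrightarrow> card B \<le> card B'"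
    and v: "v \<in> carrier T" "lc B (\<lambda>x. x) c = \<pi> \<odot>\<^bsub>T\<^esub> v" and x: "x \<in> B"
  shows "\<pi> dvd c x"
proof (rule ccontr)
  assume "\<not> \<pi> dvd c x"
  then obtain u where u: "1 = c x * u" using D.nonunit_iff by (metis dvdE)
  have fin: "finite B" and sub: "(\<lambda>x. x) \<in> B \<rightarrow> carrier T" using B by (auto simp: spans_mod_def)
  have "spans_mod (B - {x})"
    unfolding spans_mod_def
  proof (intro conjI ballI)
    fix t assume "t \<in> carrier T"
    then obtain a v' where a: "v' \<in> carrier T" "t = lc B (\<lambda>x. x) a \<oplus>\<^bsub>T\<^esub> \<pi> \<odot>\<^bsub>T\<^esub> v'"
      using B by (auto simp: spans_mod_def)
    define a' where "a' = (\<lambda>y. a y - (a x * u) * c y)"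
    have "a x * u * c x = a x" using u by (metis mult.assoc mult.commute mult_1_right)
    then have a'x: "a' x = 0" by (simp add: a'_def)
    have "lc B (\<lambda>x. x) a' = lc B (\<lambda>x. x) a \<oplus>\<^bsub>T\<^esub> (-1) \<odot>\<^bsub>T\<^esub> ((a x * u) \<odot>\<^bsub>T\<^esub> (\<pi> \<odot>\<^bsub>T\<^esub> v))"
      unfolding a'_def lc_diff[OF fin sub] lc_smult[OF fin sub] v(2) ..
    also have "\<dots> = lc B (\<lambda>x. x) a \<oplus>\<^bsub>T\<^esub> \<pi> \<odot>\<^bsub>T\<^esub> ((- (a x * u)) \<odot>\<^bsub>T\<^esub> v)"
      using v(1) by (simp add: smult_mult[symmetric] mult.commute)
    finally have "lc B (\<lambda>x. x) a' \<oplus>\<^bsub>T\<^esub> \<pi> \<odot>\<^bsub>T\<^esub> ((a x * u) \<odot>\<^bsub>T\<^esub> v) =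
        lc B (\<lambda>x. x) a \<oplus>\<^bsub>T\<^esub> \<pi> \<odot>\<^bsub>T\<^esub> ((- (a x * u)) \<odot>\<^bsub>T\<^esub> v \<oplus>\<^bsub>T\<^esub> (a x * u) \<odot>\<^bsub>T\<^esub> v)"
      using v(1) sub by (simp add: smult_add_right T.a_assoc)
    also have "(- (a x * u)) \<odot>\<^bsub>T\<^esub> v \<oplus>\<^bsub>T\<^esub> (a x * u) \<odot>\<^bsub>T\<^esub> v = \<zero>\<^bsub>T\<^esub>"
      using v(1) by (simp flip: smult_add)
    also have "lc B (\<lambda>x. x) a \<oplus>\<^bsub>T\<^esub> \<pi> \<odot>\<^bsub>T\<^esub> \<zero>\<^bsub>T\<^esub> = lc B (\<lambda>x. x) a"
      unfolding smult_zero by (rule T.M.r_zero[OF lc_closed[OF sub]])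
    finally have la: "lc B (\<lambda>x. x) a = lc B (\<lambda>x. x) a' \<oplus>\<^bsub>T\<^esub> \<pi> \<odot>\<^bsub>T\<^esub> ((a x * u) \<odot>\<^bsub>T\<^esub> v)" ..
    have "t = lc B (\<lambda>x. x) a' \<oplus>\<^bsub>T\<^esub> \<pi> \<odot>\<^bsub>T\<^esub> ((a x * u) \<odot>\<^bsub>T\<^esub> v \<oplus>\<^bsub>T\<^esub> v')"
      using a v(1) sub by (simp add: la smult_add_right T.a_assoc)
    moreover have "lc B (\<lambda>x. x) a' = lc (B - {x}) (\<lambda>x. x) a'" by (rule lc_remove[where c = a' and i = x, OF fin sub x a'x])
    moreover have "(a x * u) \<odot>\<^bsub>T\<^esub> v \<oplus>\<^bsub>T\<^esub> v' \<in> carrier T" using a v by simp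
    ultimately show "\<exists>c. \<exists>v\<in>carrier T. t = lc (B - {x}) (\<lambda>x. x) c \<oplus>\<^bsub>T\<^esub> \<pi> \<odot>\<^bsub>T\<^esub> v" by metis
  qed (use fin sub in auto)
  then have "card B \<le> card (B - {x})" by (rule min)
  then show False using x fin by (metis card_Diff1_less not_less)
qed

text \<open>All coefficients of a relation are divisible by \<pi>; torsion-freeness allows \<pi> to
  be cancelled, and the argument repeats.\<close>

lemma lc_zero_imp_zero:
  assumes fin: "finite B" and sub: "(\<lambda>x. x) \<in> B \<rightarrow> carrier T"
    and ind: "\<And>c v x. v \<in> carrier T \<Longrightarrow> lc B (\<lambda>x. x) c = \<pi> \<odot>\<^bsub>T\<^esub> v \<Longrightarrow> x \<in> B \<Longrightarrow> \<pi> dvd c x"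
    and z: "lc B (\<lambda>x. x) c = \<zero>\<^bsub>T\<^esub>" and x: "x \<in> B"
  shows "c x = 0"
proof -
  have "\<forall>c. lc B (\<lambda>x. x) c = \<zero>\<^bsub>T\<^esub> \<longrightarrow> (\<forall>x\<in>B. \<pi> ^ n dvd c x)" for n
  proof (induction n)
    case (Suc n)
    show ?case
    proof (intro allI impI ballI)
      fix c x assume c: "lc B (\<lambda>x. x) c = \<zero>\<^bsub>T\<^esub>" and x: "x \<in> B"
      have "\<forall>x\<in>B. \<exists>a. c x = \<pi> * a" using ind[of "\<zero>\<^bsub>T\<^esub>" c] c by (auto simp: dvd_def)
      then obtain c' where c': "\<And>x. x \<in> B \<Longrightarrow> c x = \<pi> * c' x" by metis
      have "\<pi> \<odot>\<^bsub>T\<^esub> lc B (\<lambda>x. x) c' = lc B (\<lambda>x. x) c"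
        unfolding lc_smult[OF fin sub, symmetric] by (rule lc_cong[OF sub]) (simp add: c')
      then have "lc B (\<lambda>x. x) c' = \<zero>\<^bsub>T\<^esub>" using torsion_free[of "lc B (\<lambda>x. x) c'"] c sub by simp
      then have "\<pi> ^ n dvd c' x" using Suc x by blast
      then show "\<pi> ^ Suc n dvd c x" using c'[OF x] by (simp add: mult_dvd_mono)
    qed
  qed simp
  then have "\<pi> ^ n dvd c x" for n using z x by blast
  then show ?thesis by (rule D.separated)
qed

text \<open>Successive approximation: t is a combination of B plus \<pi> times some s_1, which is
  again a combination plus \<pi> times some s_2, and so on. The coefficients converge in A, and the
  difference between t and the combination with the limit coefficients lies in every \<pi>^n
  T.\<close>

lemma spans_mod_imp_spans:
  assumes B: "spans_mod B" and t: "t \<in> carrier T"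
  shows "\<exists>c. t = lc B (\<lambda>x. x) c"
proof -
  have fin: "finite B" and sub: "(\<lambda>x. x) \<in> B \<rightarrow> carrier T" using B by (auto simp: spans_mod_def)
  have "\<forall>t\<in>carrier T. \<exists>c v. v \<in> carrier T \<and> t = lc B (\<lambda>x. x) c \<oplus>\<^bsub>T\<^esub> \<pi> \<odot>\<^bsub>T\<^esub> v"
    using B unfolding spans_mod_def Bex_def by blast
  then obtain C V where CV: "\<And>t. t \<in> carrier T \<Longrightarrow> V t \<in> carrier T \<and> t = lc B (\<lambda>x. x) (C t) \<oplus>\<^bsub>T\<^esub> \<pi> \<odot>\<^bsub>T\<^esub> V t" by metis
  define s where "s = rec_nat t (\<lambda>_. V)"
  have s: "s 0 = t" "s (Suc n) = V (s n)" for n by (simp_all add: s_def)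
  have sT: "s n \<in> carrier T" for n by (induction n) (simp_all add: s t CV)
  have exp: "t = lc B (\<lambda>x. x) (\<lambda>x. \<Sum>i<n. \<pi> ^ i * C (s i) x) \<oplus>\<^bsub>T\<^esub> \<pi> ^ n \<odot>\<^bsub>T\<^esub> s n" for n
  proof (induction n)
    case 0
    have "lc B (\<lambda>x. x) (\<lambda>x. 0) = 0 \<odot>\<^bsub>T\<^esub> lc B (\<lambda>x. x) (\<lambda>x. 0)" using lc_smult[OF fin sub, of 0 "\<lambda>x. 0"] by simp
    then show ?case using sub t by (simp add: s)
  next
    case (Suc n)
    have "\<pi> ^ n \<odot>\<^bsub>T\<^esub> s n = \<pi> ^ n \<odot>\<^bsub>T\<^esub> (lc B (\<lambda>x. x) (C (s n)) \<oplus>\<^bsub>T\<^esub> \<pi> \<odot>\<^bsub>T\<^esub> s (Suc n))"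
      using CV[OF sT[of n]] by (simp add: s)
    also have "\<dots> = lc B (\<lambda>x. x) (\<lambda>x. \<pi> ^ n * C (s n) x) \<oplus>\<^bsub>T\<^esub> \<pi> ^ Suc n \<odot>\<^bsub>T\<^esub> s (Suc n)"
      using sub sT[of "Suc n"] by (simp add: smult_add_right lc_smult[OF fin sub] smult_mult[symmetric] mult.commute)
    finally have "t = lc B (\<lambda>x. x) (\<lambda>x. \<Sum>i<n. \<pi> ^ i * C (s i) x) \<oplus>\<^bsub>T\<^esub>
        (lc B (\<lambda>x. x) (\<lambda>x. \<pi> ^ n * C (s n) x) \<oplus>\<^bsub>T\<^esub> \<pi> ^ Suc n \<odot>\<^bsub>T\<^esub> s (Suc n))" using Suc by simp
    then show ?case using sub sT[of "Suc n"] by (simp add: lc_add T.a_assoc)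
  qed
  have "\<forall>x. \<exists>y. \<forall>n. \<pi> ^ n dvd y - (\<Sum>i<n. \<pi> ^ i * C (s i) x)"
    by (intro allI tendsto_sum_digits D.complete_valuation_ring_axioms)
  then obtain c where c: "\<And>x n. \<pi> ^ n dvd c x - (\<Sum>i<n. \<pi> ^ i * C (s i) x)" by metis
  have "t \<oplus>\<^bsub>T\<^esub> (-1) \<odot>\<^bsub>T\<^esub> lc B (\<lambda>x. x) c = \<zero>\<^bsub>T\<^esub>"
  proof (rule module_separated)
    fix n
    have "\<forall>x. \<exists>a. c x - (\<Sum>i<n. \<pi> ^ i * C (s i) x) = \<pi> ^ n * a" using c[of n] by (auto simp: dvd_def)
    then obtain a where a: "\<And>x. c x - (\<Sum>i<n. \<pi> ^ i * C (s i) x) = \<pi> ^ n * a x" by metis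
    have "c = (\<lambda>x. (\<Sum>i<n. \<pi> ^ i * C (s i) x) + \<pi> ^ n * a x)" using a by (auto simp: algebra_simps)
    then have lcc: "lc B (\<lambda>x. x) c = lc B (\<lambda>x. x) (\<lambda>x. \<Sum>i<n. \<pi> ^ i * C (s i) x) \<oplus>\<^bsub>T\<^esub> \<pi> ^ n \<odot>\<^bsub>T\<^esub> lc B (\<lambda>x. x) a"
      using lc_add[OF sub] lc_smult[OF fin sub] by simp
    let ?L = "lc B (\<lambda>x. x) (\<lambda>x. \<Sum>i<n. \<pi> ^ i * C (s i) x)"
    have L: "?L \<in> carrier T" "lc B (\<lambda>x. x) a \<in> carrier T" using sub by simp_all
    have "t \<oplus>\<^bsub>T\<^esub> (-1) \<odot>\<^bsub>T\<^esub> lc B (\<lambda>x. x) c = (?L \<oplus>\<^bsub>T\<^esub> \<pi> ^ n \<odot>\<^bsub>T\<^esub> s n) \<oplus>\<^bsub>T\<^esub> (-1) \<odot>\<^bsub>T\<^esub> (?L \<oplus>\<^bsub>T\<^esub> \<pi> ^ n \<odot>\<^bsub>T\<^esub> lc B (\<lambda>x. x) a)"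
      unfolding lcc using exp[of n] by simp
    also have "\<dots> = (?L \<oplus>\<^bsub>T\<^esub> (-1) \<odot>\<^bsub>T\<^esub> ?L) \<oplus>\<^bsub>T\<^esub> (\<pi> ^ n \<odot>\<^bsub>T\<^esub> s n \<oplus>\<^bsub>T\<^esub> (-1) \<odot>\<^bsub>T\<^esub> (\<pi> ^ n \<odot>\<^bsub>T\<^esub> lc B (\<lambda>x. x) a))"
      using L sT[of n] by (simp add: smult_add_right T.a_ac)
    also have "\<dots> = \<pi> ^ n \<odot>\<^bsub>T\<^esub> (s n \<oplus>\<^bsub>T\<^esub> (-1) \<odot>\<^bsub>T\<^esub> lc B (\<lambda>x. x) a)"
      using L sT[of n] by (simp add: smult_neg smult_add_right smult_mult[symmetric])
    finally show "\<exists>u\<in>carrier T. t \<oplus>\<^bsub>T\<^esub> (-1) \<odot>\<^bsub>T\<^esub> lc B (\<lambda>x. x) c = \<pi> ^ n \<odot>\<^bsub>T\<^esub> u" using L sT[of n] by auto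
  qed (use t sub in simp)
  then show ?thesis using eq_of_diff_zero[OF t lc_closed[OF sub]] by blast
qed

text \<open>\<kappa> labels the classes modulo \<pi> T, which avoids the quotient module. A minimal
  set B that spans modulo \<pi> is a basis. Its size is d, because the combinations of B with
  coefficients from a set R of residue representatives meet each of the classes exactly once, and
  their number is the d-th power of \<open>residue_card \<pi>\<close>.\<close>

theorem free_basis_exists:
  fixes \<kappa> :: "'t \<Rightarrow> 'x"
  assumes \<kappa>: "\<And>t u. t \<in> carrier T \<Longrightarrow> u \<in> carrier T \<Longrightarrow> \<kappa> t = \<kappa> u \<longleftrightarrow> (\<exists>v\<in>carrier T. t = u \<oplus>\<^bsub>T\<^esub> \<pi> \<odot>\<^bsub>T\<^esub> v)"
    and card: "finite (\<kappa> ` carrier T)" "card (\<kappa> ` carrier T) = residue_card \<pi> ^ d"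
    and q: "residue_card \<pi> > 1"
  shows "\<exists>b. free_module_basis T d b"
proof -
  have "\<exists>B. spans_mod B"
  proof -
    define r where "r = (\<lambda>y. SOME t. t \<in> carrier T \<and> \<kappa> t = y)"
    have r: "r y \<in> carrier T" "\<kappa> (r y) = y" if "y \<in> \<kappa> ` carrier T" for y
    proof -
      have "\<exists>t. t \<in> carrier T \<and> \<kappa> t = y" using that by auto
      from someI_ex[OF this] show "r y \<in> carrier T" "\<kappa> (r y) = y" by (auto simp: r_def)
    qed
    define B where "B = r ` \<kappa> ` carrier T"
    have B: "finite B" "B \<subseteq> carrier T" using card(1) r by (auto simp: B_def)
    have "\<exists>c. \<exists>v\<in>carrier T. t = lc B (\<lambda>x. x) c \<oplus>\<^bsub>T\<^esub> \<pi> \<odot>\<^bsub>T\<^esub> v" if t: "t \<in> carrier T" for t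
    proof -
      have rt: "r (\<kappa> t) \<in> carrier T" "\<kappa> t = \<kappa> (r (\<kappa> t))" using r t by auto
      then obtain v where v: "v \<in> carrier T" "t = r (\<kappa> t) \<oplus>\<^bsub>T\<^esub> \<pi> \<odot>\<^bsub>T\<^esub> v" using \<kappa>[OF t rt(1)] by auto
      have "r (\<kappa> t) \<in> B" using t by (auto simp: B_def)
      then have "lc B (\<lambda>x. x) (\<lambda>j. if j = r (\<kappa> t) then 1 else 0) = r (\<kappa> t)"
      proof -
        have "(\<lambda>x. x) \<in> B \<rightarrow> carrier T" using B(2) by auto
        from lc_delta[OF B(1) this \<open>r (\<kappa> t) \<in> B\<close>, of 1] smult_1[OF rt(1)] show ?thesis by (rule trans)
      qed
      then show ?thesis using v by metis
    qed
    then show ?thesis using B by (auto simp: spans_mod_def)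
  qed
  then obtain B where B: "spans_mod B" and min: "\<And>B'. spans_mod B' \<Longrightarrow> card B \<le> card B'"
    using ex_has_least_nat[of spans_mod _ card] by blast
  have fin: "finite B" and subB: "B \<subseteq> carrier T" and sub: "(\<lambda>x. x) \<in> B \<rightarrow> carrier T"
    using B by (auto simp: spans_mod_def)
  have ind: "\<pi> dvd c x"
    if "v \<in> carrier T" "lc B (\<lambda>x. x) c = \<pi> \<odot>\<^bsub>T\<^esub> v" "x \<in> B" for c v x
    by (rule minimal_independent_mod[OF B]) (use min that in auto)
  have rc: "residue_card \<pi> \<noteq> 0" using q by simp
  obtain R where R: "finite R" "card R = residue_card \<pi>" "\<And>a. \<exists>!r. r \<in> R \<and> \<pi> dvd a - r"
    by (rule residue_representatives[OF rc]) blast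
  have "bij_betw (\<lambda>f. \<kappa> (lc B (\<lambda>x. x) f)) (B \<rightarrow>\<^sub>E R) (\<kappa> ` carrier T)"
    unfolding bij_betw_def
  proof
    show "inj_on (\<lambda>f. \<kappa> (lc B (\<lambda>x. x) f)) (B \<rightarrow>\<^sub>E R)"
    proof (rule inj_onI)
      fix f f' assume f: "f \<in> B \<rightarrow>\<^sub>E R" "f' \<in> B \<rightarrow>\<^sub>E R" and eq: "\<kappa> (lc B (\<lambda>x. x) f) = \<kappa> (lc B (\<lambda>x. x) f')"
      then obtain v where v: "v \<in> carrier T" "lc B (\<lambda>x. x) f = lc B (\<lambda>x. x) f' \<oplus>\<^bsub>T\<^esub> \<pi> \<odot>\<^bsub>T\<^esub> v" using \<kappa> sub by auto
      then have "lc B (\<lambda>x. x) (\<lambda>x. f x - f' x) = \<pi> \<odot>\<^bsub>T\<^esub> v"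
        using sub add_diff_cancel[of "\<pi> \<odot>\<^bsub>T\<^esub> v" "lc B (\<lambda>x. x) f'"] by (simp add: lc_diff[OF fin sub] T.a_comm)
      then have d: "\<pi> dvd f x - f' x" if "x \<in> B" for x using ind[OF v(1)] that by blast
      show "f = f'"
      proof (rule PiE_ext[OF f])
        fix x assume x: "x \<in> B"
        have "f x \<in> R" "f' x \<in> R" using f x by auto
        then show "f x = f' x" using R(3)[of "f x"] d[OF x] by (metis diff_self dvd_0_right)
      qed
    qed
    show "(\<lambda>f. \<kappa> (lc B (\<lambda>x. x) f)) ` (B \<rightarrow>\<^sub>E R) = \<kappa> ` carrier T"
    proof (intro equalityI subsetI)
      fix y assume "y \<in> \<kappa> ` carrier T"
      then obtain t where t: "t \<in> carrier T" "y = \<kappa> t" by auto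
      obtain c v where c: "v \<in> carrier T" "t = lc B (\<lambda>x. x) c \<oplus>\<^bsub>T\<^esub> \<pi> \<odot>\<^bsub>T\<^esub> v" using B t(1) by (auto simp: spans_mod_def)
      have "\<forall>a. \<exists>r b. r \<in> R \<and> a = r + \<pi> * b"
        using R(3) by (metis add.commute diff_add_cancel dvdE)
      then obtain rr bb where rb: "\<And>a. rr a \<in> R \<and> a = rr a + \<pi> * bb a" by metis
      define f where "f = restrict (\<lambda>x. rr (c x)) B"
      have "lc B (\<lambda>x. x) c = lc B (\<lambda>x. x) (\<lambda>x. f x + \<pi> * bb (c x))"
        using rb by (intro lc_cong[OF sub]) (auto simp: f_def)
      also have "\<dots> = lc B (\<lambda>x. x) f \<oplus>\<^bsub>T\<^esub> \<pi> \<odot>\<^bsub>T\<^esub> lc B (\<lambda>x. x) (\<lambda>x. bb (c x))"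
        using lc_add[OF sub] lc_smult[OF fin sub] by simp
      finally have "t = lc B (\<lambda>x. x) f \<oplus>\<^bsub>T\<^esub> \<pi> \<odot>\<^bsub>T\<^esub> (lc B (\<lambda>x. x) (\<lambda>x. bb (c x)) \<oplus>\<^bsub>T\<^esub> v)"
        using c sub by (simp add: smult_add_right T.a_assoc)
      then have "\<kappa> t = \<kappa> (lc B (\<lambda>x. x) f)" using \<kappa>[OF t(1), of "lc B (\<lambda>x. x) f"] c(1) sub by auto
      moreover have "f \<in> B \<rightarrow>\<^sub>E R" using rb by (auto simp: f_def)
      ultimately show "y \<in> (\<lambda>f. \<kappa> (lc B (\<lambda>x. x) f)) ` (B \<rightarrow>\<^sub>E R)" using t(2) by auto
    qed (use sub in auto)
  qed
  then have "card (B \<rightarrow>\<^sub>E R) = residue_card \<pi> ^ d" using card(2) bij_betw_same_card by metis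
  then have "residue_card \<pi> ^ card B = residue_card \<pi> ^ d" using fin R(2) by (simp add: card_PiE)
  then have cB: "card B = d" using q by (simp add: power_inject_exp)
  obtain b where b: "bij_betw b {..<d} B"
    using ex_bij_betw_nat_finite[OF fin] cB by (auto simp: atLeast0LessThan)
  have bT: "b \<in> {..<d} \<rightarrow> carrier T" using b subB by (auto simp: bij_betw_def)
  have lcb: "(\<Oplus>\<^bsub>T\<^esub>i\<in>{..<d}. vec_index (vec d (c \<circ> b)) i \<odot>\<^bsub>T\<^esub> b i) = lc B (\<lambda>x. x) c" for c
  proof -
    have "lc B (\<lambda>x. x) c = lc {..<d} b (c \<circ> b)" using lc_reindex[OF b sub] by (simp add: comp_def)
    also have "\<dots> = (\<Oplus>\<^bsub>T\<^esub>i\<in>{..<d}. vec_index (vec d (c \<circ> b)) i \<odot>\<^bsub>T\<^esub> b i)"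
      unfolding lc_def using bT by (intro T.finsum_cong') auto
    finally show ?thesis by simp
  qed
  have vecb: "\<exists>c'. v = vec d (c' \<circ> b)" if v: "v \<in> carrier_vec d" for v :: "'a vec"
  proof (intro exI)
    show "v = vec d ((\<lambda>x. vec_index v (inv_into {..<d} b x)) \<circ> b)"
      using v b by (intro eq_vecI) (auto simp: bij_betw_def)
  qed
  have "\<exists>!c. c \<in> carrier_vec d \<and> t = (\<Oplus>\<^bsub>T\<^esub>i\<in>{..<d}. vec_index c i \<odot>\<^bsub>T\<^esub> b i)" if t: "t \<in> carrier T" for t
  proof -
    obtain c where c: "t = lc B (\<lambda>x. x) c" using spans_mod_imp_spans[OF B t] by blast
    show ?thesis
    proof (rule ex1I)
      show "vec d (c \<circ> b) \<in> carrier_vec d \<and> t = (\<Oplus>\<^bsub>T\<^esub>i\<in>{..<d}. vec_index (vec d (c \<circ> b)) i \<odot>\<^bsub>T\<^esub> b i)"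
        unfolding lcb using c by simp
      fix v assume v: "v \<in> carrier_vec d \<and> t = (\<Oplus>\<^bsub>T\<^esub>i\<in>{..<d}. vec_index v i \<odot>\<^bsub>T\<^esub> b i)"
      then obtain c' where c': "v = vec d (c' \<circ> b)" using vecb by blast
      then have "t = lc B (\<lambda>x. x) c'" using v lcb by simp
      then have diff0: "lc B (\<lambda>x. x) (\<lambda>x. c' x - c x) = \<zero>\<^bsub>T\<^esub>"
        using c sub by (simp add: lc_diff[OF fin sub] smult_neg)
      have "c' x - c x = 0" if "x \<in> B" for x
        by (rule lc_zero_imp_zero[where B = B and c = "\<lambda>x. c' x - c x", OF fin sub _ diff0 that])
          (rule ind, assumption+)
      then have "(c' \<circ> b) i = (c \<circ> b) i" if "i < d" for i using that b by (auto simp: bij_betw_def)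
      then show "v = vec d (c \<circ> b)" unfolding c' by (intro eq_vecI) auto
    qed
  qed
  moreover have "Module.module class_ring T" by (rule T.module_axioms)
  ultimately show ?thesis using bT unfolding free_module_basis_def by blast
qed

end

section \<open>Matrices of automorphism groups of a free module\<close>

lemma mat_unit_vec_col:
  fixes A :: "'a :: semiring_1 mat"
  assumes "A \<in> carrier_mat n m" "j < m" shows "A *\<^sub>v unit_vec m j = col A j"
  using assms by (intro eq_vecI) (auto simp: scalar_prod_right_unit)

locale free_class_module = class_module T
  for T :: "('a :: idom, 't) module" +
  fixes d :: nat and b :: "nat \<Rightarrow> 't"
  assumes basis: "free_module_basis T d b"
begin

abbreviation comb :: "'a vec \<Rightarrow> 't" where
  "comb c \<equiv> lc {..<d} b (vec_index c)"

lemma b_closed: "b \<in> {..<d} \<rightarrow> carrier T"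
  using basis by (simp add: free_module_basis_def)

lemma coords: assumes "t \<in> carrier T" shows "coords T d b t \<in> carrier_vec d" "comb (coords T d b t) = t"
proof -
  have "\<exists>!c. c \<in> carrier_vec d \<and> t = comb c" using basis assms by (auto simp: free_module_basis_def lc_def)
  from theI'[OF this] show "coords T d b t \<in> carrier_vec d" "comb (coords T d b t) = t"
    by (auto simp: coords_def lc_def)
qed

lemma coords_comb: assumes "c \<in> carrier_vec d" shows "coords T d b (comb c) = c"
proof -
  have "comb c \<in> carrier T" using b_closed by simp
  then have "\<exists>!c'. c' \<in> carrier_vec d \<and> comb c = comb c'" using basis by (auto simp: free_module_basis_def lc_def)
  then show ?thesis using assms coords[OF \<open>comb c \<in> carrier T\<close>] by metis
qed

lemma comb_inj: "c \<in> carrier_vec d \<Longrightarrow> c' \<in> carrier_vec d \<Longrightarrow> comb c = comb c' \<Longrightarrow> c = c'"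
  by (metis coords_comb)

lemma comb_add:
  assumes "c \<in> carrier_vec d" "c' \<in> carrier_vec d"
  shows "comb (c + c') = comb c \<oplus>\<^bsub>T\<^esub> comb c'"
proof -
  have "comb (c + c') = lc {..<d} b (\<lambda>i. vec_index c i + vec_index c' i)"
    using assms by (intro lc_cong b_closed) auto
  then show ?thesis by (simp add: lc_add[OF b_closed])
qed

lemma comb_smult:
  assumes "c \<in> carrier_vec d" shows "comb (a \<cdot>\<^sub>v c) = a \<odot>\<^bsub>T\<^esub> comb c"
proof -
  have "comb (a \<cdot>\<^sub>v c) = lc {..<d} b (\<lambda>i. a * vec_index c i)"
    using assms by (intro lc_cong b_closed) auto
  then show ?thesis by (simp add: lc_smult[OF finite_lessThan b_closed])
qed

lemma comb_unit: "i < d \<Longrightarrow> comb (unit_vec d i) = b i"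
proof -
  assume i: "i < d"
  have "comb (unit_vec d i) = lc {..<d} b (\<lambda>j. if j = i then 1 else 0)"
    using i by (intro lc_cong b_closed) auto
  also have "\<dots> = 1 \<odot>\<^bsub>T\<^esub> b i" using i by (intro lc_delta b_closed) auto
  finally show ?thesis using smult_1[OF funcset_mem[OF b_closed, of i]] i by simp
qed

definition matrix_of :: "('t \<Rightarrow> 't) \<Rightarrow> 'a mat" where
  "matrix_of L = mat d d (\<lambda>(i, j). vec_index (coords T d b (L (b j))) i)"

definition linear_on :: "('t \<Rightarrow> 't) \<Rightarrow> bool" where
  "linear_on L \<longleftrightarrow> (\<forall>t\<in>carrier T. L t \<in> carrier T) \<and>
     (\<forall>t\<in>carrier T. \<forall>u\<in>carrier T. L (t \<oplus>\<^bsub>T\<^esub> u) = L t \<oplus>\<^bsub>T\<^esub> L u) \<and>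
     (\<forall>a. \<forall>t\<in>carrier T. L (a \<odot>\<^bsub>T\<^esub> t) = a \<odot>\<^bsub>T\<^esub> L t)"

lemma linear_on_lc:
  assumes L: "linear_on L" and f: "f \<in> I \<rightarrow> carrier T" and fin: "finite I"
  shows "L (lc I f c) = lc I (L \<circ> f) c"
  using fin f
proof (induction I rule: finite_induct)
  case empty
  have "L (\<zero>\<^bsub>T\<^esub>) = L (0 \<odot>\<^bsub>T\<^esub> \<zero>\<^bsub>T\<^esub>)" by simp
  also have "\<dots> = 0 \<odot>\<^bsub>T\<^esub> L (\<zero>\<^bsub>T\<^esub>)" using L T.zero_closed unfolding linear_on_def by blast
  also have "\<dots> = \<zero>\<^bsub>T\<^esub>" using L T.zero_closed unfolding linear_on_def by simp
  finally show ?case by (simp add: lc_def)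
next
  case (insert i I)
  have f: "f i \<in> carrier T" "f \<in> I \<rightarrow> carrier T" using insert.prems by auto
  have Lf: "L \<circ> f \<in> insert i I \<rightarrow> carrier T" using L insert.prems by (auto simp: linear_on_def)
  have "L (lc (insert i I) f c) = L (c i \<odot>\<^bsub>T\<^esub> f i \<oplus>\<^bsub>T\<^esub> lc I f c)"
    using insert by (simp add: lc_insert)
  also have "\<dots> = c i \<odot>\<^bsub>T\<^esub> L (f i) \<oplus>\<^bsub>T\<^esub> L (lc I f c)" using L f by (simp add: linear_on_def)
  also have "\<dots> = lc (insert i I) (L \<circ> f) c"
    unfolding insert.IH[OF f(2)] using lc_insert[OF insert.hyps(1) Lf insert.hyps(2)] by simp
  finally show ?case .
qed

lemma matrix_of_carrier [simp]: "matrix_of L \<in> carrier_mat d d"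
  by (simp add: matrix_of_def)

lemma matrix_of_mult_vec:
  assumes L: "linear_on L" and c: "c \<in> carrier_vec d"
  shows "L (comb c) = comb (matrix_of L *\<^sub>v c)"
proof -
  have Lb: "L (b j) \<in> carrier T" if "j < d" for j using L b_closed that by (auto simp: linear_on_def)
  have col: "comb (col (matrix_of L) j) = L (b j)" if j: "j < d" for j
  proof -
    have "col (matrix_of L) j = coords T d b (L (b j))"
      using j coords(1)[OF Lb[OF j]] by (intro eq_vecI) (auto simp: matrix_of_def)
    then show ?thesis using coords(2)[OF Lb[OF j]] by simp
  qed
  \<comment> \<open>Induction on an index k from which on v vanishes; each step splits off one
    coordinate.\<close>
  have Mc: "comb (matrix_of L *\<^sub>v v) = lc {..<d} (L \<circ> b) (vec_index v)"
    if v: "v \<in> carrier_vec d" "\<forall>i<d. i \<ge> k \<longrightarrow> vec_index v i = 0" for k v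
    using v
  proof (induction k arbitrary: v)
    case 0
    then have v0: "v = 0\<^sub>v d" by (intro eq_vecI) auto
    have lc0: "lc {..<d} f (vec_index (0\<^sub>v d)) = \<zero>\<^bsub>T\<^esub>" if f: "f \<in> {..<d} \<rightarrow> carrier T" for f
    proof -
      have "lc {..<d} f (vec_index (0\<^sub>v d)) = lc {..<d} f (\<lambda>i. 0 * 0)"
        by (intro lc_cong f) auto
      also have "\<dots> = 0 \<odot>\<^bsub>T\<^esub> lc {..<d} f (\<lambda>i. 0)" by (rule lc_smult[OF finite_lessThan f])
      finally show ?thesis using f by simp
    qed
    have "L \<circ> b \<in> {..<d} \<rightarrow> carrier T" using Lb by auto
    moreover have "matrix_of L *\<^sub>v 0\<^sub>v d = 0\<^sub>v d"
      by (intro eq_vecI) (auto simp: matrix_of_def scalar_prod_def)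
    ultimately show ?case unfolding v0 by (simp only: lc0[OF b_closed] lc0)
  next
    case (Suc k)
    show ?case
    proof (cases "k < d")
      case False
      then show ?thesis using Suc by auto
    next
      case True
      define w where "w = v - vec_index v k \<cdot>\<^sub>v unit_vec d k"
      have w: "w \<in> carrier_vec d" "\<forall>i<d. i \<ge> k \<longrightarrow> vec_index w i = 0"
        using Suc.prems True by (auto simp: w_def)
      have vw: "v = w + vec_index v k \<cdot>\<^sub>v unit_vec d k" using Suc.prems(1) by (intro eq_vecI) (auto simp: w_def)
      have "matrix_of L *\<^sub>v v = matrix_of L *\<^sub>v w + vec_index v k \<cdot>\<^sub>v col (matrix_of L) k"
      proof -
        have "matrix_of L *\<^sub>v unit_vec d k = col (matrix_of L) k"
          using True by (intro mat_unit_vec_col[of _ d d]) auto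
        moreover have sm: "matrix_of L *\<^sub>v (a \<cdot>\<^sub>v unit_vec d k) = a \<cdot>\<^sub>v (matrix_of L *\<^sub>v unit_vec d k)" for a
          by (intro eq_vecI) (auto simp: scalar_prod_def sum_distrib_left mult_ac matrix_of_def intro!: sum.cong)
        ultimately show ?thesis
          by (subst vw, subst mult_add_distrib_mat_vec[of _ d d])
             (use w(1) True in \<open>auto simp: sm\<close>)
      qed
      have "comb (matrix_of L *\<^sub>v v) = comb (matrix_of L *\<^sub>v w) \<oplus>\<^bsub>T\<^esub> vec_index v k \<odot>\<^bsub>T\<^esub> L (b k)"
      proof -
        have "matrix_of L *\<^sub>v w \<in> carrier_vec d" by (rule mult_mat_vec_carrier[OF matrix_of_carrier w(1)])
        moreover have "col (matrix_of L) k \<in> carrier_vec d" by (intro carrier_vecI) (simp add: matrix_of_def)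
        ultimately show ?thesis
          using \<open>matrix_of L *\<^sub>v v = _\<close> True by (simp add: comb_add comb_smult col)
      qed
      also have "comb (matrix_of L *\<^sub>v w) = lc {..<d} (L \<circ> b) (vec_index w)" by (rule Suc.IH[OF w])
      also have "vec_index v k \<odot>\<^bsub>T\<^esub> L (b k) = lc {..<d} (L \<circ> b) (\<lambda>j. if j = k then vec_index v k else 0)"
        using lc_delta[of "{..<d}" "L \<circ> b" k] Lb True by auto
      also have "lc {..<d} (L \<circ> b) (vec_index w) \<oplus>\<^bsub>T\<^esub> \<dots> = lc {..<d} (L \<circ> b) (vec_index v)"
      proof -
        have "lc {..<d} (L \<circ> b) (vec_index v) =
            lc {..<d} (L \<circ> b) (\<lambda>j. vec_index w j + (if j = k then vec_index v k else 0))"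
          using Lb Suc.prems(1) True by (intro lc_cong) (auto simp: w_def)
        then show ?thesis using Lb by (subst (asm) lc_add) auto
      qed
      finally show ?thesis .
    qed
  qed
  show ?thesis using Mc[OF c, of d] linear_on_lc[OF L b_closed finite_lessThan] by simp
qed

lemma matrix_of_comp:
  assumes L: "linear_on L" "linear_on L'" and K: "\<And>t. t \<in> carrier T \<Longrightarrow> K t = L (L' t)"
  shows "matrix_of K = matrix_of L * matrix_of L'"
proof (rule eq_matI)
  fix i j assume ij: "i < dim_row (matrix_of L * matrix_of L')" "j < dim_col (matrix_of L * matrix_of L')"
  then have ij: "i < d" "j < d" by (auto simp: matrix_of_def)
  have bj: "b j \<in> carrier T" using b_closed ij by auto
  have "K (b j) = L (L' (comb (unit_vec d j)))" using K[OF bj] ij by (simp add: comb_unit)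
  also have "\<dots> = comb (matrix_of L *\<^sub>v (matrix_of L' *\<^sub>v unit_vec d j))"
    by (subst matrix_of_mult_vec[OF L(2)], simp, subst matrix_of_mult_vec[OF L(1)])
       (auto intro: mult_mat_vec_carrier[OF matrix_of_carrier])
  also have "matrix_of L *\<^sub>v (matrix_of L' *\<^sub>v unit_vec d j) = (matrix_of L * matrix_of L') *\<^sub>v unit_vec d j"
    by (rule assoc_mult_mat_vec[of _ d d _ d, symmetric]) auto
  also have "\<dots> = col (matrix_of L * matrix_of L') j"
    by (rule mat_unit_vec_col[OF mult_carrier_mat[OF matrix_of_carrier matrix_of_carrier] ij(2)])
  finally have "coords T d b (K (b j)) = col (matrix_of L * matrix_of L') j"
    using ij by (simp add: coords_comb carrier_vecI matrix_of_def)
  then show "matrix_of K $$ (i, j) = (matrix_of L * matrix_of L') $$ (i, j)"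
    using ij by (simp add: matrix_of_def)
qed (auto simp: matrix_of_def)

lemma matrix_of_id:
  assumes "\<And>t. t \<in> carrier T \<Longrightarrow> K t = t" shows "matrix_of K = 1\<^sub>m d"
proof (rule eq_matI)
  fix i j assume "i < dim_row (1\<^sub>m d :: 'a mat)" "j < dim_col (1\<^sub>m d :: 'a mat)"
  then have ij: "i < d" "j < d" by auto
  then have "K (b j) = comb (unit_vec d j)" using assms b_closed by (auto simp: comb_unit)
  then show "matrix_of K $$ (i, j) = 1\<^sub>m d $$ (i, j)"
    using ij by (simp add: matrix_of_def coords_comb)
qed (auto simp: matrix_of_def)

lemma representation_hom:
  fixes \<Gamma> :: "'g monoid"
  assumes lin: "\<And>\<sigma>. \<sigma> \<in> carrier \<Gamma> \<Longrightarrow> linear_on (act \<sigma>)"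
    and mult: "\<And>\<sigma> \<tau> t. \<sigma> \<in> carrier \<Gamma> \<Longrightarrow> \<tau> \<in> carrier \<Gamma> \<Longrightarrow> t \<in> carrier T \<Longrightarrow> act (\<sigma> \<otimes>\<^bsub>\<Gamma>\<^esub> \<tau>) t = act \<sigma> (act \<tau> t)"
    and inv: "\<And>\<sigma>. \<sigma> \<in> carrier \<Gamma> \<Longrightarrow> \<exists>\<tau>\<in>carrier \<Gamma>. \<forall>t\<in>carrier T. act \<sigma> (act \<tau> t) = t \<and> act \<tau> (act \<sigma> t) = t"
  shows "(\<lambda>\<sigma>. matrix_of (act \<sigma>)) \<in> hom \<Gamma> (GL d)"
proof (rule homI)
  fix \<sigma> assume \<sigma>: "\<sigma> \<in> carrier \<Gamma>"
  then obtain \<tau> where \<tau>: "\<tau> \<in> carrier \<Gamma>" "\<forall>t\<in>carrier T. act \<sigma> (act \<tau> t) = t \<and> act \<tau> (act \<sigma> t) = t"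
    using inv by blast
  have "matrix_of (act \<sigma>) * matrix_of (act \<tau>) = 1\<^sub>m d"
    using matrix_of_comp[OF lin[OF \<sigma>] lin[OF \<tau>(1)], of "\<lambda>t. act \<sigma> (act \<tau> t)"] matrix_of_id[of "\<lambda>t. act \<sigma> (act \<tau> t)"] \<tau>(2)
    by simp
  moreover have "matrix_of (act \<tau>) * matrix_of (act \<sigma>) = 1\<^sub>m d"
    using matrix_of_comp[OF lin[OF \<tau>(1)] lin[OF \<sigma>], of "\<lambda>t. act \<tau> (act \<sigma> t)"] matrix_of_id[of "\<lambda>t. act \<tau> (act \<sigma> t)"] \<tau>(2)
    by simp
  ultimately show "matrix_of (act \<sigma>) \<in> carrier (GL d)"
    by (auto simp: GL_def units_of_def Units_def ring_mat_def intro: bexI[of _ "matrix_of (act \<tau>)"])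
next
  fix \<sigma> \<tau> assume "\<sigma> \<in> carrier \<Gamma>" "\<tau> \<in> carrier \<Gamma>"
  then show "matrix_of (act (\<sigma> \<otimes>\<^bsub>\<Gamma>\<^esub> \<tau>)) = matrix_of (act \<sigma>) \<otimes>\<^bsub>GL d\<^esub> matrix_of (act \<tau>)"
    using matrix_of_comp[OF lin lin, of \<sigma> \<tau> "act (\<sigma> \<otimes>\<^bsub>\<Gamma>\<^esub> \<tau>)"] mult
    by (simp add: GL_def units_of_def ring_mat_def)
qed

lemma common_denominator:
  fixes w :: "'a fract vec"
  assumes "w \<in> carrier_vec d"
  shows "\<exists>s c. s \<noteq> 0 \<and> c \<in> carrier_vec d \<and> map_vec to_fract c = to_fract s \<cdot>\<^sub>v w"
proof -
  have "\<exists>s. s \<noteq> 0 \<and> (\<forall>i<k. \<exists>a. to_fract a = to_fract s * vec_index w i)" for k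
  proof (induction k)
    case 0
    show ?case by (intro exI[of _ 1]) simp
  next
    case (Suc k)
    then obtain s where s: "s \<noteq> 0" "\<forall>i<k. \<exists>a. to_fract a = to_fract s * vec_index w i" by blast
    obtain x y where xy: "vec_index w k = Fract x y" "y \<noteq> 0" by (cases "vec_index w k") auto
    have y: "to_fract y * vec_index w k = to_fract x" using xy by (simp add: to_fract_def eq_fract)
    have "\<exists>a. to_fract a = to_fract (s * y) * vec_index w i" if i: "i < Suc k" for i
    proof (cases "i = k")
      case True
      then show ?thesis using y by (intro exI[of _ "s * x"]) (simp add: mult.assoc)
    next
      case False
      then obtain a where "to_fract a = to_fract s * vec_index w i" using s(2) i by (metis less_Suc_eq)
      then show ?thesis by (intro exI[of _ "y * a"]) (simp add: mult_ac)
    qed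
    then show ?case using s(1) xy(2) by (intro exI[of _ "s * y"]) simp
  qed
  then obtain s where s: "s \<noteq> 0" "\<forall>i<d. \<exists>a. to_fract a = to_fract s * vec_index w i" by blast
  then obtain a where a: "\<And>i. i < d \<Longrightarrow> to_fract (a i) = to_fract s * vec_index w i" by metis
  have "map_vec to_fract (vec d a) = to_fract s \<cdot>\<^sub>v w" using assms a by (intro eq_vecI) auto
  then show ?thesis using s(1) by (intro exI[of _ s] exI[of _ "vec d a"]) simp
qed

text \<open>After clearing denominators, a nonzero invariant subspace W contains a nonzero integral
  vector c. Its orbit contains c + \<pi>^n e_i for every basis vector e_i, so W contains the
  differences \<pi>^n e_i and hence everything.\<close>

lemma representation_irreducible:
  fixes \<Gamma> :: "'g set"
  assumes d: "d > 0" and \<pi>: "\<pi> \<noteq> 0" and lin: "\<And>\<sigma>. \<sigma> \<in> \<Gamma> \<Longrightarrow> linear_on (act \<sigma>)"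
    and "open": "\<And>t. t \<in> carrier T \<Longrightarrow> t \<noteq> \<zero>\<^bsub>T\<^esub> \<Longrightarrow> \<exists>n. \<forall>u\<in>carrier T. \<exists>\<sigma>\<in>\<Gamma>. t \<oplus>\<^bsub>T\<^esub> \<pi> ^ n \<odot>\<^bsub>T\<^esub> u = act \<sigma> t"
  shows "irreducible_rep d \<Gamma> (\<lambda>\<sigma>. matrix_of (act \<sigma>))"
  unfolding irreducible_rep_def
proof (intro conjI allI impI)
  show "d > 0" by (rule d)
  fix W assume W: "VectorSpace.subspace class_ring W (module_vec TYPE('a fract) d) \<and>
    (\<forall>\<sigma>\<in>\<Gamma>. \<forall>w\<in>W. map_mat to_fract (matrix_of (act \<sigma>)) *\<^sub>v w \<in> W)"
  then have sm: "LinearCombinations.submodule class_ring W (module_vec TYPE('a fract) d)"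
    by (simp add: VectorSpace.subspace_def)
  have Wsub: "W \<subseteq> carrier_vec d" using LinearCombinations.submodule.subset[OF sm] by (simp add: module_vec_simps)
  have Wadd: "v + w \<in> W" if "v \<in> W" "w \<in> W" for v w
    using LinearCombinations.submodule.m_closed[OF sm that] by (simp add: module_vec_simps)
  have W0: "0\<^sub>v d \<in> W" using LinearCombinations.submodule.zero_closed[OF sm] by (simp add: module_vec_simps)
  have Wsm: "a \<cdot>\<^sub>v w \<in> W" if "w \<in> W" for a w
    using LinearCombinations.submodule.smult_closed[OF sm _ that, of a] by (simp add: module_vec_simps)
  show "W = {0\<^sub>v d} \<or> W = carrier_vec d"
  proof (rule disjCI)
    assume "W \<noteq> carrier_vec d"
    show "W = {0\<^sub>v d}"
    proof (rule ccontr)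
      assume "W \<noteq> {0\<^sub>v d}"
      then obtain w where w: "w \<in> W" "w \<noteq> 0\<^sub>v d" using W0 by blast
      have wd: "w \<in> carrier_vec d" using w(1) Wsub by blast
      obtain s c where s: "s \<noteq> 0" "c \<in> carrier_vec d" "map_vec to_fract c = to_fract s \<cdot>\<^sub>v w"
        using common_denominator[OF wd] by blast
      have cW: "map_vec to_fract c \<in> W" using s(3) Wsm[OF w(1)] by simp
      have "c \<noteq> 0\<^sub>v d"
      proof
        assume c0: "c = 0\<^sub>v d"
        have "w = 0\<^sub>v d"
        proof (rule eq_vecI)
          fix i assume i: "i < dim_vec (0\<^sub>v d :: 'a fract vec)"
          have "vec_index (map_vec to_fract c) i = vec_index (to_fract s \<cdot>\<^sub>v w) i" using s(3) by simp
          then show "vec_index w i = vec_index (0\<^sub>v d) i" using i s(1) wd c0 by simp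
        qed (use wd in auto)
        then show False using w(2) by blast
      qed
      have t: "comb c \<in> carrier T" using b_closed by simp
      have z: "comb (0\<^sub>v d) = \<zero>\<^bsub>T\<^esub>" 
      proof -
        have "(0 :: 'a) \<cdot>\<^sub>v 0\<^sub>v d = 0\<^sub>v d" by (intro eq_vecI) auto
        then show ?thesis using comb_smult[of "0\<^sub>v d" 0] lc_closed[OF b_closed] by simp
      qed
      have "comb c \<noteq> \<zero>\<^bsub>T\<^esub>" using comb_inj[OF s(2), of "0\<^sub>v d"] \<open>c \<noteq> 0\<^sub>v d\<close> z by auto
      from "open"[OF t this] obtain n where
        n: "\<And>u. u \<in> carrier T \<Longrightarrow> \<exists>\<sigma>\<in>\<Gamma>. comb c \<oplus>\<^bsub>T\<^esub> \<pi> ^ n \<odot>\<^bsub>T\<^esub> u = act \<sigma> (comb c)" by blast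
      have unit: "unit_vec d i \<in> W" if i: "i < d" for i
      proof -
        obtain \<sigma> where \<sigma>: "\<sigma> \<in> \<Gamma>" "comb c \<oplus>\<^bsub>T\<^esub> \<pi> ^ n \<odot>\<^bsub>T\<^esub> comb (unit_vec d i) = act \<sigma> (comb c)"
          using n[of "comb (unit_vec d i)"] b_closed by auto
        have "comb (c + \<pi> ^ n \<cdot>\<^sub>v unit_vec d i) = comb (matrix_of (act \<sigma>) *\<^sub>v c)"
          using \<sigma>(2) s(2) matrix_of_mult_vec[OF lin[OF \<sigma>(1)] s(2)] by (simp add: comb_add comb_smult)
        then have eq: "c + \<pi> ^ n \<cdot>\<^sub>v unit_vec d i = matrix_of (act \<sigma>) *\<^sub>v c"
          using s(2) by (intro comb_inj) (auto intro: mult_mat_vec_carrier[OF matrix_of_carrier])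
        have "map_mat to_fract (matrix_of (act \<sigma>)) *\<^sub>v map_vec to_fract c = map_vec to_fract (matrix_of (act \<sigma>) *\<^sub>v c)"
          using s(2) by (intro eq_vecI) (auto simp: scalar_prod_def matrix_of_def)
        then have mW: "map_vec to_fract (c + \<pi> ^ n \<cdot>\<^sub>v unit_vec d i) \<in> W"
          unfolding eq using W \<sigma>(1) cW by metis
        have "to_fract (\<pi> ^ n) \<cdot>\<^sub>v unit_vec d i = map_vec to_fract (c + \<pi> ^ n \<cdot>\<^sub>v unit_vec d i) + (-1) \<cdot>\<^sub>v map_vec to_fract c"
          using s(2) i by (intro eq_vecI) (auto simp: unit_vec_def)
        also have "\<dots> \<in> W" by (intro Wadd Wsm mW cW)
        finally have "inverse (to_fract (\<pi> ^ n)) \<cdot>\<^sub>v (to_fract (\<pi> ^ n) \<cdot>\<^sub>v unit_vec d i) \<in> W" by (rule Wsm)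
        moreover have "inverse (to_fract (\<pi> ^ n)) \<cdot>\<^sub>v (to_fract (\<pi> ^ n) \<cdot>\<^sub>v unit_vec d i) = unit_vec d i"
          using \<pi> by (intro eq_vecI) auto
        ultimately show ?thesis by simp
      qed
      have "v \<in> W" if v: "v \<in> carrier_vec d" for v
      proof -
        have "\<forall>v\<in>carrier_vec d. (\<forall>i<d. i \<ge> k \<longrightarrow> vec_index v i = 0) \<longrightarrow> v \<in> W" for k
        proof (induction k)
          case 0
          show ?case
          proof (intro ballI impI)
            fix v :: "'a fract vec" assume "v \<in> carrier_vec d" "\<forall>i<d. i \<ge> 0 \<longrightarrow> vec_index v i = 0"
            then have "v = 0\<^sub>v d" by (intro eq_vecI) auto
            then show "v \<in> W" using W0 by simp
          qed
        next
          case (Suc k)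
          show ?case
          proof (intro ballI impI)
            fix v :: "'a fract vec" assume v: "v \<in> carrier_vec d" "\<forall>i<d. i \<ge> Suc k \<longrightarrow> vec_index v i = 0"
            show "v \<in> W"
            proof (cases "k < d")
              case True
              define u where "u = v - vec_index v k \<cdot>\<^sub>v unit_vec d k"
              have "u \<in> carrier_vec d" "\<forall>i<d. i \<ge> k \<longrightarrow> vec_index u i = 0"
                using v True by (auto simp: u_def)
              then have "u \<in> W" using Suc by blast
              moreover have "v = u + vec_index v k \<cdot>\<^sub>v unit_vec d k"
                using v(1) by (intro eq_vecI) (auto simp: u_def)
              ultimately show ?thesis using Wadd Wsm unit[OF True] by metis
            next
              case False
              then show ?thesis using v Suc by auto
            qed
          qed
        qed
        from this[of d] show ?thesis using v by auto
      qed
      then show False using \<open>W \<noteq> carrier_vec d\<close> Wsub by blast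
    qed
  qed
qed

end

section \<open>Points of finite flat group schemes\<close>

text \<open>The linear extension of the values on the basis. For a point it is the algebra
  homomorphism itself, and \<open>point_ext2\<close> is the tensor product of two of them.\<close>

definition point_ext :: "'r :: idom hopf \<Rightarrow> (nat \<Rightarrow> 'r fract alg_closure) \<Rightarrow> (nat \<Rightarrow> 'r) \<Rightarrow> 'r fract alg_closure" where
  "point_ext H \<phi> v = (\<Sum>k<rk H. emb (v k) * \<phi> k)"

definition point_ext2 :: "'r :: idom hopf \<Rightarrow> (nat \<Rightarrow> 'r fract alg_closure) \<Rightarrow> (nat \<Rightarrow> 'r fract alg_closure) \<Rightarrow>
    (nat \<Rightarrow> nat \<Rightarrow> 'r) \<Rightarrow> 'r fract alg_closure" where
  "point_ext2 H \<phi> \<psi> v = (\<Sum>k<rk H. \<Sum>l<rk H. emb (v k l) * (\<phi> k * \<psi> l))"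

lemmas emb_sum = to_ac_sum

lemma pointsD:
  assumes "\<phi> \<in> points H"
  shows "k \<ge> rk H \<Longrightarrow> \<phi> k = 0" "(\<Sum>k<rk H. emb (unt H k) * \<phi> k) = 1"
    "i < rk H \<Longrightarrow> j < rk H \<Longrightarrow> \<phi> i * \<phi> j = (\<Sum>k<rk H. emb (mlt H i j k) * \<phi> k)"
  using assms unfolding points_def mem_Collect_eq by (elim conjE, blast)+

lemma sum_swap3:
  "(\<Sum>k\<in>A. \<Sum>l\<in>B. \<Sum>x\<in>C. h k l x) = (\<Sum>x\<in>C. \<Sum>k\<in>A. \<Sum>l\<in>B. h k l x :: 'b :: comm_monoid_add)"
proof -
  have "(\<Sum>k\<in>A. \<Sum>l\<in>B. \<Sum>x\<in>C. h k l x) = (\<Sum>k\<in>A. \<Sum>x\<in>C. \<Sum>l\<in>B. h k l x)"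
    by (intro sum.cong refl sum.swap)
  also have "\<dots> = (\<Sum>x\<in>C. \<Sum>k\<in>A. \<Sum>l\<in>B. h k l x)" by (rule sum.swap)
  finally show ?thesis .
qed

lemma point_ext_mult:
  assumes \<phi>: "\<phi> \<in> points H"
  shows "point_ext H \<phi> (elt_mult H v w) = point_ext H \<phi> v * point_ext H \<phi> w"
proof -
  let ?N = "{..<rk H}"
  have "point_ext H \<phi> (elt_mult H v w) =
      (\<Sum>k\<in>?N. \<Sum>i\<in>?N. \<Sum>j\<in>?N. emb (v i) * emb (w j) * (emb (mlt H i j k) * \<phi> k))"
    unfolding point_ext_def elt_mult_def
    by (intro sum.cong) (auto simp: emb_sum sum_distrib_right mult.assoc)
  also have "\<dots> = (\<Sum>i\<in>?N. \<Sum>j\<in>?N. \<Sum>k\<in>?N. emb (v i) * emb (w j) * (emb (mlt H i j k) * \<phi> k))"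
    by (rule sum_swap3[symmetric])
  also have "\<dots> = (\<Sum>i\<in>?N. \<Sum>j\<in>?N. emb (v i) * emb (w j) * (\<phi> i * \<phi> j))"
    using pointsD(3)[OF \<phi>] by (intro sum.cong) (auto simp: sum_distrib_left)
  also have "\<dots> = point_ext H \<phi> v * point_ext H \<phi> w"
    unfolding point_ext_def sum_product by (intro sum.cong) (auto simp: mult_ac)
  finally show ?thesis .
qed

lemma point_ext_one: assumes "\<phi> \<in> points H" shows "point_ext H \<phi> (elt_one H) = 1"
  using pointsD(2)[OF assms] by (simp add: point_ext_def elt_one_def)

lemma sum_product_scaled:
  fixes c :: "'b :: comm_semiring_0"
  shows "(\<Sum>k\<in>A. \<Sum>l\<in>B. c * (f k * g l)) = c * (sum f A * sum g B)"
proof -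
  have "(\<Sum>k\<in>A. \<Sum>l\<in>B. c * (f k * g l)) = c * (\<Sum>k\<in>A. \<Sum>l\<in>B. f k * g l)"
    by (simp only: sum_distrib_left)
  then show ?thesis by (simp only: sum_product)
qed

lemma sum_product_double:
  fixes f g :: "nat \<Rightarrow> nat \<Rightarrow> 'b :: comm_semiring_0"
  shows "(\<Sum>i\<in>A. \<Sum>j\<in>B. \<Sum>k\<in>C. \<Sum>l\<in>D. f i j * g k l) = (\<Sum>i\<in>A. \<Sum>j\<in>B. f i j) * (\<Sum>k\<in>C. \<Sum>l\<in>D. g k l)"
proof -
  have 1: "(\<Sum>i\<in>A. \<Sum>j\<in>B. f i j) * s = (\<Sum>i\<in>A. \<Sum>j\<in>B. f i j * s)" for s by (simp only: sum_distrib_right)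
  have 2: "y * (\<Sum>k\<in>C. \<Sum>l\<in>D. g k l) = (\<Sum>k\<in>C. \<Sum>l\<in>D. y * g k l)" for y by (simp only: sum_distrib_left)
  show ?thesis by (simp only: 1 2[symmetric])
qed

lemma point_ext2_tensor_mult:
  assumes \<phi>: "\<phi> \<in> points H" and \<psi>: "\<psi> \<in> points H"
  shows "point_ext2 H \<phi> \<psi> (tensor_mult H v w) = point_ext2 H \<phi> \<psi> v * point_ext2 H \<phi> \<psi> w"
proof -
  let ?N = "{..<rk H}"
  let ?h = "\<lambda>k l i j i' j'. emb (v i j) * emb (w i' j') * ((emb (mlt H i i' k) * \<phi> k) * (emb (mlt H j j' l) * \<psi> l))"
  have "point_ext2 H \<phi> \<psi> (tensor_mult H v w) =
      (\<Sum>k\<in>?N. \<Sum>l\<in>?N. \<Sum>i\<in>?N. \<Sum>j\<in>?N. \<Sum>i'\<in>?N. \<Sum>j'\<in>?N. ?h k l i j i' j')"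
    unfolding point_ext2_def tensor_mult_def
    by (intro sum.cong refl) (simp add: emb_sum sum_distrib_right sum_distrib_left mult_ac)
  also have "\<dots> = (\<Sum>i\<in>?N. \<Sum>j\<in>?N. \<Sum>i'\<in>?N. \<Sum>j'\<in>?N. \<Sum>k\<in>?N. \<Sum>l\<in>?N. ?h k l i j i' j')"
    by (rule trans[OF sum_swap3], rule sum.cong[OF refl], rule trans[OF sum_swap3], rule sum.cong[OF refl],
        rule trans[OF sum_swap3], rule sum.cong[OF refl], rule sum_swap3)
  also have "\<dots> = (\<Sum>i\<in>?N. \<Sum>j\<in>?N. \<Sum>i'\<in>?N. \<Sum>j'\<in>?N. emb (v i j) * emb (w i' j') * ((\<phi> i * \<phi> i') * (\<psi> j * \<psi> j')))"
  proof (intro sum.cong refl)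
    fix i j i' j' assume ij: "i \<in> ?N" "j \<in> ?N" "i' \<in> ?N" "j' \<in> ?N"
    show "(\<Sum>k\<in>?N. \<Sum>l\<in>?N. ?h k l i j i' j') = emb (v i j) * emb (w i' j') * ((\<phi> i * \<phi> i') * (\<psi> j * \<psi> j'))"
      using pointsD(3)[OF \<phi>, of i i'] pointsD(3)[OF \<psi>, of j j'] ij by (simp add: sum_product_scaled)
  qed
  also have "\<dots> = (\<Sum>i\<in>?N. \<Sum>j\<in>?N. \<Sum>i'\<in>?N. \<Sum>j'\<in>?N. (emb (v i j) * (\<phi> i * \<psi> j)) * (emb (w i' j') * (\<phi> i' * \<psi> j')))"
    by (intro sum.cong refl) (simp only: mult_ac)
  also have "\<dots> = point_ext2 H \<phi> \<psi> v * point_ext2 H \<phi> \<psi> w"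
    unfolding point_ext2_def by (rule sum_product_double)
  finally show ?thesis .
qed

lemma point_ext2_product: "point_ext2 H \<phi> \<psi> (\<lambda>k l. v k * w l) = point_ext H \<phi> v * point_ext H \<psi> w"
  unfolding point_ext2_def point_ext_def sum_product by (intro sum.cong) (auto simp: mult_ac)

lemma point_add_nth: "k < rk H \<Longrightarrow> point_add H \<phi> \<psi> k = point_ext2 H \<phi> \<psi> (cml H k)"
  by (simp add: point_add_def point_ext2_def mult.assoc)

lemma point_ext_add: "point_ext H (point_add H \<phi> \<psi>) v = point_ext2 H \<phi> \<psi> (elt_comult H v)"
proof -
  let ?N = "{..<rk H}"
  have "point_ext H (point_add H \<phi> \<psi>) v = (\<Sum>k\<in>?N. \<Sum>i\<in>?N. \<Sum>j\<in>?N. emb (v k * cml H k i j) * (\<phi> i * \<psi> j))"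
    unfolding point_ext_def by (intro sum.cong) (auto simp: point_add_nth point_ext2_def sum_distrib_left mult.assoc)
  also have "\<dots> = (\<Sum>i\<in>?N. \<Sum>j\<in>?N. \<Sum>k\<in>?N. emb (v k * cml H k i j) * (\<phi> i * \<psi> j))"
    by (rule sum_swap3[symmetric])
  also have "\<dots> = point_ext2 H \<phi> \<psi> (elt_comult H v)"
    unfolding point_ext2_def elt_comult_def by (intro sum.cong) (auto simp: emb_sum sum_distrib_right)
  finally show ?thesis .
qed

lemma point_ext_map: "point_ext H (point_map H H' f \<phi>) v = point_ext H' \<phi> (lin_app H H' f v)"
proof -
  have "point_ext H (point_map H H' f \<phi>) v = (\<Sum>k<rk H. \<Sum>j<rk H'. emb (v k * f k j) * \<phi> j)"
    unfolding point_ext_def point_map_def by (intro sum.cong) (auto simp: sum_distrib_left mult.assoc)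
  also have "\<dots> = (\<Sum>j<rk H'. \<Sum>k<rk H. emb (v k * f k j) * \<phi> j)" by (rule sum.swap)
  also have "\<dots> = point_ext H' \<phi> (lin_app H H' f v)"
    unfolding point_ext_def lin_app_def by (intro sum.cong) (auto simp: emb_sum sum_distrib_right)
  finally show ?thesis .
qed

lemma hopf_algebraD:
  assumes "hopf_algebra H"
  defines "N \<equiv> rk H"
  shows "j < N \<Longrightarrow> k < N \<Longrightarrow> (\<Sum>i<N. unt H i * mlt H i j k) = (if j = k then 1 else 0)"
    and "k < N \<Longrightarrow> i < N \<Longrightarrow> j < N \<Longrightarrow> cml H k i j = cml H k j i"
    and "k < N \<Longrightarrow> i < N \<Longrightarrow> j < N \<Longrightarrow> m < N \<Longrightarrow>
      (\<Sum>l<N. cml H k l m * cml H l i j) = (\<Sum>l<N. cml H k i l * cml H l j m)"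
    and "k < N \<Longrightarrow> j < N \<Longrightarrow> (\<Sum>i<N. cnt H i * cml H k i j) = (if k = j then 1 else 0)"
    and "a < N \<Longrightarrow> b < N \<Longrightarrow> i < N \<Longrightarrow> j < N \<Longrightarrow> (\<Sum>l<N. mlt H a b l * cml H l i j) =
        (\<Sum>i1<N. \<Sum>j1<N. \<Sum>i2<N. \<Sum>j2<N. cml H a i1 j1 * cml H b i2 j2 * mlt H i1 i2 i * mlt H j1 j2 j)"
    and "i < N \<Longrightarrow> j < N \<Longrightarrow> (\<Sum>k<N. unt H k * cml H k i j) = unt H i * unt H j"
    and "i < N \<Longrightarrow> j < N \<Longrightarrow> (\<Sum>k<N. mlt H i j k * cnt H k) = cnt H i * cnt H j"
    and "(\<Sum>k<N. unt H k * cnt H k) = 1"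
proof -
  note h = assms(1)[unfolded hopf_algebra_def Let_def N_def[symmetric]]
  note c3 = h[THEN conjunct2, THEN conjunct2]
  note c5 = c3[THEN conjunct2, THEN conjunct2]
  note c7 = c5[THEN conjunct2, THEN conjunct2]
  note c9 = c7[THEN conjunct2, THEN conjunct2]
  show "j < N \<Longrightarrow> k < N \<Longrightarrow> (\<Sum>i<N. unt H i * mlt H i j k) = (if j = k then 1 else 0)"
    using c3[THEN conjunct1] by simp
  show "k < N \<Longrightarrow> i < N \<Longrightarrow> j < N \<Longrightarrow> cml H k i j = cml H k j i"
    using c3[THEN conjunct2, THEN conjunct1, rule_format] .
  show "k < N \<Longrightarrow> i < N \<Longrightarrow> j < N \<Longrightarrow> m < N \<Longrightarrow>
      (\<Sum>l<N. cml H k l m * cml H l i j) = (\<Sum>l<N. cml H k i l * cml H l j m)"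
    using c5[THEN conjunct1, rule_format] .
  show "k < N \<Longrightarrow> j < N \<Longrightarrow> (\<Sum>i<N. cnt H i * cml H k i j) = (if k = j then 1 else 0)"
    using c5[THEN conjunct2, THEN conjunct1] by simp
  show "a < N \<Longrightarrow> b < N \<Longrightarrow> i < N \<Longrightarrow> j < N \<Longrightarrow> (\<Sum>l<N. mlt H a b l * cml H l i j) =
        (\<Sum>i1<N. \<Sum>j1<N. \<Sum>i2<N. \<Sum>j2<N. cml H a i1 j1 * cml H b i2 j2 * mlt H i1 i2 i * mlt H j1 j2 j)"
    using c7[THEN conjunct1, rule_format] .
  show "i < N \<Longrightarrow> j < N \<Longrightarrow> (\<Sum>k<N. unt H k * cml H k i j) = unt H i * unt H j"
    using c7[THEN conjunct2, THEN conjunct1, rule_format] .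
  show "i < N \<Longrightarrow> j < N \<Longrightarrow> (\<Sum>k<N. mlt H i j k * cnt H k) = cnt H i * cnt H j"
    using c9[THEN conjunct1, rule_format] .
  show "(\<Sum>k<N. unt H k * cnt H k) = 1"
    using c9[THEN conjunct2, THEN conjunct1] .
qed

context
  fixes H :: "'r :: idom hopf"
  assumes H: "hopf_algebra H"
begin

lemma point_zero_in_points: "point_zero H \<in> points H"
proof -
  have "(\<Sum>k<rk H. emb (unt H k) * emb (cnt H k)) = 1"
  proof -
    have "(\<Sum>k<rk H. emb (unt H k) * emb (cnt H k)) = emb (\<Sum>k<rk H. unt H k * cnt H k)" by (simp add: emb_sum)
    then show ?thesis by (simp only: hopf_algebraD(8)[OF H]) simp
  qed
  moreover have "emb (cnt H i) * emb (cnt H j) = (\<Sum>k<rk H. emb (mlt H i j k) * emb (cnt H k))"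
    if "i < rk H" "j < rk H" for i j
  proof -
    have "emb (cnt H i) * emb (cnt H j) = emb (\<Sum>k<rk H. mlt H i j k * cnt H k)"
      unfolding hopf_algebraD(7)[OF H that] by simp
    then show ?thesis by (simp add: emb_sum)
  qed
  ultimately show ?thesis by (simp add: points_def point_zero_def)
qed

text \<open>The convolution of two points is multiplicative because the comultiplication is a
  homomorphism of algebras and \<phi> \<otimes> \<psi> is multiplicative on the tensor
  square.\<close>

lemma point_add_in_points:
  assumes \<phi>: "\<phi> \<in> points H" and \<psi>: "\<psi> \<in> points H" shows "point_add H \<phi> \<psi> \<in> points H"
proof -
  let ?N = "{..<rk H}"
  have "(\<Sum>k\<in>?N. emb (unt H k) * point_add H \<phi> \<psi> k) = point_ext H (point_add H \<phi> \<psi>) (unt H)"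
    by (simp add: point_ext_def)
  also have "\<dots> = point_ext2 H \<phi> \<psi> (\<lambda>i j. unt H i * unt H j)"
    unfolding point_ext_add point_ext2_def
    by (intro sum.cong) (auto simp: elt_comult_def hopf_algebraD(6)[OF H])
  also have "\<dots> = 1" using pointsD(2)[OF \<phi>] pointsD(2)[OF \<psi>] unfolding point_ext2_product by (simp add: point_ext_def)
  finally have 1: "(\<Sum>k\<in>?N. emb (unt H k) * point_add H \<phi> \<psi> k) = 1" .
  have 2: "point_add H \<phi> \<psi> a * point_add H \<phi> \<psi> b = (\<Sum>k\<in>?N. emb (mlt H a b k) * point_add H \<phi> \<psi> k)"
    if ab: "a < rk H" "b < rk H" for a b
  proof -
    have "point_add H \<phi> \<psi> a * point_add H \<phi> \<psi> b = point_ext2 H \<phi> \<psi> (tensor_mult H (cml H a) (cml H b))"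
      using ab by (simp add: point_add_nth point_ext2_tensor_mult[OF \<phi> \<psi>])
    also have "\<dots> = point_ext2 H \<phi> \<psi> (elt_comult H (mlt H a b))"
      unfolding point_ext2_def
      by (intro sum.cong refl) (simp add: tensor_mult_def elt_comult_def hopf_algebraD(5)[OF H ab])
    also have "\<dots> = point_ext H (point_add H \<phi> \<psi>) (mlt H a b)" by (rule point_ext_add[symmetric])
    finally show ?thesis by (simp add: point_ext_def)
  qed
  have "point_add H \<phi> \<psi> k = 0" if "k \<ge> rk H" for k using that by (simp add: point_add_def)
  then show ?thesis using 1 2 by (simp add: points_def)
qed

lemma point_add_comm: "point_add H \<phi> \<psi> = point_add H \<psi> \<phi>"
proof
  fix k
  show "point_add H \<phi> \<psi> k = point_add H \<psi> \<phi> k"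
  proof (cases "k < rk H")
    case True
    have "point_ext2 H \<phi> \<psi> (cml H k) = (\<Sum>l<rk H. \<Sum>i<rk H. emb (cml H k i l) * (\<phi> i * \<psi> l))"
      unfolding point_ext2_def by (rule sum.swap)
    also have "\<dots> = point_ext2 H \<psi> \<phi> (cml H k)"
      unfolding point_ext2_def using hopf_algebraD(2)[OF H True] by (intro sum.cong) (auto simp: mult_ac)
    finally show ?thesis using True by (simp add: point_add_nth)
  qed (simp add: point_add_def)
qed

lemma point_add_assoc: "point_add H (point_add H \<phi> \<psi>) \<chi> = point_add H \<phi> (point_add H \<psi> \<chi>)"
proof
  fix k
  let ?N = "{..<rk H}"
  show "point_add H (point_add H \<phi> \<psi>) \<chi> k = point_add H \<phi> (point_add H \<psi> \<chi>) k"
  proof (cases "k < rk H")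
    case True
    have "point_add H (point_add H \<phi> \<psi>) \<chi> k =
        (\<Sum>l\<in>?N. \<Sum>m\<in>?N. \<Sum>i\<in>?N. \<Sum>j\<in>?N. emb (cml H k l m * cml H l i j) * (\<phi> i * (\<psi> j * \<chi> m)))"
      using True unfolding point_add_nth[OF True] point_ext2_def
      by (intro sum.cong) (auto simp: point_add_nth point_ext2_def sum_distrib_left sum_distrib_right mult_ac)
    also have "\<dots> = (\<Sum>i\<in>?N. \<Sum>j\<in>?N. \<Sum>l\<in>?N. \<Sum>m\<in>?N. emb (cml H k l m * cml H l i j) * (\<phi> i * (\<psi> j * \<chi> m)))"
      by (rule trans[OF sum_swap3], rule sum.cong[OF refl], rule sum_swap3)
    also have "\<dots> = (\<Sum>i\<in>?N. \<Sum>j\<in>?N. \<Sum>m\<in>?N. \<Sum>l\<in>?N. emb (cml H k l m * cml H l i j) * (\<phi> i * (\<psi> j * \<chi> m)))"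
      by (intro sum.cong refl sum.swap)
    also have "\<dots> = (\<Sum>i\<in>?N. \<Sum>j\<in>?N. \<Sum>m\<in>?N. emb (\<Sum>l\<in>?N. cml H k l m * cml H l i j) * (\<phi> i * (\<psi> j * \<chi> m)))"
      by (intro sum.cong refl) (simp add: emb_sum sum_distrib_right)
    also have "\<dots> = (\<Sum>i\<in>?N. \<Sum>j\<in>?N. \<Sum>m\<in>?N. emb (\<Sum>l\<in>?N. cml H k i l * cml H l j m) * (\<phi> i * (\<psi> j * \<chi> m)))"
      by (intro sum.cong refl) (simp add: hopf_algebraD(3)[OF H True])
    also have "\<dots> = (\<Sum>i\<in>?N. \<Sum>j\<in>?N. \<Sum>m\<in>?N. \<Sum>l\<in>?N. emb (cml H k i l * cml H l j m) * (\<phi> i * (\<psi> j * \<chi> m)))"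
      by (intro sum.cong refl) (simp add: emb_sum sum_distrib_right)
    also have "\<dots> = (\<Sum>i\<in>?N. \<Sum>l\<in>?N. \<Sum>j\<in>?N. \<Sum>m\<in>?N. emb (cml H k i l * cml H l j m) * (\<phi> i * (\<psi> j * \<chi> m)))"
      by (rule sum.cong[OF refl], rule sum_swap3)
    also have "\<dots> = point_add H \<phi> (point_add H \<psi> \<chi>) k"
      using True unfolding point_add_nth[OF True] point_ext2_def
      by (intro sum.cong) (auto simp: point_add_nth point_ext2_def sum_distrib_left sum_distrib_right mult_ac)
    finally show ?thesis .
  qed (simp add: point_add_def)
qed

lemma point_add_zero:
  assumes \<phi>: "\<phi> \<in> points H" shows "point_add H (point_zero H) \<phi> = \<phi>"
proof
  fix k
  let ?N = "{..<rk H}"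
  show "point_add H (point_zero H) \<phi> k = \<phi> k"
  proof (cases "k < rk H")
    case True
    have "point_add H (point_zero H) \<phi> k = (\<Sum>i\<in>?N. \<Sum>j\<in>?N. emb (cnt H i * cml H k i j) * \<phi> j)"
      using True by (simp add: point_add_def point_zero_def mult_ac)
    also have "\<dots> = (\<Sum>j\<in>?N. \<Sum>i\<in>?N. emb (cnt H i * cml H k i j) * \<phi> j)" by (rule sum.swap)
    also have "\<dots> = (\<Sum>j\<in>?N. emb (\<Sum>i\<in>?N. cnt H i * cml H k i j) * \<phi> j)"
      by (intro sum.cong refl) (simp add: emb_sum sum_distrib_right)
    also have "\<dots> = (\<Sum>j\<in>?N. if k = j then \<phi> j else 0)"
      using hopf_algebraD(4)[OF H True] by (intro sum.cong) auto
    also have "\<dots> = \<phi> k" using True by simp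
    finally show ?thesis .
  next
    case False
    then show ?thesis using pointsD(1)[OF \<phi>] by (simp add: point_add_def)
  qed
qed

lemma elt_mult_scalar:
  assumes w: "w \<in> elems H" shows "elt_mult H (\<lambda>k. r * elt_one H k) w = (\<lambda>k. r * w k)"
proof
  fix k
  let ?N = "{..<rk H}"
  show "elt_mult H (\<lambda>k. r * elt_one H k) w k = r * w k"
  proof (cases "k < rk H")
    case True
    have "elt_mult H (\<lambda>k. r * elt_one H k) w k = (\<Sum>i\<in>?N. \<Sum>j\<in>?N. r * w j * (unt H i * mlt H i j k))"
      using True by (simp add: elt_mult_def elt_one_def mult_ac)
    also have "\<dots> = (\<Sum>j\<in>?N. \<Sum>i\<in>?N. r * w j * (unt H i * mlt H i j k))" by (rule sum.swap)
    also have "\<dots> = (\<Sum>j\<in>?N. r * w j * (\<Sum>i\<in>?N. unt H i * mlt H i j k))" by (simp add: sum_distrib_left)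
    also have "\<dots> = (\<Sum>j\<in>?N. if j = k then r * w j else 0)"
      using hopf_algebraD(1)[OF H _ True] by (intro sum.cong) auto
    also have "\<dots> = r * w k" using True by simp
    finally show ?thesis .
  next
    case False
    then show ?thesis using w by (simp add: elt_mult_def elems_def)
  qed
qed

end

section \<open>The Tate module in coordinates\<close>

locale formal_p_divisible = complete_dvr_closure \<omega> "\<lambda>r. to_ac (to_fract r) :: 'r fract alg_closure"
  for \<omega> :: "'r :: idom" +
  fixes G :: "'r pdiv" and \<alpha> :: "nat \<Rightarrow> 'a :: idom \<Rightarrow> nat \<Rightarrow> nat \<Rightarrow> 'r" and \<gamma> :: "'a \<Rightarrow> 'r"
    and F :: "'r fps fps" and act :: "'a \<Rightarrow> 'r fps" and p :: nat and \<theta> :: "nat \<Rightarrow> 'r fps \<Rightarrow> nat \<Rightarrow> 'r"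
    and \<pi> :: 'a
  assumes hopf: "hopf_algebra (lev G n)"
    and fm: "formal_module \<gamma> F act"
    and \<theta>_range: "range (\<theta> n) = elems (lev G n)"
    and \<theta>_add: "\<theta> n (f + g) = (\<lambda>k. \<theta> n f k + \<theta> n g k)"
    and \<theta>_mult: "\<theta> n (f * g) = elt_mult (lev G n) (\<theta> n f) (\<theta> n g)"
    and \<theta>_const: "\<theta> n (fps_const r) = (\<lambda>k. r * elt_one (lev G n) k)"
    and \<theta>_ker: "\<theta> n f = (\<lambda>_. 0) \<longleftrightarrow> act (of_nat p ^ n) dvd f"
    and \<theta>_trn: "lin_app (lev G (Suc n)) (lev G n) (trn G n) (\<theta> (Suc n) f) = \<theta> n f"
    and \<theta>_act: "lin_app (lev G n) (lev G n) (\<alpha> n a) (\<theta> n f) = \<theta> n (f oo act a)"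
    and \<theta>2: "\<exists>\<Theta> :: 'r fps fps \<Rightarrow> nat \<Rightarrow> nat \<Rightarrow> 'r.
           (\<forall>f g. \<Theta> (f + g) = (\<lambda>k l. \<Theta> f k l + \<Theta> g k l)) \<and>
           (\<forall>f g. \<Theta> (f * g) = tensor_mult (lev G n) (\<Theta> f) (\<Theta> g)) \<and>
           (\<forall>f. \<Theta> (in_X f) = (\<lambda>k l. \<theta> n f k * elt_one (lev G n) l)) \<and>
           (\<forall>f. \<Theta> (in_Y f) = (\<lambda>k l. elt_one (lev G n) k * \<theta> n f l)) \<and>
           (\<forall>f. elt_comult (lev G n) (\<theta> n f) = \<Theta> (subst_1_2 f F))"
    and p_dvd: "\<exists>b. of_nat p = b * \<pi>"
begin

lemma act0 [simp]: "act a $ 0 = 0" and act1: "act a $ 1 = \<gamma> a"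
  and act_endo: "subst_1_2 (act a) F = subst_2_2 F (in_X (act a)) (in_Y (act a))"
  and act_add: "act (a + b) = subst_2_1 F (act a) (act b)"
  and act_mult: "act (a * b) = act a oo act b" and act_one [simp]: "act 1 = fps_X"
  and \<gamma>: "comm_ring_hom \<gamma>" and fgl: "formal_group_law F"
proof -
  note h = fm[unfolded formal_module_def]
  note h2 = h[THEN conjunct2, THEN conjunct2]
  note h4 = h2[THEN conjunct2, THEN conjunct2]
  show "act a $ 0 = 0" "act a $ 1 = \<gamma> a" using h2[THEN conjunct1, rule_format, of a] by blast+
  show "subst_1_2 (act a) F = subst_2_2 F (in_X (act a)) (in_Y (act a))"
    by (rule h2[THEN conjunct2, THEN conjunct1, rule_format])
  show "act (a + b) = subst_2_1 F (act a) (act b)" by (rule h4[THEN conjunct1, rule_format])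
  show "act (a * b) = act a oo act b" by (rule h4[THEN conjunct2, THEN conjunct1, rule_format])
  show "act 1 = fps_X" by (rule h4[THEN conjunct2, THEN conjunct2])
  show "comm_ring_hom \<gamma>" by (rule h[THEN conjunct1])
  show "formal_group_law F" by (rule h[THEN conjunct2, THEN conjunct1])
qed

lemma F_0: "F $ 0 = fps_X"
proof (rule fps_ext)
  fix a
  have "subst_2_1 F 0 fps_X = fps_X" using fgl by (simp add: formal_group_law_def)
  then have "fps_X $ a = subst_2_1 F 0 fps_X $ a" by simp
  also have "\<dots> = (\<Sum>i\<le>a. \<Sum>j\<le>a. F $ i $ j * (0 ^ i * fps_X ^ j) $ a)"
    unfolding subst_2_1_def fps_nth_Abs_fps ..
  also have "\<dots> = (\<Sum>i\<le>a. if i = 0 then F $ 0 $ a else 0)"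
  proof (intro sum.cong refl)
    fix i assume "i \<in> {..a}"
    have "(\<Sum>j\<le>a. F $ i $ j * (0 ^ i * fps_X ^ j) $ a) = (\<Sum>j\<le>a. if j = a then (if i = 0 then F $ 0 $ a else 0) else 0)"
      by (intro sum.cong refl) (simp add: fps_X_power_nth power_0_left)
    then show "(\<Sum>j\<le>a. F $ i $ j * (0 ^ i * fps_X ^ j) $ a) = (if i = 0 then F $ 0 $ a else 0)" by simp
  qed
  also have "\<dots> = F $ 0 $ a" by simp
  finally show "F $ 0 $ a = fps_X $ a" by simp
qed

lemma F_1: "F $ a $ 0 = fps_X $ a"
proof -
  have "subst_2_1 F fps_X 0 = fps_X" using fgl by (simp add: formal_group_law_def)
  then have "fps_X $ a = subst_2_1 F fps_X 0 $ a" by simp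
  also have "\<dots> = (\<Sum>i\<le>a. \<Sum>j\<le>a. F $ i $ j * (fps_X ^ i * 0 ^ j) $ a)"
    unfolding subst_2_1_def fps_nth_Abs_fps ..
  also have "\<dots> = (\<Sum>i\<le>a. if i = a then F $ a $ 0 else 0)"
  proof (intro sum.cong refl)
    fix i assume "i \<in> {..a}"
    have "(\<Sum>j\<le>a. F $ i $ j * (fps_X ^ i * 0 ^ j) $ a) = (\<Sum>j\<le>a. if j = 0 then (if i = a then F $ a $ 0 else 0) else 0)"
      by (intro sum.cong refl) (simp add: fps_X_power_nth power_0_left)
    then show "(\<Sum>j\<le>a. F $ i $ j * (fps_X ^ i * 0 ^ j) $ a) = (if i = a then F $ a $ 0 else 0)" by simp
  qed
  also have "\<dots> = F $ a $ 0" by simp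
  finally show ?thesis by simp
qed

lemma F_decompose: "\<exists>K. F = fps_X + fps_const fps_X + fps_X * fps_const fps_X * K"
proof -
  define K where "K = Abs_fps (\<lambda>i. Abs_fps (\<lambda>j. F $ Suc i $ Suc j))"
  have "F $ a = (fps_X + fps_const fps_X + fps_X * fps_const fps_X * K) $ a" for a
  proof (cases a)
    case 0
    then show ?thesis by (simp add: F_0 mult.assoc)
  next
    case (Suc i)
    have "F $ a $ b = (fps_X + fps_const fps_X + fps_X * fps_const fps_X * K) $ a $ b" for b
      using F_1[of a] by (cases b) (auto simp: Suc mult.assoc K_def)
    then show ?thesis by (simp add: fps_eq_iff)
  qed
  then have "F = fps_X + fps_const fps_X + fps_X * fps_const fps_X * K" by (rule fps_ext)
  then show ?thesis by blast
qed

text \<open>[0] is idempotent under composition and has no term of degree below 2, since \<gamma> 0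
  = 0. If its order were k, the composite would have order at least k^2 > k.\<close>

lemma act_zero: "act 0 = 0"
proof (rule ccontr)
  assume nz: "act 0 \<noteq> 0"
  interpret \<gamma>: comm_ring_hom \<gamma> by (rule \<gamma>)
  define k where "k = subdegree (act 0)"
  have k: "act 0 $ k \<noteq> 0" "\<And>i. i < k \<Longrightarrow> act 0 $ i = 0" using nz by (auto simp: k_def)
  have "k \<noteq> 0" "k \<noteq> 1" using k(1) act1[of 0] by (auto intro: ccontr)
  then have "k < k * k" by simp
  then have "0 dvd (act 0 oo act 0) $ k"
    using k(2) \<open>k \<noteq> 0\<close> by (intro fps_compose_order(1)[of k 0 "act 0" k "act 0"]) auto
  then show False using act_mult[of 0 0] k(1) by simp
qed

lemma in_X_X: "in_X fps_X = fps_X"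
  by (rule fps_ext) (simp add: in_X_def)

section \<open>Points of the group scheme as small elements of the closure\<close>

definition pt_eval :: "nat \<Rightarrow> (nat \<Rightarrow> 'r fract alg_closure) \<Rightarrow> 'r fps \<Rightarrow> 'r fract alg_closure" where
  "pt_eval n \<phi> f = point_ext (lev G n) \<phi> (\<theta> n f)"

text \<open>The value at the point of the parameter X of the formal group. It embeds the points of
  \<open>lev G n\<close> into the small elements, where sum and action are given by power series and
  the transition maps become inclusions.\<close>

definition crd :: "nat \<Rightarrow> (nat \<Rightarrow> 'r fract alg_closure) \<Rightarrow> 'r fract alg_closure" where
  "crd n \<phi> = pt_eval n \<phi> fps_X"

lemma pt_eval_add: "pt_eval n \<phi> (f + g) = pt_eval n \<phi> f + pt_eval n \<phi> g"
  by (simp add: pt_eval_def point_ext_def \<theta>_add distrib_right sum.distrib)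

lemma pt_eval_hom: assumes \<phi>: "\<phi> \<in> points (lev G n)" shows "eval1_hom (pt_eval n \<phi>)"
proof -
  have const: "pt_eval n \<phi> (fps_const r) = emb r" for r
  proof -
    have "pt_eval n \<phi> (fps_const r) = emb r * point_ext (lev G n) \<phi> (elt_one (lev G n))"
      by (simp add: pt_eval_def \<theta>_const point_ext_def sum_distrib_left mult.assoc)
    then show ?thesis using point_ext_one[OF \<phi>] by simp
  qed
  have "comm_ring_hom (pt_eval n \<phi>)"
  proof
    show "pt_eval n \<phi> 0 = 0" "pt_eval n \<phi> 1 = 1" using const[of 0] const[of 1] by simp_all
    show "pt_eval n \<phi> (f + g) = pt_eval n \<phi> f + pt_eval n \<phi> g" for f g by (rule pt_eval_add)
    show "pt_eval n \<phi> (f * g) = pt_eval n \<phi> f * pt_eval n \<phi> g" for f g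
      by (simp add: pt_eval_def \<theta>_mult point_ext_mult[OF \<phi>])
  qed
  then show ?thesis using const by (simp add: eval1_hom_def)
qed

lemma crd_small: "\<phi> \<in> points (lev G n) \<Longrightarrow> small (crd n \<phi>)"
  unfolding crd_def by (rule eval1_hom_small[OF pt_eval_hom]) simp_all

lemma pt_eval_eq: "\<phi> \<in> points (lev G n) \<Longrightarrow> pt_eval n \<phi> f = eval1 (crd n \<phi>) f"
  unfolding crd_def by (rule fun_cong[OF eval1_hom_eq[OF pt_eval_hom]])

definition unit_preimage :: "nat \<Rightarrow> nat \<Rightarrow> 'r fps" where
  "unit_preimage n k = (SOME f. \<theta> n f = (\<lambda>j. if j = k then 1 else 0))"

lemma unit_preimage: assumes "k < rk (lev G n)" shows "\<theta> n (unit_preimage n k) = (\<lambda>j. if j = k then 1 else 0)"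
proof -
  have "(\<lambda>j. if j = k then 1 else 0) \<in> elems (lev G n)" using assms by (auto simp: elems_def)
  then have "\<exists>f. \<theta> n f = (\<lambda>j. if j = k then 1 else 0)" unfolding \<theta>_range[symmetric] by (auto simp: image_iff)
  then show ?thesis unfolding unit_preimage_def by (rule someI_ex)
qed

lemma pt_eval_unit_preimage: assumes "k < rk (lev G n)" shows "pt_eval n \<phi> (unit_preimage n k) = \<phi> k"
proof -
  have "pt_eval n \<phi> (unit_preimage n k) = (\<Sum>j<rk (lev G n). if j = k then \<phi> k else 0)"
    unfolding pt_eval_def point_ext_def unit_preimage[OF assms] by (intro sum.cong) auto
  then show ?thesis using assms by simp
qed

text \<open>A homomorphism from R[[X]] is determined by its value on X, and the basis vectors of the
  algebra are images of power series.\<close>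

lemma crd_inj:
  assumes \<phi>: "\<phi> \<in> points (lev G n)" and \<psi>: "\<psi> \<in> points (lev G n)" and eq: "crd n \<phi> = crd n \<psi>"
  shows "\<phi> = \<psi>"
proof
  fix k
  have "pt_eval n \<phi> f = pt_eval n \<psi> f" for f using eq by (simp add: pt_eval_eq \<phi> \<psi>)
  then show "\<phi> k = \<psi> k"
    using pt_eval_unit_preimage[of k n \<phi>] pt_eval_unit_preimage[of k n \<psi>] pointsD(1)[OF \<phi>, of k] pointsD(1)[OF \<psi>, of k]
    by (cases "k < rk (lev G n)") auto
qed

lemma points_iff:
  "\<phi> \<in> points (lev G n) \<longleftrightarrow> (\<forall>k\<ge>rk (lev G n). \<phi> k = 0) \<and> eval1_hom (pt_eval n \<phi>)"
proof
  assume \<phi>: "\<phi> \<in> points (lev G n)"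
  then show "(\<forall>k\<ge>rk (lev G n). \<phi> k = 0) \<and> eval1_hom (pt_eval n \<phi>)"
    using pt_eval_hom pointsD(1) by blast
next
  let ?H = "lev G n"
  assume \<phi>: "(\<forall>k\<ge>rk ?H. \<phi> k = 0) \<and> eval1_hom (pt_eval n \<phi>)"
  then interpret h: comm_ring_hom "pt_eval n \<phi>" by (simp add: eval1_hom_def)
  have "(\<Sum>k<rk ?H. emb (unt ?H k) * \<phi> k) = pt_eval n \<phi> (fps_const 1)"
    unfolding pt_eval_def point_ext_def \<theta>_const by (intro sum.cong) (auto simp: elt_one_def)
  then have 1: "(\<Sum>k<rk ?H. emb (unt ?H k) * \<phi> k) = 1" by simp
  have "\<phi> i * \<phi> j = (\<Sum>k<rk ?H. emb (mlt ?H i j k) * \<phi> k)" if ij: "i < rk ?H" "j < rk ?H" for i j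
  proof -
    have "\<phi> i * \<phi> j = pt_eval n \<phi> (unit_preimage n i * unit_preimage n j)"
      using ij by (simp add: h.hom_mult pt_eval_unit_preimage)
    also have "\<dots> = (\<Sum>k<rk ?H. emb (mlt ?H i j k) * \<phi> k)"
      unfolding pt_eval_def point_ext_def \<theta>_mult unit_preimage[OF ij(1)] unit_preimage[OF ij(2)]
    proof (intro sum.cong refl)
      fix k assume k: "k \<in> {..<rk ?H}"
      have "elt_mult ?H (\<lambda>k. if k = i then 1 else 0) (\<lambda>k. if k = j then 1 else 0) k =
          (\<Sum>a<rk ?H. \<Sum>b<rk ?H. (if a = i then 1 else 0) * (if b = j then 1 else 0) * mlt ?H a b k)"
        using k by (simp add: elt_mult_def)
      also have "\<dots> = (\<Sum>a<rk ?H. if a = i then mlt ?H i j k else 0)"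
      proof (intro sum.cong refl)
        fix a
        have "(\<Sum>b<rk ?H. (if a = i then 1 else 0) * (if b = j then 1 else 0) * mlt ?H a b k) =
            (\<Sum>b<rk ?H. if b = j then (if a = i then mlt ?H i j k else 0) else 0)"
          by (intro sum.cong refl) simp
        then show "(\<Sum>b<rk ?H. (if a = i then 1 else 0) * (if b = j then 1 else 0) * mlt ?H a b k) =
            (if a = i then mlt ?H i j k else 0)" using ij by simp
      qed
      also have "\<dots> = mlt ?H i j k" using ij by simp
      finally show "emb (elt_mult ?H (\<lambda>k. if k = i then 1 else 0) (\<lambda>k. if k = j then 1 else 0) k) * \<phi> k =
          emb (mlt ?H i j k) * \<phi> k" by simp
    qed
    finally show ?thesis .
  qed
  then show "\<phi> \<in> points ?H" using 1 \<phi> by (simp add: points_def)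
qed

text \<open>Evaluation at x vanishes on the multiples of [p^n], which form the kernel of \<theta>,
  and so it descends to the algebra of G_n.\<close>

lemma point_exists:
  assumes x: "small x" and z: "eval1 x (act (of_nat p ^ n)) = 0"
  shows "\<exists>\<phi>\<in>points (lev G n). crd n \<phi> = x"
proof -
  let ?H = "lev G n"
  define \<phi> where "\<phi> = (\<lambda>k. if k < rk ?H then eval1 x (unit_preimage n k) else 0)"
  have \<theta>0: "\<theta> n 0 = (\<lambda>_. 0)" by (simp add: \<theta>_ker)
  have \<theta>sum: "\<theta> n (sum f A) = (\<lambda>k. \<Sum>i\<in>A. \<theta> n (f i) k)" for f and A :: "nat set"
    by (induction A rule: infinite_finite_induct) (simp_all add: \<theta>0 \<theta>_add)
  have ev: "pt_eval n \<phi> f = eval1 x f" for f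
  proof -
    \<comment> \<open>The series f is replaced by a combination of the preimages of the basis that
      has the same image under \<theta>.\<close>
    let ?g = "\<Sum>k<rk ?H. fps_const (\<theta> n f k) * unit_preimage n k"
    have el: "(\<lambda>j. if j = k then 1 else 0) \<in> elems ?H" if "k < rk ?H" for k using that by (auto simp: elems_def)
    have "\<theta> n ?g j = \<theta> n f j" for j
    proof -
      have "\<theta> n ?g j = (\<Sum>k<rk ?H. \<theta> n f k * (if j = k then 1 else 0))"
        unfolding \<theta>sum \<theta>_mult \<theta>_const
        by (intro sum.cong refl) (simp add: unit_preimage elt_mult_scalar[OF hopf el])
      also have "\<dots> = (if j < rk ?H then \<theta> n f j else 0)" by (simp add: if_distrib[of "\<lambda>x. _ * x"] cong: if_cong)
      also have "\<dots> = \<theta> n f j" using rangeI[of "\<theta> n" f] unfolding \<theta>_range by (auto simp: elems_def)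
      finally show ?thesis .
    qed
    then have gf: "\<theta> n ?g = \<theta> n f" by (rule ext)
    have sub: "\<theta> n (f - ?g) j + \<theta> n ?g j = \<theta> n f j" for j
      using fun_cong[OF \<theta>_add[of n "f - ?g" ?g], of j] by (simp only: diff_add_cancel)
    have "\<theta> n (f - ?g) j = 0" for j using sub[of j] unfolding fun_cong[OF gf, of j] by simp
    then have "\<theta> n (f - ?g) = (\<lambda>_. 0)" by (rule ext)
    then have "act (of_nat p ^ n) dvd f - ?g" by (simp add: \<theta>_ker)
    then obtain h where "f - ?g = act (of_nat p ^ n) * h" by (elim dvdE)
    then have "eval1 x (f - ?g) = 0" using z by (simp add: eval1_simps[OF x])
    then have "eval1 x f = eval1 x ?g" by (simp add: eval1_simps[OF x])
    also have "\<dots> = pt_eval n \<phi> f"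
      by (simp add: eval1_sum[OF x] eval1_simps[OF x] pt_eval_def point_ext_def \<phi>_def)
    finally show ?thesis ..
  qed
  have "pt_eval n \<phi> = eval1 x" using ev by (rule ext)
  then have "\<phi> \<in> points ?H" using eval1(1)[OF x] by (auto simp: points_iff \<phi>_def)
  moreover have "crd n \<phi> = x" by (simp add: crd_def ev eval1_simps[OF x])
  ultimately show ?thesis by blast
qed

abbreviation pact :: "nat \<Rightarrow> 'a \<Rightarrow> (nat \<Rightarrow> 'r fract alg_closure) \<Rightarrow> nat \<Rightarrow> 'r fract alg_closure" where
  "pact n a \<phi> \<equiv> point_map (lev G n) (lev G n) (\<alpha> n a) \<phi>"

abbreviation padd :: "nat \<Rightarrow> (nat \<Rightarrow> 'r fract alg_closure) \<Rightarrow> (nat \<Rightarrow> 'r fract alg_closure) \<Rightarrow> nat \<Rightarrow> 'r fract alg_closure" where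
  "padd n \<phi> \<psi> \<equiv> point_add (lev G n) \<phi> \<psi>"

abbreviation pinc :: "nat \<Rightarrow> (nat \<Rightarrow> 'r fract alg_closure) \<Rightarrow> nat \<Rightarrow> 'r fract alg_closure" where
  "pinc n \<phi> \<equiv> point_map (lev G (Suc n)) (lev G n) (trn G n) \<phi>"

lemma pt_eval_act: "pt_eval n (pact n a \<phi>) f = pt_eval n \<phi> (f oo act a)"
  by (simp add: pt_eval_def point_ext_map \<theta>_act)

lemma pact_points: assumes \<phi>: "\<phi> \<in> points (lev G n)" shows "pact n a \<phi> \<in> points (lev G n)"
proof -
  have s: "small (crd n \<phi>)" by (rule crd_small[OF \<phi>])
  have "pt_eval n (pact n a \<phi>) = eval1 (eval1 (crd n \<phi>) (act a))"
    by (rule ext) (simp add: pt_eval_act pt_eval_eq[OF \<phi>] eval1_compose[OF s])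
  then show ?thesis
    using eval1(1)[OF eval1_small[OF s act0]] by (simp add: points_iff) (simp add: point_map_def)
qed

lemma crd_act: assumes \<phi>: "\<phi> \<in> points (lev G n)" shows "crd n (pact n a \<phi>) = eval1 (crd n \<phi>) (act a)"
proof -
  have "crd n (pact n a \<phi>) = pt_eval n \<phi> (act a)" by (simp add: crd_def pt_eval_act)
  then show ?thesis by (simp only: pt_eval_eq[OF \<phi>])
qed

lemma assumes \<phi>: "\<phi> \<in> points (lev G n)"
  shows pinc_points: "pinc n \<phi> \<in> points (lev G (Suc n))"
    and crd_inc: "crd (Suc n) (pinc n \<phi>) = crd n \<phi>"
proof -
  have eq: "pt_eval (Suc n) (pinc n \<phi>) = pt_eval n \<phi>"
    by (rule ext) (simp add: pt_eval_def point_ext_map \<theta>_trn)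
  then show "pinc n \<phi> \<in> points (lev G (Suc n))"
    using pt_eval_hom[OF \<phi>] by (simp add: points_iff) (simp add: point_map_def)
  show "crd (Suc n) (pinc n \<phi>) = crd n \<phi>" by (simp add: crd_def eq)
qed

text \<open>\<Theta> followed by \<phi> \<otimes> \<psi> supplies the evaluation of two-variable
  series at a pair of points, and the compatibility of \<Theta> with the comultiplication says that
  evaluating F there gives the sum of the points.\<close>

lemma padd_eval:
  assumes \<phi>: "\<phi> \<in> points (lev G n)" and \<psi>: "\<psi> \<in> points (lev G n)"
  obtains \<Psi> where "eval2_hom \<Psi>" "\<Psi> fps_X = crd n \<phi>" "\<Psi> (fps_const fps_X) = crd n \<psi>"
    "\<And>f. \<Psi> (in_X f) = pt_eval n \<phi> f" "\<And>f. \<Psi> (in_Y f) = pt_eval n \<psi> f"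
    "\<And>f. pt_eval n (padd n \<phi> \<psi>) f = \<Psi> (subst_1_2 f F)"
proof -
  let ?H = "lev G n"
  obtain \<Theta> :: "'r fps fps \<Rightarrow> nat \<Rightarrow> nat \<Rightarrow> 'r" where
    \<Theta>: "(\<forall>f g. \<Theta> (f + g) = (\<lambda>k l. \<Theta> f k l + \<Theta> g k l)) \<and>
           (\<forall>f g. \<Theta> (f * g) = tensor_mult ?H (\<Theta> f) (\<Theta> g)) \<and>
           (\<forall>f. \<Theta> (in_X f) = (\<lambda>k l. \<theta> n f k * elt_one ?H l)) \<and>
           (\<forall>f. \<Theta> (in_Y f) = (\<lambda>k l. elt_one ?H k * \<theta> n f l)) \<and>
           (\<forall>f. elt_comult ?H (\<theta> n f) = \<Theta> (subst_1_2 f F))" using \<theta>2[of n] by (elim exE)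
  note add = \<Theta>[THEN conjunct1, rule_format] and \<Theta>' = \<Theta>[THEN conjunct2]
  note mult = \<Theta>'[THEN conjunct1, rule_format] and \<Theta>'' = \<Theta>'[THEN conjunct2, THEN conjunct2]
  note X = \<Theta>'[THEN conjunct2, THEN conjunct1, rule_format] and Y = \<Theta>''[THEN conjunct1, rule_format]
    and F = \<Theta>''[THEN conjunct2, rule_format]
 define \<Psi> where "\<Psi> = (\<lambda>f. point_ext2 ?H \<phi> \<psi> (\<Theta> f))"
  have PX: "\<Psi> (in_X f) = pt_eval n \<phi> f" for f
    by (simp add: \<Psi>_def X point_ext2_product point_ext_one[OF \<psi>] pt_eval_def)
  have PY: "\<Psi> (in_Y f) = pt_eval n \<psi> f" for f
    by (simp add: \<Psi>_def Y point_ext2_product point_ext_one[OF \<phi>] pt_eval_def)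
  have cc: "in_Y (fps_const r) = fps_const (fps_const r)" for r :: 'r by (simp add: in_Y_def)
  have const: "\<Psi> (fps_const (fps_const r)) = emb r" for r
    using PY[of "fps_const r"] pt_eval_hom[OF \<psi>] unfolding cc by (simp add: eval1_hom_def)
  have "comm_ring_hom \<Psi>"
  proof
    show "\<Psi> 0 = 0" "\<Psi> 1 = 1" using const[of 0] const[of 1] by simp_all
    show "\<Psi> (f + g) = \<Psi> f + \<Psi> g" for f g
      by (simp add: \<Psi>_def add point_ext2_def distrib_right sum.distrib)
    show "\<Psi> (f * g) = \<Psi> f * \<Psi> g" for f g
      by (simp add: \<Psi>_def mult point_ext2_tensor_mult[OF \<phi> \<psi>])
  qed
  then have "eval2_hom \<Psi>" using const by (simp add: eval2_hom_def)
  moreover have "\<Psi> fps_X = crd n \<phi>" using PX[of fps_X] by (simp add: in_X_X crd_def)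
  moreover have "\<Psi> (fps_const fps_X) = crd n \<psi>" using PY[of fps_X] by (simp add: in_Y_def crd_def)
  moreover have "pt_eval n (padd n \<phi> \<psi>) f = \<Psi> (subst_1_2 f F)" for f
    by (simp add: pt_eval_def point_ext_add F \<Psi>_def)
  ultimately show thesis using that PX PY by blast
qed

lemma padd_points: "\<phi> \<in> points (lev G n) \<Longrightarrow> \<psi> \<in> points (lev G n) \<Longrightarrow> padd n \<phi> \<psi> \<in> points (lev G n)"
  by (rule point_add_in_points[OF hopf])

lemma subst_X_F: "subst_1_2 fps_X F = F"
proof (rule fps_ext, rule fps_ext)
  fix a b
  have "subst_1_2 fps_X F $ a $ b = (\<Sum>i\<le>a + b. if i = 1 then F $ a $ b else 0)"
    unfolding subst_1_2_def fps_nth_Abs_fps by (intro sum.cong refl) simp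
  then show "subst_1_2 fps_X F $ a $ b = F $ a $ b"
    using F_0 by (cases "a + b = 0") auto
qed

lemma crd_add:
  assumes \<phi>: "\<phi> \<in> points (lev G n)" and \<psi>: "\<psi> \<in> points (lev G n)"
    and \<Psi>: "eval2_hom \<Psi>" "\<Psi> fps_X = crd n \<phi>" "\<Psi> (fps_const fps_X) = crd n \<psi>"
  shows "crd n (padd n \<phi> \<psi>) = \<Psi> F"
proof -
  obtain \<Psi>' where \<Psi>': "eval2_hom \<Psi>'" "\<Psi>' fps_X = crd n \<phi>" "\<Psi>' (fps_const fps_X) = crd n \<psi>"
    "\<And>f. \<Psi>' (in_X f) = pt_eval n \<phi> f" "\<And>f. \<Psi>' (in_Y f) = pt_eval n \<psi> f"
    "\<And>f. pt_eval n (padd n \<phi> \<psi>) f = \<Psi>' (subst_1_2 f F)" by (rule padd_eval[OF \<phi> \<psi>]) blast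
  have "crd n (padd n \<phi> \<psi>) = \<Psi>' F" using \<Psi>'(6)[of fps_X] by (simp add: crd_def subst_X_F)
  also have "\<dots> = \<Psi> F"
    by (rule eval2_hom_unique[OF \<Psi>'(1) \<Psi>(1)]) (simp_all only: \<Psi>(2,3) \<Psi>'(2,3))
  finally show ?thesis .
qed

text \<open>The coordinate e of the zero point satisfies F(e, e) = e. As F = X + Y + X Y K, this
  reads e (1 + e K(e, e)) = 0, and the second factor is not 0 because e is small.\<close>

lemma crd_zero: "crd n (point_zero (lev G n)) = 0"
proof -
  let ?z = "point_zero (lev G n)"
  have z: "?z \<in> points (lev G n)" by (rule point_zero_in_points[OF hopf])
  obtain \<Psi> where \<Psi>: "eval2_hom \<Psi>" "\<Psi> fps_X = crd n ?z" "\<Psi> (fps_const fps_X) = crd n ?z"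
    "\<And>f. \<Psi> (in_X f) = pt_eval n ?z f" "\<And>f. \<Psi> (in_Y f) = pt_eval n ?z f"
    "\<And>f. pt_eval n (padd n ?z ?z) f = \<Psi> (subst_1_2 f F)" by (rule padd_eval[OF z z]) blast
  interpret \<Psi>: comm_ring_hom \<Psi> using \<Psi>(1) by (simp add: eval2_hom_def)
  obtain K where K: "F = fps_X + fps_const fps_X + fps_X * fps_const fps_X * K" using F_decompose by blast
  let ?e = "crd n ?z"
  have "?e = \<Psi> F" using crd_add[OF z z \<Psi>(1,2,3)] point_add_zero[OF hopf z] by simp
  also have "\<dots> = ?e + ?e + ?e * ?e * \<Psi> K" by (subst K) (simp add: \<Psi>.hom_add \<Psi>.hom_mult \<Psi>(2,3))
  finally have "?e * (1 + ?e * \<Psi> K) = 0" by (simp add: algebra_simps)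
  moreover have "small (?e * \<Psi> K)" by (intro small_mult crd_small z eval2_hom_int \<Psi>(1))
  ultimately show ?thesis using one_plus_small by auto
qed

lemma zero_points: "point_zero (lev G n) \<in> points (lev G n)"
  by (rule point_zero_in_points[OF hopf])

text \<open>Like the other rules for points, this is checked on coordinates, where it becomes an
  identity between series of the formal module.\<close>

lemma pact_add:
  assumes \<phi>: "\<phi> \<in> points (lev G n)"
  shows "pact n (a + b) \<phi> = padd n (pact n a \<phi>) (pact n b \<phi>)"
proof (rule crd_inj)
  show "pact n (a + b) \<phi> \<in> points (lev G n)" "padd n (pact n a \<phi>) (pact n b \<phi>) \<in> points (lev G n)"
    by (intro pact_points padd_points \<phi>)+
  obtain \<Psi> where \<Psi>: "eval2_hom \<Psi>" "\<Psi> fps_X = crd n (pact n a \<phi>)" "\<Psi> (fps_const fps_X) = crd n (pact n b \<phi>)"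
    by (rule padd_eval[OF pact_points[OF \<phi>, of a] pact_points[OF \<phi>, of b]]) blast
  have "crd n (pact n (a + b) \<phi>) = eval1 (crd n \<phi>) (subst_2_1 F (act a) (act b))"
    by (simp add: crd_act[OF \<phi>] act_add)
  also have "\<dots> = \<Psi> F"
    by (rule eval_subst_2_1[OF eval1(1)[OF crd_small[OF \<phi>]] \<Psi>(1)]) (simp_all only: act0 \<Psi>(2,3) crd_act[OF \<phi>])
  also have "\<dots> = crd n (padd n (pact n a \<phi>) (pact n b \<phi>))"
    by (rule crd_add[OF pact_points[OF \<phi>] pact_points[OF \<phi>] \<Psi>, symmetric])
  finally show "crd n (pact n (a + b) \<phi>) = crd n (padd n (pact n a \<phi>) (pact n b \<phi>))" .
qed

lemma pact_add_right:
  assumes \<phi>: "\<phi> \<in> points (lev G n)" and \<psi>: "\<psi> \<in> points (lev G n)"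
  shows "pact n a (padd n \<phi> \<psi>) = padd n (pact n a \<phi>) (pact n a \<psi>)"
proof (rule crd_inj)
  show "pact n a (padd n \<phi> \<psi>) \<in> points (lev G n)" "padd n (pact n a \<phi>) (pact n a \<psi>) \<in> points (lev G n)"
    by (intro pact_points padd_points \<phi> \<psi>)+
  obtain \<Psi> where \<Psi>: "eval2_hom \<Psi>" "\<Psi> fps_X = crd n \<phi>" "\<Psi> (fps_const fps_X) = crd n \<psi>"
    "\<And>f. \<Psi> (in_X f) = pt_eval n \<phi> f" "\<And>f. \<Psi> (in_Y f) = pt_eval n \<psi> f"
    "\<And>f. pt_eval n (padd n \<phi> \<psi>) f = \<Psi> (subst_1_2 f F)" by (rule padd_eval[OF \<phi> \<psi>]) blast
  obtain \<Psi>' where \<Psi>': "eval2_hom \<Psi>'" "\<Psi>' fps_X = crd n (pact n a \<phi>)" "\<Psi>' (fps_const fps_X) = crd n (pact n a \<psi>)"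
    by (rule padd_eval[OF pact_points[OF \<phi>, of a] pact_points[OF \<psi>, of a]]) blast
  have "crd n (pact n a (padd n \<phi> \<psi>)) = pt_eval n (padd n \<phi> \<psi>) (act a)"
    using padd_points[OF \<phi> \<psi>] by (simp add: crd_act pt_eval_eq)
  also have "\<dots> = \<Psi> (subst_2_2 F (in_X (act a)) (in_Y (act a)))" by (simp add: \<Psi>(6) act_endo)
  also have "\<dots> = \<Psi>' F"
    by (rule eval_subst_2_2[OF \<Psi>(1) \<Psi>'(1)])
       (simp_all add: in_X_def[of "act a"] in_Y_def[of "act a"] \<Psi>'(2,3) crd_act[OF \<phi>] crd_act[OF \<psi>]
          \<Psi>(4)[unfolded in_X_def] \<Psi>(5)[unfolded in_Y_def] pt_eval_eq[OF \<phi>] pt_eval_eq[OF \<psi>])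
  also have "\<dots> = crd n (padd n (pact n a \<phi>) (pact n a \<psi>))"
    by (rule crd_add[OF pact_points[OF \<phi>] pact_points[OF \<psi>] \<Psi>', symmetric])
  finally show "crd n (pact n a (padd n \<phi> \<psi>)) = crd n (padd n (pact n a \<phi>) (pact n a \<psi>))" .
qed

lemma pact_mult:
  assumes \<phi>: "\<phi> \<in> points (lev G n)" shows "pact n (a * b) \<phi> = pact n a (pact n b \<phi>)"
  by (rule crd_inj[of _ n])
     (simp_all add: pact_points \<phi> crd_act act_mult eval1_compose[OF crd_small[OF \<phi>]])

lemma pact_one: assumes \<phi>: "\<phi> \<in> points (lev G n)" shows "pact n 1 \<phi> = \<phi>"
  by (rule crd_inj[of _ n]) (simp_all add: pact_points \<phi> crd_act eval1_simps[OF crd_small[OF \<phi>]])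

lemma pact_zero: assumes \<phi>: "\<phi> \<in> points (lev G n)" shows "pact n 0 \<phi> = point_zero (lev G n)"
  by (rule crd_inj[of _ n]) (simp_all add: pact_points \<phi> zero_points crd_act act_zero crd_zero eval1_simps[OF crd_small[OF \<phi>]])

lemma pact_point_zero: "pact n a (point_zero (lev G n)) = point_zero (lev G n)"
  by (rule crd_inj[of _ n]) (simp_all add: pact_points zero_points crd_act crd_zero eval1_0)

lemma pinc_zero: "pinc n (point_zero (lev G n)) = point_zero (lev G (Suc n))"
  by (rule crd_inj[of _ "Suc n"]) (simp_all add: pinc_points zero_points crd_inc crd_zero)

lemma pinc_act: assumes \<phi>: "\<phi> \<in> points (lev G n)" shows "pinc n (pact n a \<phi>) = pact (Suc n) a (pinc n \<phi>)"
  by (rule crd_inj[of _ "Suc n"]) (simp_all add: pinc_points pact_points \<phi> crd_act crd_inc)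

lemma pinc_add:
  assumes \<phi>: "\<phi> \<in> points (lev G n)" and \<psi>: "\<psi> \<in> points (lev G n)"
  shows "pinc n (padd n \<phi> \<psi>) = padd (Suc n) (pinc n \<phi>) (pinc n \<psi>)"
proof (rule crd_inj)
  show "pinc n (padd n \<phi> \<psi>) \<in> points (lev G (Suc n))" "padd (Suc n) (pinc n \<phi>) (pinc n \<psi>) \<in> points (lev G (Suc n))"
    by (intro pinc_points padd_points \<phi> \<psi>)+
  obtain \<Psi> where \<Psi>: "eval2_hom \<Psi>" "\<Psi> fps_X = crd n \<phi>" "\<Psi> (fps_const fps_X) = crd n \<psi>"
    by (rule padd_eval[OF \<phi> \<psi>]) blast
  have "crd (Suc n) (pinc n (padd n \<phi> \<psi>)) = \<Psi> F"
    using crd_add[OF \<phi> \<psi> \<Psi>] crd_inc[OF padd_points[OF \<phi> \<psi>]] by simp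
  also have "\<dots> = crd (Suc n) (padd (Suc n) (pinc n \<phi>) (pinc n \<psi>))"
    by (rule crd_add[symmetric]) (simp_all add: pinc_points \<phi> \<psi> \<Psi> crd_inc)
  finally show "crd (Suc n) (pinc n (padd n \<phi> \<psi>)) = crd (Suc n) (padd (Suc n) (pinc n \<phi>) (pinc n \<psi>))" .
qed

lemma padd_neg: assumes \<phi>: "\<phi> \<in> points (lev G n)" shows "padd n (pact n (-1) \<phi>) \<phi> = point_zero (lev G n)"
  using pact_add[OF \<phi>, of "-1" 1] by (simp add: pact_one[OF \<phi>] pact_zero[OF \<phi>])

section \<open>The Tate module as a module over A\<close>

definition zeros :: "nat \<Rightarrow> 'r fract alg_closure set" where
  "zeros n = {x. small x \<and> eval1 x (act (\<pi> ^ n)) = 0}"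

lemma pi_torsion_iff: "\<phi> \<in> pi_torsion G \<alpha> \<pi> n \<longleftrightarrow> \<phi> \<in> points (lev G n) \<and> crd n \<phi> \<in> zeros n"
proof -
  have "pact n (\<pi> ^ n) \<phi> = point_zero (lev G n) \<longleftrightarrow> eval1 (crd n \<phi>) (act (\<pi> ^ n)) = 0" if \<phi>: "\<phi> \<in> points (lev G n)"
    using crd_inj[OF pact_points[OF \<phi>] zero_points] by (auto simp flip: crd_act[OF \<phi>] simp: crd_zero)
  then show ?thesis by (auto simp: pi_torsion_def zeros_def crd_small)
qed

text \<open>\<open>lev G n\<close> belongs to the p^n-torsion, and a zero of [\<pi>^n] is also one
  of [p^n], which is [b^n] composed with [\<pi>^n].\<close>

lemma torsion_point_exists:
  assumes "x \<in> zeros n" shows "\<exists>\<phi>\<in>pi_torsion G \<alpha> \<pi> n. crd n \<phi> = x"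
proof -
  have x: "small x" "eval1 x (act (\<pi> ^ n)) = 0" using assms by (auto simp: zeros_def)
  obtain b where "of_nat p = b * \<pi>" using p_dvd by blast
  then have "act (of_nat p ^ n) = act (b ^ n) oo act (\<pi> ^ n)" by (simp add: power_mult_distrib act_mult)
  then have "eval1 x (act (of_nat p ^ n)) = 0" by (simp add: eval1_compose[OF x(1)] x(2) eval1_0)
  then obtain \<phi> where "\<phi> \<in> points (lev G n)" "crd n \<phi> = x" using point_exists[OF x(1)] by blast
  then show ?thesis using assms pi_torsion_iff by blast
qed

abbreviation T where "T \<equiv> tate_module G \<alpha> \<pi>"

lemma T_simps:
  "\<zero>\<^bsub>T\<^esub> = (\<lambda>n. point_zero (lev G n))" "t \<oplus>\<^bsub>T\<^esub> u = (\<lambda>n. padd n (t n) (u n))"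
  "a \<odot>\<^bsub>T\<^esub> t = (\<lambda>n. pact n a (t n))"
  by (simp_all add: tate_module_def)

text \<open>As \<open>pinc\<close> preserves coordinates, compatibility of t means that [\<pi>]
  takes the coordinate of index n + 1 to that of index n.\<close>

lemma T_carrier: "t \<in> carrier T \<longleftrightarrow>
    (\<forall>n. t n \<in> points (lev G n) \<and> crd n (t n) \<in> zeros n \<and> eval1 (crd (Suc n) (t (Suc n))) (act \<pi>) = crd n (t n))"
proof -
  have "pact (Suc n) \<pi> (t (Suc n)) = pinc n (t n) \<longleftrightarrow> eval1 (crd (Suc n) (t (Suc n))) (act \<pi>) = crd n (t n)"
    if t: "t n \<in> points (lev G n)" "t (Suc n) \<in> points (lev G (Suc n))" for n
    using crd_inj[OF pact_points[OF t(2), of \<pi>] pinc_points[OF t(1)]]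
    by (auto simp: crd_act[OF t(2), symmetric] crd_inc[OF t(1)])
  then show ?thesis by (auto simp: tate_module_def pi_torsion_iff)
qed

lemma T_points: "t \<in> carrier T \<Longrightarrow> t n \<in> points (lev G n)" by (simp add: T_carrier)

lemma T_torsion: assumes "t \<in> carrier T" shows "pact n (\<pi> ^ n) (t n) = point_zero (lev G n)"
  by (rule crd_inj[of _ n]) (use assms in \<open>simp_all add: T_carrier pact_points zero_points crd_act crd_zero zeros_def\<close>)

lemma T_compat: assumes "t \<in> carrier T" shows "pact (Suc n) \<pi> (t (Suc n)) = pinc n (t n)"
  using assms by (simp add: tate_module_def)

lemma T_I:
  assumes "\<And>n. t n \<in> points (lev G n)" "\<And>n. pact n (\<pi> ^ n) (t n) = point_zero (lev G n)"
    "\<And>n. pact (Suc n) \<pi> (t (Suc n)) = pinc n (t n)"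
  shows "t \<in> carrier T"
  using assms by (simp add: tate_module_def pi_torsion_def)

lemma T_add_closed: assumes t: "t \<in> carrier T" and u: "u \<in> carrier T" shows "t \<oplus>\<^bsub>T\<^esub> u \<in> carrier T"
  unfolding T_simps
  by (rule T_I) (simp_all add: padd_points T_points[OF t] T_points[OF u] pact_add_right T_torsion[OF t] T_torsion[OF u]
      point_add_zero[OF hopf zero_points] T_compat[OF t] T_compat[OF u] pinc_add)

lemma T_smult_closed: assumes t: "t \<in> carrier T" shows "a \<odot>\<^bsub>T\<^esub> t \<in> carrier T"
  unfolding T_simps
proof (rule T_I)
  fix n
  have tn: "t n \<in> points (lev G n)" for n by (rule T_points[OF t])
  show "pact n a (t n) \<in> points (lev G n)" by (rule pact_points[OF tn])
  have "pact n (\<pi> ^ n) (pact n a (t n)) = pact n a (pact n (\<pi> ^ n) (t n))"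
    by (simp add: pact_mult[OF tn, symmetric] mult.commute)
  then show "pact n (\<pi> ^ n) (pact n a (t n)) = point_zero (lev G n)" by (simp add: T_torsion[OF t] pact_point_zero)
  have "pact (Suc n) \<pi> (pact (Suc n) a (t (Suc n))) = pact (Suc n) a (pact (Suc n) \<pi> (t (Suc n)))"
    by (simp add: pact_mult[OF tn, symmetric] mult.commute)
  then show "pact (Suc n) \<pi> (pact (Suc n) a (t (Suc n))) = pinc n (pact n a (t n))"
    by (simp add: T_compat[OF t] pinc_act[OF tn])
qed

lemma T_zero_closed: "\<zero>\<^bsub>T\<^esub> \<in> carrier T"
  unfolding T_simps by (rule T_I) (simp_all add: zero_points pact_point_zero pinc_zero)

lemma T_module: "Module.module class_ring T"
proof (rule moduleI)
  show "cring (class_ring :: 'a ring)" by unfold_locales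
  show "abelian_group T"
  proof (rule abelian_groupI)
    fix x y z assume xyz: "x \<in> carrier T" "y \<in> carrier T" "z \<in> carrier T"
    show "x \<oplus>\<^bsub>T\<^esub> y \<oplus>\<^bsub>T\<^esub> z = x \<oplus>\<^bsub>T\<^esub> (y \<oplus>\<^bsub>T\<^esub> z)" by (simp add: T_simps point_add_assoc[OF hopf])
  next
    fix x y assume "x \<in> carrier T" "y \<in> carrier T"
    show "x \<oplus>\<^bsub>T\<^esub> y = y \<oplus>\<^bsub>T\<^esub> x" unfolding T_simps by (rule ext) (rule point_add_comm[OF hopf])
  next
    fix x assume x: "x \<in> carrier T"
    show "\<zero>\<^bsub>T\<^esub> \<oplus>\<^bsub>T\<^esub> x = x" unfolding T_simps by (rule ext) (rule point_add_zero[OF hopf T_points[OF x]])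
    have "(-1) \<odot>\<^bsub>T\<^esub> x \<oplus>\<^bsub>T\<^esub> x = \<zero>\<^bsub>T\<^esub>" unfolding T_simps by (rule ext) (rule padd_neg[OF T_points[OF x]])
    then show "\<exists>y\<in>carrier T. y \<oplus>\<^bsub>T\<^esub> x = \<zero>\<^bsub>T\<^esub>" using T_smult_closed[OF x] by blast
  qed (simp_all add: T_add_closed T_zero_closed)
  fix a b x y assume x: "x \<in> carrier T"
  show "a \<odot>\<^bsub>T\<^esub> x \<in> carrier T" by (rule T_smult_closed[OF x])
  show "(a \<oplus>\<^bsub>class_ring\<^esub> b) \<odot>\<^bsub>T\<^esub> x = a \<odot>\<^bsub>T\<^esub> x \<oplus>\<^bsub>T\<^esub> b \<odot>\<^bsub>T\<^esub> x"
    unfolding T_simps by (rule ext) (simp add: pact_add[OF T_points[OF x]])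
  show "(a \<otimes>\<^bsub>class_ring\<^esub> b) \<odot>\<^bsub>T\<^esub> x = a \<odot>\<^bsub>T\<^esub> (b \<odot>\<^bsub>T\<^esub> x)"
    unfolding T_simps by (rule ext) (simp add: pact_mult[OF T_points[OF x]])
  show "\<one>\<^bsub>class_ring\<^esub> \<odot>\<^bsub>T\<^esub> x = x"
    unfolding T_simps by (rule ext) (simp add: pact_one[OF T_points[OF x]])
  assume y: "y \<in> carrier T"
  show "a \<odot>\<^bsub>T\<^esub> (x \<oplus>\<^bsub>T\<^esub> y) = a \<odot>\<^bsub>T\<^esub> x \<oplus>\<^bsub>T\<^esub> a \<odot>\<^bsub>T\<^esub> y"
    unfolding T_simps by (rule ext) (simp add: pact_add_right[OF T_points[OF x] T_points[OF y]])
qed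

sublocale T: class_module T
  by (simp add: class_module_def T_module)

abbreviation tcrd :: "(nat \<Rightarrow> nat \<Rightarrow> 'r fract alg_closure) \<Rightarrow> nat \<Rightarrow> 'r fract alg_closure" where
  "tcrd t n \<equiv> crd n (t n)"

lemma T_eq_iff: "t \<in> carrier T \<Longrightarrow> u \<in> carrier T \<Longrightarrow> t = u \<longleftrightarrow> (\<forall>n. tcrd t n = tcrd u n)"
  using crd_inj T_points by (metis ext)

lemma tcrd_zero_iff: "t \<in> carrier T \<Longrightarrow> t = \<zero>\<^bsub>T\<^esub> \<longleftrightarrow> (\<forall>n. tcrd t n = 0)"
  using T_eq_iff[OF _ T_zero_closed, of t] by (simp add: T_simps crd_zero)

lemma tcrd_zeros: "t \<in> carrier T \<Longrightarrow> tcrd t n \<in> zeros n" by (simp add: T_carrier)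

lemma tcrd_small: "t \<in> carrier T \<Longrightarrow> small (tcrd t n)" by (simp add: T_points crd_small)

lemma tcrd_step: "t \<in> carrier T \<Longrightarrow> eval1 (tcrd t (Suc n)) (act \<pi>) = tcrd t n" by (simp add: T_carrier)

lemma tcrd_steps: assumes t: "t \<in> carrier T" shows "eval1 (tcrd t (m + n)) (act (\<pi> ^ n)) = tcrd t m"
proof (induction n)
  case 0
  then show ?case by (simp add: eval1_simps[OF tcrd_small[OF t]])
next
  case (Suc n)
  have "act (\<pi> ^ Suc n) = act (\<pi> ^ n) oo act \<pi>" by (metis act_mult power_Suc2)
  then show ?case using Suc tcrd_step[OF t, of "m + n"]
    by (simp add: eval1_compose[OF tcrd_small[OF t, of "Suc (m + n)"]])
qed

lemma tcrd_smult: "t \<in> carrier T \<Longrightarrow> tcrd (a \<odot>\<^bsub>T\<^esub> t) n = eval1 (tcrd t n) (act a)"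
  by (simp add: T_simps crd_act T_points)

lemma T_exists:
  assumes "\<And>n. x n \<in> zeros n" "\<And>n. eval1 (x (Suc n)) (act \<pi>) = x n"
  shows "\<exists>t\<in>carrier T. \<forall>n. tcrd t n = x n"
proof -
  have "\<forall>n. \<exists>\<phi>. \<phi> \<in> pi_torsion G \<alpha> \<pi> n \<and> crd n \<phi> = x n" using torsion_point_exists[OF assms(1)] by blast
  then obtain t where t: "\<And>n. t n \<in> pi_torsion G \<alpha> \<pi> n \<and> crd n (t n) = x n" by metis
  then have "t \<in> carrier T" using assms by (simp add: T_carrier pi_torsion_iff)
  then show ?thesis using t by blast
qed

end

section \<open>Counting torsion points\<close>

lemma card_image_cong_eq:
  assumes "\<And>a b. a \<in> A \<Longrightarrow> b \<in> A \<Longrightarrow> f a = f b \<longleftrightarrow> g a = g b"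
  shows "card (f ` A) = card (g ` A)"
proof -
  let ?h = "\<lambda>x. g (inv_into A f x)"
  have inv: "inv_into A f (f a) \<in> A" "f (inv_into A f (f a)) = f a" if "a \<in> A" for a
    using that by (simp_all add: inv_into_into f_inv_into_f)
  have *: "?h (f a) = g a" if "a \<in> A" for a using assms[of "inv_into A f (f a)" a] inv[OF that] that by simp
  have "inj_on ?h (f ` A)"
  proof (rule inj_onI)
    fix x y assume "x \<in> f ` A" "y \<in> f ` A" "?h x = ?h y"
    then show "x = y" using * assms by auto
  qed
  moreover have "?h ` f ` A = g ` A" using * by (force simp: image_image)
  ultimately show ?thesis by (metis card_image)
qed

lemma prime_power_of_unique_prime:
  fixes n p :: nat
  assumes "n > 0" "\<And>r. prime r \<Longrightarrow> r dvd n \<Longrightarrow> r = p" shows "\<exists>k. n = p ^ k"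
  using assms
proof (induction n rule: less_induct)
  case (less n)
  show ?case
  proof (cases "n = 1")
    case True
    then show ?thesis by (intro exI[of _ 0]) simp
  next
    case False
    then obtain r where r: "prime r" "r dvd n" by (metis prime_factor_nat)
    then have rp: "r = p" using less.prems(2) by blast
    obtain m where m: "n = p * m" using r(2) unfolding rp by (rule dvdE)
    have "m > 0" "m < n" using less.prems(1) m r(1) rp prime_gt_1_nat[of p] by auto
    then obtain k where "m = p ^ k" using less.IH[of m] less.prems(2) m by (metis dvd_mult)
    then show ?thesis using m by (intro exI[of _ "Suc k"]) simp
  qed
qed

text \<open>If a prime r divides the order, a Sylow subgroup of order r^a contains some x not 0 with
  r^a x = 0. In an integral domain the characteristic then divides r^a, so it equals r.\<close>

lemma card_finite_subgroup_prime_power: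
  fixes S :: "'r :: idom set"
  assumes fin: "finite S" and S: "0 \<in> S" "\<And>x y. x \<in> S \<Longrightarrow> y \<in> S \<Longrightarrow> x - y \<in> S"
  shows "\<exists>k. card S = CHAR('r) ^ k"
proof (rule prime_power_of_unique_prime)
  show "card S > 0" using fin S(1) by (auto simp: card_gt_0_iff)
  define G where "G = \<lparr>carrier = S, monoid.mult = (+), one = (0 :: 'r)\<rparr>"
  have add: "x + y \<in> S" if "x \<in> S" "y \<in> S" for x y
    using S(2)[OF that(1) S(2)[OF S(1) that(2)]] by simp
  have "group G"
  proof (rule groupI)
    fix x assume "x \<in> carrier G"
    then show "\<exists>y\<in>carrier G. y \<otimes>\<^bsub>G\<^esub> x = \<one>\<^bsub>G\<^esub>" using S(2)[OF S(1), of x] by (intro bexI[of _ "- x"]) (auto simp: G_def)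
  qed (auto simp: G_def S add add.assoc)
  then interpret G: group G .
  have pow: "x [^]\<^bsub>G\<^esub> n = of_nat n * x" for x and n :: nat
    by (induction n) (simp_all add: G_def nat_pow_def algebra_simps)
  fix r assume r: "prime r" "r dvd card S"
  define a where "a = multiplicity r (card S)"
  have "r ^ a dvd card S" by (simp add: a_def multiplicity_dvd)
  then obtain m where "card S = r ^ a * m" by (elim dvdE)
  then obtain H where H: "subgroup H G" "card H = r ^ a"
    using sylow_thm[OF r(1) G.is_group, of a m] fin by (auto simp: Coset.order_def G_def)
  have "card S \<noteq> 0" using \<open>card S > 0\<close> by simp
  then have "a > 0" using r by (simp add: a_def prime_multiplicity_gt_zero_iff)
  then have "card H > 1" using H(2) prime_gt_1_nat[OF r(1)] by (simp only: one_less_power)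
  then have "\<not> H \<subseteq> {0}" using card_mono[of "{0}" H] by auto
  then obtain x where x: "x \<in> H" "x \<noteq> 0" by blast
  have HS: "H \<subseteq> S" using subgroup.subset[OF H(1)] by (simp add: G_def)
  interpret H: group "G\<lparr>carrier := H\<rparr>" by (rule subgroup.subgroup_is_group[OF H(1) G.is_group])
  have "x [^]\<^bsub>G\<lparr>carrier := H\<rparr>\<^esub> card H = \<one>\<^bsub>G\<lparr>carrier := H\<rparr>\<^esub>"
    using H.pow_order_eq_1[of x] x(1) by (simp add: Coset.order_def)
  moreover have "x [^]\<^bsub>G\<lparr>carrier := H\<rparr>\<^esub> card H = x [^]\<^bsub>G\<^esub> card H" by (simp add: nat_pow_def)
  ultimately have "of_nat (r ^ a) * x = 0" using pow[of x "card H"] H(2) by (simp add: G_def)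
  then have "CHAR('r) dvd r ^ a" using x(2) by (simp only: mult_eq_0_iff of_nat_eq_0_iff_char_dvd) simp
  moreover from this have "CHAR('r) > 0" using r(1) by (auto intro!: Nat.gr0I dest: prime_gt_0_nat)
  then have "prime CHAR('r)" by (rule prime_CHAR_semidom)
  ultimately show "r = CHAR('r)" using r(1) by (metis prime_dvd_power primes_dvd_imp_eq)
qed

section \<open>Consequences of a positive height of the generic fibre\<close>

context
  fixes \<gamma> :: "'a :: idom \<Rightarrow> 'r :: idom" and F :: "'r fps fps" and act :: "'a \<Rightarrow> 'r fps" and \<pi> :: 'a and g :: nat
  assumes fm: "formal_module \<gamma> F act" and unif: "uniformizer \<pi>" and height: "fibre_height {0} \<pi> act g" and g: "g \<ge> 1"
begin

lemma structure_map: "comm_ring_hom \<gamma>" "act a $ 1 = \<gamma> a" "act a $ 0 = 0"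
proof -
  show "comm_ring_hom \<gamma>" using fm[unfolded formal_module_def] by (rule conjunct1)
  have "\<forall>a. act a $ 0 = 0 \<and> act a $ 1 = \<gamma> a"
    using fm[unfolded formal_module_def, THEN conjunct2, THEN conjunct2, THEN conjunct1] .
  then show "act a $ 1 = \<gamma> a" "act a $ 0 = 0" by blast+
qed

text \<open>An infinite residue field would have \<open>residue_card\<close> 0, and the height
  condition would then require a nonzero constant coefficient of [\<pi>]. The value 1 would mean
  that \<pi> is a unit.\<close>

lemma residue_card_gt_1: "residue_card \<pi> > 1"
proof -
  let ?q = "residue_card \<pi>"
  have "?q \<noteq> 0"
  proof
    assume "?q = 0"
    then have "act \<pi> $ 0 \<noteq> 0" using height g by (simp add: fibre_height_def power_0_left)
    then show False by (simp add: structure_map)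
  qed
  moreover have "?q \<noteq> 1"
  proof
    assume "?q = 1"
    then obtain c where "range (\<lambda>a. {b. \<pi> dvd b - a}) = {c}" by (auto simp: residue_card_def card_1_singleton_iff)
    then have "{b. \<pi> dvd b - 0} = {b. \<pi> dvd b - 1}" by (metis rangeI singletonD)
    moreover have "1 \<in> {b. \<pi> dvd b - 1}" by simp
    ultimately have "\<pi> dvd 1" by (metis (mono_tags, lifting) diff_zero mem_Collect_eq)
    then show False using unif by (simp add: uniformizer_def)
  qed
  ultimately show ?thesis by simp
qed

text \<open>\<gamma> \<pi> is the linear coefficient of [\<pi>], and on the generic fibre only
  exponents divisible by q^g > 1 occur, where q is \<open>residue_card \<pi>\<close>.\<close>

lemma structure_map_uniformizer: "\<gamma> \<pi> = 0"
proof (rule ccontr)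
  assume "\<gamma> \<pi> \<noteq> 0"
  then have "act \<pi> $ 1 \<notin> {0}" by (simp only: structure_map(2)) simp
  then have "residue_card \<pi> ^ g dvd 1" using height unfolding fibre_height_def by blast
  then have "residue_card \<pi> = 1" using g by simp
  then show False using residue_card_gt_1 by simp
qed

lemma structure_map_eq_0_iff: "\<gamma> a = 0 \<longleftrightarrow> \<pi> dvd a"
proof
  interpret \<gamma>: comm_ring_hom \<gamma> by (rule structure_map)
  show "\<gamma> a = 0" if "\<pi> dvd a" using that by (auto simp: \<gamma>.hom_mult structure_map_uniformizer elim!: dvdE)
  assume "\<gamma> a = 0"
  show "\<pi> dvd a"
  proof (cases "a = 0")
    case False
    then obtain u n where un: "u dvd 1" "a = u * \<pi> ^ n" using unif by (auto simp: uniformizer_def)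
    have "n \<noteq> 0"
    proof
      assume "n = 0"
      then have "a dvd 1" using un by simp
      then obtain b where "1 = a * b" by (elim dvdE)
      then have "\<gamma> 1 = \<gamma> (a * b)" by (rule arg_cong)
      then show False using \<open>\<gamma> a = 0\<close> by (simp add: \<gamma>.hom_mult)
    qed
    then show ?thesis using un by (simp add: dvd_power)
  qed simp
qed

lemma uniformizer_dvd_char: "\<pi> dvd of_nat CHAR('r)"
proof -
  interpret \<gamma>: comm_ring_hom \<gamma> by (rule structure_map)
  have "\<gamma> (of_nat n) = of_nat n" for n by (induction n) (simp_all add: \<gamma>.hom_add)
  then show ?thesis by (simp add: structure_map_eq_0_iff[symmetric])
qed

text \<open>\<gamma> identifies A / \<pi> A with a finite additive subgroup of R.\<close>

lemma residue_card_prime_power: "\<exists>k. residue_card \<pi> = CHAR('r) ^ k"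
proof -
  interpret \<gamma>: comm_ring_hom \<gamma> by (rule structure_map)
  have eq: "{b. \<pi> dvd b - a} = {b. \<pi> dvd b - a'} \<longleftrightarrow> \<gamma> a = \<gamma> a'" for a a'
  proof -
    have "{b. \<pi> dvd b - a} = {b. \<gamma> b = \<gamma> a}" for a
      by (simp add: structure_map_eq_0_iff[symmetric] \<gamma>.hom_minus)
    then show ?thesis by auto
  qed
  have card: "residue_card \<pi> = card (range \<gamma>)"
    unfolding residue_card_def by (rule card_image_cong_eq) (rule eq)
  then have fin: "finite (range \<gamma>)" using residue_card_gt_1 by (metis card.infinite not_one_less_zero)
  have "\<exists>k. card (range \<gamma>) = CHAR('r) ^ k"
  proof (rule card_finite_subgroup_prime_power[OF fin])
    show "0 \<in> range \<gamma>" by (metis \<gamma>.hom_zero rangeI)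
    fix x y assume "x \<in> range \<gamma>" "y \<in> range \<gamma>"
    then show "x - y \<in> range \<gamma>" by (auto simp flip: \<gamma>.hom_minus)
  qed
  then show ?thesis by (simp add: card)
qed

end

lemma sum_card_fibres_full:
  fixes f :: "'x \<Rightarrow> 'y"
  assumes fin: "finite A" "finite B" and f: "f ` A \<subseteq> B" and le: "\<And>y. y \<in> B \<Longrightarrow> card {x \<in> A. f x = y} \<le> c"
    and card: "card A = c * card B" and y: "y \<in> B"
  shows "card {x \<in> A. f x = y} = c"
proof (rule ccontr)
  assume "card {x \<in> A. f x = y} \<noteq> c"
  then have less: "card {x \<in> A. f x = y} < c" using le[OF y] by simp
  have "card A = (\<Sum>y\<in>B. card {x \<in> A. f x = y})"
    using sum.group[OF fin f, of "\<lambda>_. 1 :: nat"] by simp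
  also have "\<dots> < (\<Sum>y\<in>B. c)" using le less y fin by (intro sum_strict_mono_ex1) auto
  finally show False using card by (simp add: mult.commute)
qed

locale height_drop = formal_p_divisible \<omega> G \<alpha> \<gamma> F act p \<theta> \<pi> + D: complete_valuation_ring \<pi>
  for \<omega> :: "'r :: idom" and G :: "'r pdiv" and \<alpha> :: "nat \<Rightarrow> 'a :: idom \<Rightarrow> nat \<Rightarrow> nat \<Rightarrow> 'r" and \<gamma> :: "'a \<Rightarrow> 'r"
    and F :: "'r fps fps" and act :: "'a \<Rightarrow> 'r fps" and p :: nat and \<theta> :: "nat \<Rightarrow> 'r fps \<Rightarrow> nat \<Rightarrow> 'r" and \<pi> :: 'a +
  fixes q k s g :: nat
  assumes p: "prime p" "CHAR('r) = p" and q: "q = residue_card \<pi>" "q = p ^ k"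
    and special: "fibre_height max_ideal \<pi> act s" and generic: "fibre_height {0} \<pi> act g" and g: "1 \<le> g" "g < s"
begin

lemma q_gt_1: "q > 1" and \<gamma>_\<pi>: "\<gamma> \<pi> = 0"
  using residue_card_gt_1[OF fm D.uniformizer generic g(1)] structure_map_uniformizer[OF fm D.uniformizer generic g(1)]
  by (simp_all add: q(1))

lemma unit_index_act_\<pi>: "unit_index (act \<pi>) (q ^ s)"
proof -
  have "\<omega> dvd act \<pi> $ i" if "i < q ^ s" for i
  proof (cases "i = 0")
    case False
    then have "\<not> q ^ s dvd i" using that by (meson dvd_imp_le not_less neq0_conv)
    then have "act \<pi> $ i \<in> max_ideal" using special q(1) unfolding fibre_height_def by blast
    then show ?thesis using nonunit_iff by (simp add: max_ideal_def)
  qed simp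
  moreover have "act \<pi> $ (q ^ s) \<notin> max_ideal" using special q(1) unfolding fibre_height_def by blast
  ultimately show ?thesis using nonunit_iff by (simp add: unit_index_def max_ideal_def)
qed

lemma act_\<pi>_generic: "supp_mult (q ^ g) (act \<pi>)" "act \<pi> $ (q ^ g) \<noteq> 0" "i < q ^ g \<Longrightarrow> act \<pi> $ i = 0"
proof -
  show supp: "supp_mult (q ^ g) (act \<pi>)" and "act \<pi> $ (q ^ g) \<noteq> 0"
    using generic q(1) by (auto simp: fibre_height_def supp_mult_def)
  assume i: "i < q ^ g"
  show "act \<pi> $ i = 0"
  proof (rule ccontr)
    assume nz: "act \<pi> $ i \<noteq> 0"
    then have "q ^ g dvd i" "i \<noteq> 0" using supp by (auto simp: supp_mult_def intro: ccontr)
    then show False using i by (meson dvd_imp_le not_less neq0_conv)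
  qed
qed

lemma act_power_Suc: "act (\<pi> ^ Suc n) = act (\<pi> ^ n) oo act \<pi>"
  by (simp only: power_Suc2 act_mult)

lemma q_power_pos: "q ^ n > 0" using q_gt_1 by simp

lemma q_power_Suc: "q ^ (m * Suc n) = q ^ (m * n) * q ^ m" by (simp add: power_add mult.commute)

lemma act_power_supp: "supp_mult (q ^ (g * n)) (act (\<pi> ^ n))"
proof (induction n)
  case 0
  then show ?case by (simp add: supp_mult_def)
next
  case (Suc n)
  have "supp_mult (q ^ (g * n) * q ^ g) (act (\<pi> ^ n) oo act \<pi>)"
    using p q(2) by (intro supp_mult_compose[where k = "k * (g * n)"] Suc act_\<pi>_generic) (simp_all add: power_mult)
  then show ?case unfolding act_power_Suc q_power_Suc .
qed

lemma act_power_low: "(\<forall>i < q ^ (g * n). act (\<pi> ^ n) $ i = 0) \<and> act (\<pi> ^ n) $ (q ^ (g * n)) \<noteq> 0"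
proof (induction n)
  case (Suc n)
  note c = fps_compose_order[where f = "act (\<pi> ^ n)" and h = "act \<pi>" and d = 0 and m = "q ^ (g * n)" and k = "q ^ g"]
  have 1: "0 dvd act (\<pi> ^ n) $ i" if "i < q ^ (g * n)" for i using Suc.IH that by simp
  have 2: "0 dvd act \<pi> $ i" if "i < q ^ g" for i using act_\<pi>_generic(3)[OF that] by simp
  have "act (\<pi> ^ Suc n) $ i = 0" if "i < q ^ (g * Suc n)" for i
    using c(1)[OF 1 2 q_power_pos, of i] that unfolding q_power_Suc act_power_Suc by simp
  moreover have "act (\<pi> ^ Suc n) $ (q ^ (g * Suc n)) = act (\<pi> ^ n) $ (q ^ (g * n)) * (act \<pi> $ (q ^ g)) ^ (q ^ (g * n))"
    using c(2)[OF 1 2 q_power_pos] unfolding q_power_Suc act_power_Suc by simp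
  ultimately show ?case using Suc.IH act_\<pi>_generic(2) by simp
qed simp

lemma act_power_unit_index: "unit_index (act (\<pi> ^ n)) (q ^ (s * n))"
proof (induction n)
  case 0
  then show ?case using t_nonunit by (simp add: unit_index_def)
next
  case (Suc n)
  note c = fps_compose_order[where f = "act (\<pi> ^ n)" and h = "act \<pi>" and d = \<omega> and m = "q ^ (s * n)" and k = "q ^ s"]
  have 1: "\<omega> dvd act (\<pi> ^ n) $ i" if "i < q ^ (s * n)" for i using Suc.IH that by (simp add: unit_index_def)
  have 2: "\<omega> dvd act \<pi> $ i" if "i < q ^ s" for i using unit_index_act_\<pi> that by (simp add: unit_index_def)
  let ?u = "act (\<pi> ^ n) $ (q ^ (s * n)) * (act \<pi> $ (q ^ s)) ^ (q ^ (s * n))"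
  have "\<not> \<omega> dvd ?u"
    using Suc.IH unit_index_act_\<pi> by (auto simp: unit_index_def t_prime dest: t_prime_power)
  moreover have "\<omega> dvd act (\<pi> ^ Suc n) $ (q ^ (s * Suc n)) - ?u"
    using c(2)[OF 1 2 q_power_pos] unfolding q_power_Suc act_power_Suc .
  ultimately have "\<not> \<omega> dvd act (\<pi> ^ Suc n) $ (q ^ (s * Suc n))" 
    using dvd_diff[of \<omega> "act (\<pi> ^ Suc n) $ (q ^ (s * Suc n))" "act (\<pi> ^ Suc n) $ (q ^ (s * Suc n)) - ?u"] by auto
  moreover have "\<omega> dvd act (\<pi> ^ Suc n) $ i" if "i < q ^ (s * Suc n)" for i
    unfolding q_power_Suc act_power_Suc by (rule c(1)[OF 1 2 q_power_pos]) (use that in \<open>simp_all only: q_power_Suc\<close>)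
  ultimately show ?case unfolding unit_index_def by blast
qed

text \<open>The Weierstrass degree q^(s n) of [\<pi>^n] splits into the inseparability degree q^(g
  n) and the number q^((s - g) n) of zeros.\<close>

lemma formal_endomorphism_power:
  "formal_endomorphism \<omega> emb p (k * (g * n)) (q ^ (g * n)) (q ^ ((s - g) * n)) F (act (\<pi> ^ n))"
proof
  have "g * n + (s - g) * n = s * n" using g(2) by (simp flip: add_mult_distrib)
  then have "q ^ (g * n) * q ^ ((s - g) * n) = q ^ (s * n)" by (simp flip: power_add)
  then show "unit_index (act (\<pi> ^ n)) (q ^ (g * n) * q ^ ((s - g) * n))" using act_power_unit_index by simp
  show "q ^ (g * n) = p ^ (k * (g * n))" by (simp add: q(2) power_mult)
  show "F $ 1 $ 0 = 1" by (simp add: F_1)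
qed (use p act_power_low act_power_supp in \<open>simp_all add: F_0 act_endo\<close>)

lemma card_zeros: "card (zeros n) = q ^ ((s - g) * n)" and finite_zeros: "finite (zeros n)"
  using formal_endomorphism.card_zeros[OF formal_endomorphism_power] by (simp_all add: zeros_def)

abbreviation \<Phi> :: "'r fract alg_closure \<Rightarrow> 'r fract alg_closure" where "\<Phi> x \<equiv> eval1 x (act \<pi>)"

lemma zeros_small: "x \<in> zeros n \<Longrightarrow> small x" by (simp add: zeros_def)

lemma zeros_0: "zeros 0 = {0}" by (auto simp: zeros_def eval1_simps)

lemma zeros_Suc_iff: "x \<in> zeros (Suc n) \<longleftrightarrow> small x \<and> \<Phi> x \<in> zeros n"
  unfolding zeros_def act_power_Suc by (auto simp: eval1_compose[OF _ act0] eval1_small[OF _ act0])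

lemma zeros_1_iff: "x \<in> zeros 1 \<longleftrightarrow> small x \<and> \<Phi> x = 0"
  using zeros_Suc_iff[of x 0] by (simp add: zeros_0)

definition psub where "psub n \<phi> \<psi> = padd n \<phi> (pact n (-1) \<psi>)"

lemma psub:
  assumes \<phi>: "\<phi> \<in> points (lev G n)" and \<psi>: "\<psi> \<in> points (lev G n)"
  shows "psub n \<phi> \<psi> \<in> points (lev G n)" "padd n (psub n \<phi> \<psi>) \<psi> = \<phi>"
    and "pact n a (psub n \<phi> \<psi>) = psub n (pact n a \<phi>) (pact n a \<psi>)" "psub n \<phi> \<phi> = point_zero (lev G n)"
proof -
  note \<psi>' = pact_points[OF \<psi>]
  show "psub n \<phi> \<psi> \<in> points (lev G n)" unfolding psub_def by (rule padd_points[OF \<phi> \<psi>'])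
  have "padd n (psub n \<phi> \<psi>) \<psi> = padd n \<phi> (padd n (pact n (-1) \<psi>) \<psi>)"
    unfolding psub_def by (rule point_add_assoc[OF hopf])
  also have "\<dots> = padd n (point_zero (lev G n)) \<phi>"
    unfolding padd_neg[OF \<psi>] by (rule point_add_comm[OF hopf])
  also have "\<dots> = \<phi>" by (rule point_add_zero[OF hopf \<phi>])
  finally show "padd n (psub n \<phi> \<psi>) \<psi> = \<phi>" .
  show "pact n a (psub n \<phi> \<psi>) = psub n (pact n a \<phi>) (pact n a \<psi>)"
    unfolding psub_def pact_add_right[OF \<phi> \<psi>'] by (simp add: pact_mult[OF \<psi>, symmetric] mult.commute)
  show "psub n \<phi> \<phi> = point_zero (lev G n)"
    unfolding psub_def using padd_neg[OF \<phi>] point_add_comm[OF hopf, of n \<phi>] by simp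
qed

text \<open>Subtracting a fixed element of the fibre, in the group of points, maps the fibre
  injectively into the kernel of [\<pi>], which has q^(s - g) elements.\<close>

lemma card_fibre_le: "card {x \<in> zeros (Suc n). \<Phi> x = y} \<le> q ^ (s - g)"
proof (cases "{x \<in> zeros (Suc n). \<Phi> x = y} = {}")
  case False
  then obtain x0 where x0: "x0 \<in> zeros (Suc n)" "\<Phi> x0 = y" by blast
  let ?P = "points (lev G (Suc n))"
  have "\<forall>x\<in>zeros (Suc n). \<exists>\<phi>. \<phi> \<in> ?P \<and> crd (Suc n) \<phi> = x"
    using torsion_point_exists pi_torsion_iff by blast
  then obtain P where P: "\<And>x. x \<in> zeros (Suc n) \<Longrightarrow> P x \<in> ?P" "\<And>x. x \<in> zeros (Suc n) \<Longrightarrow> crd (Suc n) (P x) = x"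
    by metis
  define f where "f = (\<lambda>x. crd (Suc n) (psub (Suc n) (P x) (P x0)))"
  have "f x \<in> zeros 1" if x: "x \<in> zeros (Suc n)" "\<Phi> x = y" for x
  proof -
    have "pact (Suc n) \<pi> (P x) = pact (Suc n) \<pi> (P x0)"
    proof (rule crd_inj)
      show "crd (Suc n) (pact (Suc n) \<pi> (P x)) = crd (Suc n) (pact (Suc n) \<pi> (P x0))"
        using x x0 P by (simp add: crd_act)
    qed (intro pact_points P x x0)+
    then have "pact (Suc n) \<pi> (psub (Suc n) (P x) (P x0)) = point_zero (lev G (Suc n))"
      using psub(3)[OF P(1)[OF x(1)] P(1)[OF x0(1)], of \<pi>] psub(4)[OF pact_points[OF P(1)[OF x0(1)]] pact_points[OF P(1)[OF x0(1)]]] by simp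
    then have "\<Phi> (f x) = 0"
      unfolding f_def using crd_act[OF psub(1)[OF P(1)[OF x(1)] P(1)[OF x0(1)]], of \<pi>] by (simp add: crd_zero)
    moreover have "small (f x)" unfolding f_def by (intro crd_small psub P x x0)
    ultimately show ?thesis unfolding zeros_1_iff by blast
  qed
  moreover have "inj_on f {x \<in> zeros (Suc n). \<Phi> x = y}"
  proof (rule inj_onI)
    fix x x' assume "x \<in> {x \<in> zeros (Suc n). \<Phi> x = y}" "x' \<in> {x \<in> zeros (Suc n). \<Phi> x = y}" "f x = f x'"
    then have x: "x \<in> zeros (Suc n)" and x': "x' \<in> zeros (Suc n)" and eq: "f x = f x'" by auto
    have "psub (Suc n) (P x) (P x0) = psub (Suc n) (P x') (P x0)"
      by (rule crd_inj[OF psub(1)[OF P(1)[OF x] P(1)[OF x0(1)]] psub(1)[OF P(1)[OF x'] P(1)[OF x0(1)]]])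
         (rule eq[unfolded f_def])
    then have "P x = P x'"
      using psub(2)[OF P(1)[OF x] P(1)[OF x0(1)]] psub(2)[OF P(1)[OF x'] P(1)[OF x0(1)]] by metis
    then show "x = x'" using P(2)[OF x] P(2)[OF x'] by metis
  qed
  ultimately have "card {x \<in> zeros (Suc n). \<Phi> x = y} \<le> card (zeros 1)"
    by (intro card_inj_on_le[of f] finite_zeros) blast+
  then show ?thesis using card_zeros[of 1] by simp
next
  case True
  show ?thesis unfolding True by simp
qed

text \<open>The fibres over \<open>zeros n\<close> have at most q^(s - g) elements each, and
  together they make up all q^((s - g) (n + 1)) elements of \<open>zeros (Suc n)\<close>, so none of
  them can be smaller.\<close>

lemma card_fibre: assumes "y \<in> zeros n" shows "card {x \<in> zeros (Suc n). \<Phi> x = y} = q ^ (s - g)"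
proof (rule sum_card_fibres_full[OF finite_zeros finite_zeros _ card_fibre_le _ assms])
  show "\<Phi> ` zeros (Suc n) \<subseteq> zeros n" using zeros_Suc_iff by blast
  show "card (zeros (Suc n)) = q ^ (s - g) * card (zeros n)" by (simp add: card_zeros power_add)
qed

lemma \<Phi>_surj: assumes "y \<in> zeros n" shows "\<exists>x\<in>zeros (Suc n). \<Phi> x = y"
proof -
  have "card {x \<in> zeros (Suc n). \<Phi> x = y} > 0" unfolding card_fibre[OF assms] by (rule q_power_pos)
  then have "{x \<in> zeros (Suc n). \<Phi> x = y} \<noteq> {}" by (metis card.empty less_irrefl)
  then show ?thesis by blast
qed

lemma T_lift: assumes y: "y \<in> zeros 1" shows "\<exists>t\<in>carrier T. tcrd t 1 = y"
proof -
  \<comment> \<open>Besides membership in \<open>zeros n\<close> the predicate prescribes the value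
    y at index 1; index 0 can only carry 0.\<close>
  let ?P = "\<lambda>n x. x \<in> zeros n \<and> (n = 1 \<longrightarrow> x = y)"
  have "\<exists>x. \<forall>n. ?P n (x n) \<and> \<Phi> (x (Suc n)) = x n"
  proof (rule dependent_nat_choice)
    show "\<exists>x. ?P 0 x" by (simp add: zeros_0)
    fix x n assume x: "?P n x"
    show "\<exists>x'. ?P (Suc n) x' \<and> \<Phi> x' = x"
    proof (cases "n = 0")
      case True
      then have "x = 0" using x by (simp add: zeros_0)
      then show ?thesis using y True zeros_1_iff[of y] by (intro exI[of _ y]) simp
    next
      case False
      then show ?thesis using \<Phi>_surj[of x n] x by auto
    qed
  qed
  then obtain x where x: "\<And>n. x n \<in> zeros n" "x 1 = y" "\<And>n. \<Phi> (x (Suc n)) = x n" by blast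
  then show ?thesis using T_exists[of x] by auto
qed

text \<open>If the coordinate of w at index 1 vanishes, the one at index n + 1 is killed by
  [\<pi>^n]. Shifting the index by one therefore gives an element v of T, and \<pi> v = w by
  compatibility.\<close>

lemma T_shift:
  assumes w: "w \<in> carrier T" and w1: "tcrd w 1 = 0" shows "\<exists>v\<in>carrier T. w = \<pi> \<odot>\<^bsub>T\<^esub> v"
proof -
  have "tcrd w (Suc n) \<in> zeros n" for n
    using tcrd_steps[OF w, of 1 n] tcrd_small[OF w, of "Suc n"] w1 by (simp add: zeros_def)
  then obtain v where v: "v \<in> carrier T" "\<And>n. tcrd v n = tcrd w (Suc n)"
    using T_exists[of "\<lambda>n. tcrd w (Suc n)"] tcrd_step[OF w] by blast
  have "tcrd (\<pi> \<odot>\<^bsub>T\<^esub> v) n = tcrd w n" for n using tcrd_smult[OF v(1), of n \<pi>] v(2) tcrd_step[OF w] by simp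
  then have "w = \<pi> \<odot>\<^bsub>T\<^esub> v" using T_eq_iff[OF w T_smult_closed[OF v(1)], of \<pi>] by simp
  then show ?thesis using v(1) by blast
qed

lemma tcrd_power_smult: assumes "u \<in> carrier T" "m \<le> n" shows "tcrd (\<pi> ^ n \<odot>\<^bsub>T\<^esub> u) m = 0"
proof -
  have "act (\<pi> ^ n) = act (\<pi> ^ (n - m)) oo act (\<pi> ^ m)" using assms(2) by (simp flip: act_mult power_add)
  then have "tcrd (\<pi> ^ n \<odot>\<^bsub>T\<^esub> u) m = eval1 (eval1 (tcrd u m) (act (\<pi> ^ m))) (act (\<pi> ^ (n - m)))"
    using eval1_compose[OF tcrd_small[OF assms(1), of m] act0] tcrd_smult[OF assms(1)] by simp
  then show ?thesis using tcrd_zeros[OF assms(1), of m] by (simp add: zeros_def eval1_0)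
qed

lemma tcrd_add_zero:
  assumes t: "t \<in> carrier T" and u: "u \<in> carrier T" and u0: "tcrd u n = 0"
  shows "tcrd (t \<oplus>\<^bsub>T\<^esub> u) n = tcrd t n"
proof -
  have un: "u n = point_zero (lev G n)"
    by (rule crd_inj[OF T_points[OF u] zero_points]) (simp add: u0 crd_zero)
  have "padd n (t n) (u n) = t n"
    unfolding un using point_add_comm[OF hopf] point_add_zero[OF hopf T_points[OF t]] by metis
  then show ?thesis by (simp add: T_simps)
qed

sublocale M: dvr_module T \<pi>
proof
  show "t = \<zero>\<^bsub>T\<^esub>" if t: "t \<in> carrier T" and z: "\<pi> \<odot>\<^bsub>T\<^esub> t = \<zero>\<^bsub>T\<^esub>" for t
  proof -
    have "tcrd t n = tcrd (\<pi> \<odot>\<^bsub>T\<^esub> t) (Suc n)" for n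
      using tcrd_smult[OF t] tcrd_step[OF t] by simp
    then show ?thesis using tcrd_zero_iff[OF t] tcrd_zero_iff[OF T_zero_closed] z by metis
  qed
  show "t = \<zero>\<^bsub>T\<^esub>" if t: "t \<in> carrier T" and z: "\<And>n. \<exists>u\<in>carrier T. t = \<pi> ^ n \<odot>\<^bsub>T\<^esub> u" for t
  proof -
    have "tcrd t n = 0" for n using z[of n] tcrd_power_smult[of _ n n] by auto
    then show ?thesis using tcrd_zero_iff[OF t] by blast
  qed
qed

text \<open>The coordinate of index 1 identifies T / \<pi> T with the q^(s - g) zeros of [\<pi>]: it
  is onto by \<open>T_lift\<close>, and \<open>T_shift\<close> describes where it vanishes.\<close>

theorem tate_module_free: "\<exists>b. free_module_basis T (s - g) b"
proof (rule M.free_basis_exists[where \<kappa> = "\<lambda>t. tcrd t 1"])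
  have img: "(\<lambda>t. tcrd t 1) ` carrier T = zeros 1" using T_lift tcrd_zeros by blast
  show "finite ((\<lambda>t. tcrd t 1) ` carrier T)" unfolding img by (rule finite_zeros)
  show "card ((\<lambda>t. tcrd t 1) ` carrier T) = residue_card \<pi> ^ (s - g)" unfolding img card_zeros q(1) by simp
  show "residue_card \<pi> > 1" using q_gt_1 q(1) by simp
  fix t u assume t: "t \<in> carrier T" and u: "u \<in> carrier T"
  show "tcrd t 1 = tcrd u 1 \<longleftrightarrow> (\<exists>v\<in>carrier T. t = u \<oplus>\<^bsub>T\<^esub> \<pi> \<odot>\<^bsub>T\<^esub> v)"
  proof
    assume "\<exists>v\<in>carrier T. t = u \<oplus>\<^bsub>T\<^esub> \<pi> \<odot>\<^bsub>T\<^esub> v"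
    then obtain v where v: "v \<in> carrier T" "t = u \<oplus>\<^bsub>T\<^esub> \<pi> \<odot>\<^bsub>T\<^esub> v" by blast
    have "tcrd (\<pi> \<odot>\<^bsub>T\<^esub> v) 1 = 0" using tcrd_power_smult[OF v(1), of 1 1] by simp
    then show "tcrd t 1 = tcrd u 1" unfolding v(2) by (rule tcrd_add_zero[OF u T_smult_closed[OF v(1)]])
  next
    assume eq: "tcrd t 1 = tcrd u 1"
    let ?w = "t \<oplus>\<^bsub>T\<^esub> (-1) \<odot>\<^bsub>T\<^esub> u"
    have w: "?w \<in> carrier T" by (intro T_add_closed T_smult_closed t u)
    have tu: "t 1 = u 1" by (rule crd_inj[OF T_points[OF t] T_points[OF u] eq])
    have "?w 1 = point_zero (lev G 1)"
      using psub(4)[OF T_points[OF u] T_points[OF u], of 1] by (simp add: T_simps tu psub_def del: One_nat_def)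
    then have "tcrd ?w 1 = 0" by (simp add: crd_zero)
    then obtain v where v: "v \<in> carrier T" "?w = \<pi> \<odot>\<^bsub>T\<^esub> v" using T_shift[OF w] by blast
    have "u \<oplus>\<^bsub>T\<^esub> ?w = t"
    proof -
      have "u \<oplus>\<^bsub>T\<^esub> ?w = ?w \<oplus>\<^bsub>T\<^esub> u" unfolding T_simps by (rule ext) (rule point_add_comm[OF hopf])
      also have "\<dots> = t" unfolding T_simps
        by (rule ext) (use psub(2)[OF T_points[OF t] T_points[OF u]] in \<open>simp add: psub_def\<close>)
      finally show ?thesis .
    qed
    then show "\<exists>v\<in>carrier T. t = u \<oplus>\<^bsub>T\<^esub> \<pi> \<odot>\<^bsub>T\<^esub> v" using v by metis
  qed
qed

end

section \<open>Orbits of the Galois group\<close>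

text \<open>Having the same valuation, in a form that avoids choosing an extension of the valuation to the
  algebraic closure.\<close>

definition (in complete_dvr_closure) associated :: "'e \<Rightarrow> 'e \<Rightarrow> bool" where
  "associated x y \<longleftrightarrow> x \<noteq> 0 \<and> y \<noteq> 0 \<and> x / y \<in> int_closure \<and> y / x \<in> int_closure"

context complete_dvr_closure
begin

lemma associated_trans: assumes "associated x y" "associated y z" shows "associated x z"
proof -
  have "(x / y) * (y / z) \<in> int_closure" "(z / y) * (y / x) \<in> int_closure"
    using assms unfolding associated_def by (blast intro: int_closure_closed)+
  then show ?thesis using assms by (simp add: associated_def)
qed

lemma associated_mult: assumes "associated x y" "associated u v" shows "associated (x * u) (y * v)"
proof -
  have "(x / y) * (u / v) \<in> int_closure" "(y / x) * (v / u) \<in> int_closure"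
    using assms unfolding associated_def by (blast intro: int_closure_closed)+
  then show ?thesis using assms by (simp add: associated_def)
qed

lemma associated_refl: "x \<noteq> 0 \<Longrightarrow> associated x x"
  using int_closure_base[of 1] by (simp add: associated_def)

lemma associated_power: assumes "associated x y" shows "associated (x ^ n) (y ^ n)"
proof (induction n)
  case 0
  then show ?case by (simp add: associated_refl)
next
  case (Suc n)
  then show ?case using associated_mult[OF assms Suc] by simp
qed

lemma associated_prod:
  assumes "finite A" "\<And>z. z \<in> A \<Longrightarrow> associated z y" shows "associated (\<Prod>A) (y ^ card A)"
  using assms
proof (induction A rule: finite_induct)
  case empty
  then show ?case by (simp add: associated_refl)
next
  case (insert z A)
  then show ?case using associated_mult[of z y "\<Prod>A" "y ^ card A"] by simp
qed

lemma div_int_closure_associated: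
  assumes "associated x y" "x / z \<in> int_closure" shows "y / z \<in> int_closure"
proof -
  have "(y / x) * (x / z) \<in> int_closure" using assms unfolding associated_def by (blast intro: int_closure_closed)
  then show ?thesis using assms(1) by (simp add: associated_def)
qed

lemma int_closure_div_power: assumes "x / y \<in> int_closure" shows "x ^ n / y ^ n \<in> int_closure"
  using int_closure_power[OF assms, of n] by (simp add: power_divide)

end

lemma closure_aut_hom: "closure_aut \<tau> \<Longrightarrow> comm_ring_hom \<tau>" "closure_aut \<tau> \<Longrightarrow> \<tau> (to_ac c) = to_ac c"
  by (simp_all add: closure_aut_def)

context formal_p_divisible
begin

lemma aut_small: "closure_aut \<tau> \<Longrightarrow> small x \<Longrightarrow> small (\<tau> x)"
  by (rule small_image[OF closure_aut_hom(1)]) (simp_all add: closure_aut_hom(2))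

lemma aut_eval1: "closure_aut \<tau> \<Longrightarrow> small x \<Longrightarrow> \<tau> (eval1 x f) = eval1 (\<tau> x) f"
  by (rule eval1_image[OF closure_aut_hom(1)]) (simp_all add: closure_aut_hom(2))

text \<open>If \<open>y / \<tau> y\<close> were small, so would be all \<open>\<tau>\<^sup>i y / \<tau>\<^sup>j y\<close> with \<open>i < j\<close>, but the orbit is finite.\<close>

lemma conjugate_quotient_integral:
  assumes \<tau>: "closure_aut \<tau>" and y: "y \<noteq> 0" shows "\<tau> y / y \<in> int_closure"
proof (rule ccontr)
  assume n: "\<tau> y / y \<notin> int_closure"
  interpret \<tau>: comm_ring_hom \<tau> by (rule closure_aut_hom[OF \<tau>])
  have inj: "inj \<tau>" using \<tau> by (simp add: closure_aut_def bij_is_inj)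
  have pow: "closure_aut (\<tau> ^^ i)" for i
  proof (induction i)
    case 0
    then show ?case using closure_aut_id by (simp add: id_def)
  next
    case (Suc i)
    show ?case unfolding funpow.simps by (rule closure_aut_comp[OF \<tau> Suc])
  qed
  have nz: "(\<tau> ^^ i) y \<noteq> 0" for i
  proof (induction i)
    case (Suc i)
    show ?case
    proof
      assume "(\<tau> ^^ Suc i) y = 0"
      then have "\<tau> ((\<tau> ^^ i) y) = \<tau> 0" by simp
      then show False using Suc injD[OF inj] by blast
    qed
  qed (simp add: y)
  have "small (y / \<tau> y)" using n by (simp add: small_iff)
  then have "small ((\<tau> ^^ i) (y / \<tau> y))" for i using pow aut_small by blast
  moreover have "(\<tau> ^^ i) (y / \<tau> y) = (\<tau> ^^ i) y / (\<tau> ^^ Suc i) y" for i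
  proof -
    interpret h: comm_ring_hom "\<tau> ^^ i" by (rule closure_aut_hom[OF pow])
    have "(\<tau> ^^ i) (y / \<tau> y) * (\<tau> ^^ i) (\<tau> y) = (\<tau> ^^ i) (y / \<tau> y * \<tau> y)" by (rule h.hom_mult[symmetric])
    also have "y / \<tau> y * \<tau> y = y" using nz[of 1] by simp
    finally have "(\<tau> ^^ i) (y / \<tau> y) * (\<tau> ^^ Suc i) y = (\<tau> ^^ i) y" by (simp add: funpow_swap1)
    then show ?thesis using nz[of "Suc i"] by (simp add: field_simps)
  qed
  ultimately have step: "small ((\<tau> ^^ i) y / (\<tau> ^^ Suc i) y)" for i by simp
  have less: "small ((\<tau> ^^ i) y / (\<tau> ^^ (i + Suc j)) y)" for i j
  proof (induction j)
    case 0
    then show ?case using step[of i] by simp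
  next
    case (Suc j)
    have "small ((\<tau> ^^ i) y / (\<tau> ^^ (i + Suc j)) y * ((\<tau> ^^ (i + Suc j)) y / (\<tau> ^^ Suc (i + Suc j)) y))"
      by (rule small_mult[OF Suc small_in_int_closure[OF step]])
    then show ?case using nz[of "i + Suc j"] by simp
  qed
  have "\<not> inj (\<lambda>i. (\<tau> ^^ i) y)"
  proof
    assume "inj (\<lambda>i. (\<tau> ^^ i) y)"
    moreover have "range (\<lambda>i. (\<tau> ^^ i) y) \<subseteq> conjugates y" using pow by (auto simp: conjugates_def)
    ultimately show False using finite_conjugates[of y] by (meson finite_imageD finite_subset infinite_UNIV_nat)
  qed
  then obtain i j where ij: "(\<tau> ^^ i) y = (\<tau> ^^ j) y" "i \<noteq> j" by (auto simp: inj_def)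
  have False if lt: "i < j" "(\<tau> ^^ i) y = (\<tau> ^^ j) y" for i j :: nat
  proof -
    obtain l where "j = i + Suc l" using less_imp_Suc_add[OF lt(1)] by auto
    then show False using less[of i l] lt(2) nz[of j] by simp
  qed
  then show False using ij by (metis linorder_neqE_nat)
qed

text \<open>\<open>conjugate_quotient_integral\<close> is applied to \<tau> and to its inverse,
  which bounds the quotient from both sides.\<close>

lemma conjugates_associated:
  assumes y: "y \<noteq> 0" and z: "z \<in> conjugates y" shows "associated z y"
proof -
  obtain \<tau> where \<tau>: "closure_aut \<tau>" "z = \<tau> y" using z by (auto simp: conjugates_def)
  let ?i = "inv_into UNIV \<tau>"
  have i: "closure_aut ?i" by (rule closure_aut_inv[OF \<tau>(1)])
  have b: "?i z = y" using \<tau> by (simp add: closure_aut_def bij_is_inj)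
  interpret i: comm_ring_hom ?i by (rule closure_aut_hom[OF i])
  have nz: "z \<noteq> 0" using b y i.hom_zero by metis
  have "?i z / z \<in> int_closure" by (rule conjugate_quotient_integral[OF i nz])
  then show ?thesis using conjugate_quotient_integral[OF \<tau>(1) y] y nz \<tau>(2) b by (simp add: associated_def)
qed

text \<open>Discreteness of the valuation on K: a unit times \<omega>^i / \<omega>^j has an integral
  inverse unless i > j.\<close>

lemma small_base_divisible:
  assumes "small (to_ac c)" shows "to_ac c / emb \<omega> \<in> int_closure"
proof -
  obtain a b where ab: "c = Fract a b" "b \<noteq> 0" by (cases c) auto
  have c: "to_ac c = emb a / emb b"
    using ab(2) unfolding ab(1) by (simp add: Fract_conv_to_fract to_ac_divide)
  show ?thesis
  proof (cases "a = 0")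
    case True
    then show ?thesis using int_closure_base[of 0] by (simp add: c)
  next
    case False
    obtain u i where a: "u dvd 1" "a = u * \<omega> ^ i" using unit_times_power[OF False] by blast
    obtain v j where b: "v dvd 1" "b = v * \<omega> ^ j" using unit_times_power[OF ab(2)] by blast
    obtain u' where u': "1 = u * u'" using a(1) by (elim dvdE)
    obtain v' where v': "1 = v * v'" using b(1) by (elim dvdE)
    have e1: "emb u * emb u' = 1" "emb v * emb v' = 1"
      using arg_cong[OF u', of emb] arg_cong[OF v', of emb] by simp_all
    then have nz: "emb u \<noteq> 0" "emb v \<noteq> 0" and eu: "inverse (emb u) = emb u'" "inverse (emb v) = emb v'"
      by (auto intro: inverse_unique)
    have "i > j"
    proof (rule ccontr)
      assume "\<not> i > j"
      then obtain l where l: "j = i + l" by (metis add.commute le_Suc_ex not_less)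
      have "inverse (to_ac c) = emb (v * u' * \<omega> ^ l)"
        using t_nonzero nz by (simp add: c a(2) b(2) l power_add field_simps flip: eu)
      then have "inverse (to_ac c) \<in> int_closure" using int_closure_base by metis
      moreover have "to_ac c \<noteq> 0" using False ab(2) by (simp add: c)
      ultimately show False using assms by (simp add: small_iff)
    qed
    then obtain l where l: "i = Suc (j + l)" by (metis less_imp_Suc_add)
    have "to_ac c / emb \<omega> = emb (u * v' * \<omega> ^ l)"
      using t_nonzero nz by (simp add: c a(2) b(2) l power_add field_simps flip: eu)
    then show ?thesis using int_closure_base by metis
  qed
qed

end

context height_drop
begin

text \<open>The height of the special fibre enters here: modulo \<omega> the series [\<pi>] is
  X^(q^s) times a unit.\<close>

lemma \<Phi>_decompose: assumes x: "small x"
  obtains a where "a \<in> int_closure" "\<Phi> x = emb \<omega> * a + x ^ (q ^ s) * eval1 x (fps_shift (q ^ s) (act \<pi>))"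
    "eval1 x (fps_shift (q ^ s) (act \<pi>)) \<noteq> 0" "inverse (eval1 x (fps_shift (q ^ s) (act \<pi>))) \<in> int_closure"
proof -
  obtain A U V where A: "act \<pi> = fps_const \<omega> * A + fps_X ^ (q ^ s) * U" "U * V = 1" "U = fps_shift (q ^ s) (act \<pi>)"
    by (rule unit_index_decompose[OF unit_index_act_\<pi>]) blast
  have "U $ 0 * V $ 0 = 1" using arg_cong[OF A(2), of "\<lambda>f. f $ 0"] by (simp add: fps_mult_nth_0)
  then have U0: "U $ 0 dvd 1" by (metis dvd_triv_left)
  have "\<Phi> x = eval1 x (fps_const \<omega> * A + fps_X ^ (q ^ s) * U)" by (simp only: A(1)[symmetric])
  also have "\<dots> = emb \<omega> * eval1 x A + x ^ (q ^ s) * eval1 x U" by (simp add: eval1_simps[OF x])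
  finally show thesis using eval1_unit[OF x U0] eval1_int[OF x, of A] that unfolding A(3) by blast
qed

text \<open>The linear coefficient of [\<pi>] is \<gamma> \<pi> = 0, so X^2 divides [\<pi>].\<close>

lemma \<Phi>_square: assumes x: "small x" shows "\<exists>b\<in>int_closure. \<Phi> x = x * x * b"
proof -
  have "act \<pi> = fps_X * (fps_X * fps_shift 2 (act \<pi>))"
  proof (rule fps_ext)
    fix n
    have "act \<pi> $ 1 = 0" by (simp only: act1 \<gamma>_\<pi>)
    then show "act \<pi> $ n = (fps_X * (fps_X * fps_shift 2 (act \<pi>))) $ n"
      by (cases n rule: nat.exhaust, simp, rename_tac m, case_tac m) (auto simp: numeral_2_eq_2)
  qed
  then have "\<Phi> x = eval1 x (fps_X * (fps_X * fps_shift 2 (act \<pi>)))" by (rule arg_cong)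
  also have "\<dots> = x * x * eval1 x (fps_shift 2 (act \<pi>))" by (simp add: eval1_simps[OF x] mult.assoc)
  finally show ?thesis using eval1_int[OF x] by blast
qed

section \<open>Valuations and conjugates along a compatible system of torsion points\<close>

context
  fixes x :: "nat \<Rightarrow> 'r fract alg_closure"
  assumes x: "\<And>n. x n \<in> zeros n" "\<And>n. \<Phi> (x (Suc n)) = x n" and x_nonzero: "\<exists>n. x n \<noteq> 0"
begin

lemma tower_small: "small (x n)" using x(1) by (rule zeros_small)

text \<open>Some nonzero x n has smaller valuation than \<omega>. Otherwise \<omega> would divide
  all of them, and since x n is the square of x (n + 1) times an integral element, the power of
  \<omega> that divides every x n could be raised indefinitely, so that all would be 0.\<close>

lemma tower_eventually_large: "\<exists>n. x n \<noteq> 0 \<and> small (emb \<omega> / x n)"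
proof (rule ccontr)
  assume "\<not> ?thesis"
  then have *: "x n = 0 \<or> \<not> small (emb \<omega> / x n)" for n by blast
  have base: "x n / emb \<omega> \<in> int_closure" for n
  proof (cases "x n = 0")
    case False
    then show ?thesis using * small_iff[of "emb \<omega> / x n"] by auto
  qed (use int_closure_base[of 0] in simp)
  have "x n / emb \<omega> ^ Suc j \<in> int_closure" for n j
  proof (induction j arbitrary: n)
    case 0
    then show ?case using base by simp
  next
    case (Suc j)
    obtain b where b: "b \<in> int_closure" "\<Phi> (x (Suc n)) = x (Suc n) * x (Suc n) * b"
      using \<Phi>_square[OF tower_small[of "Suc n"]] by blast
    have "(x (Suc n) / emb \<omega> ^ Suc j) * (x (Suc n) / emb \<omega>) * b \<in> int_closure"
      by (intro int_closure_closed Suc base b)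
    then show ?case using b(2) x(2) by (simp add: mult_ac)
  qed
  then have "x n / emb \<omega> ^ j \<in> int_closure" for n j
    using small_in_int_closure[OF tower_small[of n]] by (cases j) auto
  then have "x n = 0" for n by (rule int_closure_separated)
  then show False using x_nonzero by blast
qed

text \<open>In x n = \<omega> a + x (n + 1)^(q^s) u the first term has larger valuation than x n, so
  the second has the valuation of x n, and u is a unit. As the valuation of x (n + 1) is at most
  that of x n, the hypothesis persists.\<close>

lemma tower_step:
  assumes n: "x n \<noteq> 0" "small (emb \<omega> / x n)"
  shows "associated (x (Suc n) ^ (q ^ s)) (x n)" "x (Suc n) \<noteq> 0" "small (emb \<omega> / x (Suc n))"
proof -
  let ?y = "x (Suc n)"
  let ?u = "eval1 ?y (fps_shift (q ^ s) (act \<pi>))"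
  obtain a where a: "a \<in> int_closure" "x n = emb \<omega> * a + ?y ^ (q ^ s) * ?u" "?u \<noteq> 0" "inverse ?u \<in> int_closure"
    by (rule \<Phi>_decompose[OF tower_small[of "Suc n"]]) (use x(2)[of n] in simp)
  have y0: "?y \<noteq> 0"
  proof
    assume "?y = 0"
    then have "x n = 0" using x(2)[of n] by (simp add: eval1_0)
    then show False using n(1) by simp
  qed
  have small': "small (- (emb \<omega> / x n * a))" by (intro small_uminus small_mult n a)
  have quo: "?y ^ (q ^ s) * ?u / x n = 1 + - (emb \<omega> / x n * a)"
    using a(2) n(1) by (simp add: field_simps)
  have quo_unit: "inverse (?y ^ (q ^ s) * ?u / x n) \<in> int_closure" "?y ^ (q ^ s) * ?u / x n \<in> int_closure"
  proof -
    let ?z = "1 + - (emb \<omega> / x n * a)"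
    have "\<not> small ?z"
    proof
      assume "small ?z"
      then have "small (?z - - (emb \<omega> / x n * a))" by (rule small_diff[OF _ small'])
      then show False by simp
    qed
    then show "inverse (?y ^ (q ^ s) * ?u / x n) \<in> int_closure" unfolding quo by (simp add: small_iff)
    show "?y ^ (q ^ s) * ?u / x n \<in> int_closure"
      unfolding quo using int_closure_base[of 1] by (intro int_closure_closed small_in_int_closure[OF small']) simp
  qed
  have "inverse (?y ^ (q ^ s) * ?u / x n) * ?u \<in> int_closure"
    by (intro int_closure_closed quo_unit eval1_int tower_small)
  moreover have "inverse (?y ^ (q ^ s) * ?u / x n) * ?u = x n / ?y ^ (q ^ s)"
    using a(3) n(1) y0 by (simp add: field_simps)
  ultimately have 1: "x n / ?y ^ (q ^ s) \<in> int_closure" by (simp only:)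
  have "?y ^ (q ^ s) * ?u / x n * inverse ?u \<in> int_closure"
    by (intro int_closure_closed quo_unit a(4))
  moreover have "?y ^ (q ^ s) * ?u / x n * inverse ?u = ?y ^ (q ^ s) / x n"
    using a(3) n(1) y0 by (simp add: field_simps)
  ultimately have 2: "?y ^ (q ^ s) / x n \<in> int_closure" by (simp only:)
  show as: "associated (?y ^ (q ^ s)) (x n)"
    using 1 2 n(1) y0 by (simp add: associated_def)
  show "?y \<noteq> 0" by (rule y0)
  obtain m where m: "q ^ s = Suc m" using q_power_pos[of s] gr0_conv_Suc by blast
  have "x n / ?y ^ (q ^ s) * ?y ^ m \<in> int_closure"
    by (intro int_closure_closed int_closure_power 1 small_in_int_closure[OF tower_small[of "Suc n"]])
  then have "small (emb \<omega> / x n * (x n / ?y ^ (q ^ s) * ?y ^ m))" by (rule small_mult[OF n(2)])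
  moreover have "emb \<omega> / x n * (x n / ?y ^ (q ^ s) * ?y ^ m) = emb \<omega> / ?y"
    using n(1) y0 by (simp add: m)
  ultimately show "small (emb \<omega> / ?y)" by simp
qed

lemma tower_valuation:
  assumes n: "x n \<noteq> 0" "small (emb \<omega> / x n)"
  shows "associated (x (n + j) ^ (q ^ (s * j))) (x n) \<and> x (n + j) \<noteq> 0 \<and> small (emb \<omega> / x (n + j))"
proof (induction j)
  case 0
  then show ?case using n by (simp add: associated_refl)
next
  case (Suc j)
  note st = tower_step[OF Suc[THEN conjunct2, THEN conjunct1] Suc[THEN conjunct2, THEN conjunct2]]
  have "associated ((x (Suc (n + j)) ^ (q ^ s)) ^ (q ^ (s * j))) (x (n + j) ^ (q ^ (s * j)))"
    by (rule associated_power[OF st(1)])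
  then have "associated (x (Suc (n + j)) ^ (q ^ (s * Suc j))) (x (n + j) ^ (q ^ (s * j)))"
    by (simp only: q_power_Suc power_mult[symmetric] mult.commute)
  then have "associated (x (Suc (n + j)) ^ (q ^ (s * Suc j))) (x n)"
    by (rule associated_trans[OF _ Suc[THEN conjunct1]])
  then show ?case using st by simp
qed

text \<open>Let Q = q^(g n), y = x_n^Q, D the number of conjugates of y, and n = n0 + j. The norm of
  y is a small element of K, hence divisible by \<omega>, and it has the valuation of y^D. With v
  for the valuation this means Q D v(x_n) \<ge> v(\<omega>), where q^(s j) v(x_n) = v(x_n0) <
  v(\<omega>). Therefore Q D \<ge> q^(s j), and the factor q^(s n0) accounts for the difference
  between j and n.\<close>

lemma card_conjugates_bound: "\<exists>n0. \<forall>n \<ge> n0. q ^ ((s - g) * n) \<le> card (conjugates (x n)) * q ^ (s * n0)"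
proof -
  obtain n0 where n0: "x n0 \<noteq> 0" "small (emb \<omega> / x n0)" using tower_eventually_large by blast
  have "q ^ ((s - g) * n) \<le> card (conjugates (x n)) * q ^ (s * n0)" if n: "n \<ge> n0" for n
  proof -
    obtain j where j: "n = n0 + j" using n le_Suc_ex by blast
    note val = tower_valuation[OF n0, of j, folded j]
    let ?Q = "q ^ (g * n)"
    let ?y = "x n ^ ?Q"
    let ?D = "card (conjugates ?y)"
    interpret E: formal_endomorphism \<omega> emb p "k * (g * n)" ?Q "q ^ ((s - g) * n)" F "act (\<pi> ^ n)"
      by (rule formal_endomorphism_power)
    obtain W where W: "\<And>z. small z \<Longrightarrow> eval1 z (act (\<pi> ^ n)) = 0 \<longleftrightarrow> ev W (z ^ ?Q) = 0"
      "\<And>z. ev W z = 0 \<Longrightarrow> ev (pderiv W) z \<noteq> 0" by (rule E.weierstrass_polynomial) blast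
    have y0: "?y \<noteq> 0" using val by simp
    have y: "ev W ?y = 0" using W(1)[OF tower_small[of n]] x(1)[of n] by (simp add: zeros_def)
    have hf: "idom_hom (to_fract :: 'r \<Rightarrow> 'r fract)" by unfold_locales simp_all
    have map: "aeval (map_poly to_fract f) z = ev f z" for f z
      by (simp add: map_poly_map_poly o_def)
    have "\<exists>c. \<Prod>(conjugates ?y) = to_ac c"
    proof (rule prod_conjugates_in_base)
      show "aeval (map_poly to_fract W) ?y = 0" unfolding map by (rule y)
      show "aeval (pderiv (map_poly to_fract W)) ?y \<noteq> 0"
        unfolding idom_hom.map_poly_pderiv[OF hf, symmetric] map by (rule W(2)[OF y])
    qed
    then obtain c where c: "\<Prod>(conjugates ?y) = to_ac c" by blast
    have asc: "associated (to_ac c) (?y ^ ?D)"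
      unfolding c[symmetric] by (rule associated_prod[OF finite_conjugates conjugates_associated[OF y0]])
    have D: "?D > 0"
    proof -
      have "?y \<in> conjugates ?y" unfolding conjugates_def using closure_aut_id by (metis (mono_tags, lifting) id_apply mem_Collect_eq)
      then show ?thesis using finite_conjugates[of ?y] by (auto simp: card_gt_0_iff)
    qed
    have "small (?y ^ ?D)" by (intro small_power tower_small D q_power_pos)
    then have "small (?y ^ ?D * (to_ac c / ?y ^ ?D))" using asc by (intro small_mult) (auto simp: associated_def)
    then have "small (to_ac c)" using val by simp
    then have "to_ac c / emb \<omega> \<in> int_closure" by (rule small_base_divisible)
    then have "?y ^ ?D / emb \<omega> \<in> int_closure" by (rule div_int_closure_associated[OF asc])
    \<comment> \<open>Raised to the power q^(s j), x n becomes associated to x n0 by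
      \<open>tower_valuation\<close>.\<close>
    then have 1: "(?y ^ ?D) ^ (q ^ (s * j)) / emb \<omega> ^ (q ^ (s * j)) \<in> int_closure" by (rule int_closure_div_power)
    have "(?y ^ ?D) ^ (q ^ (s * j)) = (x n ^ (q ^ (s * j))) ^ (?Q * ?D)"
      by (simp only: power_mult[symmetric] mult.commute mult.left_commute)
    then have "associated ((?y ^ ?D) ^ (q ^ (s * j))) (x n0 ^ (?Q * ?D))"
      using associated_power[OF val[THEN conjunct1], of "?Q * ?D"] by simp
    then have "x n0 ^ (?Q * ?D) / emb \<omega> ^ (q ^ (s * j)) \<in> int_closure"
      using 1 by (rule div_int_closure_associated)
    moreover have "emb \<omega> ^ (?Q * ?D) / x n0 ^ (?Q * ?D) \<in> int_closure"
      by (rule int_closure_div_power[OF small_in_int_closure[OF n0(2)]])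
    ultimately have "emb \<omega> ^ (?Q * ?D) / x n0 ^ (?Q * ?D) * (x n0 ^ (?Q * ?D) / emb \<omega> ^ (q ^ (s * j))) \<in> int_closure"
      by (intro int_closure_closed)
    then have "emb \<omega> ^ (?Q * ?D) / emb \<omega> ^ (q ^ (s * j)) \<in> int_closure" using n0(1) by simp
    then have "q ^ (s * j) \<le> ?Q * ?D" by (rule t_power_unit_imp_eq)
    then have "q ^ (s * j) * q ^ (s * n0) \<le> ?Q * ?D * q ^ (s * n0)" by (rule mult_le_mono1)
    moreover have "q ^ (s * j) * q ^ (s * n0) = ?Q * q ^ ((s - g) * n)"
    proof -
      have "s * j + s * n0 = g * n + (s - g) * n" using g(2) j by (simp flip: add_mult_distrib add_mult_distrib2) 
      then show ?thesis by (simp flip: power_add)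
    qed
    ultimately have "q ^ ((s - g) * n) \<le> ?D * q ^ (s * n0)" using q_power_pos[of "g * n"] q_gt_1 by (simp add: mult.assoc)
    \<comment> \<open>Raising to the power Q maps the conjugates of x n onto those of y.\<close>
    moreover have "?D \<le> card (conjugates (x n))"
    proof (rule surj_card_le[OF finite_conjugates])
      show "conjugates ?y \<subseteq> (\<lambda>z. z ^ ?Q) ` conjugates (x n)"
      proof
        fix z assume "z \<in> conjugates ?y"
        then obtain \<tau> where \<tau>: "closure_aut \<tau>" "z = \<tau> ?y" by (auto simp: conjugates_def)
        interpret \<tau>: comm_ring_hom \<tau> by (rule closure_aut_hom[OF \<tau>(1)])
        have "z = \<tau> (x n) ^ ?Q" using \<tau>(2) by (simp add: \<tau>.hom_power)
        then show "z \<in> (\<lambda>z. z ^ ?Q) ` conjugates (x n)" using \<tau>(1) by (auto simp: conjugates_def)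
      qed
    qed
    ultimately show ?thesis by (rule le_trans[OF _ mult_le_mono1])
  qed
  then show ?thesis by (intro exI[of _ n0] allI impI)
qed

end

end

text \<open>A substitute for the compactness of the Galois group: the pairs (z, w) such that
  \<sigma> n z = w for all large n form a partial automorphism, and this extends to the closure. The
  limit has the prescribed values wherever the sequence is eventually constant.\<close>

lemma partial_aut_eventually:
  fixes N :: nat
  assumes \<sigma>: "\<And>n. n \<ge> N \<Longrightarrow> closure_aut (\<sigma> n :: 'k :: field alg_closure \<Rightarrow> 'k alg_closure)"
  shows "\<exists>\<tau>. closure_aut \<tau> \<and> (\<forall>z w. (\<exists>M. \<forall>n\<ge>M. \<sigma> n z = w) \<longrightarrow> \<tau> z = w)"
proof -
  define S where "S = {(z, w). \<exists>M. \<forall>n\<ge>M. \<sigma> n z = w}"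
  have S_iff: "(z, w) \<in> S \<longleftrightarrow> (\<exists>M. \<forall>n\<ge>M. \<sigma> n z = w)" for z w by (simp add: S_def)
  have "partial_aut S"
    unfolding partial_aut_def
  proof (intro conjI allI impI)
    show "(to_ac c, to_ac c) \<in> S" for c
      unfolding S_iff using closure_aut_hom(2)[OF \<sigma>] by (intro exI[of _ N] allI impI)
    fix a b c d assume ab: "(a, b) \<in> S" and cd: "(c, d) \<in> S"
    obtain M where M1: "\<forall>n\<ge>M. \<sigma> n a = b" using ab unfolding S_iff ..
    obtain M' where M2: "\<forall>n\<ge>M'. \<sigma> n c = d" using cd unfolding S_iff ..
    have "\<sigma> n (a + c) = b + d \<and> \<sigma> n (a * c) = b * d" if n: "n \<ge> max N (max M M')" for n
    proof -
      have "n \<ge> N" using n by simp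
      interpret h: comm_ring_hom "\<sigma> n" by (rule closure_aut_hom(1)[OF \<sigma>[OF \<open>n \<ge> N\<close>]])
      show ?thesis using M1 M2 n by (simp add: h.hom_add h.hom_mult)
    qed
    then have 1: "\<forall>n\<ge>max N (max M M'). \<sigma> n (a + c) = b + d" and 2: "\<forall>n\<ge>max N (max M M'). \<sigma> n (a * c) = b * d"
      by simp_all
    show "(a + c, b + d) \<in> S" unfolding S_iff by (rule exI, rule 1)
    show "(a * c, b * d) \<in> S" unfolding S_iff by (rule exI, rule 2)
  next
    fix b assume "(0, b) \<in> S"
    then obtain M where M: "\<forall>n\<ge>M. \<sigma> n 0 = b" unfolding S_iff ..
    have N: "closure_aut (\<sigma> (max M N))" by (rule \<sigma>) simp
    interpret h: comm_ring_hom "\<sigma> (max M N)" by (rule closure_aut_hom(1)[OF N])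
    show "b = 0" using M[rule_format, of "max M N"] by simp
  qed
  then obtain \<tau> where \<tau>: "closure_aut \<tau>" "\<forall>(a, b)\<in>S. \<tau> a = b" by (blast dest: partial_aut_extends)
  have "\<tau> z = w" if zw: "\<exists>M. \<forall>n\<ge>M. \<sigma> n z = w" for z w
  proof -
    have "(z, w) \<in> S" using zw unfolding S_iff .
    then show ?thesis using \<tau>(2) by (auto dest: bspec)
  qed
  then show ?thesis using \<tau>(1) by blast
qed

context height_drop
begin

lemma aut_\<Phi>: "closure_aut \<tau> \<Longrightarrow> z \<in> zeros n \<Longrightarrow> \<Phi> (\<tau> z) = \<tau> (\<Phi> z)"
  by (rule aut_eval1[OF _ zeros_small, symmetric])

lemma aut_zeros: assumes \<tau>: "closure_aut \<tau>" and z: "z \<in> zeros n" shows "\<tau> z \<in> zeros n"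
proof -
  interpret \<tau>: comm_ring_hom \<tau> by (rule closure_aut_hom[OF \<tau>])
  have z': "small z" "eval1 z (act (\<pi> ^ n)) = 0" using z by (simp_all add: zeros_def)
  have "eval1 (\<tau> z) (act (\<pi> ^ n)) = 0"
    using aut_eval1[OF \<tau> z'(1), of "act (\<pi> ^ n)"] z'(2) by simp
  then show ?thesis using aut_small[OF \<tau> z'(1)] by (simp add: zeros_def)
qed

section \<open>The orbit of a compatible system\<close>

context
  fixes x :: "nat \<Rightarrow> 'r fract alg_closure"
  assumes x: "\<And>n. x n \<in> zeros n" "\<And>n. \<Phi> (x (Suc n)) = x n" and x_nonzero: "\<exists>n. x n \<noteq> 0"
begin

lemma conjugates_zeros: "z \<in> conjugates (x n) \<Longrightarrow> z \<in> zeros n"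
  unfolding conjugates_def using aut_zeros[OF _ x(1)[of n]] by auto

lemma conjugates_aut: "closure_aut \<tau> \<Longrightarrow> z \<in> conjugates y \<Longrightarrow> \<tau> z \<in> conjugates y"
proof -
  assume \<tau>: "closure_aut \<tau>" and "z \<in> conjugates y"
  then obtain \<sigma> where \<sigma>: "closure_aut \<sigma>" "z = \<sigma> y" by (auto simp: conjugates_def)
  then have "\<tau> z = (\<tau> \<circ> \<sigma>) y" by simp
  then show "\<tau> z \<in> conjugates y" using closure_aut_comp[OF \<tau> \<sigma>(1)] unfolding conjugates_def by blast
qed

lemma \<Phi>_conjugates: "z \<in> conjugates (x (Suc n)) \<Longrightarrow> \<Phi> z \<in> conjugates (x n)"
  using aut_\<Phi>[OF _ x(1)[of "Suc n"]] x(2)[of n] unfolding conjugates_def by auto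

definition fibre_card :: "nat \<Rightarrow> nat" where
  "fibre_card n = card {w \<in> conjugates (x (Suc n)). \<Phi> w = x n}"

text \<open>An automorphism that takes x n to z takes one fibre bijectively to the other, because it
  commutes with \<Phi>.\<close>

lemma card_conjugate_fibre:
  assumes z: "z \<in> conjugates (x n)" shows "card {w \<in> conjugates (x (Suc n)). \<Phi> w = z} = fibre_card n"
proof -
  obtain \<tau> where \<tau>: "closure_aut \<tau>" "z = \<tau> (x n)" using z by (auto simp: conjugates_def)
  have bij: "bij \<tau>" using \<tau>(1) by (simp add: closure_aut_def)
  have "{w \<in> conjugates (x (Suc n)). \<Phi> w = z} = \<tau> ` {w \<in> conjugates (x (Suc n)). \<Phi> w = x n}"
  proof (intro equalityI subsetI)
    fix w assume "w \<in> {w \<in> conjugates (x (Suc n)). \<Phi> w = z}"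
    then have w: "w \<in> conjugates (x (Suc n))" "\<Phi> w = z" by auto
    let ?w = "inv_into UNIV \<tau> w"
    have w': "\<tau> ?w = w" using bij by (simp add: bij_is_surj surj_f_inv_f)
    have wc: "?w \<in> conjugates (x (Suc n))" by (rule conjugates_aut[OF closure_aut_inv[OF \<tau>(1)] w(1)])
    have "\<tau> (\<Phi> ?w) = \<tau> (x n)" using aut_\<Phi>[OF \<tau>(1) conjugates_zeros[OF wc]] w' w(2) \<tau>(2) by simp
    then have "\<Phi> ?w = x n" using bij by (meson bij_is_inj injD)
    then show "w \<in> \<tau> ` {w \<in> conjugates (x (Suc n)). \<Phi> w = x n}" using wc w' by (intro image_eqI[of _ _ ?w]) auto
  next
    fix w assume "w \<in> \<tau> ` {w \<in> conjugates (x (Suc n)). \<Phi> w = x n}"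
    then obtain v where v: "v \<in> conjugates (x (Suc n))" "\<Phi> v = x n" "w = \<tau> v" by auto
    then show "w \<in> {w \<in> conjugates (x (Suc n)). \<Phi> w = z}"
      using conjugates_aut[OF \<tau>(1) v(1)] aut_\<Phi>[OF \<tau>(1) conjugates_zeros[OF v(1)]] \<tau>(2) by simp
  qed
  then show ?thesis
    unfolding fibre_card_def using bij by (simp add: card_image bij_is_inj inj_on_subset[OF bij_is_inj])
qed

lemma card_conjugates_Suc: "card (conjugates (x (Suc n))) = fibre_card n * card (conjugates (x n))"
proof -
  have sub: "\<Phi> ` conjugates (x (Suc n)) \<subseteq> conjugates (x n)" using \<Phi>_conjugates by blast
  have "card (conjugates (x (Suc n))) = (\<Sum>z\<in>conjugates (x n). card {w \<in> conjugates (x (Suc n)). \<Phi> w = z})"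
    using sum.group[OF finite_conjugates finite_conjugates sub, of "\<lambda>_. 1 :: nat"] by simp
  also have "\<dots> = (\<Sum>z\<in>conjugates (x n). fibre_card n)" by (intro sum.cong refl card_conjugate_fibre)
  finally show ?thesis by (simp add: mult.commute)
qed

lemma fibre_card_le: "fibre_card n \<le> q ^ (s - g)"
proof -
  have "fibre_card n \<le> card {w \<in> zeros (Suc n). \<Phi> w = x n}"
    unfolding fibre_card_def by (rule card_mono) (use finite_zeros conjugates_zeros in auto)
  then show ?thesis unfolding card_fibre[OF x(1)] .
qed

lemma card_conjugates_pos: "card (conjugates y) > 0"
proof -
  have "y \<in> conjugates y" unfolding conjugates_def using closure_aut_id by (metis (mono_tags, lifting) id_apply mem_Collect_eq)
  then show ?thesis using finite_conjugates[of y] by (auto simp: card_gt_0_iff)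
qed

text \<open>The proportion of \<open>zeros n\<close> that is taken up by the orbit of \<open>x n\<close> decreases with \<open>n\<close> but is bounded
  away from \<open>0\<close>, so it converges to a positive limit.\<close>

lemma fibre_card_eventually: "\<exists>N. \<forall>n\<ge>N. fibre_card n = q ^ (s - g)"
proof -
  define C where "C = real (q ^ (s - g))"
  have C: "C > 0" using q_power_pos[of "s - g"] unfolding C_def by (simp only: of_nat_0_less_iff)
  define r where "r = (\<lambda>n. real (card (conjugates (x n))) / C ^ n)"
  have r_pos: "r n > 0" for n using card_conjugates_pos[of "x n"] C by (simp add: r_def)
  have r_Suc: "r (Suc n) = r n * (real (fibre_card n) / C)" for n
    by (simp add: r_def card_conjugates_Suc mult_ac)
  have le: "real (fibre_card n) \<le> C" for n using fibre_card_le[of n] unfolding C_def by (simp only: of_nat_le_iff)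
  have "r (Suc n) \<le> r n * 1" for n
    unfolding r_Suc by (rule mult_left_mono) (use le C r_pos[of n] in \<open>auto simp: less_imp_le\<close>)
  then have dec: "decseq r" by (simp add: decseq_Suc_iff)
  have "\<forall>i. 0 \<le> r i" using r_pos less_imp_le by blast
  then obtain L where L: "r \<longlonglongrightarrow> L" using decseq_convergent[OF dec] by blast
  obtain n0 where n0: "\<And>n. n \<ge> n0 \<Longrightarrow> q ^ ((s - g) * n) \<le> card (conjugates (x n)) * q ^ (s * n0)"
    using card_conjugates_bound[OF x x_nonzero] by blast
  \<comment> \<open>The lower bound for r that \<open>card_conjugates_bound\<close> gives after
    division by C^n q^(s n0).\<close>
  define c where "c = 1 / real (q ^ (s * n0))"
  have c: "c > 0" using q_power_pos[of "s * n0"] unfolding c_def by (simp del: of_nat_power)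
  have "c \<le> r n" if n: "n \<ge> n0" for n
  proof -
    have "real (q ^ ((s - g) * n)) \<le> real (card (conjugates (x n)) * q ^ (s * n0))" using n0[OF n] by (simp only: of_nat_le_iff)
    then have "C ^ n \<le> real (card (conjugates (x n))) * real (q ^ (s * n0))" by (simp add: C_def power_mult)
    then show ?thesis using C q_power_pos[of "s * n0"] unfolding c_def r_def by (simp add: field_simps del: of_nat_power)
  qed
  then have "c \<le> L" by (intro LIMSEQ_le_const[OF L]) blast
  then have L0: "L \<noteq> 0" using c by simp
  have "(\<lambda>n. r (Suc n) / r n) \<longlonglongrightarrow> L / L" by (rule tendsto_divide[OF LIMSEQ_Suc[OF L] L L0])
  then have "(\<lambda>n. real (fibre_card n) / C) \<longlonglongrightarrow> 1"
    using r_pos L0 by (simp add: r_Suc less_imp_neq[symmetric] del: of_nat_power)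
  \<comment> \<open>\<open>fibre_card n\<close> is an integer and at most C, so it equals C as soon
    as its ratio to C exceeds 1 - 1 / C.\<close>
  moreover have "1 - 1 / C < 1" using C by simp
  ultimately have "eventually (\<lambda>n. 1 - 1 / C < real (fibre_card n) / C) sequentially"
    by (rule order_tendstoD(1))
  then obtain N where N: "\<And>n. n \<ge> N \<Longrightarrow> 1 - 1 / C < real (fibre_card n) / C"
    unfolding eventually_sequentially by blast
  have "fibre_card n = q ^ (s - g)" if n: "n \<ge> N" for n
  proof -
    have "C - 1 < real (fibre_card n)" using N[OF n] C by (simp add: field_simps)
    then have "real (q ^ (s - g)) < real (fibre_card n + 1)" by (simp add: C_def)
    then have "q ^ (s - g) < fibre_card n + 1" by (simp only: of_nat_less_iff)
    then show ?thesis using fibre_card_le[of n] by simp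
  qed
  then show ?thesis by blast
qed

text \<open>N is an index from which on all fibres between the orbits are full, so a compatible y
  that agrees with x up to N stays in the orbits of the x n. An automorphism that takes x n to y n
  does the same at all lower levels, as it commutes with \<Phi>, and a limit of these automorphisms
  serves for all n.\<close>

lemma orbit_open_sequence:
  "\<exists>N. \<forall>y. (\<forall>n. y n \<in> zeros n \<and> \<Phi> (y (Suc n)) = y n) \<longrightarrow> (\<forall>n\<le>N. y n = x n) \<longrightarrow> (\<exists>\<tau>. closure_aut \<tau> \<and> (\<forall>n. \<tau> (x n) = y n))"
proof -
  obtain N where N: "\<And>n. n \<ge> N \<Longrightarrow> fibre_card n = q ^ (s - g)" using fibre_card_eventually by blast
  have full: "z \<in> conjugates (x (Suc n))" if n: "n \<ge> N" and z: "z \<in> zeros (Suc n)" "\<Phi> z \<in> conjugates (x n)" for n z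
  proof -
    have "{w \<in> conjugates (x (Suc n)). \<Phi> w = \<Phi> z} = {w \<in> zeros (Suc n). \<Phi> w = \<Phi> z}"
    proof (rule card_subset_eq)
      show "finite {w \<in> zeros (Suc n). \<Phi> w = \<Phi> z}" using finite_zeros[of "Suc n"] by simp
      show "{w \<in> conjugates (x (Suc n)). \<Phi> w = \<Phi> z} \<subseteq> {w \<in> zeros (Suc n). \<Phi> w = \<Phi> z}" using conjugates_zeros by blast
      show "card {w \<in> conjugates (x (Suc n)). \<Phi> w = \<Phi> z} = card {w \<in> zeros (Suc n). \<Phi> w = \<Phi> z}"
        by (simp only: card_conjugate_fibre[OF z(2)] N[OF n] card_fibre[OF conjugates_zeros[OF z(2)]])
    qed
    then show ?thesis using z(1) by blast
  qed
  have "\<exists>\<tau>. closure_aut \<tau> \<and> (\<forall>n. \<tau> (x n) = y n)"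
    if y: "\<forall>n. y n \<in> zeros n \<and> \<Phi> (y (Suc n)) = y n" and yx: "\<forall>n\<le>N. y n = x n" for y
  proof -
    have conj: "y n \<in> conjugates (x n)" if "n \<ge> N" for n
      using that
    proof (induction n rule: dec_induct)
      case base
      have "x N \<in> conjugates (x N)" unfolding conjugates_def using closure_aut_id by (metis (mono_tags, lifting) id_apply mem_Collect_eq)
      then show ?case using yx by simp
    next
      case (step n)
      show ?case by (rule full[OF step(1)]) (use y step(3) in simp_all)
    qed
    have "\<exists>\<tau>. n \<ge> N \<longrightarrow> closure_aut \<tau> \<and> \<tau> (x n) = y n" for n
    proof (cases "n \<ge> N")
      case True
      obtain \<tau> where "closure_aut \<tau>" "y n = \<tau> (x n)" using conj[OF True] unfolding conjugates_def by auto
      then have "closure_aut \<tau> \<and> \<tau> (x n) = y n" by simp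
      then show ?thesis by (intro exI impI)
    qed simp
    then have "\<forall>n. \<exists>\<tau>. n \<ge> N \<longrightarrow> closure_aut \<tau> \<and> \<tau> (x n) = y n" by (rule allI)
    then obtain \<sigma> where \<sigma>: "\<And>n. n \<ge> N \<Longrightarrow> closure_aut (\<sigma> n)" "\<And>n. n \<ge> N \<Longrightarrow> \<sigma> n (x n) = y n" by metis
    have low: "\<sigma> n (x m) = y m" if n: "n \<ge> N" and m: "m \<le> n" for m n
      using m
    proof (induction m rule: inc_induct)
      case base
      then show ?case by (rule \<sigma>(2)[OF n])
    next
      case (step m)
      have "\<sigma> n (x m) = \<Phi> (\<sigma> n (x (Suc m)))" using aut_\<Phi>[OF \<sigma>(1)[OF n] x(1)[of "Suc m"]] x(2)[of m] by simp
      also have "\<dots> = y m" using step y by simp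
      finally show ?case .
    qed
    obtain \<tau> where \<tau>: "closure_aut \<tau>" "\<forall>z w. (\<exists>M. \<forall>n\<ge>M. \<sigma> n z = w) \<longrightarrow> \<tau> z = w"
      using partial_aut_eventually[of N \<sigma>] \<sigma>(1) by blast
    have "\<tau> (x m) = y m" for m
    proof -
      have "\<forall>n\<ge>max N m. \<sigma> n (x m) = y m" using low by simp
      then show ?thesis using \<tau>(2) by blast
    qed
    then show ?thesis using \<tau>(1) by blast
  qed
  then show ?thesis by blast
qed

end

text \<open>\<pi>^N v has coordinate 0 up to index N, so t + \<pi>^N v agrees with t there.\<close>

lemma orbit_open_coordinates:
  assumes t: "t \<in> carrier T" and t0: "t \<noteq> \<zero>\<^bsub>T\<^esub>"
  shows "\<exists>N. \<forall>v\<in>carrier T. \<exists>\<tau>. closure_aut \<tau> \<and> (\<forall>n. \<tau> (tcrd t n) = tcrd (t \<oplus>\<^bsub>T\<^esub> \<pi> ^ N \<odot>\<^bsub>T\<^esub> v) n)"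
proof -
  have nz: "\<exists>n. tcrd t n \<noteq> 0" using t0 tcrd_zero_iff[OF t] by blast
  obtain N where N: "\<And>y. (\<forall>n. y n \<in> zeros n \<and> \<Phi> (y (Suc n)) = y n) \<Longrightarrow> (\<forall>n\<le>N. y n = tcrd t n) \<Longrightarrow>
      (\<exists>\<tau>. closure_aut \<tau> \<and> (\<forall>n. \<tau> (tcrd t n) = y n))"
    using orbit_open_sequence[of "\<lambda>n. tcrd t n", OF tcrd_zeros[OF t] tcrd_step[OF t] nz] by blast
  have "\<exists>\<tau>. closure_aut \<tau> \<and> (\<forall>n. \<tau> (tcrd t n) = tcrd (t \<oplus>\<^bsub>T\<^esub> \<pi> ^ N \<odot>\<^bsub>T\<^esub> v) n)" if v: "v \<in> carrier T" for v
  proof (rule N)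
    let ?u = "t \<oplus>\<^bsub>T\<^esub> \<pi> ^ N \<odot>\<^bsub>T\<^esub> v"
    have u: "?u \<in> carrier T" by (intro T_add_closed T_smult_closed t v)
    show "\<forall>n. tcrd ?u n \<in> zeros n \<and> \<Phi> (tcrd ?u (Suc n)) = tcrd ?u n"
      using tcrd_zeros[OF u] tcrd_step[OF u] by blast
    show "\<forall>n\<le>N. tcrd ?u n = tcrd t n"
      using tcrd_add_zero[OF t T_smult_closed[OF v] tcrd_power_smult[OF v]] by blast
  qed
  then show ?thesis by blast
qed

end

section \<open>The Galois action on the Tate module\<close>

definition aut_action :: "('k \<Rightarrow> 'k) \<Rightarrow> (nat \<Rightarrow> nat \<Rightarrow> 'k) \<Rightarrow> nat \<Rightarrow> nat \<Rightarrow> 'k" where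
  "aut_action \<tau> t = (\<lambda>n k. \<tau> (t n k))"

lemma aut_action_comp: "aut_action (\<sigma> \<circ> \<tau>) t = aut_action \<sigma> (aut_action \<tau> t)"
  by (simp add: aut_action_def)

context
  fixes \<tau> :: "'r :: idom fract alg_closure \<Rightarrow> 'r fract alg_closure"
  assumes \<tau>: "closure_aut \<tau>"
begin

interpretation \<tau>: comm_ring_hom \<tau> by (rule closure_aut_hom[OF \<tau>])

lemma aut_point_ext: "point_ext H (\<lambda>k. \<tau> (\<phi> k)) v = \<tau> (point_ext H \<phi> v)"
  by (simp add: point_ext_def \<tau>.hom_sum \<tau>.hom_mult closure_aut_hom(2)[OF \<tau>])

lemma aut_point_map: "point_map H H' f (\<lambda>k. \<tau> (\<phi> k)) = (\<lambda>k. \<tau> (point_map H H' f \<phi> k))"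
  by (rule ext) (simp add: point_map_def \<tau>.hom_sum \<tau>.hom_mult closure_aut_hom(2)[OF \<tau>])

lemma aut_point_add: "point_add H (\<lambda>k. \<tau> (\<phi> k)) (\<lambda>k. \<tau> (\<psi> k)) = (\<lambda>k. \<tau> (point_add H \<phi> \<psi> k))"
  by (rule ext) (simp add: point_add_def \<tau>.hom_sum \<tau>.hom_mult closure_aut_hom(2)[OF \<tau>])

lemma aut_points: assumes "\<phi> \<in> points H" shows "(\<lambda>k. \<tau> (\<phi> k)) \<in> points H"
proof -
  have "(\<Sum>k<rk H. emb (unt H k) * \<tau> (\<phi> k)) = \<tau> (\<Sum>k<rk H. emb (unt H k) * \<phi> k)"
    by (simp add: \<tau>.hom_sum \<tau>.hom_mult closure_aut_hom(2)[OF \<tau>])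
  moreover have "\<tau> (\<phi> i) * \<tau> (\<phi> j) = (\<Sum>k<rk H. emb (mlt H i j k) * \<tau> (\<phi> k))" if "i < rk H" "j < rk H" for i j
  proof -
    have "\<tau> (\<phi> i) * \<tau> (\<phi> j) = \<tau> (\<Sum>k<rk H. emb (mlt H i j k) * \<phi> k)"
      using pointsD(3)[OF assms that] by (simp only: \<tau>.hom_mult[symmetric])
    then show ?thesis by (simp add: \<tau>.hom_sum \<tau>.hom_mult closure_aut_hom(2)[OF \<tau>])
  qed
  ultimately show ?thesis using pointsD(1,2)[OF assms] by (simp add: points_def)
qed

end

context formal_p_divisible
begin

lemma crd_aut: "closure_aut \<tau> \<Longrightarrow> crd n (\<lambda>k. \<tau> (\<phi> k)) = \<tau> (crd n \<phi>)"
  by (simp add: crd_def pt_eval_def aut_point_ext)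

end

context height_drop
begin

lemma tcrd_aut_action: "closure_aut \<tau> \<Longrightarrow> tcrd (aut_action \<tau> t) n = \<tau> (tcrd t n)"
  by (simp add: aut_action_def crd_aut)

lemma aut_action_closed: assumes \<tau>: "closure_aut \<tau>" and t: "t \<in> carrier T" shows "aut_action \<tau> t \<in> carrier T"
  unfolding T_carrier
proof (intro allI conjI)
  fix n
  show "aut_action \<tau> t n \<in> points (lev G n)" unfolding aut_action_def by (rule aut_points[OF \<tau> T_points[OF t]])
  show "tcrd (aut_action \<tau> t) n \<in> zeros n"
    unfolding tcrd_aut_action[OF \<tau>] by (rule aut_zeros[OF \<tau> tcrd_zeros[OF t]])
  show "\<Phi> (tcrd (aut_action \<tau> t) (Suc n)) = tcrd (aut_action \<tau> t) n"
    unfolding tcrd_aut_action[OF \<tau>] aut_\<Phi>[OF \<tau> tcrd_zeros[OF t]] tcrd_step[OF t] ..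
qed

lemma aut_action_add: "closure_aut \<tau> \<Longrightarrow> aut_action \<tau> (t \<oplus>\<^bsub>T\<^esub> u) = aut_action \<tau> t \<oplus>\<^bsub>T\<^esub> aut_action \<tau> u"
  unfolding T_simps aut_action_def by (simp add: aut_point_add)

lemma aut_action_smult: "closure_aut \<tau> \<Longrightarrow> aut_action \<tau> (a \<odot>\<^bsub>T\<^esub> t) = a \<odot>\<^bsub>T\<^esub> aut_action \<tau> t"
  unfolding T_simps aut_action_def by (simp add: aut_point_map)

lemma orbit_open:
  assumes t: "t \<in> carrier T" and t0: "t \<noteq> \<zero>\<^bsub>T\<^esub>"
  shows "\<exists>N. \<forall>v\<in>carrier T. \<exists>\<tau>. closure_aut \<tau> \<and> t \<oplus>\<^bsub>T\<^esub> \<pi> ^ N \<odot>\<^bsub>T\<^esub> v = aut_action \<tau> t"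
proof -
  obtain N where N: "\<And>v. v \<in> carrier T \<Longrightarrow> \<exists>\<tau>. closure_aut \<tau> \<and> (\<forall>n. \<tau> (tcrd t n) = tcrd (t \<oplus>\<^bsub>T\<^esub> \<pi> ^ N \<odot>\<^bsub>T\<^esub> v) n)"
    using orbit_open_coordinates[OF t t0] by blast
  have "\<exists>\<tau>. closure_aut \<tau> \<and> t \<oplus>\<^bsub>T\<^esub> \<pi> ^ N \<odot>\<^bsub>T\<^esub> v = aut_action \<tau> t" if v: "v \<in> carrier T" for v
  proof -
    obtain \<tau> where \<tau>: "closure_aut \<tau>" "\<forall>n. \<tau> (tcrd t n) = tcrd (t \<oplus>\<^bsub>T\<^esub> \<pi> ^ N \<odot>\<^bsub>T\<^esub> v) n" using N[OF v] by blast
    have u: "t \<oplus>\<^bsub>T\<^esub> \<pi> ^ N \<odot>\<^bsub>T\<^esub> v \<in> carrier T" by (intro T_add_closed T_smult_closed t v)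
    have "t \<oplus>\<^bsub>T\<^esub> \<pi> ^ N \<odot>\<^bsub>T\<^esub> v = aut_action \<tau> t"
      using T_eq_iff[OF u aut_action_closed[OF \<tau>(1) t]] \<tau>(2) tcrd_aut_action[OF \<tau>(1)] by simp
    then show ?thesis using \<tau>(1) by blast
  qed
  then show ?thesis by blast
qed

lemma aut_action_nonzero:
  assumes \<tau>: "closure_aut \<tau>" and t: "t \<in> carrier T" "t \<noteq> \<zero>\<^bsub>T\<^esub>" shows "aut_action \<tau> t \<noteq> \<zero>\<^bsub>T\<^esub>"
proof
  assume "aut_action \<tau> t = \<zero>\<^bsub>T\<^esub>"
  interpret \<tau>: comm_ring_hom \<tau> by (rule closure_aut_hom[OF \<tau>])
  have "\<forall>n. tcrd (aut_action \<tau> t) n = 0"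
    using tcrd_zero_iff[OF aut_action_closed[OF \<tau> t(1)]] \<open>aut_action \<tau> t = _\<close> by (rule iffD1)
  then have "\<tau> (tcrd t n) = \<tau> 0" for n unfolding tcrd_aut_action[OF \<tau>] by simp
  then have "tcrd t n = 0" for n using \<tau> by (meson closure_aut_def bij_is_inj injD)
  then show False using tcrd_zero_iff[OF t(1)] t(2) by blast
qed

end

context height_drop
begin

lemma CHAR_fract: "prime p" "CHAR('r fract) = p"
proof -
  show "prime p" by (rule p)
  show "CHAR('r fract) = p"
  proof (rule CHAR_eqI)
    have of_nat: "of_nat n = to_fract (of_nat n :: 'r)" for n by (induction n) simp_all
    show "of_nat p = (0 :: 'r fract)" unfolding of_nat using p(2) by auto
    fix n :: nat assume "of_nat n = (0 :: 'r fract)"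
    then have "of_nat n = (0 :: 'r)" unfolding of_nat by simp
    then show "p dvd n" using p(2) by (simp add: of_nat_eq_0_iff_char_dvd)
  qed
qed

lemma galois_action_eq: "galois_action \<sigma> = aut_action (gal_ext \<sigma>)"
  by (simp add: fun_eq_iff galois_action_def aut_action_def)

lemmas gal_ext_aut = gal_ext_closure_aut(1)[OF CHAR_fract]
lemmas aut_in_Gal = restrict_closure_aut[OF CHAR_fract]

text \<open>Passes from the Galois group to the automorphisms of the closure, for which
  \<open>orbit_open\<close> is available: extension by \<open>gal_ext\<close> and restriction to
  \<open>sep_closure\<close> do not change the action on T.\<close>

lemma orbit_eq:
  assumes t: "t \<in> carrier T"
  shows "{m t | m. m \<in> monodromy_group T} = {aut_action \<tau> t | \<tau>. closure_aut \<tau>}"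
proof (intro equalityI subsetI)
  fix u assume "u \<in> {m t | m. m \<in> monodromy_group T}"
  then obtain \<sigma> where \<sigma>: "\<sigma> \<in> carrier Gal_sep" "u = restrict (galois_action \<sigma>) (carrier T) t"
    unfolding monodromy_group_def by blast
  then have "u = aut_action (gal_ext \<sigma>) t" using t by (simp add: galois_action_eq)
  then show "u \<in> {aut_action \<tau> t | \<tau>. closure_aut \<tau>}" using gal_ext_aut[OF \<sigma>(1)] by blast
next
  fix u assume "u \<in> {aut_action \<tau> t | \<tau>. closure_aut \<tau>}"
  then obtain \<tau> where \<tau>: "closure_aut \<tau>" "u = aut_action \<tau> t" by blast
  let ?\<sigma> = "restrict \<tau> sep_closure"
  have "u = restrict (galois_action ?\<sigma>) (carrier T) t"
    using t \<tau>(2) by (simp add: galois_action_eq aut_in_Gal(2)[OF \<tau>(1)])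
  moreover have "restrict (galois_action ?\<sigma>) (carrier T) \<in> monodromy_group T"
    unfolding monodromy_group_def using aut_in_Gal(1)[OF \<tau>(1)] by (rule imageI)
  ultimately show "u \<in> {m t | m. m \<in> monodromy_group T}" by blast
qed

text \<open>Openness has to be checked at every point u of the orbit. As u is again nonzero,
  \<open>orbit_open\<close> applies to u itself, and composition of automorphisms leads back to the
  orbit of t.\<close>

theorem monodromy_orbit_open:
  assumes t: "t \<in> carrier T" and t0: "t \<noteq> \<zero>\<^bsub>T\<^esub>"
  shows "pi_adic_open T \<pi> {m t | m. m \<in> monodromy_group T}"
  unfolding orbit_eq[OF t] pi_adic_open_def
proof (intro conjI ballI)
  show "{aut_action \<tau> t | \<tau>. closure_aut \<tau>} \<subseteq> carrier T" using aut_action_closed t by blast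
  fix u assume "u \<in> {aut_action \<tau> t | \<tau>. closure_aut \<tau>}"
  then obtain \<tau> where \<tau>: "closure_aut \<tau>" "u = aut_action \<tau> t" by blast
  have u: "u \<in> carrier T" "u \<noteq> \<zero>\<^bsub>T\<^esub>"
    unfolding \<tau>(2) by (rule aut_action_closed[OF \<tau>(1) t], rule aut_action_nonzero[OF \<tau>(1) t t0])
  obtain N where N: "\<forall>v\<in>carrier T. \<exists>\<tau>. closure_aut \<tau> \<and> u \<oplus>\<^bsub>T\<^esub> \<pi> ^ N \<odot>\<^bsub>T\<^esub> v = aut_action \<tau> u"
    using orbit_open[OF u] ..
  have "u \<oplus>\<^bsub>T\<^esub> \<pi> ^ N \<odot>\<^bsub>T\<^esub> v \<in> {aut_action \<tau> t | \<tau>. closure_aut \<tau>}" if v: "v \<in> carrier T" for v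
  proof -
    obtain \<tau>' where \<tau>': "closure_aut \<tau>'" "u \<oplus>\<^bsub>T\<^esub> \<pi> ^ N \<odot>\<^bsub>T\<^esub> v = aut_action \<tau>' u" using N v by blast
    have "u \<oplus>\<^bsub>T\<^esub> \<pi> ^ N \<odot>\<^bsub>T\<^esub> v = aut_action (\<tau>' \<circ> \<tau>) t" using \<tau>'(2) unfolding aut_action_comp \<tau>(2)[symmetric] .
    then show ?thesis using closure_aut_comp[OF \<tau>'(1) \<tau>(1)] by blast
  qed
  then show "\<exists>n. \<forall>v\<in>carrier T. u \<oplus>\<^bsub>T\<^esub> \<pi> ^ n \<odot>\<^bsub>T\<^esub> v \<in> {aut_action \<tau> t | \<tau>. closure_aut \<tau>}" by blast
qed

theorem galois_rep_irreducible:
  assumes b: "free_module_basis T (s - g) b"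
  shows "galois_rep T (s - g) b \<in> hom Gal_sep (GL (s - g))"
    and "irreducible_rep (s - g) (carrier Gal_sep) (galois_rep T (s - g) b)"
proof -
  interpret B: free_class_module T "s - g" b by unfold_locales (rule b)
  have rep: "galois_rep T (s - g) b = (\<lambda>\<sigma>. B.matrix_of (galois_action \<sigma>))"
    by (rule ext) (simp add: galois_rep_def B.matrix_of_def)
  have lin: "B.linear_on (galois_action \<sigma>)" if \<sigma>: "\<sigma> \<in> carrier Gal_sep" for \<sigma>
    unfolding B.linear_on_def galois_action_eq
    using aut_action_closed[OF gal_ext_aut[OF \<sigma>]] aut_action_add[OF gal_ext_aut[OF \<sigma>]] aut_action_smult[OF gal_ext_aut[OF \<sigma>]]
    by blast
  show "galois_rep T (s - g) b \<in> hom Gal_sep (GL (s - g))"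
    unfolding rep
  proof (rule B.representation_hom[OF lin])
    fix \<sigma> \<sigma>' :: "'r fract alg_closure \<Rightarrow> 'r fract alg_closure" and t
    assume "\<sigma> \<in> carrier Gal_sep" "\<sigma>' \<in> carrier Gal_sep"
    then show "galois_action (\<sigma> \<otimes>\<^bsub>Gal_sep\<^esub> \<sigma>') t = galois_action \<sigma> (galois_action \<sigma>' t)"
      by (simp only: galois_action_eq gal_ext_mult[OF CHAR_fract] aut_action_comp)
  next
    fix \<sigma> :: "'r fract alg_closure \<Rightarrow> 'r fract alg_closure" assume \<sigma>: "\<sigma> \<in> carrier Gal_sep"
    let ?\<tau> = "gal_ext \<sigma>"
    \<comment> \<open>For the invertibility of the matrices, the inverse Galois element is obtained
      by restricting the inverse of the extension to the closure.\<close>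
    let ?i = "inv_into UNIV ?\<tau>"
    have \<tau>: "closure_aut ?\<tau>" by (rule gal_ext_aut[OF \<sigma>])
    have i: "closure_aut ?i" by (rule closure_aut_inv[OF \<tau>])
    have bij: "bij ?\<tau>" using \<tau> by (simp add: closure_aut_def)
    have "?\<tau> (?i z) = z" "?i (?\<tau> z) = z" for z
      using bij by (simp_all add: bij_is_surj surj_f_inv_f bij_is_inj)
    then have "galois_action \<sigma> (aut_action ?i t) = t \<and> aut_action ?i (galois_action \<sigma> t) = t" for t
      by (simp add: galois_action_eq aut_action_def)
    moreover have "galois_action (restrict ?i sep_closure) = aut_action ?i"
      by (simp only: galois_action_eq aut_in_Gal(2)[OF i])
    ultimately have "\<forall>t\<in>carrier T. galois_action \<sigma> (galois_action (restrict ?i sep_closure) t) = t \<and>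
        galois_action (restrict ?i sep_closure) (galois_action \<sigma> t) = t" by simp
    then show "\<exists>\<tau>\<in>carrier Gal_sep. \<forall>t\<in>carrier T. galois_action \<sigma> (galois_action \<tau> t) = t \<and> galois_action \<tau> (galois_action \<sigma> t) = t"
      using aut_in_Gal(1)[OF i] by blast
  qed
  show "irreducible_rep (s - g) (carrier Gal_sep) (galois_rep T (s - g) b)"
    unfolding rep
  proof (rule B.representation_irreducible[OF _ D.t_nonzero lin])
    show "s - g > 0" using g(2) by simp
    fix t assume t: "t \<in> carrier T" "t \<noteq> \<zero>\<^bsub>T\<^esub>"
    obtain N where N: "\<forall>v\<in>carrier T. \<exists>\<tau>. closure_aut \<tau> \<and> t \<oplus>\<^bsub>T\<^esub> \<pi> ^ N \<odot>\<^bsub>T\<^esub> v = aut_action \<tau> t"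
      using orbit_open[OF t] ..
    have "\<exists>\<sigma>\<in>carrier Gal_sep. t \<oplus>\<^bsub>T\<^esub> \<pi> ^ N \<odot>\<^bsub>T\<^esub> v = galois_action \<sigma> t" if v: "v \<in> carrier T" for v
    proof -
      obtain \<tau> where \<tau>: "closure_aut \<tau>" "t \<oplus>\<^bsub>T\<^esub> \<pi> ^ N \<odot>\<^bsub>T\<^esub> v = aut_action \<tau> t" using N v by blast
      have "t \<oplus>\<^bsub>T\<^esub> \<pi> ^ N \<odot>\<^bsub>T\<^esub> v = galois_action (restrict \<tau> sep_closure) t"
        unfolding galois_action_eq aut_in_Gal(2)[OF \<tau>(1)] by (rule \<tau>(2))
      then show ?thesis using aut_in_Gal(1)[OF \<tau>(1)] by blast
    qed
    then show "\<exists>n. \<forall>u\<in>carrier T. \<exists>\<sigma>\<in>carrier Gal_sep. t \<oplus>\<^bsub>T\<^esub> \<pi> ^ n \<odot>\<^bsub>T\<^esub> u = galois_action \<sigma> t" by blast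
  qed
qed

end

text \<open>A common denominator of the coefficients of h turns it into a polynomial over R with the
  same root.\<close>

lemma fract_algebraic:
  fixes x :: "'r :: idom fract alg_closure"
  shows "\<exists>f :: 'r poly. f \<noteq> 0 \<and> poly (map_poly (\<lambda>r. emb r) f) x = 0"
proof -
  obtain h :: "'r fract poly" where h: "h \<noteq> 0" "aeval h x = 0" by (rule alg_closure_algebraic)
  have "\<exists>d f. d \<noteq> 0 \<and> smult (to_fract d) h = map_poly to_fract (f :: 'r poly)" for h :: "'r fract poly"
  proof (induction h)
    case 0
    show ?case by (intro exI[of _ 1] exI[of _ 0]) simp
  next
    case (pCons a h)
    then obtain d f where df: "d \<noteq> 0" "smult (to_fract d) h = map_poly to_fract (f :: 'r poly)" by blast
    obtain u v where a: "a = Fract u v" "v \<noteq> 0" by (cases a) auto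
    have "smult (to_fract (d * v)) (pCons a h) = map_poly to_fract (pCons (d * u) (smult v f))"
    proof -
      have "smult (to_fract (d * v)) h = smult (to_fract v) (smult (to_fract d) h)" by (simp add: mult.commute)
      also have "\<dots> = map_poly to_fract (smult v f)" unfolding df(2) by (simp add: poly_eq_iff coeff_map_poly)
      finally have "smult (to_fract (d * v)) h = map_poly to_fract (smult v f)" .
      moreover have "to_fract (d * v) * a = to_fract (d * u)"
        using a(2) unfolding a(1) by (simp add: to_fract_def eq_fract)
      moreover have "map_poly to_fract (pCons (d * u) (smult v f)) = pCons (to_fract (d * u)) (map_poly to_fract (smult v f))"
        by (rule poly_eqI) (simp add: coeff_map_poly coeff_pCons split: nat.split)
      ultimately show ?thesis by (simp only: smult_pCons)
    qed
    moreover have "d * v \<noteq> 0" using df(1) a(2) by simp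
    ultimately show ?case by blast
  qed
  then obtain d f where df: "d \<noteq> 0" "smult (to_fract d) h = map_poly to_fract (f :: 'r poly)" by blast
  have "f \<noteq> 0" using df h(1) by auto
  moreover have "map_poly (\<lambda>r. emb r) f = map_poly to_ac (smult (to_fract d) h)"
    unfolding df(2) by (simp add: map_poly_map_poly o_def)
  moreover have "map_poly to_ac (smult (to_fract d) h) = smult (to_ac (to_fract d)) (map_poly to_ac h)"
    by (rule poly_eqI) (simp add: coeff_map_poly)
  ultimately show ?thesis using h(2) by auto
qed

theorem mainTheorem2:
  fixes G :: "'r :: idom pdiv"
    and \<gamma> :: "'a :: idom \<Rightarrow> 'r"
    and F :: "'r fps fps"
    and act :: "'a \<Rightarrow> 'r fps"
    and \<alpha> :: "nat \<Rightarrow> 'a \<Rightarrow> nat \<Rightarrow> nat \<Rightarrow> 'r"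
    and \<pi> :: 'a
    and s g :: nat
  defines "T \<equiv> tate_module G \<alpha> \<pi>"
  assumes "complete_dvr TYPE('r)"
    and "CHAR('r) = CARD('p :: prime_card)"
    and "padic_integer_ring TYPE('p) TYPE('a)"
    and "uniformizer \<pi>"
    and "p_divisible_group CARD('p) G"
    and "formal_module \<gamma> F act"
    and "associated_formal_module CARD('p) G \<alpha> F act"
    and "fibre_height max_ideal \<pi> act s"
    and "fibre_height {0} \<pi> act g"
    and "1 \<le> g" and "g < s"
  shows "(\<exists>b. free_module_basis T (s - g) b) \<and>
    (\<forall>t\<in>carrier T. t \<noteq> \<zero>\<^bsub>T\<^esub> \<longrightarrow> pi_adic_open T \<pi> {m t | m. m \<in> monodromy_group T}) \<and>
    (\<forall>b. free_module_basis T (s - g) b \<longrightarrow>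
       galois_rep T (s - g) b \<in> hom Gal_sep (GL (s - g)) \<and>
       irreducible_rep (s - g) (carrier Gal_sep) (galois_rep T (s - g) b))"
proof -
  note heights = assms(7,5,10,11)
  obtain \<omega> :: 'r where \<omega>: "uniformizer \<omega>"
      "\<forall>x. (\<forall>n. \<omega> ^ n dvd x (Suc n) - x n) \<longrightarrow> (\<exists>y. \<forall>n. \<omega> ^ n dvd y - x n)"
    using assms(2) unfolding complete_dvr_def by blast
  obtain \<theta> :: "nat \<Rightarrow> 'r fps \<Rightarrow> nat \<Rightarrow> 'r" where \<theta>: "\<forall>n. let H = lev G n in
        range (\<theta> n) = elems H \<and>
        (\<forall>f g. \<theta> n (f + g) = (\<lambda>k. \<theta> n f k + \<theta> n g k)) \<and>
        (\<forall>f g. \<theta> n (f * g) = elt_mult H (\<theta> n f) (\<theta> n g)) \<and>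
        (\<forall>r. \<theta> n (fps_const r) = (\<lambda>k. r * elt_one H k)) \<and>
        {f. \<theta> n f = (\<lambda>_. 0)} = {f. act (of_nat CARD('p) ^ n) dvd f} \<and>
        (\<forall>f. lin_app (lev G (Suc n)) H (trn G n) (\<theta> (Suc n) f) = \<theta> n f) \<and>
        (\<forall>a f. lin_app H H (\<alpha> n a) (\<theta> n f) = \<theta> n (f oo act a)) \<and>
        (\<exists>\<Theta> :: 'r fps fps \<Rightarrow> nat \<Rightarrow> nat \<Rightarrow> 'r.
           (\<forall>f g. \<Theta> (f + g) = (\<lambda>k l. \<Theta> f k l + \<Theta> g k l)) \<and>
           (\<forall>f g. \<Theta> (f * g) = tensor_mult H (\<Theta> f) (\<Theta> g)) \<and>
           (\<forall>f. \<Theta> (in_X f) = (\<lambda>k l. \<theta> n f k * elt_one H l)) \<and>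
           (\<forall>f. \<Theta> (in_Y f) = (\<lambda>k l. elt_one H k * \<theta> n f l)) \<and>
           (\<forall>f. elt_comult H (\<theta> n f) = \<Theta> (subst_1_2 f F)))"
    using assms(8) unfolding associated_formal_module_def by (elim exE)
  note \<theta>' = \<theta>[unfolded Let_def, rule_format]
  note \<theta>4 = \<theta>'[THEN conjunct2, THEN conjunct2, THEN conjunct2]
  note \<theta>7 = \<theta>4[THEN conjunct2, THEN conjunct2, THEN conjunct2]
  \<comment> \<open>\<gamma> kills exactly the multiples of \<pi>, and p = 0 in R.\<close>
  have dvd: "\<pi> dvd of_nat CARD('p)" using uniformizer_dvd_char[OF heights] by (simp only: assms(3))
  obtain k where k: "residue_card \<pi> = CARD('p) ^ k" using residue_card_prime_power[OF heights] assms(3) by auto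
  have "residue_card \<pi> \<noteq> 0" using residue_card_gt_1[OF heights] by simp
  \<comment> \<open>The residue field is finite and \<pi> divides p, so A is complete for the
    \<pi>-adic topology.\<close>
  then interpret D: complete_valuation_ring \<pi> using padic_integer_ring_complete[OF assms(4,5)] dvd by blast
  interpret C: complete_dvr_closure \<omega> "\<lambda>r. emb r :: 'r fract alg_closure"
  proof
    show "uniformizer \<omega>" by (rule \<omega>(1))
    show "\<exists>y. \<forall>n. \<omega> ^ n dvd y - x n" if "\<And>n. \<omega> ^ n dvd x (Suc n) - x n" for x using \<omega>(2) that by blast
    show "\<exists>f :: 'r poly. f \<noteq> 0 \<and> poly (map_poly (\<lambda>r. emb r) f) x = 0" for x by (rule fract_algebraic)
  qed auto
  interpret H: height_drop \<omega> G \<alpha> \<gamma> F act "CARD('p)" \<theta> \<pi> "residue_card \<pi>" k s g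
  proof
    show "hopf_algebra (lev G n)" for n using assms(6) unfolding p_divisible_group_def by blast
    show "range (\<theta> n) = elems (lev G n)" for n by (rule \<theta>'[THEN conjunct1])
    show "\<theta> n (f + g) = (\<lambda>k. \<theta> n f k + \<theta> n g k)" for n f g
      by (rule \<theta>'[THEN conjunct2, THEN conjunct1, rule_format])
    show "\<theta> n (f * g) = elt_mult (lev G n) (\<theta> n f) (\<theta> n g)" for n f g
      by (rule \<theta>'[THEN conjunct2, THEN conjunct2, THEN conjunct1, rule_format])
    show "\<theta> n (fps_const r) = (\<lambda>k. r * elt_one (lev G n) k)" for n r
      by (rule \<theta>4[THEN conjunct1, rule_format])
    show "\<theta> n f = (\<lambda>_. 0) \<longleftrightarrow> act (of_nat CARD('p) ^ n) dvd f" for n f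
      using \<theta>4[THEN conjunct2, THEN conjunct1, of n] by blast
    show "lin_app (lev G (Suc n)) (lev G n) (trn G n) (\<theta> (Suc n) f) = \<theta> n f" for n f
      by (rule \<theta>4[THEN conjunct2, THEN conjunct2, THEN conjunct1, rule_format])
    show "lin_app (lev G n) (lev G n) (\<alpha> n a) (\<theta> n f) = \<theta> n (f oo act a)" for n a f
      by (rule \<theta>7[THEN conjunct1, rule_format])
    show "\<exists>\<Theta> :: 'r fps fps \<Rightarrow> nat \<Rightarrow> nat \<Rightarrow> 'r.
           (\<forall>f g. \<Theta> (f + g) = (\<lambda>k l. \<Theta> f k l + \<Theta> g k l)) \<and>
           (\<forall>f g. \<Theta> (f * g) = tensor_mult (lev G n) (\<Theta> f) (\<Theta> g)) \<and>
           (\<forall>f. \<Theta> (in_X f) = (\<lambda>k l. \<theta> n f k * elt_one (lev G n) l)) \<and>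
           (\<forall>f. \<Theta> (in_Y f) = (\<lambda>k l. elt_one (lev G n) k * \<theta> n f l)) \<and>
           (\<forall>f. elt_comult (lev G n) (\<theta> n f) = \<Theta> (subst_1_2 f F))" for n
      by (rule \<theta>7[THEN conjunct2])
    show "\<exists>b. of_nat CARD('p) = b * \<pi>" using dvd by (auto simp: dvd_def mult.commute)
    show "prime CARD('p)" by (rule prime_card)
  qed (use assms k in simp_all)
  show ?thesis
    unfolding T_def
    using H.tate_module_free H.monodromy_orbit_open H.galois_rep_irreducible by blast
qed

end
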